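(* For any real number $r > 1$ (possibly depending on $n$), there exists an algorithm running in time $\exp(n/2^{\Omega(r^2)})\,\mathrm{poly}(n)$ that achieves an $O(r)$-approximation for Min Symmetric DiCut on symmetric directed graphs with vertex set $\{-n,\dots,-1\}\cup\{1,\dots,n\}$.
   Context: A directed graph $G=(V,E)$ is symmetric if $V = [-n]\cup[n]$, where $[n]=\{1,\dots,n\}$ and $[-n]=\{-n,\dots,-1\}$, and an arc $(i,j)$ belongs to $E$ if and only if $(-j,-i)$ belongs to $E$. For $S\subseteq V$ let $-S=\{-i : i\in S\}$. A cut $(S, V\setminus S)$ is symmetric if $V\setminus S = -S$. Min Symmetric DiCut: given a symmetric directed graph $G$, find a symmetric cut $(S,-S)$ minimizing the number of arcs going from $S$ to $-S$. An $O(r)$-approximation outputs a symmetric cut whose number of such arcs is at most $C r$ times the optimum, for an absolute constant $C$. *)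

theory Defs
  imports
    Complex_Main
    "HOL-Computational_Algebra.Polynomial"
    "Graph_Theory.Pair_Digraph"
begin

definition sym_verts :: "nat \<Rightarrow> int set" where
  "sym_verts n = {- int n..-1} \<union> {1..int n}"

definition symmetric_digraph :: "nat \<Rightarrow> int pair_pre_digraph \<Rightarrow> bool" where
  "symmetric_digraph n G \<longleftrightarrow>
     pair_wf_digraph G \<and> pverts G = sym_verts n \<and>
     (\<forall>i j. (i, j) \<in> parcs G \<longleftrightarrow> (- j, - i) \<in> parcs G)"

definition symmetric_cut :: "int pair_pre_digraph \<Rightarrow> int set \<Rightarrow> bool" where
  "symmetric_cut G S \<longleftrightarrow> S \<subseteq> pverts G \<and> pverts G - S = uminus ` S"

definition cut_value :: "int pair_pre_digraph \<Rightarrow> int set \<Rightarrow> nat" where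
  "cut_value G S = card {(i, j) \<in> parcs G. i \<in> S \<and> j \<in> uminus ` S}"

definition min_symmetric_dicut :: "int pair_pre_digraph \<Rightarrow> nat" where
  "min_symmetric_dicut G = Min (cut_value G ` {S. symmetric_cut G S})"

text \<open>
  Model of computation: a unit-cost random access machine with registers and a random access
  memory, both holding natural numbers, programmed in a structured language. A register is
  named by a constant of the program; memory is accessed only through the address held in a
  register. The arithmetic instructions are addition, truncated subtraction and halving.
  Multiplication is deliberately not an instruction: one instruction then lengthens numbers by
  at most one bit, so unit-cost time is polynomially related to Turing machine time.
\<close>

datatype com =
    Const nat nat    \<comment> \<open>\<open>R\<^sub>i := k\<close>\<close>
  | Add nat nat nat  \<comment> \<open>\<open>R\<^sub>i := R\<^sub>j + R\<^sub>k\<close>\<close>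
  | Sub nat nat nat  \<comment> \<open>\<open>R\<^sub>i := R\<^sub>j - R\<^sub>k\<close>\<close>
  | Half nat nat     \<comment> \<open>\<open>R\<^sub>i := R\<^sub>j div 2\<close>\<close>
  | Load nat nat     \<comment> \<open>\<open>R\<^sub>i := mem[R\<^sub>j]\<close>\<close>
  | Store nat nat    \<comment> \<open>\<open>mem[R\<^sub>i] := R\<^sub>j\<close>\<close>
  | Seq com com
  | If nat com com   \<comment> \<open>branch on \<open>R\<^sub>i \<noteq> 0\<close>\<close>
  | While nat com    \<comment> \<open>loop while \<open>R\<^sub>i \<noteq> 0\<close>\<close>

record state =
  reg :: "nat \<Rightarrow> nat"
  mem :: "nat \<Rightarrow> nat"

text \<open>
  \<open>exec c s t s'\<close>: started in \<open>s\<close>, the program \<open>c\<close> halts in \<open>s'\<close> after exactly \<open>t\<close> steps, where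
  every instruction and every evaluation of a test is one step.
\<close>

inductive exec :: "com \<Rightarrow> state \<Rightarrow> nat \<Rightarrow> state \<Rightarrow> bool" where
  Const: "exec (Const i k) s 1 (s\<lparr>reg := (reg s)(i := k)\<rparr>)"
| Add: "exec (Add i j k) s 1 (s\<lparr>reg := (reg s)(i := reg s j + reg s k)\<rparr>)"
| Sub: "exec (Sub i j k) s 1 (s\<lparr>reg := (reg s)(i := reg s j - reg s k)\<rparr>)"
| Half: "exec (Half i j) s 1 (s\<lparr>reg := (reg s)(i := reg s j div 2)\<rparr>)"
| Load: "exec (Load i j) s 1 (s\<lparr>reg := (reg s)(i := mem s (reg s j))\<rparr>)"
| Store: "exec (Store i j) s 1 (s\<lparr>mem := (mem s)(reg s i := reg s j)\<rparr>)"
| Seq: "exec c\<^sub>1 s t\<^sub>1 s' \<Longrightarrow> exec c\<^sub>2 s' t\<^sub>2 s'' \<Longrightarrow> exec (Seq c\<^sub>1 c\<^sub>2) s (t\<^sub>1 + t\<^sub>2) s''"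
| IfTrue: "reg s i \<noteq> 0 \<Longrightarrow> exec c\<^sub>1 s t s' \<Longrightarrow> exec (If i c\<^sub>1 c\<^sub>2) s (t + 1) s'"
| IfFalse: "reg s i = 0 \<Longrightarrow> exec c\<^sub>2 s t s' \<Longrightarrow> exec (If i c\<^sub>1 c\<^sub>2) s (t + 1) s'"
| WhileFalse: "reg s i = 0 \<Longrightarrow> exec (While i c) s 1 s"
| WhileTrue: "reg s i \<noteq> 0 \<Longrightarrow> exec c s t\<^sub>1 s' \<Longrightarrow> exec (While i c) s' t\<^sub>2 s''
    \<Longrightarrow> exec (While i c) s (t\<^sub>1 + t\<^sub>2 + 1) s''"

inductive_cases exec_elims:
  "exec (Const i k) s t s'" "exec (Add i j k) s t s'" "exec (Sub i j k) s t s'"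
  "exec (Half i j) s t s'" "exec (Load i j) s t s'" "exec (Store i j) s t s'"
  "exec (Seq c\<^sub>1 c\<^sub>2) s t s'" "exec (If i c\<^sub>1 c\<^sub>2) s t s'" "exec (While i c) s t s'"

lemma exec_deterministic:
  "exec c s t s' \<Longrightarrow> exec c s u s'' \<Longrightarrow> u = t \<and> s'' = s'"
proof (induction arbitrary: u s'' rule: exec.induct)
  case (Seq c\<^sub>1 s t\<^sub>1 s' c\<^sub>2 t\<^sub>2 s2)
  from Seq.prems obtain v w s3 where "exec c\<^sub>1 s v s3" "exec c\<^sub>2 s3 w s''" "u = v + w"
    by (rule exec_elims(7)) auto
  then show ?case using Seq.IH by blast
next
  case (IfTrue s i c\<^sub>1 t s' c\<^sub>2)
  from IfTrue.prems IfTrue.hyps(1) obtain v where "exec c\<^sub>1 s v s''" "u = v + 1"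
    by - (erule exec_elims(8), simp_all)
  then show ?case using IfTrue.IH by blast
next
  case (IfFalse s i c\<^sub>2 t s' c\<^sub>1)
  from IfFalse.prems IfFalse.hyps(1) obtain v where "exec c\<^sub>2 s v s''" "u = v + 1"
    by - (erule exec_elims(8), simp_all)
  then show ?case using IfFalse.IH by blast
next
  case (WhileFalse s i c)
  from WhileFalse.prems show ?case
    by (rule exec_elims(9)) (use WhileFalse.hyps in simp_all)
next
  case (WhileTrue s i c t\<^sub>1 s' t\<^sub>2 s2)
  from WhileTrue.prems WhileTrue.hyps obtain v w s3
    where "exec c s v s3" "exec (While i c) s3 w s''" "u = v + w + 1"
    by - (erule exec_elims(9), simp_all)
  then show ?case using WhileTrue.IH by blast
qed (erule exec_elims; simp)+

text \<open>The vertices \<open>-n, \<dots>, -1, 1, \<dots>, n\<close> are numbered \<open>0, \<dots>, 2 * n - 1\<close> in this order.\<close>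

definition vert_index :: "nat \<Rightarrow> int \<Rightarrow> nat" where
  "vert_index n v = nat (if v < 0 then v + int n else v + int n - 1)"

lemma vert_index_bij: "bij_betw (vert_index n) (sym_verts n) {..<2 * n}"
proof (rule bij_betw_byWitness
    [where f' = "\<lambda>k. if k < n then int k - int n else int k - int n + 1"])
qed (auto simp: vert_index_def sym_verts_def)

text \<open>
  Input: \<open>n\<close> in register 0, the parameter \<open>k\<close> in register 1, and the row-major adjacency matrix
  of the graph in memory from address 0; all other cells are 0.
\<close>

definition input_state :: "nat \<Rightarrow> nat \<Rightarrow> int pair_pre_digraph \<Rightarrow> state" where
  "input_state n k G =
     \<lparr>reg = (\<lambda>_. 0)(0 := n, 1 := k),
      mem = (\<lambda>a. if \<exists>(i, j) \<in> parcs G. a = 2 * n * vert_index n i + vert_index n j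
                 then 1 else 0)\<rparr>"

text \<open>Output: the characteristic vector of a vertex set in memory from address 0.\<close>

definition output_set :: "nat \<Rightarrow> state \<Rightarrow> int set" where
  "output_set n s = {v \<in> sym_verts n. mem s (vert_index n v) = 1}"

text \<open>
  The approximation parameter \<open>r\<close> is an arbitrary real function of \<open>n\<close>, possibly uncomputable,
  so the algorithm is told its value; being discrete, the machine only receives \<open>\<lceil>r n\<rceil>\<close>. The
  approximation and time guarantees refer to \<open>r n\<close> itself.
\<close>

definition approximates_in_time ::
    "com \<Rightarrow> (nat \<Rightarrow> real) \<Rightarrow> (nat \<Rightarrow> real) \<Rightarrow> (nat \<Rightarrow> real) \<Rightarrow> bool" where
  "approximates_in_time A r \<rho> T \<longleftrightarrow>
     (\<forall>n G. symmetric_digraph n G \<longrightarrow>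
       (\<exists>t s. exec A (input_state n (nat \<lceil>r n\<rceil>) G) t s \<and>
              real t \<le> T n \<and>
              symmetric_cut G (output_set n s) \<and>
              real (cut_value G (output_set n s)) \<le> \<rho> n * real (min_symmetric_dicut G)))"

end

theory Submission
  imports Defs
begin

text \<open>
  The algorithm searches for a pseudo-measure of degree about n / 2^(k^2) on the truth assignments,
  nonnegative and of small objective value along all conditionings that it inspects, by a perceptron:
  each violated inequality is added to the current signed measure, which brings it closer to the
  point mass of an optimal cut in the Fourier norm. The low degree bounds the initial distance and
  hence the number of updates.

  Given such a measure, conditioning on a literal with more than 2^(k^2) close literals lowers the
  total variance proportionally, so some leaf has small volume and only small balls. There the
  l1-metric of the measure is rounded as by Arora, Rao and Vazirani: sparse cuts found by random walks
  give a vector embedding in which small balls allow chains of length k only, and region growing from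
  a large separated set costs a factor O(k). If the walks find no sparse cut they certify a spectral
  inequality that every assignment satisfies and the measure violates, which is the next update.
\<close>

section \<open>Linear forms on the discrete cube\<close>

text \<open>The ball size \<open>2^b\<close>, \<open>b <= k^2\<close>, is where the two halves meet.
  Chaining \<open>k\<close> steps pays a union bound over a ball, which is affordable up to log-size
  \<open>k^2\<close>. Larger balls are conditioned away: the potential starts at O(N) times the mass
  and each step removes about \<open>2^b\<close> times the mass, so some \<open>N / 2^b\<close>
  steps suffice. That number times \<open>b\<close> governs the exponent of the running time. The
  machine only adds, subtracts and halves naturals, which shapes the rest. The measure is never
  stored; it is a log of the inequalities added so far with integer coefficients, from which each
  mass is recomputed. Eigenvectors are replaced by integer random walks. Inequalities are demanded
  only where the rounding looks, so that a check is a search over \<open>2^q\<close> paths. The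
  optimum enters as a guess \<open>o1\<close>. If \<open>o1\<close> is the value of some cut, every
  update correlates with the point mass at that cut and the updates must end; the least guess for
  which they end is thus at most the optimum, and the certified measure bounds the output against
  it.\<close>

definition EP :: "'a set => ('a set => real) => real" where
 "EP I f = (SUM A:Pow I. f A) / 2 ^ card I"

definition sg :: "'a set => 'a => real" where
 "sg A i = (if i : A then 1 else -1)"

definition lin :: "'a set => 'a set => ('a => real) => real" where
 "lin I A x = (SUM i:I. sg A i * x i)"

definition flip :: "'a => 'a set => 'a set" where
 "flip i A = (if i : A then A - {i} else insert i A)"

lemma EP_empty: "EP {} f = f {}"
 by (simp add: EP_def)

lemma EP_insert:
 assumes "finite I" "i ~: I"
 shows "EP (insert i I) f = EP I (%A. (f A + f (insert i A)) / 2)"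
proof -
 have inj: "inj_on (insert i) (Pow I)" using assms(2) by (auto simp: inj_on_def)
 have "(SUM A:Pow (insert i I). f A) = (SUM A:Pow I. f A) + (SUM A:insert i ` Pow I. f A)"
  unfolding Pow_insert using assms by (intro sum.union_disjoint) auto
 also have "(SUM A:insert i ` Pow I. f A) = (SUM A:Pow I. f (insert i A))"
  by (simp add: sum.reindex[OF inj])
 finally show ?thesis using assms
  by (simp add: EP_def sum.distrib add_divide_distrib sum_divide_distrib[symmetric])
qed

lemma EP_cong: "(!!A. A <= I ==> f A = g A) ==> EP I f = EP I g"
 unfolding EP_def by (intro arg_cong2[where f = "(/)"] sum.cong) auto

lemma EP_mono: "(!!A. A <= I ==> f A <= g A) ==> EP I f <= EP I g"
 unfolding EP_def by (intro divide_right_mono sum_mono) auto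

lemma EP_add: "EP I (%A. f A + g A) = EP I f + EP I g"
 by (simp add: EP_def sum.distrib add_divide_distrib)

lemma EP_diff: "EP I (%A. f A - g A) = EP I f - EP I g"
 by (simp add: EP_def sum_subtractf diff_divide_distrib)

lemma EP_cmul: "EP I (%A. c * f A) = c * EP I f"
 by (simp add: EP_def sum_distrib_left)

lemma EP_mulc: "EP I (%A. f A * c) = EP I f * c"
 using EP_cmul[of I c f] by (simp add: mult.commute)

lemma EP_const: "finite I ==> EP I (%A. c) = c"
 by (simp add: EP_def card_Pow)

lemma EP_sum: "EP I (%A. SUM j:J. f j A) = (SUM j:J. EP I (f j))"
 unfolding EP_def by (subst sum.swap) (simp add: sum_divide_distrib)

lemma EP_compl: "EP I (%A. f (I - A)) = EP I f"
proof -
 have "(SUM A:Pow I. f (I - A)) = (SUM A:Pow I. f A)"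
  by (rule sum.reindex_bij_witness[of _ "%A. I - A" "%A. I - A"]) auto
 thus ?thesis by (simp add: EP_def)
qed

lemma EP_nonneg: "(!!A. A <= I ==> 0 <= f A) ==> 0 <= EP I f"
 unfolding EP_def by (intro divide_nonneg_nonneg sum_nonneg) auto

text \<open>Variance splits over the new coordinate: \<open>g\<close> averages it out, and its own
  contribution is a quarter of the squared flip difference. Flips of the old coordinates commute
  with this averaging, which can only shrink their squared differences.\<close>

lemma poincare:
 assumes "finite I"
 shows "EP I (%A. (f A)^2) - (EP I f)^2 <= (SUM i:I. EP I (%A. (f A - f (flip i A))^2)) / 4"
 using assms
proof (induction I arbitrary: f)
 case empty
 thus ?case by (simp add: EP_empty)
next
 case (insert i I)
 define g where "g A = (f A + f (insert i A)) / 2" for A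
 have fl: "insert i (flip j A) = flip j (insert i A)" if "j : I" for j A
  using that insert.hyps(2) by (auto simp: flip_def)
 have "EP (insert i I) (%A. (f A)^2) = EP I (%A. (g A)^2 + (f A - f (insert i A))^2 / 4)"
  unfolding EP_insert[OF insert.hyps] by (rule EP_cong) (simp add: g_def power2_eq_square field_simps)
 hence 1: "EP (insert i I) (%A. (f A)^2) = EP I (%A. (g A)^2) + EP I (%A. (f A - f (insert i A))^2) / 4"
  by (simp add: EP_add EP_mulc[of I _ "1/4", simplified])
 have 2: "EP (insert i I) f = EP I g" unfolding EP_insert[OF insert.hyps] g_def ..
 have 3: "EP (insert i I) (%A. (f A - f (flip i A))^2) = EP I (%A. (f A - f (insert i A))^2)"
  unfolding EP_insert[OF insert.hyps]
 proof (rule EP_cong)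
  fix A assume "A <= I"
  hence "i ~: A" using insert.hyps(2) by blast
  thus "((f A - f (flip i A))^2 + (f (insert i A) - f (flip i (insert i A)))^2) / 2 = (f A - f (insert i A))^2"
   by (simp add: flip_def power2_commute)
 qed
 have 4: "EP I (%A. (g A - g (flip j A))^2) <= EP (insert i I) (%A. (f A - f (flip j A))^2)" if j: "j : I" for j
  unfolding EP_insert[OF insert.hyps]
 proof (rule EP_mono)
  fix A assume "A <= I"
  have "((a + b) / 2 - (c + d) / 2)^2 <= ((a - c)^2 + (b - d)^2) / 2" for a b c d :: real
  proof -
   have "((a - c)^2 + (b - d)^2) / 2 - ((a + b) / 2 - (c + d) / 2)^2 = (((a - c) - (b - d)) / 2)^2"
    by (simp add: power2_eq_square field_simps)
   thus ?thesis by (metis diff_ge_0_iff_ge zero_le_power2)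
  qed
  thus "(g A - g (flip j A))^2 <= ((f A - f (flip j A))^2 + (f (insert i A) - f (flip j (insert i A)))^2) / 2"
   unfolding g_def fl[OF j] by blast
 qed
 have "EP I (%A. (g A)^2) - (EP I g)^2 <= (SUM j:I. EP I (%A. (g A - g (flip j A))^2)) / 4"
  by (rule insert.IH)
 also have "... <= (SUM j:I. EP (insert i I) (%A. (f A - f (flip j A))^2)) / 4"
  using 4 by (intro divide_right_mono sum_mono) auto
 finally show ?case using insert.hyps by (simp add: 1 2 3)
qed

section \<open>Moments and anticoncentration of Rademacher sums\<close>

lemma lin_insert:
 assumes "finite I" "i ~: I" "A <= I"
 shows "lin (insert i I) A x = lin I A x - x i" "lin (insert i I) (insert i A) x = lin I A x + x i"
proof -
 have "i ~: A" using assms by auto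
 thus "lin (insert i I) A x = lin I A x - x i"
  using assms by (simp add: lin_def sg_def)
 have "(SUM j:I. sg (insert i A) j * x j) = (SUM j:I. sg A j * x j)"
  using assms(2) by (intro sum.cong) (auto simp: sg_def)
 thus "lin (insert i I) (insert i A) x = lin I A x + x i"
  using assms by (simp add: lin_def sg_def)
qed

lemma lin_compl: "lin I (I - A) x = - lin I A x"
 by (auto simp: lin_def sg_def sum_negf[symmetric] intro!: sum.cong)

lemma EP_lin2: "finite I ==> EP I (%A. (lin I A x)^2) = (SUM i:I. (x i)^2)"
proof (induction I rule: finite_induct)
 case empty
 thus ?case by (simp add: EP_empty lin_def)
next
 case (insert i I)
 have "EP (insert i I) (%A. (lin (insert i I) A x)^2) = EP I (%A. (lin I A x)^2 + (x i)^2)"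
  unfolding EP_insert[OF insert.hyps]
  by (rule EP_cong) (simp add: lin_insert insert.hyps power2_eq_square field_simps)
 thus ?case using insert by (simp add: EP_add EP_const)
qed

text \<open>Averaging over a new sign kills the odd powers. With \<open>a = x i\<close> and
  \<open>s\<close> the old sum of squares, the new terms \<open>6 a^2 s + a^4\<close> fit because
  \<open>3 (a^2 + s)^2\<close> leaves \<open>2 a^4\<close> to spare.\<close>

lemma EP_lin4: "finite I ==> EP I (%A. (lin I A x) ^ 4) <= 3 * (SUM i:I. (x i)^2)^2"
proof (induction I rule: finite_induct)
 case empty
 thus ?case by (simp add: EP_empty lin_def)
next
 case (insert i I)
 let ?s = "SUM i:I. (x i)^2"
 have nn4: "0 <= x i ^ 4" by (rule zero_le_even_power) simp
 have "EP (insert i I) (%A. (lin (insert i I) A x) ^ 4)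
  = EP I (%A. (lin I A x) ^ 4 + 6 * (x i)^2 * (lin I A x)^2 + x i ^ 4)"
  unfolding EP_insert[OF insert.hyps]
  by (rule EP_cong) (simp add: lin_insert insert.hyps power2_eq_square power4_eq_xxxx field_simps)
 also have "... = EP I (%A. (lin I A x) ^ 4) + 6 * (x i)^2 * ?s + x i ^ 4"
  using insert.hyps by (simp add: EP_add EP_const EP_cmul EP_lin2)
 also have "... <= 3 * ?s^2 + 6 * (x i)^2 * ?s + 3 * x i ^ 4"
  using insert.IH nn4 by linarith
 also have "... = 3 * ((x i)^2 + ?s)^2"
  by (simp add: power2_eq_square power4_eq_xxxx algebra_simps)
 finally show ?case using insert.hyps by simp
qed

text \<open>\<open>t^2 / 2 - ln (cosh t)\<close> vanishes at 0 and has derivative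
  \<open>t - tanh t\<close>; the latter is nonnegative for \<open>t >= 0\<close>, its own derivative
  being \<open>tanh t ^ 2\<close>.\<close>

lemma cosh_le_exp: "cosh x <= exp (x^2 / 2)" for x :: real
proof -
 define g where "g t = t^2 / 2 - ln (cosh t)" for t :: real
 have tanh: "tanh t <= t" if "t >= 0" for t :: real
 proof -
  define h where "h t = t - tanh t" for t :: real
  have "h 0 <= h t"
  proof (rule DERIV_nonneg_imp_nondecreasing[OF that])
   fix s :: real
   have "(h has_real_derivative (1 - (1 - tanh s ^ 2))) (at s)"
    unfolding h_def by (auto intro!: derivative_eq_intros)
   thus "EX y. (h has_real_derivative y) (at s) & 0 <= y" by (intro exI[of _ "tanh s ^ 2"]) auto
  qed
  thus ?thesis by (simp add: h_def)
 qed
 have "g 0 <= g t" if "t >= 0" for t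
 proof (rule DERIV_nonneg_imp_nondecreasing[OF that])
  fix s :: real assume s: "0 <= s"
  have "(g has_real_derivative (s - sinh s / cosh s)) (at s)"
   unfolding g_def by (auto intro!: derivative_eq_intros simp: cosh_real_pos)
  moreover have "0 <= s - sinh s / cosh s" using tanh[OF s] by (simp add: tanh_def)
  ultimately show "EX y. (g has_real_derivative y) (at s) & 0 <= y" by blast
 qed
 hence "g \<bar>x\<bar> >= 0" by (metis abs_ge_zero g_def cosh_0 ln_one power_zero_numeral diff_zero div_0)
 hence "ln (cosh x) <= x^2 / 2" by (simp add: g_def)
 thus ?thesis by (metis cosh_real_pos exp_le_cancel_iff exp_ln)
qed

lemma EP_exp_lin: "finite I ==> EP I (%A. exp (l * lin I A x)) <= exp (l^2 * (SUM i:I. (x i)^2) / 2)"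
proof (induction I rule: finite_induct)
 case empty
 thus ?case by (simp add: EP_empty lin_def)
next
 case (insert i I)
 have "EP (insert i I) (%A. exp (l * lin (insert i I) A x)) = EP I (%A. exp (l * lin I A x) * cosh (l * x i))"
  unfolding EP_insert[OF insert.hyps]
  by (rule EP_cong) (simp add: lin_insert insert.hyps algebra_simps exp_add exp_diff cosh_field_def exp_minus field_simps)
 also have "... = EP I (%A. exp (l * lin I A x)) * cosh (l * x i)" by (rule EP_mulc)
 also have "... <= exp (l^2 * (SUM i:I. (x i)^2) / 2) * exp ((l * x i)^2 / 2)"
  using insert.IH cosh_le_exp[of "l * x i"] by (intro mult_mono) auto
 also have "... = exp (l^2 * (SUM i:insert i I. (x i)^2) / 2)"
  using insert.hyps by (simp add: exp_add[symmetric] power_mult_distrib field_simps)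
 finally show ?case .
qed

text \<open>A Paley-Zygmund argument: with second moment \<open>m\<close> and fourth moment at most
  \<open>3 * m^2\<close> the form must often have size at least \<open>sqrt m / 2\<close>.
  Complementing \<open>A\<close> reverses the sign, so both tails are equally likely.\<close>

lemma lin_anticonc:
 assumes "finite I" and m: "m = (SUM i:I. (x i)^2)" "m > 0"
 shows "EP I (%A. if lin I A x >= sqrt m / 2 then 1 else 0) >= 3 / 32"
proof -
 let ?f = "%A. lin I A x"
 let ?p = "%A. if ?f A >= sqrt m / 2 then 1 else (0::real)"
 let ?n = "%A. if - ?f A >= sqrt m / 2 then 1 else (0::real)"
 \<comment> \<open>Where \<open>?f A\<close> is large, AM-GM covers its square by the quartic term
   and \<open>2 * m\<close>. In expectation this reads \<open>m <= m/4 + 3m/8 + 4 m p\<close> for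
   the tail probability \<open>p\<close>.\<close>
 have pt: "(?f A)^2 <= m / 4 + (?f A) ^ 4 / (8 * m) + 2 * m * (?p A + ?n A)" for A
 proof (cases "(?f A)^2 <= m / 4")
  case True
  moreover have "0 <= (?f A) ^ 4 / (8 * m)" using m(2) zero_le_even_power[of 4 "?f A"] by simp
  moreover have "0 <= 2 * m * (?p A + ?n A)" using m(2) by simp
  ultimately show ?thesis by linarith
 next
  case False
  have "sqrt m / 2 <= \<bar>?f A\<bar>"
  proof -
   have "(sqrt m / 2)^2 = m / 4" using m(2) by (simp add: power_divide)
   hence "(sqrt m / 2)^2 <= \<bar>?f A\<bar>^2" using False by simp
   thus ?thesis by (rule power2_le_imp_le) simp
  qed
  hence "?p A + ?n A >= 1" by (auto simp: abs_if split: if_splits)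
  hence "2 * m <= 2 * m * (?p A + ?n A)" using m(2) by simp
  moreover have "(?f A)^2 <= (?f A) ^ 4 / (8 * m) + 2 * m"
  proof -
   have "0 <= ((?f A)^2 - 4 * m)^2" by simp
   hence "8 * m * (?f A)^2 <= (?f A) ^ 4 + 16 * m^2" by (simp add: power2_eq_square power4_eq_xxxx algebra_simps)
   thus ?thesis using m(2) by (simp add: field_simps power2_eq_square)
  qed
  ultimately show ?thesis using m(2) by linarith
 qed
 have "m = EP I (%A. (?f A)^2)" using EP_lin2[OF assms(1)] m(1) by simp
 also have "... <= EP I (%A. m / 4 + (?f A) ^ 4 / (8 * m) + 2 * m * (?p A + ?n A))"
  by (rule EP_mono) (rule pt)
 also have "... = m / 4 + EP I (%A. (?f A) ^ 4) / (8 * m) + 2 * m * (EP I ?p + EP I ?n)"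
  using assms(1) EP_mulc[of I "%A. (?f A) ^ 4" "1 / (8 * m)"] by (simp add: EP_add EP_const EP_cmul)
 also have "... <= m / 4 + 3 * m^2 / (8 * m) + 2 * m * (EP I ?p + EP I ?n)"
  using EP_lin4[OF assms(1), of x] m by (simp add: divide_right_mono)
 also have "EP I ?n = EP I ?p"
  using EP_compl[of I ?p] by (simp add: lin_compl)
 finally have "m * (3 / 8) <= m * (4 * EP I ?p)" using m(2) by (simp add: power2_eq_square field_simps)
 thus ?thesis using m(2) by simp
qed

section \<open>Concentration of maxima of Rademacher sums\<close>

lemma EP_abs_dev:
 assumes "finite I" "EP I (%A. (f A)^2) - (EP I f)^2 <= v"
 shows "EP I (%A. \<bar>f A - EP I f\<bar>) <= sqrt v"
proof -
 let ?g = "%A. \<bar>f A - EP I f\<bar>"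
 have "EP I (%A. (?g A - EP I ?g)^2) >= 0" by (rule EP_nonneg) simp
 moreover have "EP I (%A. (?g A - c)^2) = EP I (%A. (?g A)^2) - 2 * c * EP I ?g + c^2" for c
  using assms(1) by (simp add: power2_diff EP_add EP_diff EP_const EP_mulc EP_cmul algebra_simps)
 ultimately have "(EP I ?g)^2 <= EP I (%A. (?g A)^2)"
  by (simp add: power2_eq_square)
 also have "... = EP I (%A. (f A)^2 - (2 * EP I f) * f A + (EP I f)^2)"
  by (simp add: power2_diff algebra_simps)
 also have "... = EP I (%A. (f A)^2) - (EP I f)^2"
  using assms(1) by (simp add: EP_add EP_diff EP_const EP_cmul power2_eq_square)
 finally show ?thesis using assms(2) by (intro real_le_rsqrt) linarith
qed

lemma lin_flip:
 assumes "finite I" "i : I"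
 shows "lin I (flip i A) x = lin I A x - 2 * sg A i * x i"
proof -
 have "sg (flip i A) j * x j = sg A j * x j - (if j = i then 2 * sg A i * x i else 0)" for j
  by (cases "j = i"; cases "i : A") (simp_all add: sg_def flip_def)
 hence "lin I (flip i A) x = (SUM j:I. sg A j * x j - (if j = i then 2 * sg A i * x i else 0))"
  by (simp add: lin_def)
 thus ?thesis using assms by (simp add: sum_subtractf lin_def)
qed

text \<open>The deviation bound is free of the number of forms: a flip lowers the maximum by at most
  what the maximising form loses, so the squared decreases sum up to \<open>4 * v\<close> at most,
  as Poincare's inequality requires. The number of forms enters the mean alone, through the
  exponential moment.\<close>

lemma lin_max:
 assumes I: "finite I" and J: "finite J" "J ~= {}" and v: "!!j. j : J ==> (SUM i:I. (y j i)^2) <= v"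
 defines "Z \<equiv> %A. Max ((%j. lin I A (y j)) ` J)"
 shows lin_max_var: "EP I (%A. \<bar>Z A - EP I Z\<bar>) <= sqrt (2 * v)"
  and lin_max_mean: "l > 0 ==> l * EP I Z <= ln (card J) + l^2 * v / 2"
proof -
 have Zj: "EX j:J. Z A = lin I A (y j)" for A
 proof -
  have "Z A : (%j. lin I A (y j)) ` J" unfolding Z_def using J by (intro Max_in) auto
  thus ?thesis by blast
 qed
 have Zge: "lin I A (y j) <= Z A" if "j : J" for A j
  unfolding Z_def using J that by (intro Max_ge) auto
 note lf = lin_flip[OF I]
 have ff: "flip i (flip i A) = A" for i :: 'a and A by (cases "i : A") (simp_all add: flip_def insert_absorb)
 have fI: "flip i A <= I" if "A <= I" "i : I" for i A using that by (auto simp: flip_def)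
 \<comment> \<open>Flipping is a bijection that reverses each difference, so decreases carry half of
   the squared differences.\<close>
 have pos: "EP I (%A. (Z A - Z (flip i A))^2) = 2 * EP I (%A. (max 0 (Z A - Z (flip i A)))^2)" if i: "i : I" for i
 proof -
  have "EP I (%A. (max 0 (Z (flip i A) - Z A))^2) = EP I (%A. (max 0 (Z A - Z (flip i A)))^2)"
   unfolding EP_def
   by (rule arg_cong2[where f = "(/)"], rule sum.reindex_bij_witness[of _ "flip i" "flip i"])
    (use i fI in \<open>auto simp: ff\<close>)
  moreover have "EP I (%A. (Z A - Z (flip i A))^2) = EP I (%A. (max 0 (Z A - Z (flip i A)))^2 + (max 0 (Z (flip i A) - Z A))^2)"
   by (rule EP_cong) (simp add: max_def power2_commute)
  ultimately show ?thesis by (simp add: EP_add)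
 qed
 have "(SUM i:I. (max 0 (Z A - Z (flip i A)))^2) <= 4 * v" for A
 proof -
  obtain j where j: "j : J" "Z A = lin I A (y j)" using Zj by blast
  have "(max 0 (Z A - Z (flip i A)))^2 <= 4 * (y j i)^2" if "i : I" for i
  proof -
   have "Z A - Z (flip i A) <= 2 * sg A i * y j i"
    using Zge[OF j(1), of "flip i A"] j(2) lf[OF that, of A "y j"] by simp
   also have "... <= \<bar>2 * y j i\<bar>" by (auto simp: sg_def)
   finally have "max 0 (Z A - Z (flip i A)) <= \<bar>2 * y j i\<bar>" by simp
   hence "(max 0 (Z A - Z (flip i A)))^2 <= \<bar>2 * y j i\<bar>^2" by (intro power_mono) auto
   thus ?thesis by (simp add: power_mult_distrib)
  qed
  hence "(SUM i:I. (max 0 (Z A - Z (flip i A)))^2) <= (SUM i:I. 4 * (y j i)^2)" by (rule sum_mono)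
  also have "... <= 4 * v" using v[OF j(1)] by (simp add: sum_distrib_left[symmetric])
  finally show ?thesis .
 qed
 hence "EP I (%A. SUM i:I. (max 0 (Z A - Z (flip i A)))^2) <= 4 * v"
  using EP_mono[of I _ "%A. 4 * v"] EP_const[OF I, of "4 * v"] by simp
 hence "(SUM i:I. EP I (%A. (Z A - Z (flip i A))^2)) <= 8 * v"
  by (simp add: EP_sum pos sum_distrib_left[symmetric])
 hence "EP I (%A. (Z A)^2) - (EP I Z)^2 <= 2 * v"
  using poincare[OF I, of Z] by linarith
 thus "EP I (%A. \<bar>Z A - EP I Z\<bar>) <= sqrt (2 * v)" by (rule EP_abs_dev[OF I])
 show "l * EP I Z <= ln (card J) + l^2 * v / 2" if l: "l > 0"
 proof -
  define c where "c = ln (card J) + l^2 * v / 2"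
  have cJ: "real (card J) > 0" using J by (simp add: card_gt_0_iff)
  \<comment> \<open>The tangent of the exponential, shifted by \<open>c\<close>, replaces Jensen's
    inequality for \<open>ln\<close>.\<close>
  have "l * Z A <= c - 1 + exp (- c) * (SUM j:J. exp (l * lin I A (y j)))" for A
  proof -
   obtain j where j: "j : J" "Z A = lin I A (y j)" using Zj by blast
   have "1 + (l * Z A - c) <= exp (l * Z A - c)" by (rule exp_ge_add_one_self)
   also have "... = exp (- c) * exp (l * lin I A (y j))" using j by (simp add: exp_add[symmetric])
   also have "... <= exp (- c) * (SUM j:J. exp (l * lin I A (y j)))"
    using j J by (intro mult_left_mono member_le_sum) auto
   finally show ?thesis by simp
  qed
  hence "EP I (%A. l * Z A) <= EP I (%A. c - 1 + exp (- c) * (SUM j:J. exp (l * lin I A (y j))))"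
   by (intro EP_mono)
  hence "l * EP I Z <= c - 1 + exp (- c) * (SUM j:J. EP I (%A. exp (l * lin I A (y j))))"
   using I by (simp add: EP_cmul EP_add EP_const EP_sum EP_diff)
  also have "... <= c - 1 + exp (- c) * (SUM j:J. exp (l^2 * v / 2))"
  proof (intro add_left_mono mult_left_mono sum_mono)
   fix j assume "j : J"
   have "EP I (%A. exp (l * lin I A (y j))) <= exp (l^2 * (SUM i:I. (y j i)^2) / 2)" by (rule EP_exp_lin[OF I])
   also have "... <= exp (l^2 * v / 2)" using v[OF \<open>j : J\<close>] by (simp add: mult_left_mono)
   finally show "EP I (%A. exp (l * lin I A (y j))) <= exp (l^2 * v / 2)" .
  qed simp
  also have "... = c"
  proof -
   have "exp (- c) * (real (card J) * exp (l^2 * v / 2)) = exp (- c) * exp c"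
    using cJ by (simp add: c_def exp_add)
   thus ?thesis by (simp add: exp_minus)
  qed
  finally show ?thesis by (simp add: c_def)
 qed
qed

text \<open>The chaining step of the Arora--Rao--Vazirani structure theorem. Along a matched pair the best
 projection seen from a point within \<open>j + 1\<close> steps exceeds the one within \<open>j\<close> steps by \<open>2 * gam\<close>;
 concentration of the maximum allows averaging this gain over the directions.\<close>

lemma arv_chain:
 fixes x :: "'v => 'a => real"
 assumes fin: "finite V" "finite I"
  and ng: "!!v. v : V ==> ng v : V" "!!v. v : V ==> ng (ng v) = v"
  and xng: "!!v i. v : V ==> i : I ==> x (ng v) i = - x v i"
  and dst0: "!!v. v : V ==> dst v v = (0::real)"
  and tri: "!!u v w. u : V ==> v : V ==> w : V ==> dst u w <= dst u v + dst v w"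
  and dng: "!!u v. u : V ==> v : V ==> dst (ng u) (ng v) = dst u v"
  and rho: "rho >= 0"
  and near: "!!u v. u : V ==> v : V ==> dst v u <= real k * rho ==> (SUM i:I. (x u i - x v i)^2) <= vv"
  and N: "!!v. v : V ==> card {u : V. dst v u <= real k * rho} <= N" "N > 0"
  and msym: "!!A u v. m A u v = m A v u" and mnn: "!!A u v. m A u v >= (0::real)"
  and mpos: "!!A u v. A <= I ==> u : V ==> v : V ==> m A u v > 0 ==>
    dst (ng u) v <= rho & gam <= lin I A (x u) & gam <= lin I A (x v)"
  and mw: "!!A u. A <= I ==> u : V ==> (SUM v:V. m A u v) <= w u"
  and M: "M <= EP I (%A. SUM u:V. SUM v:V. m A u v)"
  and l: "l > 0" and gam: "gam >= 0" and vv: "vv >= 0"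
 shows "l * (real k * (2 * gam * M - 2 * (SUM u:V. w u) * sqrt (2 * vv))) <= (SUM u:V. w u) * (ln N + l^2 * vv / 2)"
proof -
 define B where "B j v = {u : V. dst v u <= real j * rho}" for j v
 define Z where "Z j v A = Max ((%u. lin I A (%i. x u i - x v i)) ` B j v)" for j v A
 define z where "z j v = EP I (Z j v)" for j v
 define mu where "mu A u = (SUM v:V. m A u v)" for A u
 define p where "p u = EP I (%A. mu A u)" for u
 let ?W = "SUM u:V. w u"
 have jk: "real j * rho <= real k * rho" if "j <= k" for j using that rho by (intro mult_right_mono) auto
 have Bf: "finite (B j v)" for j v using fin by (simp add: B_def)
 have Bne: "v : B j v" if "v : V" for j v using that dst0 rho by (simp add: B_def)
 have ld: "lin I A (%i. x u i - x v i) = lin I A (x u) - lin I A (x v)" for A u v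
  by (simp add: lin_def right_diff_distrib sum_subtractf)
 have ln: "lin I A (x (ng v)) = - lin I A (x v)" if "v : V" for A v
  using xng[OF that] by (simp add: lin_def sum_negf)
 have mu0: "0 <= mu A u" for A u using mnn by (simp add: mu_def sum_nonneg)
 have muw: "mu A u <= w u" if "A <= I" "u : V" for A u using mw[OF that] by (simp add: mu_def)
 have w0: "0 <= w u" if "u : V" for u using order_trans[OF mu0 muw[OF _ that]] by blast
 have p0: "0 <= p u" for u unfolding p_def by (rule EP_nonneg) (rule mu0)
 have pw: "p u <= w u" if "u : V" for u
  using EP_mono[of I "%A. mu A u" "%A. w u"] muw that EP_const[OF fin(2)] by (simp add: p_def)
 have dev: "EP I (%A. \<bar>Z j v A - z j v\<bar>) <= sqrt (2 * vv)" if "v : V" "j <= k" for j v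
  unfolding z_def Z_def
  by (rule lin_max_var) (use fin(2) Bf Bne[OF that(1)] near that jk[OF that(2)] in \<open>auto simp: B_def\<close>)
 have mean: "l * z j v <= ln N + l^2 * vv / 2" if "v : V" "j <= k" for j v
 proof -
  have "l * z j v <= ln (card (B j v)) + l^2 * vv / 2"
   unfolding z_def Z_def
   by (rule lin_max_mean) (use fin(2) Bf Bne[OF that(1)] near that jk[OF that(2)] l in \<open>auto simp: B_def\<close>)
  moreover have "card (B j v) <= N"
  proof -
   have "card (B j v) <= card {u : V. dst v u <= real k * rho}"
    using fin jk[OF that(2)] by (intro card_mono) (auto simp: B_def)
   thus ?thesis using N(1)[OF that(1)] by simp
  qed
  moreover have "card (B j v) > 0" using Bf Bne[OF that(1)] by (auto simp: card_gt_0_iff)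
  ultimately show ?thesis by (smt (verit) ln_mono of_nat_0_less_iff of_nat_mono)
 qed
 \<comment> \<open>Negation maps balls to balls and forms to their negatives; complementing
   \<open>A\<close> restores the sign without changing the average.\<close>
 have zsym: "z j (ng v) = z j v" if v: "v : V" for j v
 proof -
  have BB: "B j (ng v) = ng ` B j v"
  proof
   show "ng ` B j v <= B j (ng v)" using dng[OF v] ng by (auto simp: B_def)
   show "B j (ng v) <= ng ` B j v"
   proof
    fix u assume u: "u : B j (ng v)"
    hence "ng u : B j v" using dng[of "ng v" u] ng v by (auto simp: B_def)
    thus "u : ng ` B j v" using ng(2)[of u] u by (force simp: B_def)
   qed
  qed
  have "Z j (ng v) A = Z j v (I - A)" for A
  proof -
   have "(%u. lin I A (%i. x u i - x (ng v) i)) ` B j (ng v) = (%u. lin I (I - A) (%i. x u i - x v i)) ` B j v"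
    unfolding BB image_image
    by (intro image_cong) (auto simp: ld ln lin_compl v B_def)
   thus ?thesis by (simp add: Z_def)
  qed
  hence "Z j (ng v) = (%A. Z j v (I - A))" by (rule ext)
  thus ?thesis using EP_compl[of I "Z j v"] by (simp add: z_def)
 qed
 have z0: "0 <= z j v" if "v : V" for j v
  unfolding z_def
 proof (rule EP_nonneg)
  fix A
  have "lin I A (%i. x v i - x v i) <= Z j v A" unfolding Z_def
   by (rule Max_ge[OF finite_imageI[OF Bf] imageI[OF Bne[OF that]]])
  thus "0 <= Z j v A" by (simp add: lin_def)
 qed
 \<comment> \<open>A point within \<open>j\<close> steps of \<open>v\<close> is within
   \<open>j + 1\<close> steps of \<open>ng u\<close>. Moving the base point from \<open>v\<close> to
   \<open>ng u\<close> gains the projections of \<open>v\<close> and of \<open>u\<close>, each at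
   least \<open>gam\<close>.\<close>
 have step: "m A u v * (Z j v A + 2 * gam) <= m A u v * Z (Suc j) (ng u) A"
  if "A <= I" "u : V" "v : V" for A u v j
 proof (cases "m A u v = 0")
  case False
  hence mp: "m A u v > 0" using mnn[of A u v] by simp
  note mm = mpos[OF that mp]
  have "Z j v A : (%u. lin I A (%i. x u i - x v i)) ` B j v"
   unfolding Z_def using Bf Bne[OF that(3)] by (intro Max_in) auto
  then obtain c where c: "c : B j v" "Z j v A = lin I A (x c) - lin I A (x v)" by (auto simp: ld)
  have "dst (ng u) c <= dst (ng u) v + dst v c" using c that ng by (intro tri) (auto simp: B_def)
  also have "... <= rho + real j * rho" using mm c by (intro add_mono) (auto simp: B_def)
  finally have "c : B (Suc j) (ng u)" using c by (simp add: B_def algebra_simps)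
  hence "lin I A (%i. x c i - x (ng u) i) <= Z (Suc j) (ng u) A" unfolding Z_def using Bf by (intro Max_ge) auto
  moreover have "lin I A (%i. x c i - x (ng u) i) = Z j v A + lin I A (x v) + lin I A (x u)"
   using c that by (simp add: ld ln)
  ultimately have "Z j v A + 2 * gam <= Z (Suc j) (ng u) A" using mm by linarith
  thus ?thesis using mp by (intro mult_left_mono) auto
 qed simp
 have gain: "(SUM u:V. p u * z (Suc j) u) >= (SUM u:V. p u * z j u) + (2 * gam * M - 2 * ?W * sqrt (2 * vv))"
  if j: "Suc j <= k" for j
 proof -
  have a: "(SUM u:V. mu A u * Z j u A) + 2 * gam * (SUM u:V. mu A u) <= (SUM u:V. mu A u * Z (Suc j) (ng u) A)"
   if A: "A <= I" for A
  proof -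
   have "(SUM u:V. SUM v:V. m A u v * (Z j v A + 2 * gam)) <= (SUM u:V. SUM v:V. m A u v * Z (Suc j) (ng u) A)"
    using step[OF A] by (intro sum_mono)
   moreover have "(SUM u:V. SUM v:V. m A u v * Z (Suc j) (ng u) A) = (SUM u:V. mu A u * Z (Suc j) (ng u) A)"
    by (simp add: mu_def sum_distrib_right)
   \<comment> \<open>Symmetry of \<open>m\<close> moves the weight of the pairs from
     \<open>u\<close> to \<open>v\<close>, so both sides become averages with the same weights
     \<open>mu A\<close>.\<close>
   moreover have "(SUM u:V. SUM v:V. m A u v * (Z j v A + 2 * gam)) = (SUM v:V. mu A v * (Z j v A + 2 * gam))"
    by (subst sum.swap) (simp add: mu_def sum_distrib_right msym[of A])
   ultimately show ?thesis by (simp add: algebra_simps sum.distrib sum_distrib_left)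
  qed
  have up: "EP I (%A. mu A u * Z (Suc j) (ng u) A) <= p u * z (Suc j) u + w u * sqrt (2 * vv)" if u: "u : V" for u
  proof -
   have "EP I (%A. mu A u * Z (Suc j) (ng u) A)
     <= EP I (%A. mu A u * z (Suc j) u + w u * \<bar>Z (Suc j) (ng u) A - z (Suc j) (ng u)\<bar>)"
   proof (rule EP_mono)
    fix A assume A: "A <= I"
    have "mu A u * (Z (Suc j) (ng u) A - z (Suc j) u) <= mu A u * \<bar>Z (Suc j) (ng u) A - z (Suc j) u\<bar>"
     using mu0 by (intro mult_left_mono) auto
    also have "... <= w u * \<bar>Z (Suc j) (ng u) A - z (Suc j) u\<bar>" using muw[OF A u] by (intro mult_right_mono) auto
    finally show "mu A u * Z (Suc j) (ng u) A <= mu A u * z (Suc j) u + w u * \<bar>Z (Suc j) (ng u) A - z (Suc j) (ng u)\<bar>"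
     by (simp add: zsym[OF u] algebra_simps)
   qed
   also have "... = p u * z (Suc j) u + w u * EP I (%A. \<bar>Z (Suc j) (ng u) A - z (Suc j) (ng u)\<bar>)"
    by (simp add: EP_add EP_mulc EP_cmul p_def)
   also have "... <= p u * z (Suc j) u + w u * sqrt (2 * vv)"
    using dev[OF ng(1)[OF u] j] w0[OF u] by (intro add_left_mono mult_left_mono) auto
   finally show ?thesis .
  qed
  have lo: "p u * z j u - w u * sqrt (2 * vv) <= EP I (%A. mu A u * Z j u A)" if u: "u : V" for u
  proof -
   have "p u * z j u - w u * sqrt (2 * vv) <= p u * z j u - w u * EP I (%A. \<bar>Z j u A - z j u\<bar>)"
    using dev[OF u, of j] j w0[OF u] by (intro diff_left_mono mult_left_mono) auto
   also have "... = EP I (%A. mu A u * z j u - w u * \<bar>Z j u A - z j u\<bar>)"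
    by (simp add: EP_diff EP_mulc EP_cmul p_def)
   also have "... <= EP I (%A. mu A u * Z j u A)"
   proof (rule EP_mono)
    fix A assume A: "A <= I"
    have "mu A u * (z j u - Z j u A) <= mu A u * \<bar>Z j u A - z j u\<bar>"
     using mu0 by (intro mult_left_mono) auto
    also have "... <= w u * \<bar>Z j u A - z j u\<bar>" using muw[OF A u] by (intro mult_right_mono) auto
    finally show "mu A u * z j u - w u * \<bar>Z j u A - z j u\<bar> <= mu A u * Z j u A" by (simp add: algebra_simps)
   qed
   finally show ?thesis .
  qed
  have "EP I (%A. (SUM u:V. mu A u * Z j u A) + 2 * gam * (SUM u:V. mu A u)) <= EP I (%A. SUM u:V. mu A u * Z (Suc j) (ng u) A)"
   by (rule EP_mono) (rule a)
  hence "(SUM u:V. EP I (%A. mu A u * Z j u A)) + 2 * gam * EP I (%A. SUM u:V. mu A u) <= (SUM u:V. EP I (%A. mu A u * Z (Suc j) (ng u) A))"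
   by (simp add: EP_add EP_cmul EP_sum)
  moreover have "(SUM u:V. EP I (%A. mu A u * Z (Suc j) (ng u) A)) <= (SUM u:V. p u * z (Suc j) u + w u * sqrt (2 * vv))"
   using up by (rule sum_mono)
  moreover have "(SUM u:V. p u * z j u - w u * sqrt (2 * vv)) <= (SUM u:V. EP I (%A. mu A u * Z j u A))"
   using lo by (rule sum_mono)
  moreover have "2 * gam * M <= 2 * gam * EP I (%A. SUM u:V. mu A u)" using M gam by (simp add: mu_def mult_left_mono)
  ultimately show ?thesis unfolding sum.distrib sum_subtractf sum_distrib_right[symmetric] by linarith
 qed
 \<comment> \<open>Telescoping. Each step pays for concentration twice, in \<open>up\<close> and in
   \<open>lo\<close>.\<close>
 have "j <= k ==> real j * (2 * gam * M - 2 * ?W * sqrt (2 * vv)) <= (SUM u:V. p u * z j u)" for j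
 proof (induction j)
  case 0
  thus ?case using p0 z0 by (simp add: sum_nonneg)
 next
  case (Suc j)
  thus ?case using gain[of j] by (simp add: algebra_simps)
 qed
 hence "real k * (2 * gam * M - 2 * ?W * sqrt (2 * vv)) <= (SUM u:V. p u * z k u)" by simp
 hence "l * (real k * (2 * gam * M - 2 * ?W * sqrt (2 * vv))) <= l * (SUM u:V. p u * z k u)"
  using l by (intro mult_left_mono) auto
 also have "... = (SUM u:V. p u * (l * z k u))" by (simp add: sum_distrib_left mult.left_commute)
 also have "... <= (SUM u:V. w u * (ln N + l^2 * vv / 2))"
 proof (rule sum_mono)
  fix u assume u: "u : V"
  have "p u * (l * z k u) <= w u * (l * z k u)" using pw[OF u] z0[OF u] l by (intro mult_right_mono) auto
  also have "... <= w u * (ln N + l^2 * vv / 2)" using mean[OF u] w0[OF u] by (intro mult_left_mono) auto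
  finally show "p u * (l * z k u) <= w u * (ln N + l^2 * vv / 2)" .
 qed
 finally show ?thesis by (simp add: sum_distrib_right)
qed

section \<open>Sweep cuts of lazy random walks\<close>

definition ip :: "'v set => ('v => real) => ('v => real) => real" where
 "ip R x y = (SUM v:R. x v * y v)"

definition app :: "'v set => ('v => 'v => real) => ('v => real) => 'v => real" where
 "app R L x v = (SUM u:R. L v u * x u)"

text \<open>The source of both Cauchy-Schwarz inequalities below, for the inner product and for the
  merely semidefinite form of \<open>L\<close>; hence \<open>c = 0\<close> must be allowed.\<close>

lemma discriminant_le:
 fixes a b c :: real
 assumes "!!t. 0 <= a + 2 * t * b + t^2 * c"
 shows "b^2 <= a * c"
proof (cases "c = 0")
 case True
 have "b = 0"
 proof (rule ccontr)
  assume "b ~= 0"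
  thus False using assms[of "- (a + 1) / (2 * b)"] True by (simp add: field_simps)
 qed
 thus ?thesis using True by simp
next
 case False
 have c: "c > 0"
 proof (rule ccontr)
  assume "~ c > 0"
  hence c0: "c < 0" using False by simp
  \<comment> \<open>At this \<open>t\<close> the negative quadratic term outweighs the other
    two.\<close>
  define t where "t = (\<bar>a\<bar> + 2 * \<bar>b\<bar> + 1) / (- c) + 1"
  have "0 <= (\<bar>a\<bar> + 2 * \<bar>b\<bar> + 1) / (- c)" using c0 by (intro divide_nonneg_pos) auto
  hence t1: "t >= 1" by (simp add: t_def)
  have "t * (- c) > \<bar>a\<bar> + 2 * \<bar>b\<bar>" using c0 by (simp add: t_def field_simps)
  hence "t * (t * (- c)) >= t * (\<bar>a\<bar> + 2 * \<bar>b\<bar>)" using t1 by (intro mult_left_mono) auto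
  moreover have "t * \<bar>a\<bar> >= \<bar>a\<bar>" using t1 by (simp add: mult_right_mono[of 1 t "\<bar>a\<bar>", simplified])
  ultimately have "a + 2 * t * b + t^2 * c <= a - \<bar>a\<bar> + 2 * t * (b - \<bar>b\<bar>)" by (simp add: power2_eq_square algebra_simps)
  moreover have "2 * t * (b - \<bar>b\<bar>) <= 0" using t1 by (simp add: mult_le_0_iff)
  ultimately have le0: "a + 2 * t * b + t^2 * c <= 0" by linarith
  have "2 * \<bar>b\<bar> + \<bar>a\<bar> < t * (- c)" using \<open>t * (- c) > \<bar>a\<bar> + 2 * \<bar>b\<bar>\<close> by simp
  hence "t * (t * (- c)) > t * (\<bar>a\<bar> + 2 * \<bar>b\<bar>)" using t1 by (intro mult_strict_left_mono) auto
  hence "a + 2 * t * b + t^2 * c < 0"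
   using \<open>t * \<bar>a\<bar> >= \<bar>a\<bar>\<close> \<open>2 * t * (b - \<bar>b\<bar>) <= 0\<close> by (simp add: power2_eq_square algebra_simps)
  thus False using assms[of t] by simp
 qed
 have "a + 2 * (- b / c) * b + (- b / c)^2 * c = a - b^2 / c"
  using c by (simp add: power2_eq_square field_simps)
 hence "b^2 / c <= a" using assms[of "- b / c"] by simp
 thus ?thesis using c by (simp add: field_simps)
qed

lemma ip_commute: "ip R x y = ip R y x"
 by (simp add: ip_def mult.commute)

lemma ip_ge0: "0 <= ip R x x"
 by (simp add: ip_def sum_nonneg)

lemma ip_lin: "ip R (%v. x v + t * y v) z = ip R x z + t * ip R y z"
 by (simp add: ip_def algebra_simps sum.distrib sum_distrib_left)

lemma app_lin: "app R L (%v. x v + t * y v) = (%v. app R L x v + t * app R L y v)"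
 by (simp add: app_def algebra_simps sum.distrib sum_distrib_left fun_eq_iff)

locale psd_form =
 fixes R :: "'v set" and L :: "'v => 'v => real"
 assumes finR: "finite R"
  and symL: "!!u v. u : R ==> v : R ==> L u v = L v u"
  and psd: "!!x. 0 <= ip R x (app R L x)"
begin

lemma self_adj: "ip R (app R L x) y = ip R x (app R L y)"
proof -
 have "ip R (app R L x) y = (SUM v:R. SUM u:R. L v u * x u * y v)"
  by (simp add: ip_def app_def sum_distrib_right)
 also have "... = (SUM u:R. SUM v:R. L u v * x u * y v)"
  by (subst sum.swap) (intro sum.cong refl, simp add: symL)
 also have "... = ip R x (app R L y)"
  by (simp add: ip_def app_def sum_distrib_left mult_ac)
 finally show ?thesis .
qed

lemma cs: "(ip R x y)^2 <= ip R x x * ip R y y"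
proof (rule discriminant_le)
 fix t
 have "ip R (%v. x v + t * y v) (%v. x v + t * y v) = ip R x x + 2 * t * ip R x y + t^2 * ip R y y"
  by (simp add: ip_lin ip_commute[of R _ "%v. x v + t * y v"] ip_commute[of R y x] power2_eq_square algebra_simps)
 thus "0 <= ip R x x + 2 * t * ip R x y + t^2 * ip R y y" using ip_ge0 by metis
qed

lemma cs_psd: "(ip R x (app R L y))^2 <= ip R x (app R L x) * ip R y (app R L y)"
proof (rule discriminant_le)
 fix t
 have "ip R (%v. x v + t * y v) (app R L (%v. x v + t * y v)) = ip R x (app R L x) + 2 * t * ip R x (app R L y) + t^2 * ip R y (app R L y)"
  unfolding app_lin using self_adj[of x y] ip_commute[of R y "app R L x"]
  by (simp add: ip_lin ip_commute[of R _ "%v. app R L x v + t * app R L y v"] self_adj ip_commute[of R "app R L x" y]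
    ip_commute[of R "app R L y"] power2_eq_square algebra_simps)
 thus "0 <= ip R x (app R L x) + 2 * t * ip R x (app R L y) + t^2 * ip R y (app R L y)" using psd by metis
qed

abbreviation "pw x t \<equiv> (app R L ^^ t) x"

text \<open>For \<open>z = L y\<close>, Cauchy-Schwarz in the form of \<open>L\<close> bounds the
  squared norm of \<open>z\<close>, squared, by the product of the forms at \<open>y\<close> and
  \<open>z\<close>. The Rayleigh bounds at both points then give growth by at most
  \<open>lam^2\<close>.\<close>

lemma power_upper:
 assumes lam: "lam > 0" and "!!t. t <= T ==> ip R (pw x t) (app R L (pw x t)) <= lam * ip R (pw x t) (pw x t)"
 shows "t <= T ==> ip R (pw x t) (pw x t) <= lam ^ (2 * t) * ip R x x"
proof (induction t)
 case (Suc t)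
 let ?y = "pw x t" and ?z = "pw x (Suc t)"
 have z: "?z = app R L ?y" by simp
 have a1: "ip R ?y (app R L ?y) <= lam * ip R ?y ?y" using assms(2) Suc.prems by simp
 have a3: "ip R ?z (app R L ?z) <= lam * ip R ?z ?z" using assms(2) Suc.prems by blast
 have zz: "ip R ?z ?z = ip R ?y (app R L ?z)" unfolding z by (rule self_adj)
 have "(ip R ?z ?z)^2 <= ip R ?y (app R L ?y) * ip R ?z (app R L ?z)" unfolding zz by (rule cs_psd)
 also have "... <= ip R ?y (app R L ?y) * (lam * ip R ?z ?z)" using a3 psd by (intro mult_left_mono)
 finally have "ip R ?z ?z * ip R ?z ?z <= (lam * ip R ?y (app R L ?y)) * ip R ?z ?z"
  by (simp add: power2_eq_square mult_ac)
 hence "ip R ?z ?z <= lam * ip R ?y (app R L ?y)"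
  using ip_ge0[of R ?z] psd[of ?y] lam by (cases "ip R ?z ?z = 0") (auto simp: mult_le_cancel_right)
 also have "... <= lam * (lam * ip R ?y ?y)" using a1 lam by (intro mult_left_mono) auto
 also have "... <= lam * (lam * (lam ^ (2 * t) * ip R x x))" using Suc lam by (intro mult_left_mono) auto
 finally show ?case by (simp add: mult_ac)
qed simp

text \<open>Rayleigh quotients do not decrease under power iteration: one plain Cauchy-Schwarz and
  one in the form of \<open>L\<close> carry the bound from \<open>y\<close> to
  \<open>L y\<close>.\<close>

lemma power_lower:
 assumes k: "kap > 0" "ip R x x > 0" "kap * ip R x x <= ip R x (app R L x)"
 shows "kap * ip R (pw x t) (pw x t) <= ip R (pw x t) (app R L (pw x t)) & ip R (pw x t) (pw x t) >= kap ^ (2 * t) * ip R x x"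
proof (induction t)
 case 0
 thus ?case using k by simp
next
 case (Suc t)
 let ?y = "pw x t" and ?z = "pw x (Suc t)"
 have z: "?z = app R L ?y" by simp
 have y0: "ip R ?y ?y > 0" using Suc k by (meson less_le_trans mult_pos_pos zero_less_power)
 have yz: "ip R ?y ?z >= kap * ip R ?y ?y" using Suc by simp
 hence yz0: "ip R ?y ?z > 0" using k(1) y0 by (meson less_le_trans mult_pos_pos)
 have "kap * ip R ?y ?y * ip R ?y ?z <= (ip R ?y ?z)^2" using yz yz0 by (simp add: power2_eq_square)
 also have "... <= ip R ?y ?y * ip R ?z ?z" by (rule cs)
 finally have zz: "kap * ip R ?y ?z <= ip R ?z ?z" using y0 by (simp add: mult.left_commute mult.assoc)
 hence z0: "ip R ?z ?z > 0" using k(1) yz0 by (meson less_le_trans mult_pos_pos)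
 have "ip R ?z ?z = ip R ?y (app R L ?z)" unfolding z by (rule self_adj)
 hence "(ip R ?z ?z)^2 <= ip R ?y ?z * ip R ?z (app R L ?z)" using cs_psd[of ?y ?z] by simp
 moreover have "kap * ip R ?y ?z * ip R ?z ?z <= (ip R ?z ?z)^2" using zz z0 by (simp add: power2_eq_square)
 ultimately have "ip R ?y ?z * (kap * ip R ?z ?z) <= ip R ?y ?z * ip R ?z (app R L ?z)" by (simp add: mult_ac)
 hence "kap * ip R ?z ?z <= ip R ?z (app R L ?z)" using yz0 by simp
 moreover have "kap ^ (2 * Suc t) * ip R x x <= ip R ?z ?z"
 proof -
  have "kap ^ (2 * Suc t) * ip R x x = kap * (kap * (kap ^ (2 * t) * ip R x x))" by simp
  also have "... <= kap * (kap * ip R ?y ?y)" using Suc k(1) by (intro mult_left_mono) auto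
  also have "... <= kap * ip R ?y ?z" using yz k(1) by (intro mult_left_mono) auto
  finally show ?thesis using zz by linarith
 qed
 ultimately show ?case by blast
qed

end

section \<open>Cheeger's inequality for antisymmetric vectors\<close>

definition bsgn :: "('v => 'v) => 'v set => 'v => int" where
 "bsgn ng A v = (if v : A then 1 else if ng v : A then -1 else 0)"

lemma layer_cake:
 fixes g :: int
 assumes "\<bar>g\<bar> <= int M"
 shows "(SUM h<M. (if int h < g then 1 else if int h < - g then -1 else 0)) = g"
proof (cases "g >= 0")
 case True
 have "(SUM h<M. (if int h < g then 1 else if int h < - g then -1 else 0)) = (SUM h:{..<M}. if h < nat g then 1 else (0::int))"
  using True by (intro sum.cong) auto
 also have "... = (SUM h:{..<M} Int {h. h < nat g}. 1)" by (simp add: sum.If_cases Int_def)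
 also have "{..<M} Int {h. h < nat g} = {..<nat g}" using assms True by auto
 finally show ?thesis using True by simp
next
 case False
 have "(SUM h<M. (if int h < g then 1 else if int h < - g then -1 else 0)) = (SUM h:{..<M}. if h < nat (- g) then -1 else (0::int))"
  using False by (intro sum.cong) auto
 also have "... = (SUM h:{..<M} Int {h. h < nat (- g)}. -1)" by (simp add: sum.If_cases Int_def)
 also have "{..<M} Int {h. h < nat (- g)} = {..<nat (- g)}" using assms False by auto
 finally show ?thesis using False by simp
qed

text \<open>The levels of the signed square \<open>g\<close> of \<open>x\<close> are pairs of a
  sweep set and its mirror image. Each level obeys the hypothesis on sweep cuts; summed over levels
  this bounds the total of \<open>x^2\<close> by the variation of \<open>g\<close>, and AM-GM passes
  from there to the energy of \<open>x\<close>.\<close>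

lemma cheeger:
 fixes x :: "'v => int" and E :: "'v => 'v => nat" and wl :: "'v => nat"
 assumes fin: "finite R" and ng: "!!v. v : R ==> ng v : R" "!!v. v : R ==> ng (ng v) = v"
  and xng: "!!v. v : R ==> x (ng v) = - x v"
  and Esym: "!!u v. u : R ==> v : R ==> E u v = E v u"
  and deg: "!!v. v : R ==> (SUM u:R. E u v) <= wl v"
  and C: "C > 0"
  and nonsparse: "!!m. m : R ==> 0 < x m ==>
    (SUM v:R. int (wl v) * \<bar>bsgn ng {v : R. x m <= x v} v\<bar>) <=
    int C * (SUM u:R. SUM v:R. int (E u v) * \<bar>bsgn ng {v : R. x m <= x v} u - bsgn ng {v : R. x m <= x v} v\<bar>)"
 shows "(SUM v:R. real (wl v) * (real_of_int (x v))^2) <= 4 * (real C)^2 * (SUM u:R. SUM v:R. real (E u v) * (real_of_int (x u) - real_of_int (x v))^2)"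
proof -
 define g where "g v = sgn (x v) * (x v)^2" for v
 obtain M :: nat where M: "!!v. v : R ==> \<bar>g v\<bar> <= int M"
 proof
  fix v assume "v : R"
  hence "\<bar>g v\<bar> <= (SUM v:R. \<bar>g v\<bar>)" using fin by (intro member_le_sum) auto
  thus "\<bar>g v\<bar> <= int (nat (SUM v:R. \<bar>g v\<bar>))" by (simp add: sum_nonneg)
 qed
 define b where "b h v = (if int h < g v then 1 else if int h < - g v then -1 else (0::int))" for h v
 have lc: "(SUM h<M. b h v) = g v" if "v : R" for v unfolding b_def by (rule layer_cake[OF M[OF that]])
 have gab: "\<bar>g v\<bar> = (x v)^2" for v by (auto simp: g_def sgn_if)
 have absb: "(SUM h<M. \<bar>b h v\<bar>) = (x v)^2" if "v : R" for v
 proof (cases "g v >= 0")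
  case True
  hence "(SUM h<M. \<bar>b h v\<bar>) = (SUM h<M. b h v)" by (intro sum.cong) (auto simp: b_def)
  thus ?thesis using lc[OF that] gab[of v] True by simp
 next
  case False
  hence "(SUM h<M. \<bar>b h v\<bar>) = (SUM h<M. - b h v)" by (intro sum.cong) (auto simp: b_def)
  thus ?thesis using lc[OF that] gab[of v] False by (simp add: sum_negf)
 qed
 have dif: "(SUM h<M. \<bar>b h u - b h v\<bar>) = \<bar>g u - g v\<bar>" if "u : R" "v : R" for u v
 proof -
  have mon: "(SUM h<M. \<bar>b h u - b h v\<bar>) = g u - g v" if "u : R" "v : R" "g v <= g u" for u v
  proof -
   have "(SUM h<M. \<bar>b h u - b h v\<bar>) = (SUM h<M. b h u - b h v)"
    using that(3) by (intro sum.cong) (auto simp: b_def)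
   thus ?thesis using lc that by (simp add: sum_subtractf)
  qed
  show ?thesis
  proof (cases "g v <= g u")
   case False
   thus ?thesis using mon[of v u] that by (simp add: abs_minus_commute)
  qed (use mon that in simp)
 qed
 have ns: "(SUM v:R. int (wl v) * \<bar>b h v\<bar>) <= int C * (SUM u:R. SUM v:R. int (E u v) * \<bar>b h u - b h v\<bar>)" for h
 proof (cases "EX v:R. int h < g v")
  case False
  hence F: "~ int h < g v" if "v : R" for v using that by blast
  have "~ int h < - g v" if "v : R" for v
   using F[OF ng(1)[OF that]] xng[OF that] by (simp add: g_def)
  hence "b h v = 0" if "v : R" for v using F that by (simp add: b_def)
  thus ?thesis by simp
 next
  case True
  \<comment> \<open>The level set is the sweep set of its element \<open>m\<close> with the least
    \<open>x\<close>.\<close>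
  define A where "A = {v : R. int h < g v}"
  have A: "finite A" "A ~= {}" using fin True by (auto simp: A_def)
  obtain m where m: "m : A" "!!v. v : A ==> x m <= x v"
   using arg_min_if_finite[OF A, of x] by (metis not_le)
  have pos: "x v > 0" if "int h < g v" for v
  proof (rule ccontr)
   assume "~ x v > 0"
   hence "g v <= 0" by (cases "x v = 0") (auto simp: g_def)
   thus False using that by simp
  qed
  have gv: "g v = (x v)^2" if "x v > 0" for v using that by (simp add: g_def)
  have AA: "{v : R. x m <= x v} = A"
  proof
   show "A <= {v : R. x m <= x v}" using m by (auto simp: A_def)
   show "{v : R. x m <= x v} <= A"
   proof
    fix v assume v: "v : {v : R. x m <= x v}"
    have xm: "x m > 0" using m(1) pos by (simp add: A_def)
    have "(x m)^2 <= (x v)^2" using v xm by (intro power_mono) auto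
    hence "g m <= g v" using gv xm v by simp
    thus "v : A" using v m(1) by (simp add: A_def)
   qed
  qed
  have bb: "b h v = bsgn ng A v" if "v : R" for v
  proof -
   have "int h < - g v \<longleftrightarrow> ng v : A" using ng(1)[OF that] xng[OF that] by (simp add: A_def g_def)
   thus ?thesis using that by (simp add: b_def bsgn_def A_def)
  qed
  have "m : R" "0 < x m" using m(1) pos by (auto simp: A_def)
  from nonsparse[OF this] show ?thesis unfolding AA by (simp add: bb cong: sum.cong)
 qed
 let ?x = "%v. real_of_int (x v)"
 let ?Q = "SUM u:R. SUM v:R. real (E u v) * (?x u - ?x v)^2"
 let ?S = "SUM v:R. real (wl v) * (?x v)^2"
 have "(SUM v:R. int (wl v) * (x v)^2) = (SUM v:R. SUM h<M. int (wl v) * \<bar>b h v\<bar>)"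
  by (intro sum.cong refl) (simp add: absb sum_distrib_left[symmetric])
 also have "... = (SUM h<M. SUM v:R. int (wl v) * \<bar>b h v\<bar>)" by (rule sum.swap)
 also have "... <= (SUM h<M. int C * (SUM u:R. SUM v:R. int (E u v) * \<bar>b h u - b h v\<bar>))" by (rule sum_mono) (rule ns)
 also have "... = int C * (SUM u:R. SUM h<M. SUM v:R. int (E u v) * \<bar>b h u - b h v\<bar>)"
  unfolding sum_distrib_left[symmetric] by (subst sum.swap) (rule refl)
 also have "... = int C * (SUM u:R. SUM v:R. int (E u v) * \<bar>g u - g v\<bar>)"
 proof -
  have "(SUM u:R. SUM h<M. SUM v:R. int (E u v) * \<bar>b h u - b h v\<bar>) = (SUM u:R. SUM v:R. SUM h<M. int (E u v) * \<bar>b h u - b h v\<bar>)"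
   by (intro sum.cong refl sum.swap)
  also have "... = (SUM u:R. SUM v:R. int (E u v) * \<bar>g u - g v\<bar>)"
   by (intro sum.cong refl) (simp add: dif sum_distrib_left[symmetric])
  finally show ?thesis by simp
 qed
 finally have "real_of_int (SUM v:R. int (wl v) * (x v)^2) <= real_of_int (int C * (SUM u:R. SUM v:R. int (E u v) * \<bar>g u - g v\<bar>))"
  by (simp only: of_int_le_iff)
 hence 1: "?S <= real C * (SUM u:R. SUM v:R. real (E u v) * real_of_int \<bar>g u - g v\<bar>)" by simp
 have gd: "real_of_int \<bar>g u - g v\<bar> <= \<bar>?x u - ?x v\<bar> * (\<bar>?x u\<bar> + \<bar>?x v\<bar>)" for u v
 proof -
  have *: "\<bar>sgn a * a^2 - sgn c * c^2\<bar> <= \<bar>a - c\<bar> * (\<bar>a\<bar> + \<bar>c\<bar>)" for a c :: int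
  proof -
   have "sgn a * a^2 - sgn c * c^2 = a * \<bar>a\<bar> - c * \<bar>c\<bar>" by (auto simp: sgn_if power2_eq_square abs_if)
   moreover have "\<bar>a * \<bar>a\<bar> - c * \<bar>c\<bar>\<bar> <= \<bar>a - c\<bar> * (\<bar>a\<bar> + \<bar>c\<bar>)"
   proof -
    have "2 * (a * \<bar>a\<bar> - c * \<bar>c\<bar>) = (a - c) * (\<bar>a\<bar> + \<bar>c\<bar>) + (a + c) * (\<bar>a\<bar> - \<bar>c\<bar>)" by (simp add: algebra_simps)
    moreover have "\<bar>(a + c) * (\<bar>a\<bar> - \<bar>c\<bar>)\<bar> <= (\<bar>a\<bar> + \<bar>c\<bar>) * \<bar>a - c\<bar>"
     unfolding abs_mult by (intro mult_mono) auto
    moreover have "\<bar>(a - c) * (\<bar>a\<bar> + \<bar>c\<bar>)\<bar> = \<bar>a - c\<bar> * (\<bar>a\<bar> + \<bar>c\<bar>)" by (simp add: abs_mult)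
    ultimately show ?thesis by (smt (verit) mult.commute)
   qed
   ultimately show ?thesis by simp
  qed
  have "real_of_int \<bar>g u - g v\<bar> <= real_of_int (\<bar>x u - x v\<bar> * (\<bar>x u\<bar> + \<bar>x v\<bar>))"
   unfolding g_def using * by (simp only: of_int_le_iff)
  thus ?thesis by simp
 qed
 \<comment> \<open>The weights are such that the second term, after the degree bound, adds up to
   half of the left-hand side of the claim.\<close>
 have am: "a * c <= 2 * real C * a^2 + c^2 / (8 * real C)" for a c :: real
 proof -
  have "0 <= (4 * real C * a - c)^2" by simp
  hence "8 * real C * (a * c) <= 16 * (real C)^2 * a^2 + c^2" by (simp add: power2_eq_square algebra_simps)
  hence "a * c <= (16 * (real C)^2 * a^2 + c^2) / (8 * real C)" using C by (simp add: field_simps)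
  thus ?thesis using C by (simp add: field_simps power2_eq_square)
 qed
 have "(SUM u:R. SUM v:R. real (E u v) * real_of_int \<bar>g u - g v\<bar>)
   <= (SUM u:R. SUM v:R. real (E u v) * (2 * real C * (?x u - ?x v)^2 + (2 * (?x u)^2 + 2 * (?x v)^2) / (8 * real C)))"
 proof (intro sum_mono mult_left_mono)
  fix u v
  have "real_of_int \<bar>g u - g v\<bar> <= 2 * real C * (\<bar>?x u - ?x v\<bar>)^2 + (\<bar>?x u\<bar> + \<bar>?x v\<bar>)^2 / (8 * real C)"
   using order_trans[OF gd am] .
  moreover have "(\<bar>?x u\<bar> + \<bar>?x v\<bar>)^2 <= 2 * (?x u)^2 + 2 * (?x v)^2"
   using sum_squares_bound[of "\<bar>?x u\<bar>" "\<bar>?x v\<bar>"] by (simp add: power2_sum)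
  hence "(\<bar>?x u\<bar> + \<bar>?x v\<bar>)^2 / (8 * real C) <= (2 * (?x u)^2 + 2 * (?x v)^2) / (8 * real C)"
   by (intro divide_right_mono) auto
  ultimately show "real_of_int \<bar>g u - g v\<bar> <= 2 * real C * (?x u - ?x v)^2 + (2 * (?x u)^2 + 2 * (?x v)^2) / (8 * real C)" by simp
 qed simp
 also have "... = 2 * real C * ?Q + ((SUM u:R. SUM v:R. real (E u v) * (?x u)^2) + (SUM u:R. SUM v:R. real (E u v) * (?x v)^2)) / (4 * real C)"
  by (simp add: distrib_left sum.distrib sum_distrib_left sum_divide_distrib add_divide_distrib mult_ac)
 also have "(SUM u:R. SUM v:R. real (E u v) * (?x u)^2) = (SUM u:R. SUM v:R. real (E u v) * (?x v)^2)"
  by (subst sum.swap) (intro sum.cong refl, simp add: Esym)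
 also have "(SUM u:R. SUM v:R. real (E u v) * (?x v)^2) = (SUM v:R. real (SUM u:R. E u v) * (?x v)^2)"
  by (subst sum.swap) (simp add: sum_distrib_right)
 also have "2 * real C * ?Q + ((SUM v:R. real (SUM u:R. E u v) * (?x v)^2) + (SUM v:R. real (SUM u:R. E u v) * (?x v)^2)) / (4 * real C)
   <= 2 * real C * ?Q + (?S + ?S) / (4 * real C)"
  using deg by (intro add_left_mono divide_right_mono add_mono sum_mono mult_right_mono) (auto simp del: of_nat_sum)
 finally have "?S <= real C * (2 * real C * ?Q + (?S + ?S) / (4 * real C))"
  using 1 C by (meson order_trans mult_left_mono of_nat_0_le_iff)
 also have "... = 2 * (real C)^2 * ?Q + ?S / 2" using C by (simp add: field_simps power2_eq_square)
 finally show ?thesis by linarith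
qed

text \<open>If no sweep cut of the lazy random walks is sparse, the walks decay at the rate of the trivial
 eigenvalue, so no antisymmetric vector has small energy.\<close>

lemma spectral_certificate:
 fixes E :: "'v => 'v => nat" and wl :: "'v => nat" and y :: "'v => nat => 'v => nat" and s :: "'v => real"
 assumes fin: "finite R" and ng: "!!v. v : R ==> ng v : R" "!!v. v : R ==> ng (ng v) = v"
  and Esym: "!!u v. u : R ==> v : R ==> E u v = E v u"
  and Eng: "!!u v. u : R ==> v : R ==> E (ng u) (ng v) = E u v"
  and wng: "!!v. v : R ==> wl (ng v) = wl v"
  and deg: "!!v. v : R ==> (SUM u:R. E u v) <= wl v"
  and lam: "!!v. v : R ==> 2 * (SUM u:R. E u v) <= lam" "lam > 0"
  and y0: "!!i v. i : R ==> v : R ==> y i 0 v = (if v = i then 1 else 0)"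
  and yS: "!!i t v. i : R ==> v : R ==> t < T ==>
    y i (Suc t) v = c * ((SUM u:R. y i t u * E u v) + y i t v * (lam - (SUM u:R. E u v))) + y i t v * wl v"
  and C: "C > 0" "8 * C^2 <= c"
  and nonsparse: "!!i t m. i : R ==> m : R ==> t <= T ==> y i t (ng m) < y i t m ==>
    (let A = {v : R. y i t m - y i t (ng m) <= y i t v - y i t (ng v)} in
    (SUM v:R. int (wl v) * \<bar>bsgn ng A v\<bar>) <= int C * (SUM u:R. SUM v:R. int (E u v) * \<bar>bsgn ng A u - bsgn ng A v\<bar>))"
  and s: "!!v. v : R ==> \<bar>s v\<bar> = 1" "!!v. v : R ==> s (ng v) = - s v"
  and T: "c * lam * (card R)^2 <= 2 * T * (SUM v:R. wl v)" "R ~= {}"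
 shows "(SUM v:R. real (wl v)) <= real c * (SUM u:R. SUM v:R. real (E u v) * (s u - s v)^2)"
proof (rule ccontr)
 assume neg: "~ ?thesis"
 define d where "d v = (SUM u:R. E u v)" for v
 \<comment> \<open>The matrix of one step of \<open>y\<close>: a lazy walk with row sums
   \<open>c * lam\<close>, diagonally dominant because \<open>lam\<close> is at least twice each
   degree, plus the perturbation \<open>wl\<close>.\<close>
 define L where "L u v = real c * real (E u v) + (if u = v then real c * (real lam - real (d v)) + real (wl v) else 0)" for u v
 have c0: "c > 0" using C by (cases c) auto
 have form: "ip R x (app R L x) = real c * real lam * ip R x x + (SUM v:R. real (wl v) * (x v)^2) - real c / 2 * (SUM u:R. SUM v:R. real (E u v) * (x u - x v)^2)" for x
 proof -
  have ap: "app R L x v = real c * (SUM u:R. real (E v u) * x u) + (real c * (real lam - real (d v)) + real (wl v)) * x v" if "v : R" for v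
  proof -
   have "app R L x v = (SUM u:R. real c * (real (E v u) * x u) + (if v = u then (real c * (real lam - real (d v)) + real (wl v)) * x v else 0))"
    unfolding app_def L_def by (intro sum.cong) (auto simp: algebra_simps)
   thus ?thesis using fin that by (simp add: sum.distrib sum_distrib_left)
  qed
  have "ip R x (app R L x) = (SUM v:R. x v * (real c * (SUM u:R. real (E v u) * x u) + (real c * (real lam - real (d v)) + real (wl v)) * x v))"
   unfolding ip_def by (intro sum.cong refl) (simp add: ap)
  also have "... = real c * (SUM v:R. SUM u:R. real (E v u) * x u * x v) + real c * real lam * (SUM v:R. x v * x v) + (SUM v:R. real (wl v) * (x v)^2) - real c * (SUM v:R. real (d v) * (x v)^2)"
   by (simp add: algebra_simps sum.distrib sum_subtractf sum_distrib_left power2_eq_square)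
  finally have A: "ip R x (app R L x) = real c * (SUM v:R. SUM u:R. real (E v u) * x u * x v) + real c * real lam * ip R x x + (SUM v:R. real (wl v) * (x v)^2) - real c * (SUM v:R. real (d v) * (x v)^2)"
   by (simp add: ip_def)
  have d1: "(SUM v:R. real (d v) * (x v)^2) = (SUM u:R. SUM v:R. real (E u v) * (x v)^2)"
   by (subst sum.swap) (simp add: d_def sum_distrib_right)
  have d2: "(SUM u:R. SUM v:R. real (E u v) * (x u)^2) = (SUM u:R. SUM v:R. real (E u v) * (x v)^2)"
   by (subst sum.swap) (intro sum.cong refl, simp add: Esym)
  have "(SUM u:R. SUM v:R. real (E u v) * (x u - x v)^2) = (SUM u:R. SUM v:R. real (E u v) * (x u)^2) + (SUM u:R. SUM v:R. real (E u v) * (x v)^2) - 2 * (SUM u:R. SUM v:R. real (E u v) * x v * x u)"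
   by (simp add: power2_diff algebra_simps sum.distrib sum_subtractf sum_distrib_left)
  hence "(SUM u:R. SUM v:R. real (E u v) * (x u - x v)^2) = 2 * (SUM v:R. real (d v) * (x v)^2) - 2 * (SUM u:R. SUM v:R. real (E u v) * x v * x u)"
   using d1 d2 by simp
  moreover have "r * e + p + q - r * b = p + q - r / 2 * (2 * b - 2 * e)" for b e r p q :: real by (simp add: algebra_simps)
  ultimately show ?thesis unfolding A by (simp only:)
 qed
 have En: "(SUM u:R. SUM v:R. real (E u v) * (x u - x v)^2) <= 2 * real lam * ip R x x" for x
 proof -
  have "(SUM u:R. SUM v:R. real (E u v) * (x u - x v)^2) <= (SUM u:R. SUM v:R. real (E u v) * (2 * (x u)^2 + 2 * (x v)^2))"
  proof (intro sum_mono mult_left_mono)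
   fix u v
   have "0 <= (x u + x v)^2" by simp
   thus "(x u - x v)^2 <= 2 * (x u)^2 + 2 * (x v)^2" by (simp add: power2_eq_square algebra_simps)
  qed simp
  also have "... = 2 * (SUM u:R. SUM v:R. real (E u v) * (x u)^2) + 2 * (SUM u:R. SUM v:R. real (E u v) * (x v)^2)"
   by (simp add: algebra_simps sum.distrib sum_distrib_left)
  also have "(SUM u:R. SUM v:R. real (E u v) * (x u)^2) = (SUM u:R. SUM v:R. real (E u v) * (x v)^2)"
   by (subst sum.swap) (intro sum.cong refl, simp add: Esym)
  also have "(SUM u:R. SUM v:R. real (E u v) * (x v)^2) = (SUM v:R. real (d v) * (x v)^2)"
   by (subst sum.swap) (simp add: d_def sum_distrib_right)
  also have "2 * (SUM v:R. real (d v) * (x v)^2) + 2 * (SUM v:R. real (d v) * (x v)^2) = 2 * (SUM v:R. real (2 * d v) * (x v)^2)"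
   by (simp add: sum_distrib_left algebra_simps)
  also have "... <= 2 * (SUM v:R. real lam * (x v)^2)"
   using lam(1) by (intro mult_left_mono sum_mono mult_right_mono) (auto simp: d_def simp del: of_nat_mult of_nat_sum)
  finally show ?thesis by (simp add: ip_def sum_distrib_left power2_eq_square mult_ac)
 qed
 interpret psd_form R L
 proof
  show "L u v = L v u" if "u : R" "v : R" for u v using Esym[OF that] by (simp add: L_def)
  show "0 <= ip R x (app R L x)" for x
  proof -
   have "real c / 2 * (SUM u:R. SUM v:R. real (E u v) * (x u - x v)^2) <= real c / 2 * (2 * real lam * ip R x x)"
    using En[of x] by (intro mult_left_mono) auto
   moreover have "0 <= (SUM v:R. real (wl v) * (x v)^2)" by (simp add: sum_nonneg)
   moreover have "real c / 2 * (2 * real lam * ip R x x) = real c * real lam * ip R x x" by simp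
   ultimately show ?thesis unfolding form by linarith
  qed
 qed (rule fin)
 \<comment> \<open>The walk runs in naturals; as the matrix commutes with negation, it may be
   antisymmetrised afterwards.\<close>
 define X where "X i t v = (if v : R then real (y i t v) - real (y i t (ng v)) else 0)" for i t v
 have dng: "d (ng v) = d v" if v: "v : R" for v
 proof -
  have "d (ng v) = (SUM u:R. E (ng u) (ng v))"
   unfolding d_def by (rule sum.reindex_bij_witness[of _ ng ng]) (use ng in auto)
  thus ?thesis using Eng[OF _ v] by (simp add: d_def)
 qed
 have rec: "real (y i (Suc t) v) = (SUM u:R. L v u * real (y i t u))" if i: "i : R" and v: "v : R" and t: "t < T" for i t v
 proof -
  have dl: "d v <= lam" using lam(1)[OF v] by (simp add: d_def)
  have "(SUM u:R. L v u * real (y i t u)) = (SUM u:R. real c * (real (E v u) * real (y i t u)) + (if v = u then (real c * (real lam - real (d v)) + real (wl v)) * real (y i t v) else 0))"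
   unfolding L_def by (intro sum.cong) (auto simp: algebra_simps)
  also have "... = real c * (SUM u:R. real (E v u) * real (y i t u)) + (real c * (real lam - real (d v)) + real (wl v)) * real (y i t v)"
   using fin v by (simp add: sum.distrib sum_distrib_left)
  also have "(SUM u:R. real (E v u) * real (y i t u)) = (SUM u:R. real (y i t u * E u v))"
   using Esym[OF v] by (intro sum.cong) (auto simp: mult.commute)
  finally show ?thesis unfolding yS[OF i v t] d_def[symmetric] of_nat_add of_nat_mult of_nat_sum of_nat_diff[OF dl]
   by (simp add: algebra_simps)
 qed
 have XS: "X i (Suc t) v = app R L (X i t) v" if i: "i : R" and v: "v : R" and t: "t < T" for i t v
 proof -
  have Lng: "L (ng v) (ng u) = L v u" if "u : R" for u
  proof -
   have "ng v = ng u \<longleftrightarrow> v = u" using ng(2)[OF v] ng(2)[OF that] by metis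
   thus ?thesis using Eng[OF v that] dng[OF that] wng[OF that] by (simp add: L_def)
  qed
  have "(SUM u:R. L (ng v) u * real (y i t u)) = (SUM u:R. L (ng v) (ng u) * real (y i t (ng u)))"
   by (rule sum.reindex_bij_witness[of _ ng ng]) (use ng in auto)
  also have "... = (SUM u:R. L v u * real (y i t (ng u)))" by (intro sum.cong) (auto simp: Lng)
  finally have "X i (Suc t) v = (SUM u:R. L v u * real (y i t u)) - (SUM u:R. L v u * real (y i t (ng u)))"
   using rec[OF i v t] rec[OF i ng(1)[OF v] t] v by (simp add: X_def)
  also have "... = app R L (X i t) v" unfolding app_def X_def sum_subtractf[symmetric]
   by (intro sum.cong) (auto simp: algebra_simps)
  finally show ?thesis .
 qed
 have apc: "app R L f = app R L g" if "!!v. v : R ==> f v = g v" for f g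
  unfolding app_def using that by (auto intro!: sum.cong)
 have Xpw: "t <= T ==> v : R ==> X i t v = pw (X i 0) t v" if i: "i : R" for i t v
 proof (induction t arbitrary: v)
  case (Suc t)
  have "X i (Suc t) v = app R L (X i t) v" using XS[OF i Suc.prems(2)] Suc.prems(1) by simp
  also have "app R L (X i t) = app R L (pw (X i 0) t)" by (rule apc) (use Suc in simp)
  finally show ?case by simp
 qed simp
 let ?l = "real c * real lam"
 have l0: "?l > 0" using c0 lam(2) by simp
 \<comment> \<open>Cheeger's inequality with \<open>8 * C^2 <= c\<close> makes the \<open>wl\<close>
   term at most half of \<open>c\<close> times the energy.\<close>
 have test: "ip R (pw (X i 0) t) (app R L (pw (X i 0) t)) <= ?l * ip R (pw (X i 0) t) (pw (X i 0) t)"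
  if i: "i : R" and t: "t <= T" for i t
 proof -
  define x where "x v = int (y i t v) - int (y i t (ng v))" for v
  have xr: "real_of_int (x v) = pw (X i 0) t v" if "v : R" for v
   using Xpw[OF i t that] that by (simp add: x_def X_def)
  have "(SUM v:R. real (wl v) * (real_of_int (x v))^2) <= 4 * (real C)^2 * (SUM u:R. SUM v:R. real (E u v) * (real_of_int (x u) - real_of_int (x v))^2)"
  proof (rule cheeger[OF fin ng _ Esym deg C(1)])
   show "x (ng v) = - x v" if "v : R" for v using ng(2)[OF that] by (simp add: x_def)
   fix m assume m: "m : R" "0 < x m"
   have "{v : R. x m <= x v} = {v : R. y i t m - y i t (ng m) <= y i t v - y i t (ng v)}"
    using m(2) by (auto simp: x_def)
   thus "(SUM v:R. int (wl v) * \<bar>bsgn ng {v : R. x m <= x v} v\<bar>) <=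
    int C * (SUM u:R. SUM v:R. int (E u v) * \<bar>bsgn ng {v : R. x m <= x v} u - bsgn ng {v : R. x m <= x v} v\<bar>)"
    using nonsparse[OF i m(1) t] m(2) by (simp add: Let_def x_def)
  qed
  hence "(SUM v:R. real (wl v) * (pw (X i 0) t v)^2) <= 4 * (real C)^2 * (SUM u:R. SUM v:R. real (E u v) * (pw (X i 0) t u - pw (X i 0) t v)^2)"
   by (simp add: xr cong: sum.cong)
  also have "... <= real c / 2 * (SUM u:R. SUM v:R. real (E u v) * (pw (X i 0) t u - pw (X i 0) t v)^2)"
  proof (rule mult_right_mono)
   have "real (8 * C^2) <= real c" using C(2) by (simp only: of_nat_le_iff)
   thus "4 * (real C)^2 <= real c / 2" by simp
  qed (simp add: sum_nonneg)
  finally show ?thesis unfolding form by simp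
 qed
 have X0: "ip R (X i 0) (X i 0) <= 2" if i: "i : R" for i
 proof -
  have "ip R (X i 0) (X i 0) <= (SUM v:R. (if v = i then 1 else 0) + (if v = ng i then 1 else 0))"
   unfolding ip_def
  proof (rule sum_mono)
   fix v assume v: "v : R"
   have "ng v = i \<longleftrightarrow> v = ng i" using ng v i by metis
   thus "X i 0 v * X i 0 v <= (if v = i then 1 else 0) + (if v = ng i then 1 else 0)"
    using y0[OF i v] y0[OF i ng(1)[OF v]] v by (auto simp: X_def)
  qed
  also have "... = 2" using fin i ng(1)[OF i] by (simp add: sum.distrib)
  finally show ?thesis .
 qed
 have XT: "ip R (pw (X i 0) T) (pw (X i 0) T) <= ?l ^ (2 * T) * 2" if i: "i : R" for i
 proof -
  have "ip R (pw (X i 0) T) (pw (X i 0) T) <= ?l ^ (2 * T) * ip R (X i 0) (X i 0)"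
   by (rule power_upper[OF l0 test[OF i]]) auto
  also have "... <= ?l ^ (2 * T) * 2" using X0[OF i] l0 by (intro mult_left_mono) auto
  finally show ?thesis .
 qed
 \<comment> \<open>The factor \<open>1/2\<close> is there because the starts at \<open>i\<close> and
   at \<open>ng i\<close> contribute the same vector.\<close>
 have sdec: "s v = (SUM i:R. s i / 2 * X i 0 v)" if v: "v : R" for v
 proof -
  have "(SUM i:R. s i / 2 * X i 0 v) = (SUM i:R. (if i = v then s i / 2 else 0) + (if i = ng v then - s i / 2 else 0))"
   using y0 ng v by (intro sum.cong) (auto simp: X_def)
  also have "... = s v" using fin v ng(1)[OF v] s(2)[OF v] by (simp add: sum.distrib)
  finally show ?thesis by simp
 qed
 have spw: "v : R ==> pw s t v = (SUM i:R. s i / 2 * pw (X i 0) t v)" for t v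
 proof (induction t arbitrary: v)
  case 0
  thus ?case using sdec by simp
 next
  case (Suc t)
  have "pw s (Suc t) v = (SUM u:R. L v u * pw s t u)" by (simp add: app_def)
  also have "... = (SUM u:R. SUM i:R. L v u * (s i / 2 * pw (X i 0) t u))"
   by (intro sum.cong refl) (simp add: Suc.IH sum_distrib_left)
  also have "... = (SUM i:R. SUM u:R. L v u * (s i / 2 * pw (X i 0) t u))" by (rule sum.swap)
  also have "... = (SUM i:R. s i / 2 * pw (X i 0) (Suc t) v)"
   by (simp add: app_def sum_distrib_left mult_ac)
  finally show ?case .
 qed
 define W where "W = (SUM v:R. real (wl v))"
 let ?r = "real (card R)"
 have r0: "?r > 0" using fin T(2) by (simp add: card_gt_0_iff)
 have sR: "ip R s s = ?r"
 proof -
  have "s v * s v = 1" if "v : R" for v using s(1)[OF that] by (metis abs_mult_self_eq mult_1)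
  thus ?thesis by (simp add: ip_def)
 qed
 have "ip R (pw s T) (pw s T) <= (SUM v:R. ?r * (SUM i:R. (s i / 2 * pw (X i 0) T v)^2))"
  unfolding ip_def
 proof (rule sum_mono)
  fix v assume v: "v : R"
  have sq: "(SUM i:R. f i)^2 <= ?r * (SUM i:R. (f i)^2)" for f :: "'v => real"
   using cs[of "%_. 1" f] by (simp add: ip_def power2_eq_square)
  show "pw s T v * pw s T v <= ?r * (SUM i:R. (s i / 2 * pw (X i 0) T v)^2)"
   using sq[of "%i. s i / 2 * pw (X i 0) T v"] spw[OF v, of T] by (simp add: power2_eq_square)
 qed
 also have "... = ?r * (SUM i:R. SUM v:R. (s i / 2 * pw (X i 0) T v)^2)"
  by (simp add: sum_distrib_left[symmetric]) (subst sum.swap, simp)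
 also have "... = ?r * (SUM i:R. ip R (pw (X i 0) T) (pw (X i 0) T) / 4)"
 proof -
  have "(s i / 2 * z)^2 = z * z / 4" if "i : R" for i z
  proof -
   have "(s i)^2 = 1" using s(1)[OF that] by (metis power2_abs one_power2)
   thus ?thesis by (simp add: power_mult_distrib power_divide power2_eq_square)
  qed
  hence "(SUM i:R. SUM v:R. (s i / 2 * pw (X i 0) T v)^2) = (SUM i:R. SUM v:R. pw (X i 0) T v * pw (X i 0) T v / 4)"
   by (intro sum.cong refl)
  thus ?thesis by (simp only: ip_def sum_divide_distrib)
 qed
 also have "... <= ?r * (SUM i:R. ?l ^ (2 * T) * 2 / 4)"
  using XT by (intro mult_left_mono sum_mono divide_right_mono) auto
 finally have upper: "ip R (pw s T) (pw s T) <= ?r * (?r * ?l ^ (2 * T) / 2)" by simp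
 \<comment> \<open>Denying the claim lifts the Rayleigh quotient of \<open>s\<close> above
   \<open>?l\<close> by at least \<open>eta\<close>, so its powers outgrow those of the walks of
   which \<open>s\<close> is a combination.\<close>
 define eta where "eta = W / (2 * ?r)"
 have W0: "W > 0"
 proof -
  have "(0::nat) < c * lam * (card R)^2" using c0 lam(2) r0 by simp
  hence "0 < (SUM v:R. wl v)" using T(1) by (metis gr0I less_le_trans mult_0_right)
  hence "0 < real (SUM v:R. wl v)" by (simp only: of_nat_0_less_iff)
  thus ?thesis by (simp add: W_def)
 qed
 have sL: "(?l + eta) * ip R s s <= ip R s (app R L s)"
 proof -
  have "(SUM v:R. real (wl v) * (s v)^2) = W" unfolding W_def
  proof (rule sum.cong)
   fix v assume "v : R"
   hence "(s v)^2 = 1" using s(1) by (metis power2_abs one_power2)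
   thus "real (wl v) * (s v)^2 = real (wl v)" by simp
  qed simp
  moreover have "real c / 2 * (SUM u:R. SUM v:R. real (E u v) * (s u - s v)^2) <= W / 2" using neg by (simp add: W_def)
  moreover have "eta * ?r = W / 2" using r0 by (simp add: eta_def)
  ultimately show ?thesis unfolding form sR by (simp add: algebra_simps)
 qed
 have eta0: "eta > 0" using W0 r0 by (simp add: eta_def)
 have "(?l + eta) ^ (2 * T) * ?r <= ip R (pw s T) (pw s T)"
  using power_lower[of "?l + eta" s T, OF _ _ sL] l0 eta0 sR r0 by simp
 hence "(?l + eta) ^ (2 * T) * ?r <= (?r * ?l ^ (2 * T) / 2) * ?r" using upper by (simp add: mult_ac)
 hence le: "(?l + eta) ^ (2 * T) <= ?r * ?l ^ (2 * T) / 2" using r0 by (simp only: mult_le_cancel_right_pos)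
 have "0 < l ==> (l + e) ^ j = l ^ j * (1 + e / l) ^ j" for l e :: real and j
  by (simp add: power_mult_distrib[symmetric] distrib_left)
 hence "(?l + eta) ^ (2 * T) = ?l ^ (2 * T) * (1 + eta / ?l) ^ (2 * T)" using l0 by blast
 hence "?l ^ (2 * T) * (1 + eta / ?l) ^ (2 * T) <= ?l ^ (2 * T) * (?r / 2)" using le by (simp add: mult_ac)
 \<comment> \<open>By Bernoulli and the choice of \<open>T\<close> the left-hand side exceeds
   \<open>?r / 2\<close>.\<close>
 hence "(1 + eta / ?l) ^ (2 * T) <= ?r / 2" using l0 by (simp only: mult_le_cancel_left_pos zero_less_power)
 moreover have "1 + real (2 * T) * (eta / ?l) <= (1 + eta / ?l) ^ (2 * T)"
  using eta0 l0 by (intro Bernoulli_inequality) (smt (verit) divide_nonneg_pos)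
 moreover have "?r / 2 <= real (2 * T) * (eta / ?l)"
 proof -
  have "real (c * lam * (card R)^2) <= real (2 * T * (SUM v:R. wl v))" using T(1) by (simp only: of_nat_le_iff)
  hence "?l * ?r^2 <= 2 * real T * W" by (simp add: W_def)
  moreover have "0 < r ==> 0 < l ==> l * r^2 <= t * w ==> r / 2 <= t * (w / (2 * r) / l)" for l r t w :: real
   by (simp add: field_simps power2_eq_square)
  ultimately show ?thesis using l0 r0 by (simp add: eta_def)
 qed
 ultimately show False by linarith
qed

section \<open>Computable functions on the register machine\<close>

text \<open>Register 0 holds a bound K, and array a occupies the K addresses from a * K. At level t the
registers and the arrays with index below t are protected: CN t f says that f depends on protected
data only and that, for each t' from t on, some program computes f into register t' in time
polynomial in K without changing anything protected at level t'.\<close>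

definition agr :: "nat => state => state => bool" where
 "agr t s s' \<longleftrightarrow> (ALL i<t. reg s i = reg s' i) & (ALL a<t * reg s 0. mem s a = mem s' a)"

abbreviation runs :: "com => nat => nat => (state => nat) => bool" where
 "runs c a t f \<equiv> ALL s. EX n s'. exec c s n s' & n <= (reg s 0 + 2) ^ a & agr t s s' & reg s' t = f s"

definition CN :: "nat => (state => nat) => bool" where
 "CN t f \<longleftrightarrow> 1 <= t & (ALL s s'. agr t s s' --> f s = f s') &
   (ALL t'>=t. EX c a. runs c a t' f)"

text \<open>Arrays stay unevaluated: an array counts as computable when its entry at every
  computable index is. Only an iteration stores one in memory.\<close>

definition CA :: "nat => (state => nat => nat) => bool" where
 "CA t A \<longleftrightarrow> (ALL t'>=t. ALL g. CN t' g --> CN t' (%s. A s (g s)))"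

lemma agr_refl [simp]: "agr t s s"
 by (simp add: agr_def)

lemma agr_mono: "agr t s s' ==> t' <= t ==> agr t' s s'"
 unfolding agr_def
 by (meson less_le_trans mult_le_mono1)

lemma agr_reg: "agr t s s' ==> i < t ==> reg s' i = reg s i"
 by (simp add: agr_def)

lemma agr_trans: "agr t s s' ==> agr t s' s'' ==> 1 <= t ==> agr t s s''"
 by (simp add: agr_def)

lemma agr_upd: "t <= i ==> agr t s (s\<lparr>reg := (reg s)(i := x)\<rparr>)"
 by (auto simp: agr_def)

lemma agr_upd': "agr t s s' ==> t <= i ==> agr t s (s'\<lparr>reg := (reg s')(i := x)\<rparr>)"
 by (auto simp: agr_def)

lemma CN_ge1: "CN t f ==> 1 <= t"
 by (simp add: CN_def)

lemma CN_dep: "CN t f ==> agr t s s' ==> f s' = f s"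
 unfolding CN_def by metis

lemma CN_exec:
 "CN t f ==> t <= t' ==>
  EX c a. runs c a t' f"
 unfolding CN_def by blast

lemma CN_mono: "CN t f ==> t <= t' ==> CN t' f"
 unfolding CN_def by (meson agr_mono order_trans)

lemma CA_mono: "CA t A ==> t <= t' ==> CA t' A"
 unfolding CA_def by (meson order_trans)

lemma CN_I:
 assumes "1 <= t" "!!s s'. agr t s s' ==> f s = f s'"
  and "!!t'. t <= t' ==> EX c a. runs c a t' f"
 shows "CN t f"
 using assms unfolding CN_def by blast

text \<open>Time bounds \<open>(K + 2) ^ a\<close> absorb sums by raising the exponent, since the
  base is at least 2.\<close>

lemma pow_add_le: "(x::nat) >= 2 ==> x ^ a + x ^ b <= x ^ (a + b + 1)"
proof -
 assume x: "x >= 2"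
 have "x ^ a <= x ^ (a + b)" "x ^ b <= x ^ (a + b)"
  using x by (auto intro!: power_increasing)
 hence "x ^ a + x ^ b <= 2 * x ^ (a + b)" by linarith
 also have "... <= x * x ^ (a + b)" using x by simp
 finally show ?thesis by simp
qed

lemma const_le_pow: "(x::nat) >= 2 ==> m <= x ^ m"
proof -
 assume "x >= 2"
 hence "2 ^ m <= x ^ m" by (simp add: power_mono)
 moreover have "m < 2 ^ m" by simp
 ultimately show ?thesis by linarith
qed

lemma loop_bound:
 assumes x: "(x::nat) >= 2" and "m <= x" "n <= m * (x ^ a + c + 1) + 1"
 shows "n + e <= x ^ (a + c + e + 5)"
proof -
 have "x ^ a + (c + 1) <= x ^ (a + (c + 1) + 1)"
  using pow_add_le[OF x, of a "c+1"] const_le_pow[OF x, of "c+1"] by linarith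
 hence "m * (x ^ a + c + 1) <= x * x ^ (a + (c + 1) + 1)"
  using assms(2) by (intro mult_mono) auto
 hence "n + e <= x ^ (a + c + 3) + (1 + e)" using assms(3) by (simp add: numeral_eq_Suc)
 also have "... <= x ^ (a + c + 3 + (1 + e) + 1)"
  using pow_add_le[OF x, of "a+c+3" "1+e"] const_le_pow[OF x, of "1+e"] by linarith
 finally show ?thesis by (simp add: ac_simps numeral_eq_Suc)
qed

section \<open>Straight-line programs\<close>

primrec straight :: "com => bool" where
 "straight (Const i k) = True"
| "straight (Add i j k) = True"
| "straight (Sub i j k) = True"
| "straight (Half i j) = True"
| "straight (Load i j) = True"
| "straight (Store i j) = True"
| "straight (Seq c d) = (straight c & straight d)"
| "straight (If i c d) = False"
| "straight (While i c) = False"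

primrec straight_time :: "com => nat" where
 "straight_time (Const i k) = 1"
| "straight_time (Add i j k) = 1"
| "straight_time (Sub i j k) = 1"
| "straight_time (Half i j) = 1"
| "straight_time (Load i j) = 1"
| "straight_time (Store i j) = 1"
| "straight_time (Seq c d) = straight_time c + straight_time d"
| "straight_time (If i c d) = 0"
| "straight_time (While i c) = 0"

primrec straight_run :: "com => state => state" where
 "straight_run (Const i k) s = s\<lparr>reg := (reg s)(i := k)\<rparr>"
| "straight_run (Add i j k) s = s\<lparr>reg := (reg s)(i := reg s j + reg s k)\<rparr>"
| "straight_run (Sub i j k) s = s\<lparr>reg := (reg s)(i := reg s j - reg s k)\<rparr>"
| "straight_run (Half i j) s = s\<lparr>reg := (reg s)(i := reg s j div 2)\<rparr>"
| "straight_run (Load i j) s = s\<lparr>reg := (reg s)(i := mem s (reg s j))\<rparr>"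
| "straight_run (Store i j) s = s\<lparr>mem := (mem s)(reg s i := reg s j)\<rparr>"
| "straight_run (Seq c d) s = straight_run d (straight_run c s)"
| "straight_run (If i c d) s = s"
| "straight_run (While i c) s = s"

text \<open>Lets the simplifier run loop-free fragments, in place of derivations from the rules of
  \<open>exec\<close>.\<close>

lemma exec_straight: "straight c ==> exec c s (straight_time c) (straight_run c s)"
proof (induction c arbitrary: s)
 case (Seq c d)
 thus ?case by (auto intro: exec.Seq)
qed (auto intro: exec.intros[unfolded One_nat_def] simp del: fun_upd_apply)

lemma exec_straight': "straight c ==> straight_time c = n ==> exec c s n (straight_run c s)"
 using exec_straight by blast

lemma CN_const: "1 <= t ==> CN t (%s. k)"
proof (rule CN_I)
 fix t' assume "t <= t'"
 show "EX c a. runs c a t' (%s. k)"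
  by (rule exI[of _ "Const t' k"], rule exI[of _ 0], intro allI exI conjI, rule exec.Const)
   (auto simp: agr_upd)
qed auto

lemma CN_reg: "i < t ==> CN t (%s. reg s i)"
proof (rule CN_I)
 fix t' assume i: "i < t" and t: "t <= t'"
 show "EX c a. runs c a t' (%s. reg s i)"
  by (rule exI[of _ "Seq (Const (t'+1) 0) (Add t' i (t'+1))"], rule exI[of _ 1], intro allI exI conjI,
    rule exec.Seq[OF exec.Const exec.Add])
   (use i t in \<open>auto simp: agr_def\<close>)
qed (auto simp: agr_def)

text \<open>The second argument is computed one level higher, where the first result is
  protected.\<close>

lemma CN_comb2:
 assumes f: "CN t f" and g: "CN t g"
  and op: "!!t' s. EX n s'. exec (opc t') s n s' & n <= 1 & s' = s\<lparr>reg := (reg s)(t' := h (reg s t') (reg s (t'+1)))\<rparr>"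
 shows "CN t (%s. h (f s) (g s))"
proof (rule CN_I)
 show "1 <= t" using f by (rule CN_ge1)
 show "!!s s'. agr t s s' ==> h (f s) (g s) = h (f s') (g s')"
  using CN_dep[OF f] CN_dep[OF g] by metis
 fix t' assume t: "t <= t'"
 obtain c1 a1 where c1: "runs c1 a1 t' f"
  using CN_exec[OF f, of "t'"] t by fastforce
 obtain c2 a2 where c2: "runs c2 a2 (t'+1) g"
  using CN_exec[OF g, of "t'+1"] t by fastforce
 show "EX c a. runs c a t' (%s. h (f s) (g s))"
 proof (rule exI[of _ "Seq (Seq c1 c2) (opc t')"], rule exI[of _ "a1 + a2 + 2"], rule allI)
  fix s :: state
  obtain n1 s1 where 1: "exec c1 s n1 s1" "n1 <= (reg s 0 + 2) ^ a1" "agr t' s s1" "reg s1 t' = f s"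
   using c1 by blast
  obtain n2 s2 where 2: "exec c2 s1 n2 s2" "n2 <= (reg s1 0 + 2) ^ a2" "agr (t'+1) s1 s2" "reg s2 (t'+1) = g s1"
   using c2 by blast
  obtain n3 s3 where 3: "exec (opc t') s2 n3 s3" "n3 <= 1" "s3 = s2\<lparr>reg := (reg s2)(t' := h (reg s2 t') (reg s2 (t'+1)))\<rparr>"
   using op by blast
  have t1: "1 <= t'" using CN_ge1[OF f] t by simp
  have k: "reg s1 0 = reg s 0" using 1(3) t1 by (simp add: agr_def)
  have gs: "g s1 = g s" using CN_dep[OF g] agr_mono[OF 1(3) t] by blast
  have a2': "agr t' s s2" using agr_trans[OF 1(3) agr_mono[OF 2(3)]] t1 by simp
  have "exec (Seq (Seq c1 c2) (opc t')) s (n1 + n2 + n3) s3"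
   using 1(1) 2(1) 3(1) by (meson exec.Seq)
  moreover have "n1 + n2 + n3 <= (reg s 0 + 2) ^ (a1 + a2 + 2)"
  proof -
   have "n1 + n2 <= (reg s 0 + 2) ^ (a1 + a2 + 1)"
    using pow_add_le[of "reg s 0 + 2" a1 a2] 1(2) 2(2) k by simp
   moreover have "(1::nat) <= (reg s 0 + 2) ^ (a1 + a2 + 1)" by (rule one_le_power) simp
   ultimately have "n1 + n2 + n3 <= 2 * (reg s 0 + 2) ^ (a1 + a2 + 1)" using 3(2) by linarith
   also have "... <= (reg s 0 + 2) * (reg s 0 + 2) ^ (a1 + a2 + 1)" by (intro mult_right_mono) auto
   finally show ?thesis by simp
  qed
  moreover have "agr t' s s3" using a2' 3(3) by (simp add: agr_upd')
  moreover have "reg s3 t' = h (f s) (g s)"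
   using 3(3) 2(3,4) 1(4) gs by (simp add: agr_def)
  ultimately show "EX n s'. exec (Seq (Seq c1 c2) (opc t')) s n s' & n <= (reg s 0 + 2) ^ (a1 + a2 + 2) & agr t' s s' & reg s' t' = h (f s) (g s)"
   by blast
 qed
qed

lemma CN_add: "CN t f ==> CN t g ==> CN t (%s. f s + g s)"
proof -
 assume "CN t f" "CN t g"
 thus ?thesis
 proof (rule CN_comb2)
  show "EX n s'. exec (Add t' t' (t'+1)) s n s' & n <= 1 & s' = s\<lparr>reg := (reg s)(t' := reg s t' + reg s (t'+1))\<rparr>" for t' s
   using exec.Add by blast
 qed
qed

lemma CN_sub: "CN t f ==> CN t g ==> CN t (%s. f s - g s)"
proof -
 assume "CN t f" "CN t g"
 thus ?thesis
 proof (rule CN_comb2)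
  show "EX n s'. exec (Sub t' t' (t'+1)) s n s' & n <= 1 & s' = s\<lparr>reg := (reg s)(t' := reg s t' - reg s (t'+1))\<rparr>" for t' s
   using exec.Sub by blast
 qed
qed

lemma CN_half: "CN t f ==> CN t (%s. f s div 2)"
proof -
 assume f: "CN t f"
 thus ?thesis
 proof (rule CN_comb2[where h = "%x y. x div 2" and g = f])
  show "EX n s'. exec (Half t' t') s n s' & n <= 1 & s' = s\<lparr>reg := (reg s)(t' := reg s t' div 2)\<rparr>" for t' s
   using exec.Half by blast
 qed (rule f)
qed

lemma CN_if0:
 assumes f: "CN t f" and g: "CN t g" and h: "CN t h"
 shows "CN t (%s. if f s ~= 0 then g s else h s)"
proof (rule CN_I)
 show "1 <= t" using f by (rule CN_ge1)
 show "!!s s'. agr t s s' ==> (if f s ~= 0 then g s else h s) = (if f s' ~= 0 then g s' else h s')"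
  using CN_dep[OF f] CN_dep[OF g] CN_dep[OF h] by metis
 fix t' assume t: "t <= t'"
 obtain c1 a1 where c1: "runs c1 a1 t' f"
  using CN_exec[OF f, of "t'"] t by fastforce
 obtain c2 a2 where c2: "runs c2 a2 t' g"
  using CN_exec[OF g, of "t'"] t by fastforce
 obtain c3 a3 where c3: "runs c3 a3 t' h"
  using CN_exec[OF h, of "t'"] t by fastforce
 show "EX c a. runs c a t' (%s. (if f s ~= 0 then g s else h s))"
 proof (rule exI[of _ "Seq c1 (If t' c2 c3)"], rule exI[of _ "a1 + (a2 + a3 + 1) + 1"], rule allI)
  fix s :: state
  let ?x = "reg s 0 + 2"
  obtain n1 s1 where 1: "exec c1 s n1 s1" "n1 <= ?x ^ a1" "agr t' s s1" "reg s1 t' = f s"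
   using c1 by blast
  have t1: "1 <= t'" using CN_ge1[OF f] t by simp
  have k: "reg s1 0 = reg s 0" using 1(3) t1 by (simp add: agr_def)
  have gs: "g s1 = g s" "h s1 = h s" using CN_dep[OF g] CN_dep[OF h] agr_mono[OF 1(3) t] by blast+
  obtain n2 s2 where 2: "exec (If t' c2 c3) s1 (n2 + 1) s2" "n2 <= ?x ^ (a2 + a3)" "agr t' s1 s2"
    "reg s2 t' = (if f s ~= 0 then g s else h s)"
  proof (cases "f s = 0")
   case True
   obtain n2 s2 where "exec c3 s1 n2 s2" "n2 <= (reg s1 0 + 2) ^ a3" "agr t' s1 s2" "reg s2 t' = h s1"
    using c3 by blast
   moreover have "?x ^ a3 <= ?x ^ (a2 + a3)" by (rule power_increasing) auto
   moreover have "exec (If t' c2 c3) s1 (n2 + 1) s2" if "exec c3 s1 n2 s2"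
    using True 1(4) that by (intro exec.IfFalse) auto
   ultimately show ?thesis using that[of n2 s2] True gs k by (metis order_trans)
  next
   case False
   obtain n2 s2 where "exec c2 s1 n2 s2" "n2 <= (reg s1 0 + 2) ^ a2" "agr t' s1 s2" "reg s2 t' = g s1"
    using c2 by blast
   moreover have "?x ^ a2 <= ?x ^ (a2 + a3)" by (rule power_increasing) auto
   moreover have "exec (If t' c2 c3) s1 (n2 + 1) s2" if "exec c2 s1 n2 s2"
    using False 1(4) that by (intro exec.IfTrue) auto
   ultimately show ?thesis using that[of n2 s2] False gs k by (metis order_trans)
  qed
  have "exec (Seq c1 (If t' c2 c3)) s (n1 + (n2 + 1)) s2" using 1(1) 2(1) by (rule exec.Seq)
  moreover have "n2 + 1 <= ?x ^ (a2 + a3 + 1)"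
   using pow_add_le[of ?x "a2+a3" 0] 2(2) by simp
  hence "n1 + (n2 + 1) <= ?x ^ (a1 + (a2 + a3 + 1) + 1)"
   using pow_add_le[of ?x a1 "a2+a3+1"] 1(2) by simp
  moreover have "agr t' s s2" using agr_trans[OF 1(3) 2(3) t1] .
  ultimately show "EX n s'. exec (Seq c1 (If t' c2 c3)) s n s' & n <= ?x ^ (a1 + (a2 + a3 + 1) + 1) & agr t' s s' & reg s' t' = (if f s ~= 0 then g s else h s)"
   using 2(4) by blast
 qed
qed

text \<open>\<open>I j\<close> describes the state after \<open>j\<close> rounds. The number of
  rounds is known in advance, so termination and time come together.\<close>

lemma exec_While_count:
 assumes step: "!!j s. j < m ==> I j s ==> reg s r ~= 0 & (EX n s'. exec c s n s' & n <= T & I (Suc j) s')"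
  and fin: "!!s. I m s ==> reg s r = 0"
  and init: "I 0 s"
 shows "EX n s'. exec (While r c) s n s' & n <= m * (T + 1) + 1 & I m s'"
proof -
 have "j <= m ==> I (m - j) s ==> EX n s'. exec (While r c) s n s' & n <= j * (T + 1) + 1 & I m s'" for j s
 proof (induction j arbitrary: s)
  case 0
  thus ?case using exec.WhileFalse fin by force
 next
  case (Suc j)
  have "m - Suc j < m" "Suc (m - Suc j) = m - j" using Suc.prems(1) by auto
  then obtain n1 s1 where 1: "reg s r ~= 0" "exec c s n1 s1" "n1 <= T" "I (m - j) s1"
   using step Suc.prems(2) by metis
  obtain n2 s2 where 2: "exec (While r c) s1 n2 s2" "n2 <= j * (T + 1) + 1" "I m s2"
   using Suc.IH[of s1] 1(4) Suc.prems(1) by auto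
  have "exec (While r c) s (n1 + n2 + 1) s2" using 1(1,2) 2(1) by (rule exec.WhileTrue)
  thus ?case using 1(3) 2(2,3) by (intro exI[of _ "n1+n2+1"] exI[of _ s2]) auto
 qed
 from this[of m s] init show ?thesis by simp
qed

section \<open>Tests, sets and finite tables\<close>

definition CB :: "nat => (state => bool) => bool" where
 "CB t P \<longleftrightarrow> CN t (%s. if P s then 1 else 0)"

definition CS :: "nat => (state => nat set) => bool" where
 "CS t S \<longleftrightarrow> (ALL t'>=t. ALL g. CN t' g --> CB t' (%s. g s : S s))"

lemma CS_mono: "CS t A ==> t <= t' ==> CS t' A"
 unfolding CS_def by (meson order_trans)

lemma CN_if: "CB t P ==> CN t f ==> CN t g ==> CN t (%s. if P s then f s else g s)"
proof -
 assume "CB t P" "CN t f" "CN t g"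
 hence "CN t (%s. if (if P s then 1 else 0) ~= (0::nat) then f s else g s)"
  unfolding CB_def by (rule CN_if0)
 moreover have "(%s. if (if P s then 1 else 0) ~= (0::nat) then f s else g s) = (%s. if P s then f s else g s)" by auto
 ultimately show ?thesis by simp
qed

lemma CB_le: "CN t f ==> CN t g ==> CB t (%s. f s <= g s)"
proof -
 assume a: "CN t f" "CN t g"
 have "CN t (%s. if f s - g s ~= 0 then 0 else 1)"
  using a CN_ge1[OF a(1)] by (intro CN_if0 CN_sub CN_const)
 moreover have "(%s. if f s - g s ~= 0 then 0 else 1) = (%s. if f s <= g s then 1 else (0::nat))" by auto
 ultimately show ?thesis by (simp add: CB_def)
qed

lemma CB_not: "CB t P ==> CB t (%s. ~ P s)"
proof -
 assume a: "CB t P"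
 have "CN t (%s. if P s then 0 else 1)"
  by (intro CN_if CN_const a CN_ge1[OF a[unfolded CB_def]])
 moreover have "(%s. if P s then 0 else (1::nat)) = (%s. if ~ P s then 1 else 0)" by auto
 ultimately show ?thesis by (simp add: CB_def)
qed

lemma CB_conj: "CB t P ==> CB t Q ==> CB t (%s. P s & Q s)"
proof -
 assume a: "CB t P" "CB t Q"
 have "CN t (%s. if P s then (if Q s then 1 else 0) else 0)"
  by (rule CN_if[OF a(1) a(2)[unfolded CB_def] CN_const[OF CN_ge1[OF a(1)[unfolded CB_def]]]])
 moreover have "(%s. if P s then (if Q s then 1 else 0) else (0::nat)) = (%s. if P s & Q s then 1 else 0)" by auto
 ultimately show ?thesis by (simp add: CB_def)
qed

lemma CB_disj: "CB t P ==> CB t Q ==> CB t (%s. P s | Q s)"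
 using CB_not[OF CB_conj[OF CB_not CB_not, of t P Q]] by simp

lemma CB_imp: "CB t P ==> CB t Q ==> CB t (%s. P s --> Q s)"
 unfolding imp_conv_disj by (rule CB_disj[OF CB_not])

lemma CB_less: "CN t f ==> CN t g ==> CB t (%s. f s < g s)"
 using CB_not[OF CB_le, of t g f] by (simp add: not_le)

lemma CB_eq: "CN t f ==> CN t g ==> CB t (%s. f s = g s)"
 using CB_conj[OF CB_le CB_le, of t f g g f] by (simp add: order_eq_iff)

text \<open>A fixed finite table is a case distinction. Its use is indirect: applying a closure rule
  for an iteration body to the current contents as a constant table shows that the body reads
  nothing else that is unprotected.\<close>

lemma CA_fin:
 assumes "1 <= t" "finite {j. B j ~= (0::nat)}"
 shows "CA t (%s. B)"
proof -
 have main: "CN t' (%s. SUM j:J. if g s = j then B j else 0)" if "t <= t'" "CN t' g" "finite J" for t' g J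
  using that(3)
 proof (induction J)
  case empty
  thus ?case using CN_const[OF CN_ge1[OF that(2)]] by simp
 next
  case (insert j J)
  have "CN t' (%s. (if g s = j then B j else 0) + (SUM j:J. if g s = j then B j else 0))"
   by (intro CN_add CN_if CB_eq CN_const that(2) insert.IH CN_ge1[OF that(2)])
  thus ?case by (simp only: sum.insert[OF insert.hyps])
 qed
 show ?thesis unfolding CA_def
 proof (intro allI impI)
  fix t' g assume "t <= t'" "CN t' g"
  hence "CN t' (%s. SUM j:{j. B j ~= 0}. if g s = j then B j else 0)" using main assms(2) by blast
  moreover have "(SUM j:{j. B j ~= 0}. if g s = j then B j else 0) = B (g s)" for s
   using assms(2) by (auto simp: sum.delta')
  ultimately show "CN t' (%s. B (g s))" by (simp only:)
 qed
qed

text \<open>Multiplication by a constant as repeated addition. There is no idle instruction, so the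
  empty case clears the scratch register \<open>r+1\<close>.\<close>

primrec addK :: "nat => nat => com" where
 "addK r 0 = Const (r+1) 0"
| "addK r (Suc a) = Seq (addK r a) (Add r r 0)"

lemma straight_addK: "straight (addK r a)"
 by (induction a) auto

lemma time_addK: "straight_time (addK r a) = a + 1"
 by (induction a) auto

lemma run_addK: "r ~= 0 ==> straight_run (addK r a) s = s\<lparr>reg := (reg s)(r+1 := 0, r := reg s r + a * reg s 0)\<rparr>"
proof (induction a)
 case 0
 have "(reg s)(r+1 := 0, r := reg s r) = (reg s)(r+1 := 0)" by auto
 thus ?case by (simp del: fun_upd_apply)
qed (auto simp: fun_upd_twist algebra_simps)

section \<open>Tabulating and iterating arrays\<close>

definition arr :: "nat => state => nat => nat" where
 "arr a s j = (if j < reg s 0 then mem s (a * reg s 0 + j) else 0)"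

lemma arr_agr: "agr t s s' ==> a < t ==> arr a s' j = arr a s j"
proof -
 assume a: "agr t s s'" "a < t"
 have "a * reg s 0 + j < t * reg s 0" if "j < reg s 0"
 proof -
  have "a * reg s 0 + j < Suc a * reg s 0" using that by simp
  also have "... <= t * reg s 0" using a(2) by (intro mult_right_mono) auto
  finally show ?thesis .
 qed
 thus ?thesis using a by (auto simp: arr_def agr_def)
qed

lemma CA_arr: "a < t ==> CA t (arr a)"
 unfolding CA_def
proof (intro allI impI)
 fix t' g assume at: "a < t" and tt: "t <= t'" and g: "CN t' g"
 have t1: "1 <= t'" using g by (rule CN_ge1)
 have "CN t' (%s. if g s < reg s 0 then mem s (a * reg s 0 + g s) else 0)"
 proof (rule CN_I)
  fix s s' assume ag: "agr t' s s'"
  show "(if g s < reg s 0 then mem s (a * reg s 0 + g s) else 0) = (if g s' < reg s' 0 then mem s' (a * reg s' 0 + g s') else 0)"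
   using arr_agr[OF ag, of a "g s"] CN_dep[OF g ag] at tt by (simp only: arr_def)
 next
  fix t2 assume t2: "t' <= t2"
  obtain c1 a1 where c1: "runs c1 a1 t2 g"
   using CN_exec[OF g, of t2] t2 by fastforce
  have "CB (t2+1) (%s. reg s t2 < reg s 0)" using t1 t2 by (intro CB_less CN_reg) auto
  then obtain c2 a2 where c2: "runs c2 a2 (t2+1) (%s. (if reg s t2 < reg s 0 then 1 else 0))"
   unfolding CB_def using CN_exec[of "t2+1" _ "t2+1"] by fastforce
  define d where "d = Seq (addK t2 a) (Load t2 t2)"
  let ?c = "Seq c1 (Seq c2 (If (t2+1) d (Const t2 0)))"
  show "EX c a'. ALL s. EX n s'. exec c s n s' & n <= (reg s 0 + 2) ^ a' & agr t2 s s' & reg s' t2 = (if g s < reg s 0 then mem s (a * reg s 0 + g s) else 0)"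
  proof (rule exI[of _ ?c], rule exI[of _ "a1 + (a2 + (a + 3) + 1) + 1"], rule allI)
   fix s :: state
   let ?x = "reg s 0 + 2"
   obtain n1 s1 where 1: "exec c1 s n1 s1" "n1 <= ?x ^ a1" "agr t2 s s1" "reg s1 t2 = g s" using c1 by blast
   have k1: "reg s1 0 = reg s 0" using 1(3) t1 t2 by (simp add: agr_def)
   obtain n2 s2 where 2: "exec c2 s1 n2 s2" "n2 <= ?x ^ a2" "agr (t2+1) s1 s2" "reg s2 (t2+1) = (if g s < reg s 0 then 1 else 0)"
    using c2[rule_format, of s1] unfolding k1 1(4) by blast
   have k2: "reg s2 0 = reg s 0" "reg s2 t2 = g s" using 2(3) k1 1(4) by (auto simp: agr_def)
   have ag2: "agr t2 s s2" using agr_trans[OF 1(3) agr_mono[OF 2(3)]] t1 t2 by simp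
   obtain n3 s3 where 3: "exec (If (t2+1) d (Const t2 0)) s2 n3 s3" "n3 <= a + 3" "agr t2 s2 s3"
     "reg s3 t2 = (if g s < reg s 0 then mem s (a * reg s 0 + g s) else 0)"
   proof (cases "g s < reg s 0")
    case True
    have "exec (If (t2+1) d (Const t2 0)) s2 (a + 3) (straight_run d s2)"
    proof -
     have "exec d s2 (a + 2) (straight_run d s2)" by (rule exec_straight') (simp_all add: d_def straight_addK time_addK)
     hence "exec (If (t2+1) d (Const t2 0)) s2 (a + 2 + 1) (straight_run d s2)" using 2(4) True by (intro exec.IfTrue) auto
     thus ?thesis by (simp add: numeral_eq_Suc)
    qed
    moreover have "agr t2 s2 (straight_run d s2)" using t1 t2 by (simp add: d_def run_addK agr_def)
    moreover have "reg (straight_run d s2) t2 = mem s (a * reg s 0 + g s)"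
     using arr_agr[OF ag2, of a "g s"] at tt t2 True k2 t1 by (simp add: d_def run_addK arr_def add.commute)
    ultimately show ?thesis using that True by simp
   next
    case False
    have "exec (If (t2+1) d (Const t2 0)) s2 (1 + 1) (straight_run (Const t2 0) s2)"
     using 2(4) False by (intro exec.IfFalse exec_straight') auto
    moreover have "agr t2 s2 (straight_run (Const t2 0) s2)" using t1 t2 by (simp add: agr_def)
    ultimately show ?thesis using that False by force
   qed
   have ex: "exec ?c s (n1 + (n2 + n3)) s3" using 1(1) 2(1) 3(1) by (meson exec.Seq)
   have "a + 3 <= ?x ^ (a + 3)" by (rule const_le_pow) simp
   hence "n2 + n3 <= ?x ^ (a2 + (a+3) + 1)"
    using pow_add_le[of ?x a2 "a+3"] 2(2) 3(2) by linarith
   hence "n1 + (n2 + n3) <= ?x ^ (a1 + (a2 + (a + 3) + 1) + 1)"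
    using pow_add_le[of ?x a1 "a2 + (a+3) + 1"] 1(2) by linarith
   moreover have "agr t2 s s3" using agr_trans[OF ag2 3(3)] t1 t2 by simp
   ultimately show "EX n s'. exec ?c s n s' & n <= ?x ^ (a1 + (a2 + (a + 3) + 1) + 1) & agr t2 s s' & reg s' t2 = (if g s < reg s 0 then mem s (a * reg s 0 + g s) else 0)"
    using ex 3(4) by blast
  qed
 qed (rule t1)
 thus "CN t' (%s. arr a s (g s))" by (simp add: arr_def)
qed

definition agr_but :: "nat => nat => state => state => bool" where
 "agr_but d t s s' \<longleftrightarrow> (ALL i<t. reg s i = reg s' i) &
   (ALL a<t * reg s 0. (a < d * reg s 0 | Suc d * reg s 0 <= a) --> mem s a = mem s' a)"

text \<open>Register \<open>t\<close> holds the index and \<open>t+1\<close> the number of remaining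
  rounds. Values are computed at level \<open>t+2\<close>, which spares the arrays up to
  \<open>t+1\<close> and hence the cells of array \<open>d\<close> already written; by
  \<open>ind\<close> the half-overwritten array does not influence later values.\<close>

lemma fill:
 assumes H: "CA t H" and t1: "1 <= t" and d: "d <= t + 1"
  and ind: "!!s s' j. agr_but d t s s' ==> H s' j = H s j"
 shows "EX c a. ALL s. EX n s'. exec c s n s' & n <= (reg s 0 + 2) ^ a & agr_but d t s s' &
      (ALL j<reg s 0. mem s' (d * reg s 0 + j) = H s j)"
proof -
 have "CN (t+2) (%s. H s (reg s t))"
  using H[unfolded CA_def, rule_format, of "t+2" "%s. reg s t"] CN_reg[of t "t+2"] by simp
 then obtain c2 a2 where c2: "runs c2 a2 (t+2) (%s. H s (reg s t))"
  using CN_exec[of "t+2" _ "t+2"] by fastforce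
 define pre where "pre = Seq (Const t 0) (Add (t+1) t 0)"
 define d2 where "d2 = Seq (Const (t+3) 0) (Seq (Add (t+3) (t+3) t) (Seq (addK (t+3) d) (Seq (Store (t+3) (t+2))
   (Seq (Const (t+3) 1) (Seq (Add t t (t+3)) (Sub (t+1) (t+1) (t+3)))))))"
 let ?body = "Seq c2 d2"
 let ?c = "Seq pre (While (t+1) ?body)"
 show ?thesis
 proof (rule exI[of _ ?c], rule exI[of _ "a2 + (d+7) + 7"], rule allI)
  fix s :: state
  let ?x = "reg s 0 + 2"
  let ?K = "reg s 0"
  define s1 where "s1 = straight_run pre s"
  have p: "exec pre s 2 s1" unfolding s1_def by (rule exec_straight') (simp_all add: pre_def)
  define I where "I = (%j u. agr_but d t s u & reg u t = j & reg u (t+1) = ?K - j & (ALL i<j. mem u (d * ?K + i) = H s i))"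
  have I0: "I 0 s1" using t1 by (auto simp: I_def s1_def pre_def agr_but_def)
  have step: "reg u (t+1) ~= 0 & (EX n s'. exec ?body u n s' & n <= ?x ^ a2 + (d+7) & I (Suc j) s')"
   if j: "j < ?K" and u: "I j u" for j u
  proof
   show "reg u (t+1) ~= 0" using u j by (simp add: I_def)
   have ua: "agr_but d t s u" "reg u t = j" "reg u (t+1) = ?K - j" "ALL i<j. mem u (d * ?K + i) = H s i"
    using u by (auto simp: I_def)
   obtain n2 u2 where 2: "exec c2 u n2 u2" "n2 <= (reg u 0 + 2) ^ a2" "agr (t+2) u u2" "reg u2 (t+2) = H u j"
    using c2 ua(2) by blast
   have uk: "reg u 0 = ?K" "reg u2 0 = ?K" using ua(1) t1 2(3) by (auto simp: agr_def agr_but_def)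
   have Hu: "H u j = H s j" using ind[OF ua(1)] .
   define u3 where "u3 = straight_run d2 u2"
   have "exec ?body u (n2 + (d+7)) u3"
    unfolding u3_def by (rule exec.Seq[OF 2(1) exec_straight']) (simp_all add: d2_def straight_addK time_addK)
   moreover have "n2 + (d+7) <= ?x ^ a2 + (d+7)" using 2(2) uk by simp
   moreover have "I (Suc j) u3"
   proof -
    have r: "reg u2 t = j" "reg u2 (t+1) = ?K - j" "!!i. i < t ==> reg u2 i = reg u i"
     using 2(3) ua by (simp_all add: agr_def)
    have m3: "mem u3 = (mem u2)(d * ?K + j := H s j)"
     using r 2(4) Hu uk t1 by (simp add: u3_def d2_def run_addK add.commute)
    have r3: "reg u3 t = Suc j" "reg u3 (t+1) = ?K - Suc j" "!!i. i < t ==> reg u3 i = reg u i"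
     using r t1 by (auto simp: u3_def d2_def run_addK)
    have m2: "mem u2 a = mem u a" if "a < (t+2) * ?K" for a using 2(3) that uk by (simp add: agr_def)
    have "agr_but d t s u3"
     unfolding agr_but_def
    proof (intro conjI allI impI)
     show "reg s i = reg u3 i" if "i < t" for i using that r3(3) ua(1) by (simp add: agr_but_def)
     fix a assume a: "a < t * ?K" "a < d * ?K | Suc d * ?K <= a"
     hence "a ~= d * ?K + j" using j by auto
     moreover have "a < (t+2) * ?K" using a(1) by (simp add: add_mult_distrib)
     ultimately have "mem u3 a = mem u a" using m3 m2 by simp
     thus "mem s a = mem u3 a" using ua(1) a unfolding agr_but_def by metis
    qed
    moreover have "mem u3 (d * ?K + i) = H s i" if "i < Suc j" for i
    proof (cases "i = j")
     case True
     thus ?thesis using m3 by simp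
    next
     case False
     hence "mem u3 (d * ?K + i) = mem u2 (d * ?K + i)" using m3 by simp
     also have "... = mem u (d * ?K + i)"
     proof (rule m2)
      have "d * ?K + i < Suc d * ?K" using that j by simp
      also have "... <= (t+2) * ?K" using d by (intro mult_right_mono) auto
      finally show "d * ?K + i < (t+2) * ?K" .
     qed
     finally show ?thesis using ua(4) that False by simp
    qed
    ultimately show ?thesis using r3 by (simp add: I_def)
   qed
   ultimately show "EX n s'. exec ?body u n s' & n <= ?x ^ a2 + (d+7) & I (Suc j) s'" by blast
  qed
  show "EX n s'. exec ?c s n s' & n <= ?x ^ (a2 + (d+7) + 7) & agr_but d t s s' & (ALL j<?K. mem s' (d * ?K + j) = H s j)"
  proof -
   obtain n3 s3 where 3: "exec (While (t+1) ?body) s1 n3 s3" "n3 <= ?K * (?x ^ a2 + (d+7) + 1) + 1" "I ?K s3"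
    using exec_While_count[of ?K I "t+1" ?body "?x ^ a2 + (d+7)" s1, OF step _ I0] by (auto simp: I_def)
   have "exec ?c s (2 + n3) s3" using p 3(1) by (rule exec.Seq)
   moreover have "2 + n3 <= ?x ^ (a2 + (d+7) + 7)"
   proof -
    have "n3 + 2 <= ?x ^ (a2 + (d+7) + 7)"
     by (rule order_trans[OF loop_bound[of ?x ?K n3 a2 "d+7" 2]]) (use 3(2) in auto)
    thus ?thesis by linarith
   qed
   ultimately show ?thesis using 3(3) by (auto simp: I_def)
  qed
 qed
qed

lemma agr_butD: "agr_but d t s s' ==> t' <= t ==> t' <= d ==> agr t' s s'"
 unfolding agr_but_def agr_def
 by (meson less_le_trans mult_le_mono1)

primrec itr :: "nat => (nat => (nat => nat) => nat => nat) => (nat => nat) => nat => nat => nat" where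
 "itr K f A 0 = (%j. if j < K then A j else 0)"
| "itr K f A (Suc m) = (%j. if j < K then f m (itr K f A m) j else 0)"

lemma itr_support: "K <= j ==> itr K f A m j = 0"
 by (cases m) auto

text \<open>Each round tabulates the new contents in array \<open>t'+4\<close> from the old ones in
  \<open>t'+3\<close> and then copies them back, so that all cells are updated
  simultaneously.\<close>

lemma CN_itr:
 assumes A: "CA t A" and M: "CN t M" and g: "CN t g"
  and F: "!!t' m B g. t <= t' ==> CN t' m ==> CA t' B ==> CN t' g ==> CN t' (%s. F s (m s) (B s) (g s))"
 shows "CN t (%s. itr (reg s 0) (F s) (A s) (min (M s) (reg s 0)) (g s))"
proof (rule CN_I)
 show t1: "1 <= t" using M by (rule CN_ge1)
 \<comment> \<open>The hypothesis \<open>F\<close> is applied to constant functions, with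
   \<open>B\<close> as a fixed table.\<close>
 have Fd: "F s' i B j = F s i B j" if "agr t s s'" "finite {j. B j ~= 0}" for s s' i B j
  by (rule CN_dep[OF F[OF order_refl CN_const[OF t1, of i] CA_fin[OF t1 that(2)] CN_const[OF t1, of j]] that(1)])
 have Ad: "A s' j = A s j" if "agr t s s'" for s s' j
  using CN_dep[OF A[unfolded CA_def, rule_format, OF order_refl CN_const[OF t1, of j]] that] .
 have fin: "finite {j. itr K f B m j ~= 0}" for K f B m
 proof (rule finite_subset[of _ "{..<K}"])
  show "{j. itr K f B m j ~= 0} <= {..<K}" using itr_support[of K _ f B m] by (auto simp del: itr.simps intro: leI ccontr)
 qed simp
 have itd: "itr (reg s' 0) (F s') (A s') m = itr (reg s 0) (F s) (A s) m" if "agr t s s'" for s s' m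
 proof -
  have k: "reg s' 0 = reg s 0" using agr_reg[OF that] t1 by simp
  show ?thesis by (induction m) (auto simp: k Ad[OF that] Fd[OF that fin] fun_eq_iff)
 qed
 show "itr (reg s 0) (F s) (A s) (min (M s) (reg s 0)) (g s) = itr (reg s' 0) (F s') (A s') (min (M s') (reg s' 0)) (g s')"
  if "agr t s s'" for s s'
  using itd[OF that] CN_dep[OF M that] CN_dep[OF g that] agr_reg[OF that, of 0] t1 by simp
 fix t' assume t: "t <= t'"
 \<comment> \<open>Truncated subtraction makes this the minimum of \<open>M s\<close> and
   \<open>reg s 0\<close>.\<close>
 have "CN t (%s. M s - (M s - reg s 0))" using t1 by (intro CN_sub M CN_reg) auto
 then obtain c1 a1 where c1: "runs c1 a1 (t'+2) (%s. M s - (M s - reg s 0))"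
  using CN_exec[of t _ "t'+2"] t by fastforce
 have "A s' j = A s j" if "agr_but (t'+3) (t'+3) s s'" for s s' j
  using Ad agr_butD[OF that, of t] t by simp
 hence "EX c a. ALL s. EX n s'. exec c s n s' & n <= (reg s 0 + 2) ^ a & agr_but (t'+3) (t'+3) s s' &
      (ALL j<reg s 0. mem s' ((t'+3) * reg s 0 + j) = A s j)"
  by (intro fill CA_mono[OF A]) (use t in auto)
 then obtain c2 a2 where c2: "ALL s. EX n s'. exec c2 s n s' & n <= (reg s 0 + 2) ^ a2 & agr_but (t'+3) (t'+3) s s' &
      (ALL j<reg s 0. mem s' ((t'+3) * reg s 0 + j) = A s j)"
  by blast
 let ?H = "%s. F s (reg s (t'+1)) (arr (t'+3) s)"
 have "CA (t'+4) ?H" unfolding CA_def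
 proof (intro allI impI)
  fix t2 h assume h: "t'+4 <= t2" "CN t2 h"
  have "CN t2 (%s. reg s (t'+1))" "CA t2 (arr (t'+3))" using h by (auto intro: CN_reg CA_arr)
  thus "CN t2 (%s. ?H s (h s))" using F[of t2 _ "arr (t'+3)" h] h t by simp
 qed
 moreover have "?H s' j = ?H s j" if "agr_but (t'+4) (t'+4) s s'" for s s' j
 proof -
  have ag: "agr (t'+4) s s'" using agr_butD[OF that] by simp
  have "arr (t'+3) s' = arr (t'+3) s" using arr_agr[OF ag] by (auto simp: fun_eq_iff)
  moreover have "finite {j. arr (t'+3) s j ~= 0}"
   by (rule finite_subset[of _ "{..<reg s 0}"]) (auto simp: arr_def split: if_splits)
  moreover have "agr t s s'" using agr_mono[OF ag] t by simp
  moreover have "reg s' (t'+1) = reg s (t'+1)" using agr_reg[OF ag] by simp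
  ultimately show ?thesis using Fd by metis
 qed
 ultimately have "EX c a. ALL s. EX n s'. exec c s n s' & n <= (reg s 0 + 2) ^ a & agr_but (t'+4) (t'+4) s s' &
      (ALL j<reg s 0. mem s' ((t'+4) * reg s 0 + j) = ?H s j)"
  by (intro fill) auto
 then obtain c3 a3 where c3: "ALL s. EX n s'. exec c3 s n s' & n <= (reg s 0 + 2) ^ a3 & agr_but (t'+4) (t'+4) s s' &
      (ALL j<reg s 0. mem s' ((t'+4) * reg s 0 + j) = ?H s j)"
  by blast
 have "arr (t'+4) s' j = arr (t'+4) s j" if "agr_but (t'+3) (t'+5) s s'" for s s' j
 proof -
  have k: "reg s' 0 = reg s 0" using that by (simp add: agr_but_def)
  have "mem s ((t'+4) * reg s 0 + j) = mem s' ((t'+4) * reg s 0 + j)" if "j < reg s 0"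
  proof -
   have "(t'+4) * reg s 0 + j < (t'+5) * reg s 0" using that by (simp add: algebra_simps)
   thus ?thesis using \<open>agr_but _ _ s s'\<close> by (simp add: agr_but_def algebra_simps)
  qed
  thus ?thesis using k by (simp add: arr_def)
 qed
 hence "EX c a. ALL s. EX n s'. exec c s n s' & n <= (reg s 0 + 2) ^ a & agr_but (t'+3) (t'+5) s s' &
      (ALL j<reg s 0. mem s' ((t'+3) * reg s 0 + j) = arr (t'+4) s j)"
  by (intro fill CA_arr) auto
 then obtain c4 a4 where c4: "ALL s. EX n s'. exec c4 s n s' & n <= (reg s 0 + 2) ^ a4 & agr_but (t'+3) (t'+5) s s' &
      (ALL j<reg s 0. mem s' ((t'+3) * reg s 0 + j) = arr (t'+4) s j)"
  by blast
 have "CN (t'+4) (%s. arr (t'+3) s (g s))"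
  using CA_arr[of "t'+3" "t'+4"] CN_mono[OF g, of "t'+4"] t by (simp add: CA_def)
 then obtain c5 a5 where c5: "runs c5 a5 (t'+4) (%s. arr (t'+3) s (g s))"
  using CN_exec[of "t'+4" _ "t'+4"] by fastforce
 define e1 where "e1 = Const (t'+1) 0"
 define e2 where "e2 = Seq (Const (t'+4) 1) (Seq (Add (t'+1) (t'+1) (t'+4)) (Sub (t'+2) (t'+2) (t'+4)))"
 define e3 where "e3 = Seq (Const (t'+5) 0) (Add t' (t'+4) (t'+5))"
 let ?body = "Seq c3 (Seq c4 e2)"
 let ?c = "Seq c1 (Seq e1 (Seq c2 (Seq (While (t'+2) ?body) (Seq c5 e3))))"
 let ?b = "a3 + a4 + 11"
 let ?a = "a1 + a2 + a5 + ?b + 5"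
 show "EX c a. runs c a t' (%s. itr (reg s 0) (F s) (A s) (min (M s) (reg s 0)) (g s))"
 proof (rule exI[of _ ?c], rule exI[of _ ?a], rule allI)
  fix s :: state
  let ?K = "reg s 0" and ?x = "reg s 0 + 2"
  let ?m = "min (M s) ?K"
  have t1': "1 <= t'" using t t1 by simp
  obtain n1 s1 where 1: "exec c1 s n1 s1" "n1 <= ?x ^ a1" "agr (t'+2) s s1" "reg s1 (t'+2) = M s - (M s - ?K)"
   using c1 by blast
  define s2 where "s2 = straight_run e1 s1"
  have 2: "exec e1 s1 1 s2" unfolding s2_def by (rule exec_straight') (simp_all add: e1_def)
  have k2: "reg s2 0 = ?K" "reg s2 (t'+1) = 0" "reg s2 (t'+2) = ?m" "agr t' s s2"
   using 1(3,4) t1' by (auto simp: s2_def e1_def agr_def)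
  obtain n3 s3 where 3: "exec c2 s2 n3 s3" "n3 <= ?x ^ a2" "agr_but (t'+3) (t'+3) s2 s3" "ALL j<?K. mem s3 ((t'+3) * ?K + j) = A s2 j"
   using c2[rule_format, of s2] unfolding k2(1) by blast
  define I where "I = (%i u. agr t' s u & reg u (t'+1) = i & reg u (t'+2) = ?m - i & arr (t'+3) u = itr ?K (F s) (A s) i)"
  have I0: "I 0 s3"
  proof -
   have ag: "agr (t'+3) s2 s3" using agr_butD[OF 3(3)] by simp
   have "agr t' s s3" using agr_trans[OF k2(4) agr_mono[OF ag]] t1' by simp
   moreover have "reg s3 (t'+1) = 0" "reg s3 (t'+2) = ?m" "reg s3 0 = ?K" using agr_reg[OF ag] k2 by auto
   moreover have "arr (t'+3) s3 = itr ?K (F s) (A s) 0"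
    using 3(4) Ad[OF agr_mono[OF k2(4) t]] \<open>reg s3 0 = ?K\<close> by (auto simp: arr_def fun_eq_iff)
   ultimately show ?thesis by (simp add: I_def)
  qed
  have step: "reg u (t'+2) ~= 0 & (EX n s'. exec ?body u n s' & n <= ?x ^ (a3 + a4 + 1) + 3 & I (Suc i) s')"
   if i: "i < ?m" and u: "I i u" for i u
  proof
   show "reg u (t'+2) ~= 0" using u i by (simp add: I_def min_def split: if_splits)
   have ua: "agr t' s u" "reg u (t'+1) = i" "reg u (t'+2) = ?m - i" "arr (t'+3) u = itr ?K (F s) (A s) i"
    using u by (auto simp: I_def)
   have uk: "reg u 0 = ?K" using agr_reg[OF ua(1)] t1' by simp
   obtain n2 u2 where 2: "exec c3 u n2 u2" "n2 <= ?x ^ a3" "agr_but (t'+4) (t'+4) u u2" "ALL j<?K. mem u2 ((t'+4) * ?K + j) = ?H u j"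
    using c3[rule_format, of u] unfolding uk by blast
   have ag2: "agr (t'+4) u u2" using agr_butD[OF 2(3)] by simp
   have uk2: "reg u2 0 = ?K" using agr_reg[OF ag2] uk by simp
   obtain n3 u3 where 3: "exec c4 u2 n3 u3" "n3 <= ?x ^ a4" "agr_but (t'+3) (t'+5) u2 u3" "ALL j<?K. mem u3 ((t'+3) * ?K + j) = arr (t'+4) u2 j"
    using c4[rule_format, of u2] unfolding uk2 by blast
   define u4 where "u4 = straight_run e2 u3"
   have 4: "exec e2 u3 3 u4" unfolding u4_def by (rule exec_straight') (simp_all add: e2_def)
   have "exec ?body u (n2 + (n3 + 3)) u4" using 2(1) 3(1) 4 by (meson exec.Seq)
   moreover have "n2 + (n3 + 3) <= ?x ^ (a3 + a4 + 1) + 3"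
    using pow_add_le[of ?x a3 a4] 2(2) 3(2) by simp
   moreover have "I (Suc i) u4"
   proof -
    have ag3: "agr (t'+3) u2 u3" using agr_butD[OF 3(3)] by simp
    have r3: "reg u3 j = reg u2 j" if "j < t'+5" for j using 3(3) that by (simp add: agr_but_def)
    have "agr t' s u2" using agr_trans[OF ua(1) agr_mono[OF ag2]] t1' by simp
    hence "agr t' s u3" using agr_trans[OF _ agr_mono[OF ag3]] t1' by simp
    hence "agr t' s u4" by (auto simp: u4_def e2_def agr_def)
    moreover have "reg u4 (t'+1) = Suc i" "reg u4 (t'+2) = ?m - Suc i" "reg u4 0 = ?K"
     using r3 agr_reg[OF ag2] ua t1' uk by (auto simp: u4_def e2_def)
    moreover have "arr (t'+3) u4 = itr ?K (F s) (A s) (Suc i)"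
    proof
     fix j
     have "mem u4 = mem u3" by (simp add: u4_def e2_def)
     moreover have "F u (reg u (t'+1)) (arr (t'+3) u) j = F s i (itr ?K (F s) (A s) i) j"
      unfolding ua(2,4) using Fd[OF agr_mono[OF ua(1) t] fin] .
     ultimately show "arr (t'+3) u4 j = itr ?K (F s) (A s) (Suc i) j"
      using 3(4) 2(4) uk2 \<open>reg u4 0 = ?K\<close> by (simp add: arr_def)
    qed
    ultimately show ?thesis by (simp add: I_def)
   qed
   ultimately show "EX n s'. exec ?body u n s' & n <= ?x ^ (a3 + a4 + 1) + 3 & I (Suc i) s'" by blast
  qed
  obtain n4 s4 where 4: "exec (While (t'+2) ?body) s3 n4 s4" "n4 <= ?m * (?x ^ (a3 + a4 + 1) + 3 + 1) + 1" "I ?m s4"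
   using exec_While_count[of ?m I "t'+2" ?body "?x ^ (a3 + a4 + 1) + 3" s3, OF step _ I0] by (auto simp: I_def)
  have s4: "agr t' s s4" "arr (t'+3) s4 = itr ?K (F s) (A s) ?m" using 4(3) by (auto simp: I_def)
  have k4: "reg s4 0 = ?K" using agr_reg[OF s4(1)] t1' by simp
  obtain n5 s5 where 5: "exec c5 s4 n5 s5" "n5 <= ?x ^ a5" "agr (t'+4) s4 s5" "reg s5 (t'+4) = arr (t'+3) s4 (g s4)"
   using c5[rule_format, of s4] unfolding k4 by blast
  define s6 where "s6 = straight_run e3 s5"
  have 6: "exec e3 s5 2 s6" unfolding s6_def by (rule exec_straight') (simp_all add: e3_def)
  have "exec ?c s (n1 + (1 + (n3 + (n4 + (n5 + 2))))) s6" using 1(1) 2 3(1) 4(1) 5(1) 6 by (meson exec.Seq)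
  moreover have "n1 + (1 + (n3 + (n4 + (n5 + 2)))) <= ?x ^ ?a"
  proof -
   have n4: "n4 + 3 <= ?x ^ (?b + 1)"
    by (rule order_trans[OF loop_bound[of ?x ?m n4 "a3+a4+1" 3 3]]) (use 4(2) in auto)
   have "n1 + n3 <= ?x ^ (a1 + a2 + 1)" using pow_add_le[of ?x a1 a2] 1(2) 3(2) by simp
   hence "n1 + n3 + n5 <= ?x ^ (a1 + a2 + 1 + a5 + 1)" using pow_add_le[of ?x "a1+a2+1" a5] 5(2) by simp
   hence "n1 + n3 + n5 + (n4 + 3) <= ?x ^ (a1 + a2 + 1 + a5 + 1 + (?b + 1) + 1)"
    using pow_add_le[of ?x "a1+a2+1+a5+1" "?b+1"] n4 by linarith
   also have "... <= ?x ^ ?a" by (rule power_increasing) auto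
   finally show ?thesis by simp
  qed
  moreover have "agr t' s s6" "reg s6 t' = itr ?K (F s) (A s) ?m (g s)"
  proof -
   have "agr t' s s5" using agr_trans[OF s4(1) agr_mono[OF 5(3)]] t1' by simp
   thus "agr t' s s6" by (auto simp: s6_def e3_def agr_def)
   show "reg s6 t' = itr ?K (F s) (A s) ?m (g s)"
    using 5(4) s4(2) CN_dep[OF g agr_mono[OF s4(1) t]] by (simp add: s6_def e3_def)
  qed
  ultimately show "EX n s'. exec ?c s n s' & n <= ?x ^ ?a & agr t' s s' & reg s' t' = itr ?K (F s) (A s) ?m (g s)"
   by blast
 qed
qed

lemma itr_sum: "itr K (%i B j. B 0 + f i) (%j. 0) m 0 = (if K = 0 then 0 else SUM i<m. f i)"
 by (induction m) auto

text \<open>Cell 0 of an iterated array serves as the accumulator.\<close>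

lemma CN_sum:
 assumes N: "CN t N" and F: "!!t' g. t <= t' ==> CN t' g ==> CN t' (%s. F s (g s))"
 shows "CN t (%s. SUM i<min (N s) (reg s 0). F s i)"
proof -
 have t1: "1 <= t" using N by (rule CN_ge1)
 have "CN t (%s. itr (reg s 0) (%i B j. B 0 + F s i) (%j. 0) (min (N s) (reg s 0)) 0)"
 proof (rule CN_itr[OF _ N CN_const[OF t1]])
  show "CA t (%s j. 0)" unfolding CA_def using CN_const CN_ge1 by blast
  fix t' m B g assume "t <= t'" "CN t' m" "CA t' B"
  thus "CN t' (%s. B s 0 + F s (m s))"
   using CN_const[OF CN_ge1, of t' m 0] by (intro CN_add F) (auto simp: CA_def)
 qed
 moreover have "(if K = 0 then 0 else SUM i<min M K. f i) = (SUM i<min M K. f i)" for K M and f :: "nat => nat" by simp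
 ultimately show ?thesis unfolding itr_sum by (simp only:)
qed

section \<open>The algorithm\<close>

text \<open>pK cuts off every loop, pn is the number of variables, pk the approximation parameter, 2^pb the size
of a dense ball, pq the number of conditioning steps and pL the unit of the bit lengths.\<close>

record prm =
 pK :: nat
 pn :: nat
 pk :: nat
 pb :: nat
 pq :: nat
 pL :: nat
 padj :: "nat => nat"

definition prm_of :: "state => prm" where
 "prm_of s = \<lparr>pK = reg s 0, pn = reg s 1, pk = reg s 2, pb = reg s 3, pq = reg s 4, pL = reg s 5, padj = arr 0 s\<rparr>"

text \<open>The codes 0, 1, 2 stand for the coordinates 0, 1, -1. This is their squared difference,
  and \<open>el1\<close> is their distance.\<close>

definition ell :: "prm => nat => nat => nat" where
 "ell P x y = (if x = y then 0 else if x = 0 | y = 0 then 1 else 4)"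

definition el1 :: "prm => nat => nat => nat" where
 "el1 P x y = (if x = y then 0 else if x = 0 | y = 0 then 1 else 2)"

type_synonym vec = "nat => nat"
type_synonym mat = "nat => nat => nat"

context
 fixes P :: prm
begin

section \<open>Arithmetic by bounded loops\<close>

definition bsum :: "nat => vec => nat" where
 "bsum N f = (SUM i<min N (pK P). f i)"

definition bex :: "nat => (nat => bool) => bool" where
 "bex N Q \<longleftrightarrow> (EX i<min N (pK P). Q i)"

definition bitr :: "(nat => vec => vec) => vec => nat => vec" where
 "bitr f A m = itr (pK P) f A (min m (pK P))"

text \<open>Minimisation by counting: the indices up to which no witness has appeared are those
  below the least one.\<close>

definition bleast :: "nat => (nat => bool) => nat" where
 "bleast N Q = bsum N (%i. if bex (Suc i) Q then 0 else 1)"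

definition bmul :: "nat => nat => nat" where
 "bmul x y = bsum y (%i. x)"

definition bshl :: "nat => nat => nat" where
 "bshl x m = bitr (%i B j. B 0 + B 0) (%j. x) m 0"

definition bshr :: "nat => nat => nat" where
 "bshr x m = bitr (%i B j. B 0 div 2) (%j. x) m 0"

definition bdiv :: "nat => nat => nat" where
 "bdiv x y = bsum x (%i. if bmul y (Suc i) <= x then 1 else 0)"

definition bmod :: "nat => nat => nat" where
 "bmod x y = x - bmul y (bdiv x y)"

definition bbit :: "nat => nat => bool" where
 "bbit z l \<longleftrightarrow> ~ (bshr z l = bshr z l div 2 + bshr z l div 2)"

text \<open>The literals are the numbers below nn = 2 * pn, in the order of the vertices; ng is negation.\<close>

definition nn :: "nat" where
 "nn = pn P + pn P"

definition ng :: "nat => nat" where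
 "ng u = nn - 1 - u"

definition adjb :: "nat => nat => bool" where
 "adjb u v \<longleftrightarrow> padj P (bmul nn u + v) = 1"

definition mm :: "nat" where
 "mm = pq P + 3"

definition powL :: "nat => nat" where
 "powL a = bshl 1 (bmul (pL P) a)"

definition clen :: "nat set => nat" where
 "clen g = bsum nn (%u. if u : g then 1 else 0)"

definition cns :: "nat set => bool" where
 "cns g \<longleftrightarrow> ~ bex nn (%u. u : g & ng u : g)"

definition str :: "nat" where
 "str = nn + 2"

definition slots :: "nat" where
 "slots = bmul nn nn + 1"

definition tcap :: "nat" where
 "tcap = powL 134217778"

definition cUU :: "nat" where
 "cUU = powL 67108884 + powL 67108874"

definition ecnt :: "nat" where
 "ecnt = bmul tcap slots"

text \<open>The log lg is a list of weighted literal sets: entry e occupies the str cells from str * e on,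
which hold the positive and the negative part of its coefficient and then its characteristic
vector.\<close>

definition ecp :: "vec => nat => nat" where
 "ecp lg e = lg (bmul str e)"

definition ecn :: "vec => nat => nat" where
 "ecn lg e = lg (bmul str e + 1)"

definition ebt :: "vec => nat => nat set" where
 "ebt lg e = {u. lg (bmul str e + 2 + u) ~= 0}"

text \<open>The pseudo-measure of a set g of literals is 2^(m - |g|) * (U + sum over e of c(e) * (Q(g, b(e)) -
1)) for consistent g and 0 otherwise, where Q(g, b) is 2 to the number of common literals, or 0 if
g and b conflict. Subtraction truncates, so positive and negative parts are kept apart.\<close>

definition q2sh :: "vec => nat set => nat => nat => nat" where
 "q2sh lg g e x = (if bex nn (%u. u : g & ng u : ebt lg e) then 0 else bshl x (bsum nn (%u. if u : g & u : ebt lg e then 1 else 0)))"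

definition mpos :: "vec => nat set => nat" where
 "mpos lg g = (if cns g then bshl (cUU + bsum ecnt (%e. q2sh lg g e (ecp lg e) + ecn lg e)) (mm - clen g) else 0)"

definition mneg :: "vec => nat set => nat" where
 "mneg lg g = (if cns g then bshl (bsum ecnt (%e. q2sh lg g e (ecn lg e) + ecp lg e)) (mm - clen g) else 0)"

definition mcap :: "nat" where
 "mcap = bshl cUU mm"

definition mass :: "vec => nat set => nat" where
 "mass lg g = min (mpos lg g - mneg lg g) mcap"

text \<open>The mass, given \<open>al\<close>, on which \<open>u\<close> holds and \<open>v\<close>
  fails: a directed semimetric on the literals.\<close>

definition ddm :: "vec => nat set => nat => nat => nat" where
 "ddm lg al u v = mass lg (insert u (insert (ng v) al))"

definition tr :: "mat => nat => nat" where
 "tr dd u = dd u (ng u)"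

definition und :: "nat => mat => nat => bool" where
 "und pp dd u \<longleftrightarrow> pp < bshl (tr dd u) 3 & pp < bshl (tr dd (ng u)) 3"

text \<open>The radius \<open>pp / 2^63\<close> is that of \<open>k\<close> chaining steps, each
  twice as long as the distance in \<open>conf\<close>.\<close>

definition close :: "nat => mat => nat => nat => bool" where
 "close pp dd u v \<longleftrightarrow> bshl (dd u v + dd v u) 63 <= pp"

text \<open>Conditioning on a dense literal decides most of its more than 2^pb close literals.\<close>

definition dense :: "nat => mat => nat => bool" where
 "dense pp dd u \<longleftrightarrow> und pp dd u & bshl 1 (pb P) < bsum nn (%v. if close pp dd u v then 1 else 0)"

definition hasdense :: "nat => mat => bool" where
 "hasdense pp dd \<longleftrightarrow> bex nn (%u. dense pp dd u)"

definition cen :: "nat => mat => nat" where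
 "cen pp dd = bleast nn (%u. dense pp dd u)"

section \<open>The tree of conditionings and the objective\<close>

definition pathstep :: "vec => nat => nat => nat set => nat set" where
 "pathstep lg z i al = {j. j : al | (hasdense (mass lg al) (ddm lg al) & j = (if bbit z i then cen (mass lg al) (ddm lg al) else ng (cen (mass lg al) (ddm lg al))))}"

definition path :: "vec => nat => nat set" where
 "path lg z = {u. bitr (%i A j. if j : pathstep lg z i {v. A v ~= 0} then 1 else 0) (%j. 0) (pq P) u ~= 0}"

text \<open>Three literals beyond a path are what the triangle inequality for \<open>ddm\<close>
  speaks about.\<close>

definition negz :: "vec => nat => nat => nat => nat => bool" where
 "negz lg z u v w \<longleftrightarrow> mpos lg (insert u (insert v (insert w (path lg z)))) < mneg lg (insert u (insert v (insert w (path lg z))))"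

definition neg3 :: "vec => nat => nat => nat => bool" where
 "neg3 lg z u v \<longleftrightarrow> bex nn (%w. negz lg z u v w)"

definition neg2 :: "vec => nat => nat => bool" where
 "neg2 lg z u \<longleftrightarrow> bex nn (%v. neg3 lg z u v)"

definition neg1 :: "vec => nat => bool" where
 "neg1 lg z \<longleftrightarrow> bex nn (%u. neg2 lg z u)"

definition hasneg :: "vec => bool" where
 "hasneg lg \<longleftrightarrow> bex (bshl 1 (pq P)) (%z. neg1 lg z)"

definition vz :: "vec => nat" where
 "vz lg = bleast (bshl 1 (pq P)) (%z. neg1 lg z)"

definition vu :: "vec => nat" where
 "vu lg = bleast nn (%u. neg2 lg (vz lg) u)"

definition vv :: "vec => nat" where
 "vv lg = bleast nn (%v. neg3 lg (vz lg) (vu lg) v)"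

definition vw :: "vec => nat" where
 "vw lg = bleast nn (%w. negz lg (vz lg) (vu lg) (vv lg) w)"

definition vset :: "vec => nat set" where
 "vset lg = insert (vu lg) (insert (vv lg) (insert (vw lg) (path lg (vz lg))))"

definition volr :: "mat => nat set => nat" where
 "volr dd S = bsum nn (%u. bsum nn (%v. if adjb u v & u : S & v : S then dd u v else 0))"

definition xL :: "nat" where
 "xL = pL P + pL P"

text \<open>\<open>x\<close> times the guess \<open>o1\<close> plus a slack of
  \<open>2^(-2 L)\<close>, scaled to an integer.\<close>

definition objb :: "nat => nat => nat" where
 "objb x o1 = bmul x (bshl o1 xL + 1)"

definition objviol :: "vec => nat => bool" where
 "objviol lg o1 \<longleftrightarrow> objb mcap o1 < bshl (volr (ddm lg {}) {u. u < nn}) xL"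

definition leafok :: "nat => mat => nat => bool" where
 "leafok pp dd o1 \<longleftrightarrow> ~ hasdense pp dd & bshl (volr dd {u. u < nn}) xL <= objb pp o1 + objb pp o1"

definition zsel :: "vec => nat => nat" where
 "zsel lg o1 = bleast (bshl 1 (pq P)) (%z. leafok (mass lg (path lg z)) (ddm lg (path lg z)) o1)"

definition asel :: "vec => nat => nat set" where
 "asel lg o1 = path lg (zsel lg o1)"

section \<open>Weights, random walks and sweep cuts\<close>

definition rm :: "nat set => nat set" where
 "rm S = {u. u < nn & u ~: S & ng u ~: S}"

text \<open>The volume incident to \<open>u\<close> among the remaining literals. The added 1 keeps
  the total positive while any literal remains, so that losing a fraction of it is genuine
  progress.\<close>

definition wt :: "mat => nat set => nat => nat" where
 "wt dd S u = (if u : rm S then 1 + bsum nn (%v. if v : rm S then (if adjb u v then dd u v else 0) + (if adjb v u then dd v u else 0) else 0) else 0)"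

definition wtot :: "mat => nat set => nat" where
 "wtot dd S = bsum nn (%u. wt dd S u)"

definition ix :: "nat => nat => nat" where
 "ix l v = bmul nn l + v"

text \<open>Two to the squared distance in the rows built so far: later rows avoid cutting pairs that earlier
rows have separated.\<close>

definition WW :: "nat => mat => nat set => vec => nat => nat => nat => nat" where
 "WW pp dd S rw l u v = (if u : rm S & v : rm S & close pp dd u v then bshl 1 (bsum l (%i. ell P (rw (ix i u)) (rw (ix i v)))) else 0)"

definition Wsum :: "mat => nat" where
 "Wsum W = bsum nn (%u. bsum nn (%v. W u v))"

definition edg :: "mat => nat set => mat => nat => nat => nat" where
 "edg dd S W u v = bmul (W u v) (wtot dd S)"

text \<open>Both summands have the total \<open>wtot * Wsum\<close>. The first ties this measure to
  the weight still uncovered, the second dominates the degrees as Cheeger's inequality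
  demands.\<close>

definition wtl :: "mat => nat set => mat => nat => nat" where
 "wtl dd S W u = bmul (wt dd S u) (Wsum W) + bmul (bsum nn (%v. W u v)) (wtot dd S)"

definition lamb :: "mat => nat set => mat => nat" where
 "lamb dd S W = bmul (wtot dd S) (Wsum W) + bmul (wtot dd S) (Wsum W)"

text \<open>An unnormalised step of a lazy random walk in which the weights wl slow the decay down.\<close>

definition wstep :: "nat set => mat => vec => nat => vec => nat => nat" where
 "wstep R E wl lam y v = (if v : R then bshl (bsum nn (%u. if u : R then bmul (y u) (E u v) else 0) + bmul (y v) (lam - bsum nn (%u. if u : R then E u v else 0))) 59 + bmul (y v) (wl v) else 0)"

definition walk :: "nat set => mat => vec => nat => nat => nat => vec" where
 "walk R E wl lam i t1 = bitr (%i y v. wstep R E wl lam y v) (%v. if v = i then 1 else 0) t1"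

text \<open>Truncation keeps the positive part of the antisymmetrised walk, which is all a sweep set
  looks at.\<close>

definition xx :: "vec => nat => nat" where
 "xx y v = y v - y (ng v)"

definition swp :: "nat set => vec => nat => nat set" where
 "swp R y m = {v. v : R & 0 < xx y m & xx y m <= xx y v}"

definition bc :: "nat set => nat => nat" where
 "bc A u = (if u : A then 1 else if ng u : A then 2 else 0)"

definition bnd :: "nat set => mat => nat set => nat" where
 "bnd R E A = bsum nn (%u. bsum nn (%v. if u : R & v : R then bmul (E u v) (el1 P (bc A u) (bc A v)) else 0))"

definition meas :: "vec => nat set => nat" where
 "meas wl A = bsum nn (%u. if u : A | ng u : A then wl u else 0)"

definition good :: "nat set => mat => vec => nat set => bool" where
 "good R E wl A \<longleftrightarrow> bshl (bnd R E A) 28 <= meas wl A & bex nn (%u. u : A)"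

definition Tw :: "nat" where
 "Tw = bshl (bmul nn nn) 62 + 1"

definition fd3 :: "nat set => mat => vec => nat => nat => nat => nat => bool" where
 "fd3 R E wl lam i t1 m \<longleftrightarrow> good R E wl (swp R (walk R E wl lam i t1) m)"

definition fd2 :: "nat set => mat => vec => nat => nat => nat => bool" where
 "fd2 R E wl lam i t1 \<longleftrightarrow> bex nn (%m. fd3 R E wl lam i t1 m)"

definition fd1 :: "nat set => mat => vec => nat => nat => bool" where
 "fd1 R E wl lam i \<longleftrightarrow> i : R & bex Tw (%t1. fd2 R E wl lam i t1)"

definition fd :: "nat set => mat => vec => nat => bool" where
 "fd R E wl lam \<longleftrightarrow> bex nn (%i. fd1 R E wl lam i)"

definition fi :: "nat set => mat => vec => nat => nat" where
 "fi R E wl lam = bleast nn (%i. fd1 R E wl lam i)"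

definition ft :: "nat set => mat => vec => nat => nat" where
 "ft R E wl lam = bleast Tw (%t1. fd2 R E wl lam (fi R E wl lam) t1)"

definition fm :: "nat set => mat => vec => nat => nat" where
 "fm R E wl lam = bleast nn (%m. fd3 R E wl lam (fi R E wl lam) (ft R E wl lam) m)"

definition fA :: "nat set => mat => vec => nat => nat set" where
 "fA R E wl lam = swp R (walk R E wl lam (fi R E wl lam) (ft R E wl lam)) (fm R E wl lam)"

definition unc :: "nat set => vec => nat set" where
 "unc S b = {v. v : rm S & b v = 0}"

definition cov :: "mat => nat set => vec => nat" where
 "cov dd S b = bsum nn (%v. if b v = 0 then 0 else wt dd S v)"

definition rdone :: "mat => nat set => vec => bool" where
 "rdone dd S b \<longleftrightarrow> wtot dd S <= cov dd S b + cov dd S b"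

definition rfd :: "mat => nat set => mat => vec => bool" where
 "rfd dd S W b \<longleftrightarrow> fd (unc S b) (edg dd S W) (wtl dd S W) (lamb dd S W)"

definition rfA :: "mat => nat set => mat => vec => nat set" where
 "rfA dd S W b = fA (unc S b) (edg dd S W) (wtl dd S W) (lamb dd S W)"

definition rowstep :: "mat => nat set => mat => vec => nat => nat" where
 "rowstep dd S W b j = (if rdone dd S b | ~ rfd dd S W b then b j else if j : rfA dd S W b then 1 else if ng j : rfA dd S W b then 2 else b j)"

definition row :: "mat => nat set => mat => vec" where
 "row dd S W = bitr (%i b j. rowstep dd S W b j) (%j. 0) nn"

text \<open>There are \<open>2^23 * L\<close> rows. Each multiplies the total of \<open>WW\<close>
  by at most \<open>1 + 2^(-23)\<close>, all of them together by at most \<open>4^L\<close>. As one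
  row contributes at most 4 to the exponent of a weight, this is also the origin of the bound
  \<open>2 ^ (2^25 * L)\<close> on weights.\<close>

definition DD :: "nat" where
 "DD = bmul (pL P) 8388608"

definition rowsstep :: "nat => mat => nat set => nat => vec => nat => nat" where
 "rowsstep pp dd S l rw j = (if ix l 0 <= j & j < ix l 0 + nn then row dd S (WW pp dd S rw l) (j - ix l 0) else rw j)"

definition rows :: "nat => mat => nat set => vec" where
 "rows pp dd S = bitr (%l rw j. rowsstep pp dd S l rw j) (%j. 0) DD"

definition rowl :: "vec => nat => vec" where
 "rowl rw l = (%v. rw (ix l v))"

definition stk1 :: "nat => mat => nat set => nat => bool" where
 "stk1 pp dd S l \<longleftrightarrow> ~ rdone dd S (rowl (rows pp dd S) l)"

definition stuck :: "nat => mat => nat set => bool" where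
 "stuck pp dd S \<longleftrightarrow> bex DD (%l. stk1 pp dd S l)"

definition lsel :: "nat => mat => nat set => nat" where
 "lsel pp dd S = bleast DD (%l. stk1 pp dd S l)"

definition fpos :: "vec => nat => nat => nat" where
 "fpos rw z v = bsum DD (%l. if (rw (ix l v) = 1 & bbit z l) | (rw (ix l v) = 2 & ~ bbit z l) then 1 else 0)"

definition fneg :: "vec => nat => nat => nat" where
 "fneg rw z v = bsum DD (%l. if (rw (ix l v) = 2 & bbit z l) | (rw (ix l v) = 1 & ~ bbit z l) then 1 else 0)"

text \<open>The last condition is the integer form of a projection of at least
  \<open>sqrt DD / 4\<close> on the sign pattern \<open>z\<close>. Requiring \<open>v\<close> to be
  at least as likely as its negation later lets one directed distance control the other.\<close>

definition Rz :: "mat => nat set => vec => nat => nat set" where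
 "Rz dd S rw z = {v. v : rm S & tr dd (ng v) <= tr dd v & fneg rw z v < fpos rw z v & DD <= bshl (bmul (fpos rw z v - fneg rw z v) (fpos rw z v - fneg rw z v)) 4}"

definition conf :: "nat => mat => nat => nat => bool" where
 "conf pp dd u v \<longleftrightarrow> bmul (bshl (dd u (ng v)) 64) (pk P) <= pp"

definition mtch :: "nat => mat => nat set => vec => nat => nat => nat" where
 "mtch pp dd R r u v = (if u : R & v : R & u ~= v & conf pp dd u v then min (r u) (r v) else 0)"

definition rstep :: "nat => mat => nat set => nat => vec => nat => nat" where
 "rstep pp dd R i r j = (if j = bdiv i nn | j = bmod i nn then r j - mtch pp dd R r (bdiv i nn) (bmod i nn) else r j)"

text \<open>A greedy fractional matching of conflicting literals; distinct literals with residue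
  left over do not conflict. One pass over all ordered pairs is enough because residues only
  decrease.\<close>

definition resd :: "nat => mat => nat set => nat set => vec" where
 "resd pp dd S R = bitr (%i r j. rstep pp dd R i r j) (%v. if v : R then wt dd S v else 0) (bmul nn nn)"

definition zok :: "nat => mat => nat set => vec => nat => bool" where
 "zok pp dd S rw z \<longleftrightarrow> wtot dd S <= bshl (bsum nn (%v. resd pp dd S (Rz dd S rw z) v)) 7"

definition zz :: "nat => mat => nat set => vec => nat" where
 "zz pp dd S rw = bleast (bshl 1 DD) (%z. zok pp dd S rw z)"

definition Rp :: "nat => mat => nat set => nat set" where
 "Rp pp dd S = {v. resd pp dd S (Rz dd S (rows pp dd S) (zz pp dd S (rows pp dd S))) v ~= 0}"

definition ballS :: "nat => mat => nat set => nat set => nat => nat set" where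
 "ballS pp dd S R th = {v. v : rm S & bex nn (%u. u : R & dd u v <= th)}"

definition cntb :: "nat set => nat set => nat" where
 "cntb S B = bsum nn (%u. bsum nn (%v. if adjb u v & u : rm S & v : rm S & u : B & v ~: B then 1 else 0))"

text \<open>Half the distance in \<open>conf\<close>: balls of smaller radius around conflict-free
  literals cannot contain a literal together with its negation.\<close>

definition wid :: "nat => nat" where
 "wid pp = bdiv pp (bshl (pk P) 65)"

definition thr :: "nat => mat => nat set => nat" where
 "thr pp dd S = bleast (wid pp) (%th. bmul (wid pp) (cntb S (ballS pp dd S (Rp pp dd S) th)) <= volr dd (rm S))"

text \<open>The first round fixes the nearly decided literals. Its bound on the mass of the negation
  ranges between \<open>pp / 8\<close> and \<open>pp / 4\<close>, the choice being left to region
  growing.\<close>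

definition ball0 :: "nat => mat => nat => nat set" where
 "ball0 pp dd th = {v. v < nn & tr dd (ng v) <= pp div 2 div 2 div 2 + 1 + th}"

definition thr0 :: "nat => mat => nat" where
 "thr0 pp dd = bleast (pp div 2 div 2 div 2) (%th. bmul (pp div 2 div 2 div 2) (cntb {} (ball0 pp dd th)) <= volr dd (rm {}))"

definition nempty :: "nat set => bool" where
 "nempty S \<longleftrightarrow> bex nn (%u. u : rm S)"

definition rnd :: "nat => mat => nat => nat set => nat set" where
 "rnd pp dd i S = {j. j : S | (if i = 0 then j : ball0 pp dd (thr0 pp dd) else nempty S & ~ stuck pp dd S & j : ballS pp dd S (Rp pp dd S) (thr pp dd S))}"

definition rnds :: "nat => mat => nat set" where
 "rnds pp dd = {j. bitr (%i A j. if j : rnd pp dd i {v. A v ~= 0} then 1 else 0) (%j. 0) (Suc nn) j ~= 0}"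

section \<open>Perceptron updates\<close>

definition sol :: "vec => nat => nat set" where
 "sol lg o1 = rnds (mass lg (asel lg o1)) (ddm lg (asel lg o1))"

definition upd3 :: "vec => nat => bool" where
 "upd3 lg o1 \<longleftrightarrow> nempty (sol lg o1)"

definition upd :: "vec => nat => bool" where
 "upd lg o1 \<longleftrightarrow> hasneg lg | objviol lg o1 | upd3 lg o1"

definition sl :: "vec => nat => nat" where
 "sl lg o1 = lsel (mass lg (asel lg o1)) (ddm lg (asel lg o1)) (sol lg o1)"

definition sW :: "vec => nat => nat => nat => nat" where
 "sW lg o1 u v = WW (mass lg (asel lg o1)) (ddm lg (asel lg o1)) (sol lg o1) (rows (mass lg (asel lg o1)) (ddm lg (asel lg o1)) (sol lg o1)) (sl lg o1) u v"

definition sR :: "vec => nat => nat set" where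
 "sR lg o1 = unc (sol lg o1) (rowl (rows (mass lg (asel lg o1)) (ddm lg (asel lg o1)) (sol lg o1)) (sl lg o1))"

text \<open>An update has one slot for each ordered pair of literals and a last one for a single
  atom.\<close>

definition ubet :: "vec => nat => nat => nat set" where
 "ubet lg o1 i = (if hasneg lg then vset lg else if objviol lg o1 then insert (bdiv i nn) (insert (ng (bmod i nn)) {}) else if i < bmul nn nn then insert (bdiv i nn) (insert (ng (bmod i nn)) (asel lg o1)) else asel lg o1)"

text \<open>An update adds a negative atom, subtracts the violated objective, or adds the spectral certificate
of a stuck rounding.\<close>

definition upos :: "vec => nat => nat => nat" where
 "upos lg o1 i = (if hasneg lg then (if i = bmul nn nn then 1 else 0) else if objviol lg o1 then 0 else if i < bmul nn nn & bdiv i nn : sR lg o1 & bmod i nn : sR lg o1 then bshl (sW lg o1 (bdiv i nn) (bmod i nn)) 63 else 0)"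

definition uneg :: "vec => nat => nat => nat" where
 "uneg lg o1 i = (if hasneg lg then 0 else if objviol lg o1 then (if i < bmul nn nn & adjb (bdiv i nn) (bmod i nn) then 1 else 0) else if i = bmul nn nn then Wsum (sW lg o1) else 0)"

definition scal :: "nat set => nat => nat" where
 "scal g x = (if cns g then bshl x (mm - clen g) else 0)"

definition ucell :: "vec => nat => nat => nat => nat" where
 "ucell lg o1 i f = (if f = 0 then scal (ubet lg o1 i) (upos lg o1 i) else if f = 1 then scal (ubet lg o1 i) (uneg lg o1 i) else if f - 2 : ubet lg o1 i then 1 else 0)"

definition lgstep :: "nat => nat => vec => nat => nat" where
 "lgstep o1 t1 lg j = (if upd lg o1 & bmul slots t1 <= bdiv j str & bdiv j str < bmul slots t1 + slots then ucell lg o1 (bdiv j str - bmul slots t1) (bmod j str) else lg j)"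

definition lgf :: "nat => vec" where
 "lgf o1 = bitr (%t1 lg j. lgstep o1 t1 lg j) (%j. 0) tcap"

text \<open>Minimality replaces knowledge of the optimum: the updates stop for the value of every
  cut, so this guess is at most the least such value.\<close>

definition osel :: "nat" where
 "osel = bleast (Suc (bmul nn nn)) (%o1. ~ upd (lgf o1) o1)"

definition outp :: "nat => nat" where
 "outp j = (if j : sol (lgf osel) osel then 1 else 0)"

end

section \<open>Computability of the algorithm\<close>

named_theorems cn

lemma CN_const' [cn]: "6 <= t ==> CN t (%s. k)"
 by (rule CN_const) simp

lemma CN_prm [cn]:
 assumes "6 <= t"
 shows "CN t (%s. pK (prm_of s))" "CN t (%s. pn (prm_of s))" "CN t (%s. pk (prm_of s))"
  "CN t (%s. pb (prm_of s))" "CN t (%s. pq (prm_of s))" "CN t (%s. pL (prm_of s))"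
 using assms by (auto simp: prm_of_def intro!: CN_reg)

lemma CN_padj [cn]: "6 <= t ==> CN t g ==> CN t (%s. padj (prm_of s) (g s))"
 using CA_arr[of 0 t] by (simp add: prm_of_def CA_def)

lemmas CN_basic [cn] = CN_add CN_sub CN_half CN_if CB_le CB_less CB_eq CB_not CB_conj CB_disj CB_imp

lemma CB_Collect [cn]: "CB t (%s. Q s (u s)) ==> CB t (%s. u s : {x. Q s x})"
 by simp

lemma CB_insert [cn]: "CB t (%s. u s = a s) ==> CB t (%s. u s : S s) ==> CB t (%s. u s : insert (a s) (S s))"
 unfolding insert_iff by (rule CB_disj)

lemma CB_if [cn]: "CB t Q ==> CB t (%s. u s : S s) ==> CB t (%s. u s : S' s) ==> CB t (%s. u s : (if Q s then S s else S' s))"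
 unfolding if_split_mem2 by (intro CB_conj CB_imp CB_not)

lemma CB_ite [cn]: "CB t Q ==> CB t S ==> CB t S' ==> CB t (%s. if Q s then S s else S' s)"
 unfolding if_bool_eq_conj by (intro CB_conj CB_imp CB_not)

lemma CB_empty [cn]: "6 <= t ==> CB t (%s. u s : {})"
 by (simp add: CB_def CN_const')

lemma CN_min [cn]: "CN t f ==> CN t g ==> CN t (%s. min (f s) (g s))"
 unfolding min_def by (intro CN_if CB_le)

lemma CN_Suc [cn]: "6 <= t ==> CN t f ==> CN t (%s. Suc (f s))"
 using CN_add[OF _ CN_const', of t f 1] by simp

definition CD :: "nat => (state => nat => nat => nat) => bool" where
 "CD t A \<longleftrightarrow> (ALL t'>=t. ALL g h. CN t' g --> CN t' h --> CN t' (%s. A s (g s) (h s)))"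

lemma CD_mono: "CD t A ==> t <= t' ==> CD t' A"
 unfolding CD_def by (meson order_trans)

text \<open>The first premise reappears in front of the subgoal for the argument: elimination
  consumes it, while nested applications of the same array still need it.\<close>

lemma CA_app: "CA t A ==> t <= t' ==> (CA t A ==> CN t' g) ==> CN t' (%s. A s (g s))"
 by (simp add: CA_def)

lemma CD_app: "CD t A ==> t <= t' ==> (CD t A ==> CN t' g) ==> (CD t A ==> CN t' h) ==> CN t' (%s. A s (g s) (h s))"
 by (simp add: CD_def)

lemma CS_app: "CS t A ==> t <= t' ==> (CS t A ==> CN t' g) ==> CB t' (%s. g s : A s)"
 by (simp add: CS_def)

lemmas cm = asm_rl CN_mono CA_mono CD_mono CS_mono CA_app CD_app CS_app

lemma CA_I [cn]: "(!!t' g. t <= t' ==> CN t' g ==> CN t' (%s. A s (g s))) ==> CA t A"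
 by (simp add: CA_def)

lemma CD_I [cn]: "(!!t' g h. t <= t' ==> CN t' g ==> CN t' h ==> CN t' (%s. A s (g s) (h s))) ==> CD t A"
 by (simp add: CD_def)

lemma CS_I [cn]: "(!!t' g. t <= t' ==> CN t' g ==> CB t' (%s. g s : A s)) ==> CS t A"
 by (simp add: CS_def)

lemma CN_bsum [cn]:
 assumes "CN t N" "!!t' g. t <= t' ==> CN t' g ==> CN t' (%s. F s (g s))"
 shows "CN t (%s. bsum (prm_of s) (N s) (%i. F s i))"
 using CN_sum[OF assms] by (simp add: bsum_def prm_of_def)

lemma CB_bex [cn]:
 assumes "CN t N" "!!t' g. t <= t' ==> CN t' g ==> CB t' (%s. Q s (g s))"
 shows "CB t (%s. bex (prm_of s) (N s) (%i. Q s i))"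
proof -
 have "CN t (%s. bsum (prm_of s) (N s) (%i. if Q s i then 1 else 0))"
  using assms by (intro CN_bsum) (auto simp: CB_def)
 hence "CB t (%s. ~ bsum (prm_of s) (N s) (%i. if Q s i then 1 else 0) = 0)"
  using CN_ge1[OF assms(1)] by (intro CB_not CB_eq CN_const) auto
 moreover have "(~ bsum P M (%i. if R i then 1 else 0) = 0) = bex P M R" for P M R
  by (auto simp: bsum_def bex_def)
 ultimately show ?thesis by (simp only:)
qed

lemma CN_bitr [cn]:
 assumes "CA t A" "CN t M" "CN t g"
  and F: "!!t' m B g. t <= t' ==> CN t' m ==> CA t' B ==> CN t' g ==> CN t' (%s. F s (m s) (B s) (g s))"
 shows "CN t (%s. bitr (prm_of s) (%i B j. F s i B j) (%j. A s j) (M s) (g s))"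
 using CN_itr[of t A M g F] assms by (simp add: bitr_def prm_of_def)

lemma CN_bleast [cn]:
 assumes "6 <= t" "CN t N" "!!t' g. t <= t' ==> CN t' g ==> CB t' (%s. Q s (g s))"
 shows "CN t (%s. bleast (prm_of s) (N s) (%i. Q s i))"
 unfolding bleast_def using assms(1,2)
 by - (rule cn assms(3) |assumption |linarith)+

text \<open>From here on each definition is unfolded once and its rule joins \<open>cn\<close>, so
  that later definitions treat it as a primitive.\<close>

lemma [cn]: "6 <= t ==> CN t x ==> CN t y ==> CN t (%s. bmul (prm_of s) (x s) (y s))"
 unfolding bmul_def by (erule cm | rule cn | linarith)+

lemma [cn]: "6 <= t ==> CN t x ==> CN t m ==> CN t (%s. bshl (prm_of s) (x s) (m s))"
 unfolding bshl_def by (erule cm | rule cn | linarith)+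

lemma [cn]: "6 <= t ==> CN t x ==> CN t m ==> CN t (%s. bshr (prm_of s) (x s) (m s))"
 unfolding bshr_def by (erule cm | rule cn | linarith)+

lemma [cn]: "6 <= t ==> CN t x ==> CN t y ==> CN t (%s. bdiv (prm_of s) (x s) (y s))"
 unfolding bdiv_def by (erule cm | rule cn | linarith)+

lemma [cn]: "6 <= t ==> CN t x ==> CN t y ==> CN t (%s. bmod (prm_of s) (x s) (y s))"
 unfolding bmod_def by (erule cm | rule cn | linarith)+

lemma [cn]: "6 <= t ==> CN t z ==> CN t l ==> CB t (%s. bbit (prm_of s) (z s) (l s))"
 unfolding bbit_def by (erule cm | rule cn | linarith)+

lemma [cn]: "6 <= t ==> CN t (%s. nn (prm_of s))"
 unfolding nn_def by (erule cm | rule cn | linarith)+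

lemma [cn]: "6 <= t ==> CN t u ==> CN t (%s. ng (prm_of s) (u s))"
 unfolding ng_def by (erule cm | rule cn | linarith)+

lemma [cn]: "6 <= t ==> CN t u ==> CN t v ==> CB t (%s. adjb (prm_of s) (u s) (v s))"
 unfolding adjb_def by (erule cm | rule cn | linarith)+

lemma [cn]: "6 <= t ==> CN t (%s. mm (prm_of s))"
 unfolding mm_def by (erule cm | rule cn | linarith)+

lemma [cn]: "6 <= t ==> CN t a ==> CN t (%s. powL (prm_of s) (a s))"
 unfolding powL_def by (erule cm | rule cn | linarith)+

lemma [cn]: "6 <= t ==> CS t g ==> CN t (%s. clen (prm_of s) (g s))"
 unfolding clen_def by (erule cm | rule cn | linarith)+

lemma [cn]: "6 <= t ==> CS t g ==> CB t (%s. cns (prm_of s) (g s))"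
 unfolding cns_def by (erule cm | rule cn | linarith)+

lemma [cn]: "6 <= t ==> CN t (%s. str (prm_of s))"
 unfolding str_def by (erule cm | rule cn | linarith)+

lemma [cn]: "6 <= t ==> CN t (%s. slots (prm_of s))"
 unfolding slots_def by (erule cm | rule cn | linarith)+

lemma [cn]: "6 <= t ==> CN t (%s. tcap (prm_of s))"
 unfolding tcap_def by (erule cm | rule cn | linarith)+

lemma [cn]: "6 <= t ==> CN t (%s. cUU (prm_of s))"
 unfolding cUU_def by (erule cm | rule cn | linarith)+

lemma [cn]: "6 <= t ==> CN t (%s. ecnt (prm_of s))"
 unfolding ecnt_def by (erule cm | rule cn | linarith)+

lemma [cn]: "6 <= t ==> CA t lg ==> CN t e ==> CN t (%s. ecp (prm_of s) (lg s) (e s))"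
 unfolding ecp_def by (erule cm | rule cn | linarith)+

lemma [cn]: "6 <= t ==> CA t lg ==> CN t e ==> CN t (%s. ecn (prm_of s) (lg s) (e s))"
 unfolding ecn_def by (erule cm | rule cn | linarith)+

lemma [cn]: "6 <= t ==> CA t lg ==> CN t e ==> CN t x ==> CB t (%s. x s : ebt (prm_of s) (lg s) (e s))"
 unfolding ebt_def by (erule cm | rule cn | linarith)+

lemma [cn]: "6 <= t ==> CA t lg ==> CS t g ==> CN t e ==> CN t x ==> CN t (%s. q2sh (prm_of s) (lg s) (g s) (e s) (x s))"
 unfolding q2sh_def by (erule cm | rule cn | linarith)+

lemma [cn]: "6 <= t ==> CA t lg ==> CS t g ==> CN t (%s. mpos (prm_of s) (lg s) (g s))"
 unfolding mpos_def by (erule cm | rule cn | linarith)+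

lemma [cn]: "6 <= t ==> CA t lg ==> CS t g ==> CN t (%s. mneg (prm_of s) (lg s) (g s))"
 unfolding mneg_def by (erule cm | rule cn | linarith)+

lemma [cn]: "6 <= t ==> CN t (%s. mcap (prm_of s))"
 unfolding mcap_def by (erule cm | rule cn | linarith)+

lemma [cn]: "6 <= t ==> CA t lg ==> CS t g ==> CN t (%s. mass (prm_of s) (lg s) (g s))"
 unfolding mass_def by (erule cm | rule cn | linarith)+

lemma [cn]: "6 <= t ==> CA t lg ==> CS t al ==> CN t u ==> CN t v ==> CN t (%s. ddm (prm_of s) (lg s) (al s) (u s) (v s))"
 unfolding ddm_def by (erule cm | rule cn | linarith)+

lemma [cn]: "6 <= t ==> CD t dd ==> CN t u ==> CN t (%s. tr (prm_of s) (dd s) (u s))"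
 unfolding tr_def by (erule cm | rule cn | linarith)+

lemma [cn]: "6 <= t ==> CN t pp ==> CD t dd ==> CN t u ==> CB t (%s. und (prm_of s) (pp s) (dd s) (u s))"
 unfolding und_def by (erule cm | rule cn | linarith)+

lemma [cn]: "6 <= t ==> CN t pp ==> CD t dd ==> CN t u ==> CN t v ==> CB t (%s. close (prm_of s) (pp s) (dd s) (u s) (v s))"
 unfolding close_def by (erule cm | rule cn | linarith)+

lemma [cn]: "6 <= t ==> CN t pp ==> CD t dd ==> CN t u ==> CB t (%s. dense (prm_of s) (pp s) (dd s) (u s))"
 unfolding dense_def by (erule cm | rule cn | linarith)+

lemma [cn]: "6 <= t ==> CN t pp ==> CD t dd ==> CB t (%s. hasdense (prm_of s) (pp s) (dd s))"
 unfolding hasdense_def by (erule cm | rule cn | linarith)+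

lemma [cn]: "6 <= t ==> CN t pp ==> CD t dd ==> CN t (%s. cen (prm_of s) (pp s) (dd s))"
 unfolding cen_def by (erule cm | rule cn | linarith)+

lemma [cn]: "6 <= t ==> CA t lg ==> CN t z ==> CN t i ==> CS t al ==> CN t x ==> CB t (%s. x s : pathstep (prm_of s) (lg s) (z s) (i s) (al s))"
 unfolding pathstep_def by (erule cm | rule cn | linarith)+

lemma [cn]: "6 <= t ==> CA t lg ==> CN t z ==> CN t x ==> CB t (%s. x s : path (prm_of s) (lg s) (z s))"
 unfolding path_def by (erule cm | rule cn | linarith)+

lemma [cn]: "6 <= t ==> CA t lg ==> CN t z ==> CN t u ==> CN t v ==> CN t w ==> CB t (%s. negz (prm_of s) (lg s) (z s) (u s) (v s) (w s))"
 unfolding negz_def by (erule cm | rule cn | linarith)+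

lemma [cn]: "6 <= t ==> CA t lg ==> CN t z ==> CN t u ==> CN t v ==> CB t (%s. neg3 (prm_of s) (lg s) (z s) (u s) (v s))"
 unfolding neg3_def by (erule cm | rule cn | linarith)+

lemma [cn]: "6 <= t ==> CA t lg ==> CN t z ==> CN t u ==> CB t (%s. neg2 (prm_of s) (lg s) (z s) (u s))"
 unfolding neg2_def by (erule cm | rule cn | linarith)+

lemma [cn]: "6 <= t ==> CA t lg ==> CN t z ==> CB t (%s. neg1 (prm_of s) (lg s) (z s))"
 unfolding neg1_def by (erule cm | rule cn | linarith)+

lemma [cn]: "6 <= t ==> CA t lg ==> CB t (%s. hasneg (prm_of s) (lg s))"
 unfolding hasneg_def by (erule cm | rule cn | linarith)+

lemma [cn]: "6 <= t ==> CA t lg ==> CN t (%s. vz (prm_of s) (lg s))"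
 unfolding vz_def by (erule cm | rule cn | linarith)+

lemma [cn]: "6 <= t ==> CA t lg ==> CN t (%s. vu (prm_of s) (lg s))"
 unfolding vu_def by (erule cm | rule cn | linarith)+

lemma [cn]: "6 <= t ==> CA t lg ==> CN t (%s. vv (prm_of s) (lg s))"
 unfolding vv_def by (erule cm | rule cn | linarith)+

lemma [cn]: "6 <= t ==> CA t lg ==> CN t (%s. vw (prm_of s) (lg s))"
 unfolding vw_def by (erule cm | rule cn | linarith)+

lemma [cn]: "6 <= t ==> CA t lg ==> CN t x ==> CB t (%s. x s : vset (prm_of s) (lg s))"
 unfolding vset_def by (erule cm | rule cn | linarith)+

lemma [cn]: "6 <= t ==> CD t dd ==> CS t S ==> CN t (%s. volr (prm_of s) (dd s) (S s))"
 unfolding volr_def by (erule cm | rule cn | linarith)+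

lemma [cn]: "6 <= t ==> CN t (%s. xL (prm_of s))"
 unfolding xL_def by (erule cm | rule cn | linarith)+

lemma [cn]: "6 <= t ==> CN t x ==> CN t o1 ==> CN t (%s. objb (prm_of s) (x s) (o1 s))"
 unfolding objb_def by (erule cm | rule cn | linarith)+

lemma [cn]: "6 <= t ==> CA t lg ==> CN t o1 ==> CB t (%s. objviol (prm_of s) (lg s) (o1 s))"
 unfolding objviol_def by (erule cm | rule cn | linarith)+

lemma [cn]: "6 <= t ==> CN t pp ==> CD t dd ==> CN t o1 ==> CB t (%s. leafok (prm_of s) (pp s) (dd s) (o1 s))"
 unfolding leafok_def by (erule cm | rule cn | linarith)+

lemma [cn]: "6 <= t ==> CA t lg ==> CN t o1 ==> CN t (%s. zsel (prm_of s) (lg s) (o1 s))"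
 unfolding zsel_def by (erule cm | rule cn | linarith)+

lemma [cn]: "6 <= t ==> CA t lg ==> CN t o1 ==> CN t x ==> CB t (%s. x s : asel (prm_of s) (lg s) (o1 s))"
 unfolding asel_def by (erule cm | rule cn | linarith)+

lemma [cn]: "6 <= t ==> CS t S ==> CN t x ==> CB t (%s. x s : rm (prm_of s) (S s))"
 unfolding rm_def by (erule cm | rule cn | linarith)+

lemma [cn]: "6 <= t ==> CD t dd ==> CS t S ==> CN t u ==> CN t (%s. wt (prm_of s) (dd s) (S s) (u s))"
 unfolding wt_def by (erule cm | rule cn | linarith)+

lemma [cn]: "6 <= t ==> CD t dd ==> CS t S ==> CN t (%s. wtot (prm_of s) (dd s) (S s))"
 unfolding wtot_def by (erule cm | rule cn | linarith)+

lemma [cn]: "6 <= t ==> CN t x ==> CN t y ==> CN t (%s. ell (prm_of s) (x s) (y s))"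
 unfolding ell_def by (erule cm | rule cn | linarith)+

lemma [cn]: "6 <= t ==> CN t x ==> CN t y ==> CN t (%s. el1 (prm_of s) (x s) (y s))"
 unfolding el1_def by (erule cm | rule cn | linarith)+

lemma [cn]: "6 <= t ==> CN t l ==> CN t v ==> CN t (%s. ix (prm_of s) (l s) (v s))"
 unfolding ix_def by (erule cm | rule cn | linarith)+

lemma [cn]: "6 <= t ==> CN t pp ==> CD t dd ==> CS t S ==> CA t rw ==> CN t l ==> CN t u ==> CN t v ==> CN t (%s. WW (prm_of s) (pp s) (dd s) (S s) (rw s) (l s) (u s) (v s))"
 unfolding WW_def by (erule cm | rule cn | linarith)+

lemma [cn]: "6 <= t ==> CD t W ==> CN t (%s. Wsum (prm_of s) (W s))"
 unfolding Wsum_def by (erule cm | rule cn | linarith)+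

lemma [cn]: "6 <= t ==> CD t dd ==> CS t S ==> CD t W ==> CN t u ==> CN t v ==> CN t (%s. edg (prm_of s) (dd s) (S s) (W s) (u s) (v s))"
 unfolding edg_def by (erule cm | rule cn | linarith)+

lemma [cn]: "6 <= t ==> CD t dd ==> CS t S ==> CD t W ==> CN t u ==> CN t (%s. wtl (prm_of s) (dd s) (S s) (W s) (u s))"
 unfolding wtl_def by (erule cm | rule cn | linarith)+

lemma [cn]: "6 <= t ==> CD t dd ==> CS t S ==> CD t W ==> CN t (%s. lamb (prm_of s) (dd s) (S s) (W s))"
 unfolding lamb_def by (erule cm | rule cn | linarith)+

lemma [cn]: "6 <= t ==> CS t R ==> CD t E ==> CA t wl ==> CN t lam ==> CA t y ==> CN t v ==> CN t (%s. wstep (prm_of s) (R s) (E s) (wl s) (lam s) (y s) (v s))"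
 unfolding wstep_def by (erule cm | rule cn | linarith)+

lemma [cn]: "6 <= t ==> CS t R ==> CD t E ==> CA t wl ==> CN t lam ==> CN t i ==> CN t t1 ==> CN t x ==> CN t (%s. walk (prm_of s) (R s) (E s) (wl s) (lam s) (i s) (t1 s) (x s))"
 unfolding walk_def by (erule cm | rule cn | linarith)+

lemma [cn]: "6 <= t ==> CA t y ==> CN t v ==> CN t (%s. xx (prm_of s) (y s) (v s))"
 unfolding xx_def by (erule cm | rule cn | linarith)+

lemma [cn]: "6 <= t ==> CS t R ==> CA t y ==> CN t m ==> CN t x ==> CB t (%s. x s : swp (prm_of s) (R s) (y s) (m s))"
 unfolding swp_def by (erule cm | rule cn | linarith)+

lemma [cn]: "6 <= t ==> CS t A ==> CN t u ==> CN t (%s. bc (prm_of s) (A s) (u s))"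
 unfolding bc_def by (erule cm | rule cn | linarith)+

lemma [cn]: "6 <= t ==> CS t R ==> CD t E ==> CS t A ==> CN t (%s. bnd (prm_of s) (R s) (E s) (A s))"
 unfolding bnd_def by (erule cm | rule cn | linarith)+

lemma [cn]: "6 <= t ==> CA t wl ==> CS t A ==> CN t (%s. meas (prm_of s) (wl s) (A s))"
 unfolding meas_def by (erule cm | rule cn | linarith)+

lemma [cn]: "6 <= t ==> CS t R ==> CD t E ==> CA t wl ==> CS t A ==> CB t (%s. good (prm_of s) (R s) (E s) (wl s) (A s))"
 unfolding good_def by (erule cm | rule cn | linarith)+

lemma [cn]: "6 <= t ==> CN t (%s. Tw (prm_of s))"
 unfolding Tw_def by (erule cm | rule cn | linarith)+

lemma [cn]: "6 <= t ==> CS t R ==> CD t E ==> CA t wl ==> CN t lam ==> CN t i ==> CN t t1 ==> CN t m ==> CB t (%s. fd3 (prm_of s) (R s) (E s) (wl s) (lam s) (i s) (t1 s) (m s))"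
 unfolding fd3_def by (erule cm | rule cn | linarith)+

lemma [cn]: "6 <= t ==> CS t R ==> CD t E ==> CA t wl ==> CN t lam ==> CN t i ==> CN t t1 ==> CB t (%s. fd2 (prm_of s) (R s) (E s) (wl s) (lam s) (i s) (t1 s))"
 unfolding fd2_def by (erule cm | rule cn | linarith)+

lemma [cn]: "6 <= t ==> CS t R ==> CD t E ==> CA t wl ==> CN t lam ==> CN t i ==> CB t (%s. fd1 (prm_of s) (R s) (E s) (wl s) (lam s) (i s))"
 unfolding fd1_def by (erule cm | rule cn | linarith)+

lemma [cn]: "6 <= t ==> CS t R ==> CD t E ==> CA t wl ==> CN t lam ==> CB t (%s. fd (prm_of s) (R s) (E s) (wl s) (lam s))"
 unfolding fd_def by (erule cm | rule cn | linarith)+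

lemma [cn]: "6 <= t ==> CS t R ==> CD t E ==> CA t wl ==> CN t lam ==> CN t (%s. fi (prm_of s) (R s) (E s) (wl s) (lam s))"
 unfolding fi_def by (erule cm | rule cn | linarith)+

lemma [cn]: "6 <= t ==> CS t R ==> CD t E ==> CA t wl ==> CN t lam ==> CN t (%s. ft (prm_of s) (R s) (E s) (wl s) (lam s))"
 unfolding ft_def by (erule cm | rule cn | linarith)+

lemma [cn]: "6 <= t ==> CS t R ==> CD t E ==> CA t wl ==> CN t lam ==> CN t (%s. fm (prm_of s) (R s) (E s) (wl s) (lam s))"
 unfolding fm_def by (erule cm | rule cn | linarith)+

lemma [cn]: "6 <= t ==> CS t R ==> CD t E ==> CA t wl ==> CN t lam ==> CN t x ==> CB t (%s. x s : fA (prm_of s) (R s) (E s) (wl s) (lam s))"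
 unfolding fA_def by (erule cm | rule cn | linarith)+

lemma [cn]: "6 <= t ==> CS t S ==> CA t b ==> CN t x ==> CB t (%s. x s : unc (prm_of s) (S s) (b s))"
 unfolding unc_def by (erule cm | rule cn | linarith)+

lemma [cn]: "6 <= t ==> CD t dd ==> CS t S ==> CA t b ==> CN t (%s. cov (prm_of s) (dd s) (S s) (b s))"
 unfolding cov_def by (erule cm | rule cn | linarith)+

lemma [cn]: "6 <= t ==> CD t dd ==> CS t S ==> CA t b ==> CB t (%s. rdone (prm_of s) (dd s) (S s) (b s))"
 unfolding rdone_def by (erule cm | rule cn | linarith)+

lemma [cn]: "6 <= t ==> CD t dd ==> CS t S ==> CD t W ==> CA t b ==> CB t (%s. rfd (prm_of s) (dd s) (S s) (W s) (b s))"
 unfolding rfd_def by (erule cm | rule cn | linarith)+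

lemma [cn]: "6 <= t ==> CD t dd ==> CS t S ==> CD t W ==> CA t b ==> CN t x ==> CB t (%s. x s : rfA (prm_of s) (dd s) (S s) (W s) (b s))"
 unfolding rfA_def by (erule cm | rule cn | linarith)+

lemma [cn]: "6 <= t ==> CD t dd ==> CS t S ==> CD t W ==> CA t b ==> CN t j ==> CN t (%s. rowstep (prm_of s) (dd s) (S s) (W s) (b s) (j s))"
 unfolding rowstep_def by (erule cm | rule cn | linarith)+

lemma [cn]: "6 <= t ==> CD t dd ==> CS t S ==> CD t W ==> CN t x ==> CN t (%s. row (prm_of s) (dd s) (S s) (W s) (x s))"
 unfolding row_def by (erule cm | rule cn | linarith)+

lemma [cn]: "6 <= t ==> CN t (%s. DD (prm_of s))"
 unfolding DD_def by (erule cm | rule cn | linarith)+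

lemma [cn]: "6 <= t ==> CN t pp ==> CD t dd ==> CS t S ==> CN t l ==> CA t rw ==> CN t j ==> CN t (%s. rowsstep (prm_of s) (pp s) (dd s) (S s) (l s) (rw s) (j s))"
 unfolding rowsstep_def by (erule cm | rule cn | linarith)+

lemma [cn]: "6 <= t ==> CN t pp ==> CD t dd ==> CS t S ==> CN t x ==> CN t (%s. rows (prm_of s) (pp s) (dd s) (S s) (x s))"
 unfolding rows_def by (erule cm | rule cn | linarith)+

lemma [cn]: "6 <= t ==> CA t rw ==> CN t l ==> CN t x ==> CN t (%s. rowl (prm_of s) (rw s) (l s) (x s))"
 unfolding rowl_def by (erule cm | rule cn | linarith)+

lemma [cn]: "6 <= t ==> CN t pp ==> CD t dd ==> CS t S ==> CN t l ==> CB t (%s. stk1 (prm_of s) (pp s) (dd s) (S s) (l s))"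
 unfolding stk1_def by (erule cm | rule cn | linarith)+

lemma [cn]: "6 <= t ==> CN t pp ==> CD t dd ==> CS t S ==> CB t (%s. stuck (prm_of s) (pp s) (dd s) (S s))"
 unfolding stuck_def by (erule cm | rule cn | linarith)+

lemma [cn]: "6 <= t ==> CN t pp ==> CD t dd ==> CS t S ==> CN t (%s. lsel (prm_of s) (pp s) (dd s) (S s))"
 unfolding lsel_def by (erule cm | rule cn | linarith)+

lemma [cn]: "6 <= t ==> CA t rw ==> CN t z ==> CN t v ==> CN t (%s. fpos (prm_of s) (rw s) (z s) (v s))"
 unfolding fpos_def by (erule cm | rule cn | linarith)+

lemma [cn]: "6 <= t ==> CA t rw ==> CN t z ==> CN t v ==> CN t (%s. fneg (prm_of s) (rw s) (z s) (v s))"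
 unfolding fneg_def by (erule cm | rule cn | linarith)+

lemma [cn]: "6 <= t ==> CD t dd ==> CS t S ==> CA t rw ==> CN t z ==> CN t x ==> CB t (%s. x s : Rz (prm_of s) (dd s) (S s) (rw s) (z s))"
 unfolding Rz_def by (erule cm | rule cn | linarith)+

lemma [cn]: "6 <= t ==> CN t pp ==> CD t dd ==> CN t u ==> CN t v ==> CB t (%s. conf (prm_of s) (pp s) (dd s) (u s) (v s))"
 unfolding conf_def by (erule cm | rule cn | linarith)+

lemma [cn]: "6 <= t ==> CN t pp ==> CD t dd ==> CS t R ==> CA t r ==> CN t u ==> CN t v ==> CN t (%s. mtch (prm_of s) (pp s) (dd s) (R s) (r s) (u s) (v s))"
 unfolding mtch_def by (erule cm | rule cn | linarith)+

lemma [cn]: "6 <= t ==> CN t pp ==> CD t dd ==> CS t R ==> CN t i ==> CA t r ==> CN t j ==> CN t (%s. rstep (prm_of s) (pp s) (dd s) (R s) (i s) (r s) (j s))"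
 unfolding rstep_def by (erule cm | rule cn | linarith)+

lemma [cn]: "6 <= t ==> CN t pp ==> CD t dd ==> CS t S ==> CS t R ==> CN t x ==> CN t (%s. resd (prm_of s) (pp s) (dd s) (S s) (R s) (x s))"
 unfolding resd_def by (erule cm | rule cn | linarith)+

lemma [cn]: "6 <= t ==> CN t pp ==> CD t dd ==> CS t S ==> CA t rw ==> CN t z ==> CB t (%s. zok (prm_of s) (pp s) (dd s) (S s) (rw s) (z s))"
 unfolding zok_def by (erule cm | rule cn | linarith)+

lemma [cn]: "6 <= t ==> CN t pp ==> CD t dd ==> CS t S ==> CA t rw ==> CN t (%s. zz (prm_of s) (pp s) (dd s) (S s) (rw s))"
 unfolding zz_def by (erule cm | rule cn | linarith)+

lemma [cn]: "6 <= t ==> CN t pp ==> CD t dd ==> CS t S ==> CN t x ==> CB t (%s. x s : Rp (prm_of s) (pp s) (dd s) (S s))"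
 unfolding Rp_def by (erule cm | rule cn | linarith)+

lemma [cn]: "6 <= t ==> CN t pp ==> CD t dd ==> CS t S ==> CS t R ==> CN t th ==> CN t x ==> CB t (%s. x s : ballS (prm_of s) (pp s) (dd s) (S s) (R s) (th s))"
 unfolding ballS_def by (erule cm | rule cn | linarith)+

lemma [cn]: "6 <= t ==> CS t S ==> CS t B ==> CN t (%s. cntb (prm_of s) (S s) (B s))"
 unfolding cntb_def by (erule cm | rule cn | linarith)+

lemma [cn]: "6 <= t ==> CN t pp ==> CN t (%s. wid (prm_of s) (pp s))"
 unfolding wid_def by (erule cm | rule cn | linarith)+

lemma [cn]: "6 <= t ==> CN t pp ==> CD t dd ==> CS t S ==> CN t (%s. thr (prm_of s) (pp s) (dd s) (S s))"
 unfolding thr_def by (erule cm | rule cn | linarith)+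

lemma [cn]: "6 <= t ==> CN t pp ==> CD t dd ==> CN t th ==> CN t x ==> CB t (%s. x s : ball0 (prm_of s) (pp s) (dd s) (th s))"
 unfolding ball0_def by (erule cm | rule cn | linarith)+

lemma [cn]: "6 <= t ==> CN t pp ==> CD t dd ==> CN t (%s. thr0 (prm_of s) (pp s) (dd s))"
 unfolding thr0_def by (erule cm | rule cn | linarith)+

lemma [cn]: "6 <= t ==> CS t S ==> CB t (%s. nempty (prm_of s) (S s))"
 unfolding nempty_def by (erule cm | rule cn | linarith)+

lemma [cn]: "6 <= t ==> CN t pp ==> CD t dd ==> CN t i ==> CS t S ==> CN t x ==> CB t (%s. x s : rnd (prm_of s) (pp s) (dd s) (i s) (S s))"
 unfolding rnd_def by (erule cm | rule cn | linarith)+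

lemma [cn]: "6 <= t ==> CN t pp ==> CD t dd ==> CN t x ==> CB t (%s. x s : rnds (prm_of s) (pp s) (dd s))"
 unfolding rnds_def by (erule cm | rule cn | linarith)+

lemma [cn]: "6 <= t ==> CA t lg ==> CN t o1 ==> CN t x ==> CB t (%s. x s : sol (prm_of s) (lg s) (o1 s))"
 unfolding sol_def by (erule cm | rule cn | linarith)+

lemma [cn]: "6 <= t ==> CA t lg ==> CN t o1 ==> CB t (%s. upd3 (prm_of s) (lg s) (o1 s))"
 unfolding upd3_def by (erule cm | rule cn | linarith)+

lemma [cn]: "6 <= t ==> CA t lg ==> CN t o1 ==> CB t (%s. upd (prm_of s) (lg s) (o1 s))"
 unfolding upd_def by (erule cm | rule cn | linarith)+

lemma [cn]: "6 <= t ==> CA t lg ==> CN t o1 ==> CN t (%s. sl (prm_of s) (lg s) (o1 s))"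
 unfolding sl_def by (erule cm | rule cn | linarith)+

lemma [cn]: "6 <= t ==> CA t lg ==> CN t o1 ==> CN t u ==> CN t v ==> CN t (%s. sW (prm_of s) (lg s) (o1 s) (u s) (v s))"
 unfolding sW_def by (erule cm | rule cn | linarith)+

lemma [cn]: "6 <= t ==> CA t lg ==> CN t o1 ==> CN t x ==> CB t (%s. x s : sR (prm_of s) (lg s) (o1 s))"
 unfolding sR_def by (erule cm | rule cn | linarith)+

lemma [cn]: "6 <= t ==> CA t lg ==> CN t o1 ==> CN t i ==> CN t x ==> CB t (%s. x s : ubet (prm_of s) (lg s) (o1 s) (i s))"
 unfolding ubet_def by (erule cm | rule cn | linarith)+

lemma [cn]: "6 <= t ==> CA t lg ==> CN t o1 ==> CN t i ==> CN t (%s. upos (prm_of s) (lg s) (o1 s) (i s))"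
 unfolding upos_def by (erule cm | rule cn | linarith)+

lemma [cn]: "6 <= t ==> CA t lg ==> CN t o1 ==> CN t i ==> CN t (%s. uneg (prm_of s) (lg s) (o1 s) (i s))"
 unfolding uneg_def by (erule cm | rule cn | linarith)+

lemma [cn]: "6 <= t ==> CS t g ==> CN t x ==> CN t (%s. scal (prm_of s) (g s) (x s))"
 unfolding scal_def by (erule cm | rule cn | linarith)+

lemma [cn]: "6 <= t ==> CA t lg ==> CN t o1 ==> CN t i ==> CN t f ==> CN t (%s. ucell (prm_of s) (lg s) (o1 s) (i s) (f s))"
 unfolding ucell_def by (erule cm | rule cn | linarith)+

lemma [cn]: "6 <= t ==> CN t o1 ==> CN t t1 ==> CA t lg ==> CN t j ==> CN t (%s. lgstep (prm_of s) (o1 s) (t1 s) (lg s) (j s))"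
 unfolding lgstep_def by (erule cm | rule cn | linarith)+

lemma [cn]: "6 <= t ==> CN t o1 ==> CN t x ==> CN t (%s. lgf (prm_of s) (o1 s) (x s))"
 unfolding lgf_def by (erule cm | rule cn | linarith)+

lemma [cn]: "6 <= t ==> CN t (%s. osel (prm_of s))"
 unfolding osel_def by (erule cm | rule cn | linarith)+

lemma [cn]: "6 <= t ==> CN t j ==> CN t (%s. outp (prm_of s) (j s))"
 unfolding outp_def by (erule cm | rule cn | linarith)+

section \<open>Meaning of the bounded primitives\<close>

lemma bsum_eq: "N <= pK P ==> bsum P N f = (SUM i<N. f i)"
 by (simp add: bsum_def min_absorb1)

lemma bex_eq: "N <= pK P ==> bex P N Q \<longleftrightarrow> (EX i<N. Q i)"
 by (simp add: bex_def min_absorb1)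

lemma bmul_eq: "y <= pK P ==> bmul P x y = x * y"
 by (simp add: bmul_def bsum_eq mult.commute)

lemma bleast_LEAST:
 assumes "N <= pK P" "EX i<N. Q i"
 shows "bleast P N Q = (LEAST i. Q i)"
proof -
 let ?l = "LEAST i. Q i"
 have l: "Q ?l" "?l < N" using assms(2) by (auto intro: LeastI dest: Least_le le_less_trans)
 have b: "bex P (Suc i) Q \<longleftrightarrow> ?l <= i" if "i < N" for i
 proof -
  have "bex P (Suc i) Q \<longleftrightarrow> (EX j<Suc i. Q j)" using that assms(1) by (intro bex_eq) simp
  also have "... \<longleftrightarrow> ?l <= i" using l(1) by (auto simp: less_Suc_eq_le intro: Least_le order_trans)
  finally show ?thesis .
 qed
 have "bleast P N Q = (SUM i<N. if ?l <= i then 0 else 1)"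
  unfolding bleast_def bsum_eq[OF assms(1)] using b by (intro sum.cong) auto
 also have "... = (SUM i:{..<?l}. 1)"
  using l(2) by (intro sum.mono_neutral_cong_right) auto
 finally show ?thesis by simp
qed

lemma bleast:
 assumes "N <= pK P" "EX i<N. Q i"
 shows "Q (bleast P N Q)" "bleast P N Q < N"
 unfolding bleast_LEAST[OF assms] using assms(2) by (auto intro: LeastI dest: Least_le le_less_trans)

lemma bitr_0: "j < pK P ==> bitr P f A 0 j = A j"
 by (simp add: bitr_def)

lemma bitr_Suc: "Suc m <= pK P ==> j < pK P ==> bitr P f A (Suc m) j = f m (bitr P f A m) j"
 by (simp add: bitr_def min_absorb1)

lemma bshl_eq: "m <= pK P ==> 0 < pK P ==> bshl P x m = x * 2 ^ m"
 unfolding bshl_def by (induction m) (simp_all add: bitr_0 bitr_Suc)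

lemma bshr_eq: "m <= pK P ==> 0 < pK P ==> bshr P x m = x div 2 ^ m"
 unfolding bshr_def
 by (induction m) (simp_all add: bitr_0 bitr_Suc div_mult2_eq[symmetric] mult.commute)

lemma bbit_eq: "l <= pK P ==> 0 < pK P ==> bbit P z l \<longleftrightarrow> odd (z div 2 ^ l)"
proof -
 have "(x = x div 2 + x div 2) = even x" for x :: nat by presburger
 thus "l <= pK P ==> 0 < pK P ==> bbit P z l \<longleftrightarrow> odd (z div 2 ^ l)"
  unfolding bbit_def by (simp add: bshr_eq)
qed

lemma bdiv_eq:
 assumes "x <= pK P" "y > 0"
 shows "bdiv P x y = x div y"
proof -
 have "bdiv P x y = (SUM i<x. if y * Suc i <= x then 1 else 0)"
  unfolding bdiv_def bsum_eq[OF assms(1)] using assms(1) by (intro sum.cong) (auto simp: bmul_eq)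
 also have "... = (SUM i:{..<x div y}. 1)"
 proof (rule sum.mono_neutral_cong_right)
  have iff: "y * Suc i <= x \<longleftrightarrow> i < x div y" for i
   using assms(2) by (simp add: less_eq_div_iff_mult_less_eq Suc_le_eq[symmetric] mult.commute)
  show "{..<x div y} <= {..<x}" by (meson div_le_dividend lessThan_subset_iff)
  show "ALL i:{..<x} - {..<x div y}. (if y * Suc i <= x then 1 else 0) = 0" using iff by auto
  show "!!i. i : {..<x div y} ==> (if y * Suc i <= x then 1 else 0) = 1" using iff by auto
 qed auto
 finally show ?thesis by simp
qed

lemma bmod_eq: "x <= pK P ==> y > 0 ==> bmod P x y = x mod y"
proof -
 assume a: "x <= pK P" "y > 0"
 hence "x div y <= pK P" by (meson div_le_dividend order_trans)
 thus ?thesis using a by (simp add: bmod_def bdiv_eq bmul_eq minus_mult_div_eq_mod)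
qed

text \<open>The magnitudes, with H = 2^25: the weights W are at most 2^(H L); an assignment has mass 0 or
2^m U with U = 2^((2H + 20) L), and 2^((2H + 10) L) is the slack added to U; the perceptron makes at most 2^((4H + 50) L)
updates; K = 2^((5H + 100) L) exceeds everything used as an address or as a loop bound.\<close>

locale alg =
 fixes P :: prm
 assumes K: "pK P = 2 ^ (167772260 * pL P)"
  and n1: "1 <= pn P" and N2: "nn P + 2 <= 2 ^ pL P"
  and L64: "64 <= pL P" and qL: "3 * pq P + 3 <= pL P"
  and k1: "1 <= pk P" and kL: "pk P <= 2 ^ pL P"
  and bL: "pb P * pq P <= pL P" and bk: "pb P <= (pk P)^2" and qb: "32 * nn P < pq P * 2 ^ pb P"
  and adj_sym: "!!u v. u < nn P ==> v < nn P ==> adjb P (ng P v) (ng P u) = adjb P u v"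
begin

abbreviation "N \<equiv> nn P"
abbreviation "L \<equiv> pL P"
abbreviation ng where "ng \<equiv> Submission.ng P"
abbreviation mm where "mm \<equiv> Submission.mm P"
abbreviation rm where "rm \<equiv> Submission.rm P"
abbreviation DD where "DD \<equiv> Submission.DD P"
abbreviation clen where "clen \<equiv> Submission.clen P"
abbreviation ddm where "ddm \<equiv> Submission.ddm P"
abbreviation slots where "slots \<equiv> Submission.slots P"
abbreviation mass where "mass \<equiv> Submission.mass P"
abbreviation cns where "cns \<equiv> Submission.cns P"
abbreviation wt where "wt \<equiv> Submission.wt P"
abbreviation ecnt where "ecnt \<equiv> Submission.ecnt P"
abbreviation ebt where "ebt \<equiv> Submission.ebt P"
abbreviation adjb where "adjb \<equiv> Submission.adjb P"
abbreviation str where "str \<equiv> Submission.str P"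
abbreviation wtot where "wtot \<equiv> Submission.wtot P"
abbreviation ell where "ell \<equiv> Submission.ell P"
abbreviation volr where "volr \<equiv> Submission.volr P"
abbreviation conf where "conf \<equiv> Submission.conf P"
abbreviation tcap where "tcap \<equiv> Submission.tcap P"
abbreviation ubet where "ubet \<equiv> Submission.ubet P"
abbreviation row where "row \<equiv> Submission.row P"

lemma Kle: "x <= 2 ^ e ==> e <= 167772260 * L ==> x <= pK P"
 unfolding K by (meson order_trans power_increasing one_le_numeral)

lemma K0 [simp]: "0 < pK P"
 by (simp add: K)

lemma L_le [simp]: "L <= 2 ^ L"
 using less_exp[of L] by simp

lemma smallK: "x <= 2 ^ L ==> x <= pK P"
 by (rule Kle) auto

lemma NK [simp]: "N <= pK P" "Suc N <= pK P" "N <= 2 ^ L"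
 using N2 smallK by auto

lemma numK: "x <= 64 ==> x <= pK P"
 using L64 L_le by (intro smallK) linarith

lemma N_pos: "2 <= N" using n1 by (simp add: nn_def)

lemma sumN [simp]: "bsum P N f = (SUM i<N. f i)"
 by (simp add: bsum_eq)

lemma exN [simp]: "bex P N Q \<longleftrightarrow> (EX i<N. Q i)"
 by (simp add: bex_eq)

lemma NNK: "N * N <= 2 ^ (2 * L)" "N * N <= pK P" "Suc (N * N) <= pK P"
proof -
 have "N * N <= 2 ^ L * 2 ^ L" by (intro mult_mono) auto
 thus 1: "N * N <= 2 ^ (2 * L)" by (simp add: power_add[symmetric] mult_2)
 thus "N * N <= pK P" by (rule Kle) simp
 have "Suc (N * N) <= 2 * 2 ^ (2 * L)" using 1 one_le_power[of "2::nat" "2*L"] by linarith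
 hence "Suc (N * N) <= 2 ^ Suc (2 * L)" by simp
 thus "Suc (N * N) <= pK P" by (rule Kle) (use L64 in simp)
qed

lemma mulN [simp]: "bmul P x N = x * N" by (simp add: bmul_eq)

lemma shl_num: "m <= 64 ==> bshl P x m = x * 2 ^ m"
 using numK by (simp add: bshl_eq)

lemma shl_65: "bshl P x 65 = x * 2 ^ 65"
proof -
 have "65 <= (2::nat) ^ 64" by simp
 also have "... <= 2 ^ L" using L64 by (rule power_increasing) simp
 finally show ?thesis by (intro bshl_eq smallK) auto
qed

lemma ng_lt [simp]: "u < N ==> ng u < N"
 by (auto simp: ng_def)

lemma ng_ng [simp]: "u < N ==> ng (ng u) = u"
 by (auto simp: ng_def)

lemma ng_neq: "u < N ==> ng u ~= u"
 unfolding ng_def nn_def by presburger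

lemma ng_inj: "u < N ==> v < N ==> ng u = ng v \<longleftrightarrow> u = v"
 by (metis ng_ng)

lemma sum_ng: "(SUM u<N. f (ng u)) = (SUM u<N. f u)"
 by (rule sum.reindex_bij_witness[of _ "ng" "ng"]) auto

lemma divN: "i < N * N ==> bdiv P i N = i div N" "i < N * N ==> bmod P i N = i mod N"
 using NNK N_pos by (auto intro!: bdiv_eq bmod_eq)

lemma DDv: "DD = 8388608 * L"
proof -
 have "(8388608::nat) <= 2 ^ 64" by simp
 also have "... <= 2 ^ L" using L64 by (rule power_increasing) simp
 finally show ?thesis unfolding DD_def by (simp add: bmul_eq smallK)
qed

lemma DK: "DD <= 2 ^ (2 * L)" "DD <= pK P" "0 < DD"
proof -
 have "(8388608::nat) <= 2 ^ 64" by simp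
 also have "... <= 2 ^ L" using L64 by (rule power_increasing) simp
 finally have "8388608 * L <= 2 ^ L * 2 ^ L" by (intro mult_mono) auto
 thus 1: "DD <= 2 ^ (2 * L)" by (simp add: DDv power_add[symmetric] mult_2)
 thus "DD <= pK P" by (rule Kle) simp
 show "0 < DD" using L64 by (simp add: DDv)
qed

lemma ixv [simp]: "l <= DD ==> ix P l v = N * l + v"
 using DK by (simp add: ix_def bmul_eq)

lemma ixK: "l < DD ==> v < N ==> N * l + v < pK P"
proof -
 assume "l < DD" "v < N"
 hence "N * l + v < N * Suc l" by simp
 also have "... <= 2 ^ L * 2 ^ (2 * L)" using \<open>l < DD\<close> DK(1) by (intro mult_mono) auto
 also have "... <= pK P" by (rule Kle[OF eq_refl, of _ "3 * L"]) (auto simp: power_add[symmetric])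
 finally show ?thesis .
qed

end

section \<open>Embedding by sparse cuts\<close>

text \<open>What the rounding knows of a leaf: its mass \<open>pp\<close>, and
  \<open>dd u v\<close>, the mass on which \<open>u\<close> holds and \<open>v\<close> fails. By
  \<open>bal\<close> the asymmetry of \<open>dd\<close> is a difference of potentials, namely of the
  masses \<open>dd u (ng u)\<close>.\<close>

locale rounding = alg +
 fixes pp :: nat and dd :: "nat => nat => nat"
 assumes ddpp: "!!u v. u < nn P ==> v < nn P ==> dd u v <= pp"
  and ppcap: "pp <= 2 ^ (67108890 * pL P)" and pplow: "2 ^ (4 * pL P) <= pp"
  and dd0: "!!u. u < nn P ==> dd u u = 0"
  and tri: "!!u v w. u < nn P ==> v < nn P ==> w < nn P ==> dd u w <= dd u v + dd v w"
  and dsym: "!!u v. u < nn P ==> v < nn P ==> dd (ng v) (ng u) = dd u v"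
  and tot: "!!u. u < nn P ==> dd u (ng u) + dd (ng u) u = pp"
  and bal: "!!u v. u < nn P ==> v < nn P ==> dd u v + dd v (ng v) = dd v u + dd u (ng u)"
begin

lemma ppK [simp]: "pp <= pK P"
 by (rule Kle[OF ppcap]) simp

lemma rm_iff: "u : rm S \<longleftrightarrow> u < N & u ~: S & ng u ~: S"
 by (simp add: rm_def)

lemma rm_ng: "u : rm S ==> ng u : rm S"
 by (simp add: rm_def)

lemma rm_fin [simp]: "finite (rm S)"
 by (rule finite_subset[of _ "{..<N}"]) (auto simp: rm_def)

lemma wt_eq: "wt dd S u = (if u : rm S then 1 + (SUM v<N. if v : rm S then (if adjb u v then dd u v else 0) + (if adjb v u then dd v u else 0) else 0) else 0)"
 by (simp add: wt_def)

lemma wt_ng: "u < N ==> wt dd S (ng u) = wt dd S u"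
proof -
 assume u: "u < N"
 have "(SUM v<N. if v : rm S then (if adjb (ng u) v then dd (ng u) v else 0) + (if adjb v (ng u) then dd v (ng u) else 0) else 0)
   = (SUM v<N. if v : rm S then (if adjb u v then dd u v else 0) + (if adjb v u then dd v u else 0) else 0)"
  (is "(SUM v<N. ?f v) = (SUM v<N. ?g v)")
 proof -
  have "(SUM v<N. ?f v) = (SUM v<N. ?f (ng v))" by (rule sum_ng[symmetric])
  also have "... = (SUM v<N. ?g v)"
  proof (rule sum.cong)
   fix v assume "v : {..<N}"
   hence v: "v < N" by simp
   have "ng v : rm S \<longleftrightarrow> v : rm S" using v rm_ng by (metis ng_ng)
   thus "?f (ng v) = ?g v" using adj_sym[of u v] adj_sym[of v u] dsym[of u v] dsym[of v u] u v by (simp add: add.commute)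
  qed simp
  finally show ?thesis .
 qed
 moreover have "ng u : rm S \<longleftrightarrow> u : rm S" using u rm_ng by (metis ng_ng)
 ultimately show ?thesis by (simp add: wt_eq)
qed

lemma wt_le: "u < N ==> wt dd S u <= 1 + N * (2 * pp)"
proof -
 assume u: "u < N"
 have "(SUM v<N. if v : rm S then (if adjb u v then dd u v else 0) + (if adjb v u then dd v u else 0) else 0) <= (SUM v<N. 2 * pp)"
 proof (rule sum_mono)
  fix v assume "v : {..<N}"
  thus "(if v : rm S then (if adjb u v then dd u v else 0) + (if adjb v u then dd v u else 0) else 0) <= 2 * pp"
   using ddpp[of u v] ddpp[of v u] u by auto
 qed
 thus ?thesis by (simp add: wt_eq)
qed

lemma wtot_eq: "wtot dd S = (SUM u<N. wt dd S u)"
 by (simp add: wtot_def)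

lemma wtot_le: "wtot dd S <= 2 ^ (67108894 * L)"
proof -
 have "wtot dd S <= (SUM u<N. 1 + N * (2 * pp))" unfolding wtot_eq by (rule sum_mono) (use wt_le in simp)
 also have "... = N * (1 + N * (2 * pp))" by simp
 also have "... <= 2 ^ L * (2 ^ L * 2 ^ L * (2 * pp))"
 proof (intro mult_mono)
  have "1 <= 2 * pp" using pplow one_le_power[of "2::nat" "4 * L"] by linarith
  hence "1 + N * (2 * pp) <= 2 * pp + N * (2 * pp)" by simp
  also have "... = Suc N * (2 * pp)" by simp
  also have "... <= 2 ^ L * 2 ^ L * (2 * pp)"
  proof (intro mult_right_mono)
   have "Suc N <= 2 ^ L" using N2 by simp
   also have "... <= 2 ^ L * 2 ^ L" by simp
   finally show "Suc N <= 2 ^ L * 2 ^ L" .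
  qed simp
  finally show "1 + N * (2 * pp) <= 2 ^ L * 2 ^ L * (2 * pp)" .
 qed auto
 also have "... <= 2 ^ L * (2 ^ L * 2 ^ L * (2 ^ L * 2 ^ (67108890 * L)))"
  using ppcap L64 power_increasing[of 1 L "2::nat"] by (intro mult_mono) auto
 also have "... = 2 ^ (67108894 * L)" by (simp add: power_add[symmetric])
 finally show ?thesis .
qed

lemma wtotK: "wtot dd S <= pK P"
 by (rule Kle[OF wtot_le]) simp

lemma wt_le_wtot: "u < N ==> wt dd S u <= wtot dd S"
 unfolding wtot_eq by (rule member_le_sum) auto

end

text \<open>The cost of a pair in an unfinished row. A pair with exactly one covered end is charged
  the maximum 4 at once, so covering the other end later never raises its cost.\<close>

definition ellp :: "prm => nat => nat => nat" where
 "ellp P x y = (if x = 0 & y = 0 then 0 else if x = 0 | y = 0 then 4 else ell P x y)"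

locale rowloc = rounding +
 fixes S :: "nat set" and W :: "nat => nat => nat"
 assumes Wsym: "!!u v. W u v = W v u"
  and Wng: "!!u v. u < nn P ==> v < nn P ==> W (ng u) (ng v) = W u v"
  and Wrm: "!!u v. W u v ~= 0 ==> u : rm S"
  and Wle: "!!u v. W u v <= 2 ^ (33554432 * pL P)"
  and Wdiag: "!!u. u : rm S ==> 1 <= W u u"
  and rm_ne: "rm S ~= {}"
begin

abbreviation "wT \<equiv> wtot dd S"
abbreviation "WT \<equiv> Wsum P W"
abbreviation "wv \<equiv> wt dd S"
abbreviation "Eg \<equiv> edg P dd S W"
abbreviation "wL \<equiv> wtl P dd S W"
abbreviation "lm \<equiv> lamb P dd S W"

lemma WT_eq: "WT = (SUM u<N. SUM v<N. W u v)"
 by (simp add: Wsum_def)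

lemma WT_le: "WT <= 2 ^ (33554434 * L)"
proof -
 have "WT <= (SUM u<N. SUM v<N. 2 ^ (33554432 * L))" unfolding WT_eq by (intro sum_mono Wle)
 also have "... = N * N * 2 ^ (33554432 * L)" by simp
 also have "... <= 2 ^ (2 * L) * 2 ^ (33554432 * L)" using NNK by (intro mult_right_mono) auto
 also have "... = 2 ^ (33554434 * L)" by (simp add: power_add[symmetric])
 finally show ?thesis .
qed

lemma WTK: "WT <= pK P" by (rule Kle[OF WT_le]) simp

lemma Eg_eq: "Eg u v = W u v * wT"
 by (simp add: edg_def bmul_eq wtotK)

lemma wL_eq: "u < N ==> wL u = wv u * WT + (SUM v<N. W u v) * wT"
 by (simp add: wtl_def bmul_eq wtotK WTK)

lemma lm_eq: "lm = 2 * (wT * WT)"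
 by (simp add: lamb_def bmul_eq WTK)

lemma lm_le: "lm <= 2 ^ (100663330 * L)"
proof -
 have "lm <= 2 * (2 ^ (67108894 * L) * 2 ^ (33554434 * L))" unfolding lm_eq using wtot_le WT_le by (intro mult_mono) auto
 also have "... <= 2 ^ L * (2 ^ (67108894 * L) * 2 ^ (33554434 * L))"
  using L64 power_increasing[of 1 L "2::nat"] by (intro mult_right_mono) auto
 also have "... = 2 ^ (100663329 * L)" by (simp add: power_add[symmetric])
 also have "... <= 2 ^ (100663330 * L)" by (rule power_increasing) auto
 finally show ?thesis .
qed

lemma lmK: "x <= lm ==> x <= pK P"
 by (rule Kle[OF order_trans[OF _ lm_le]]) auto

lemma row_le: "(SUM v<N. W u v) <= WT" if "u < N"
 unfolding WT_eq using that by (intro member_le_sum[of u "{..<N}" "%u. SUM v<N. W u v"]) auto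

lemma W_le_row: "v < N ==> W u v <= (SUM v<N. W u v)"
 by (rule member_le_sum) auto

lemma wT_pos: "0 < wT" and WT_pos: "0 < WT"
proof -
 obtain u where u: "u : rm S" using rm_ne by blast
 hence uN: "u < N" by (simp add: rm_iff)
 have "1 <= wv u" using u by (simp add: wt_eq)
 thus "0 < wT" using wt_le_wtot[OF uN, of S] by linarith
 have "1 <= W u u" using Wdiag u by blast
 also have "... <= WT" using W_le_row[OF uN, of u] row_le[OF uN] by linarith
 finally show "0 < WT" by simp
qed

lemma wL_le: "u < N ==> wL u <= lm"
proof -
 assume u: "u < N"
 have "wv u * WT <= wT * WT" using wt_le_wtot[OF u] by (intro mult_right_mono) auto
 moreover have "(SUM v<N. W u v) * wT <= WT * wT" using row_le[OF u] by (intro mult_right_mono) auto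
 ultimately show ?thesis using wL_eq[OF u] lm_eq mult.commute[of WT wT] by linarith
qed

lemma Eg_le: "u < N ==> v < N ==> Eg u v <= lm"
proof -
 assume "u < N" "v < N"
 hence "W u v <= WT" using W_le_row[of v u] row_le[of u] by linarith
 hence "W u v * wT <= WT * wT" by (intro mult_right_mono) auto
 thus ?thesis using Eg_eq[of u v] lm_eq mult.commute[of WT wT] by linarith
qed

lemma sum_wL: "(SUM u<N. wL u) = 2 * (wT * WT)"
proof -
 have "(SUM u<N. wL u) = (SUM u<N. wv u * WT + (SUM v<N. W u v) * wT)" by (intro sum.cong) (auto simp: wL_eq)
 also have "... = (SUM u<N. wv u) * WT + (SUM u<N. SUM v<N. W u v) * wT" by (simp add: sum.distrib sum_distrib_right)
 finally show ?thesis by (simp add: wtot_eq WT_eq mult.commute)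
qed

lemma Twv: "Tw P = N * N * 2 ^ 62 + 1"
 by (simp add: Tw_def shl_num)

lemma TwK: "Tw P <= pK P"
proof (rule Kle)
 have "N * N * 2 ^ 62 + 1 <= 2 * (N * N * 2 ^ 62)" using N_pos by simp
 also have "... <= 2 * (2 ^ (2 * L) * 2 ^ 62)" using NNK(1) by simp
 also have "... <= 2 ^ (2 * L) * 2 ^ 64" by simp
 also have "... <= 2 ^ (2 * L) * 2 ^ L" using L64 by (intro mult_left_mono power_increasing) auto
 also have "... = 2 ^ (3 * L)" by (simp add: power_add[symmetric])
 finally show "Tw P <= 2 ^ (3 * L)" by (simp add: Twv)
qed simp

section \<open>One coordinate of the embedding\<close>

definition brow :: "nat => nat => nat" where
 "brow i = bitr P (%i b j. rowstep P dd S W b j) (%j. 0) i"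

definition swap :: "nat => nat" where
 "swap x = (if x = 1 then 2 else if x = 2 then 1 else x)"

text \<open>The loss so far is paid for by the measure covered so far, as each sparse cut has
  boundary at most \<open>2^(-28)\<close> of the measure it covers.\<close>

definition rinv :: "(nat => nat) => bool" where
 "rinv b \<longleftrightarrow> (ALL v<N. b v <= 2 & (b v ~= 0 --> v : rm S) & b (ng v) = swap (b v)) &
   2 ^ 28 * (SUM u<N. SUM v<N. Eg u v * ellp P (b u) (b v)) <= 4 * (SUM v<N. if b v ~= 0 then wL v else 0)"

lemma unc_ng: "rinv b ==> v : unc P S b ==> ng v : unc P S b"
 by (auto simp: rinv_def unc_def rm_ng rm_iff swap_def)

lemma fd_good:
 assumes "fd P U E wl lam"
 shows "good P U E wl (fA P U E wl lam)"
proof -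
 have "EX i<N. fd1 P U E wl lam i" using assms by (simp add: fd_def)
 hence 1: "fd1 P U E wl lam (fi P U E wl lam)" unfolding fi_def by (rule bleast(1)[OF NK(1)])
 hence "EX t<Tw P. fd2 P U E wl lam (fi P U E wl lam) t" unfolding fd1_def bex_eq[OF TwK] by blast
 hence 2: "fd2 P U E wl lam (fi P U E wl lam) (ft P U E wl lam)" unfolding ft_def by (rule bleast(1)[OF TwK])
 hence "EX m<N. fd3 P U E wl lam (fi P U E wl lam) (ft P U E wl lam) m" by (simp add: fd2_def)
 hence "fd3 P U E wl lam (fi P U E wl lam) (ft P U E wl lam) (fm P U E wl lam)" unfolding fm_def by (rule bleast(1)[OF NK(1)])
 thus ?thesis by (simp add: fd3_def fA_def)
qed

lemma fA_sub: "fA P U E wl lam <= U"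
 by (auto simp: fA_def swp_def)

lemma fA_disj: "v < N ==> v : fA P U E wl lam ==> ng v ~: fA P U E wl lam"
 by (auto simp: fA_def swp_def xx_def)

text \<open>Pairs with a covered end are already charged in full. Only pairs inside the uncovered
  set add cost, at most four times the boundary of the new cut.\<close>

lemma rinv_step:
 assumes b: "rinv b" and f: "rfd P dd S W b"
  and b': "!!v. v < N ==> b' v = (if v : rfA P dd S W b then 1 else if ng v : rfA P dd S W b then 2 else b v)"
 shows "rinv b'" "{v. v < N & b v ~= 0} \<subset> {v. v < N & b' v ~= 0}"
proof -
 define A where "A = rfA P dd S W b"
 define U where "U = unc P S b"
 have g: "good P U Eg wL A" unfolding A_def U_def rfA_def using f unfolding rfd_def by (rule fd_good)
 have AU: "A <= U" unfolding A_def U_def rfA_def by (rule fA_sub)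
 have UN: "v < N & v : rm S & b v = 0" if "v : U" for v using that by (auto simp: U_def unc_def rm_iff)
 have Ung: "ng v : U" if "v : U" for v using unc_ng[OF b] that by (simp add: U_def)
 have Adisj: "ng v ~: A" if "v : A" for v
  using fA_disj[of v _ Eg wL lm] UN[of v] AU that unfolding A_def rfA_def by auto
 have bv: "b v <= 2" "b v ~= 0 ==> v : rm S" "b (ng v) = swap (b v)" if "v < N" for v
  using b that by (auto simp: rinv_def)
 have b'v: "b' v = (if v : A then 1 else if ng v : A then 2 else b v)" if "v < N" for v
  using b'[OF that] by (simp add: A_def)
 have notU: "v ~: A" "ng v ~: A" if "v < N" "b v ~= 0" for v
 proof -
  show "v ~: A" using AU UN[of v] that(2) by auto
  show "ng v ~: A" using AU Ung[of "ng v"] UN[of v] that ng_ng[OF that(1)] by auto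
 qed
 have pt: "Eg u v * ellp P (b' u) (b' v) <= Eg u v * ellp P (b u) (b v) + 4 * (if u : U & v : U then bmul P (Eg u v) (el1 P (bc P A u) (bc P A v)) else 0)"
  if u: "u < N" and v: "v < N" for u v
 proof (cases "W u v = 0")
  case True
  thus ?thesis by (simp add: Eg_eq)
 next
  case False
  hence R: "u : rm S" "v : rm S" using Wrm Wsym by metis+
  have el: "el1 P x y <= pK P" for x y using numK[of 2] by (auto simp: el1_def numK)
  have "ellp P (b' u) (b' v) <= ellp P (b u) (b v) + 4 * (if u : U & v : U then el1 P (bc P A u) (bc P A v) else 0)"
  proof (cases "u : U & v : U")
   case True
   hence "b' u = bc P A u" "b' v = bc P A v" using b'v u v UN by (auto simp: bc_def)
   thus ?thesis using True by (auto simp: ellp_def ell_def el1_def bc_def)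
  next
   case False
   hence "b u ~= 0 | b v ~= 0" using R by (auto simp: U_def unc_def)
   thus ?thesis
   proof
    assume "b u ~= 0"
    hence "b' u = b u" using notU[OF u] b'v[OF u] by simp
    thus ?thesis using \<open>b u ~= 0\<close> notU[OF v] b'v[OF v] by (cases "b v = 0") (auto simp: ellp_def ell_def)
   next
    assume "b v ~= 0"
    hence "b' v = b v" using notU[OF v] b'v[OF v] by simp
    thus ?thesis using \<open>b v ~= 0\<close> notU[OF u] b'v[OF u] by (cases "b u = 0") (auto simp: ellp_def ell_def)
   qed
  qed
  hence "Eg u v * ellp P (b' u) (b' v) <= Eg u v * (ellp P (b u) (b v) + 4 * (if u : U & v : U then el1 P (bc P A u) (bc P A v) else 0))"
   by (rule mult_left_mono) simp
  thus ?thesis by (auto simp: bmul_eq el algebra_simps)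
 qed
 have "(SUM u<N. SUM v<N. Eg u v * ellp P (b' u) (b' v)) <= (SUM u<N. SUM v<N. Eg u v * ellp P (b u) (b v) + 4 * (if u : U & v : U then bmul P (Eg u v) (el1 P (bc P A u) (bc P A v)) else 0))"
  using pt by (intro sum_mono) auto
 also have "... = (SUM u<N. SUM v<N. Eg u v * ellp P (b u) (b v)) + 4 * bnd P U Eg A"
  by (simp add: bnd_def sum.distrib sum_distrib_left)
 finally have "2 ^ 28 * (SUM u<N. SUM v<N. Eg u v * ellp P (b' u) (b' v)) <= 2 ^ 28 * (SUM u<N. SUM v<N. Eg u v * ellp P (b u) (b v)) + 4 * (bnd P U Eg A * 2 ^ 28)"
  by simp
 also have "... <= 4 * (SUM v<N. if b v ~= 0 then wL v else 0) + 4 * meas P wL A"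
  using g b by (intro add_mono mult_left_mono) (auto simp: good_def shl_num rinv_def)
 also have "... = 4 * (SUM v<N. if b' v ~= 0 then wL v else 0)"
 proof -
  have "(SUM v<N. if b v ~= 0 then wL v else 0) + meas P wL A = (SUM v<N. if b' v ~= 0 then wL v else 0)"
   unfolding meas_def sumN sum.distrib[symmetric]
  proof (rule sum.cong)
   fix v assume "v : {..<N}"
   hence v: "v < N" by simp
   show "(if b v ~= 0 then wL v else 0) + (if v : A | ng v : A then wL v else 0) = (if b' v ~= 0 then wL v else 0)"
    using notU[OF v] b'v[OF v] by auto
  qed simp
  thus ?thesis by simp
 qed
 finally have pot: "2 ^ 28 * (SUM u<N. SUM v<N. Eg u v * ellp P (b' u) (b' v)) <= 4 * (SUM v<N. if b' v ~= 0 then wL v else 0)" .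
 have "b' v <= 2 & (b' v ~= 0 --> v : rm S) & b' (ng v) = swap (b' v)" if v: "v < N" for v
 proof (intro conjI impI)
  show "b' v <= 2" using b'v[OF v] bv(1)[OF v] by simp
  show "v : rm S" if "b' v ~= 0"
  proof (cases "b v = 0")
   case True
   hence "v : A | ng v : A" using that b'v[OF v] by metis
   hence "v : U" using AU Ung[of "ng v"] ng_ng[OF v] by auto
   thus ?thesis using UN by simp
  qed (rule bv(2)[OF v])
  show "b' (ng v) = swap (b' v)"
  proof -
   have n: "b' (ng v) = (if ng v : A then 1 else if v : A then 2 else b (ng v))"
    using b'v[OF ng_lt[OF v]] ng_ng[OF v] by simp
   consider "v : A" | "ng v : A" | "v ~: A" "ng v ~: A" by blast
   thus ?thesis
   proof cases
    case 1
    thus ?thesis using n b'v[OF v] Adisj[OF 1] by (simp add: swap_def)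
   next
    case 2
    thus ?thesis using n b'v[OF v] Adisj[OF 2] ng_ng[OF v] by (simp add: swap_def)
   next
    case 3
    thus ?thesis using n b'v[OF v] bv(3)[OF v] by simp
   qed
  qed
 qed
 thus "rinv b'" using pot by (simp add: rinv_def)
 obtain a where a: "a : A" using g by (auto simp: good_def)
 hence "a : U" using AU by blast
 hence a': "a < N" "b a = 0" "b' a ~= 0" using UN[of a] b'v[of a] a by simp_all
 have mono: "b' v ~= 0" if "v < N" "b v ~= 0" for v using that(2) b'v[OF that(1)] by simp
 show "{v. v < N & b v ~= 0} \<subset> {v. v < N & b' v ~= 0}"
 proof (rule psubsetI)
  show "{v. v < N & b v ~= 0} <= {v. v < N & b' v ~= 0}" using mono by (intro Collect_mono impI conjI) (elim conjE, simp)+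
  have "a : {v. v < N & b' v ~= 0}" "a ~: {v. v < N & b v ~= 0}" using a' by simp_all
  thus "{v. v < N & b v ~= 0} ~= {v. v < N & b' v ~= 0}" by metis
 qed
qed

lemma brow_Suc: "i < N ==> v < N ==> brow (Suc i) v = rowstep P dd S W (brow i) v"
 unfolding brow_def by (rule bitr_Suc) (use NK in linarith)+

text \<open>Every effective step covers a new literal, so after \<open>N\<close> steps the row is
  finished or lacks a sparse cut.\<close>

lemma rinv_brow: "i <= N ==> rinv (brow i) & (rdone P dd S (brow i) | ~ rfd P dd S W (brow i) | i <= card {v. v < N & brow i v ~= 0})"
proof (induction i)
 case 0
 have "brow 0 v = 0" if "v < N" for v unfolding brow_def using that NK(1) by (intro bitr_0) linarith
 thus ?case by (simp add: rinv_def ellp_def swap_def)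
next
 case (Suc i)
 hence i: "i < N" and IH: "rinv (brow i)" "rdone P dd S (brow i) | ~ rfd P dd S W (brow i) | i <= card {v. v < N & brow i v ~= 0}" by auto
 show ?case
 proof (cases "rdone P dd S (brow i) | ~ rfd P dd S W (brow i)")
  case True
  have eq: "brow (Suc i) v = brow i v" for v
  proof (cases "v < pK P")
   case True
   hence "brow (Suc i) v = rowstep P dd S W (brow i) v"
    unfolding brow_def using i NK by (intro bitr_Suc) linarith
   thus ?thesis using \<open>rdone P dd S (brow i) | ~ rfd P dd S W (brow i)\<close> by (simp add: rowstep_def)
  qed (simp add: brow_def bitr_def itr_support)
  hence "brow (Suc i) = brow i" by blast
  thus ?thesis using True IH(1) by metis
 next
  case False
  hence st: "brow (Suc i) v = (if v : rfA P dd S W (brow i) then 1 else if ng v : rfA P dd S W (brow i) then 2 else brow i v)" if "v < N" for v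
   using brow_Suc[OF i that] by (simp add: rowstep_def)
  note r = rinv_step[OF IH(1) _ st]
  have "card {v. v < N & brow i v ~= 0} < card {v. v < N & brow (Suc i) v ~= 0}"
   using r(2) False by (intro psubset_card_mono) auto
  thus ?thesis using r(1) False IH(2) by auto
 qed
qed

lemma row_brow: "row dd S W = brow N"
 by (simp add: row_def brow_def)

lemma row_final:
 shows rinv_row: "rinv (row dd S W)" and "rdone P dd S (row dd S W) | ~ rfd P dd S W (row dd S W)"
proof -
 show "rinv (row dd S W)" using rinv_brow[of N] by (simp add: row_brow)
 have "rdone P dd S (brow N)" if "N <= card {v. v < N & brow N v ~= 0}"
 proof -
  have "{v. v < N & brow N v ~= 0} = {..<N}"
   using that by (intro card_seteq) auto
  hence nz: "brow N v ~= 0" if "v < N" for v using that by blast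
  have "cov P dd S (brow N) = wT" unfolding cov_def wtot_eq sumN
  proof (rule sum.cong)
   fix x assume "x : {..<N}"
   thus "(if brow N x = 0 then 0 else wv x) = wv x" using nz[of x] by simp
  qed simp
  thus ?thesis by (simp add: rdone_def)
 qed
 thus "rdone P dd S (row dd S W) | ~ rfd P dd S W (row dd S W)"
  using rinv_brow[of N] by (auto simp: row_brow)
qed

text \<open>The budget is four times the total measure \<open>2 * wT * WT\<close>; cancelling
  \<open>wT\<close> and this factor 8 turns \<open>2^28\<close> into \<open>2^25\<close>.\<close>

lemma row_loss: "2 ^ 25 * (SUM u<N. SUM v<N. W u v * ell (row dd S W u) (row dd S W v)) <= WT"
proof -
 let ?b = "row dd S W"
 have "2 ^ 28 * (SUM u<N. SUM v<N. Eg u v * ell (?b u) (?b v)) <= 2 ^ 28 * (SUM u<N. SUM v<N. Eg u v * ellp P (?b u) (?b v))"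
  by (intro mult_left_mono sum_mono) (auto simp: ellp_def ell_def)
 also have "... <= 4 * (SUM v<N. if ?b v ~= 0 then wL v else 0)" using rinv_row by (simp add: rinv_def)
 also have "... <= 4 * (SUM v<N. wL v)" by (intro mult_left_mono sum_mono) auto
 finally have 1: "2 ^ 28 * (SUM u<N. SUM v<N. Eg u v * ell (?b u) (?b v)) <= 8 * (wT * WT)" by (simp add: sum_wL)
 define X where "X = (SUM u<N. SUM v<N. W u v * ell (?b u) (?b v))"
 have "(SUM u<N. SUM v<N. Eg u v * ell (?b u) (?b v)) = X * wT"
  unfolding X_def sum_distrib_right by (intro sum.cong refl) (simp add: Eg_eq)
 hence "8 * ((2 ^ 25 * X) * wT) <= 8 * (WT * wT)" using 1 by (simp add: mult_ac)
 thus ?thesis using wT_pos unfolding X_def by simp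
qed

end

lemma ex_bits: "EX z<(2::nat) ^ D. ALL l<D. odd (z div 2 ^ l) \<longleftrightarrow> l : A" for D :: nat
proof (induction D arbitrary: A)
 case (Suc D)
 obtain z :: nat where z: "z < 2 ^ D" "ALL l<D. odd (z div 2 ^ l) \<longleftrightarrow> Suc l : A"
  using Suc[of "{l. Suc l : A}"] by auto
 define y where "y = 2 * z + (if 0 : A then 1 else 0)"
 have "odd (y div 2 ^ l) \<longleftrightarrow> l : A" if "l < Suc D" for l
 proof (cases l)
  case 0
  thus ?thesis by (simp add: y_def)
 next
  case (Suc j)
  have "y div 2 ^ l = (y div 2) div 2 ^ j" unfolding Suc power_Suc by (rule div_mult2_eq)
  also have "y div 2 = z" by (simp add: y_def)
  finally show ?thesis using z(2) that Suc by simp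
 qed
 moreover have "y < 2 ^ Suc D" using z(1) by (simp add: y_def)
 ultimately show ?case by blast
qed simp

section \<open>All coordinates together\<close>

locale rndS = rounding +
 fixes S :: "nat set"
 assumes balls: "!!v. v : rm S ==> card {u. u < nn P & close P pp dd v u} <= 2 ^ pb P"
  and rm_ne: "rm S ~= {}"
  and rm_und: "!!v. v : rm S ==> pp < 8 * dd v (ng v)"
begin

definition rwf :: "nat => nat" where "rwf = rows P pp dd S"
abbreviation "Wl l \<equiv> WW P pp dd S rwf l"
abbreviation "rv l v \<equiv> rwf (N * l + v)"

lemma close_eq: "close P pp dd u v \<longleftrightarrow> (dd u v + dd v u) * 2 ^ 63 <= pp"
 by (simp add: close_def shl_num)

lemma ell_le: "ell x y <= 4" by (simp add: ell_def)

lemma W_eq: "l <= DD ==> WW P pp dd S rw l u v =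
 (if u : rm S & v : rm S & close P pp dd u v then 2 ^ (SUM i<l. ell (rw (N * i + u)) (rw (N * i + v))) else 0)"
proof -
 assume l: "l <= DD"
 have lK: "l <= pK P" using l DK(2) by simp
 have e: "bsum P l (%i. ell (rw (ix P i u)) (rw (ix P i v))) = (SUM i<l. ell (rw (N * i + u)) (rw (N * i + v)))"
  unfolding bsum_eq[OF lK] using l by (intro sum.cong) auto
 have "(SUM i<l. ell (rw (N * i + u)) (rw (N * i + v))) <= (SUM i<l. 4)" by (intro sum_mono ell_le)
 also have "... <= 4 * DD" using l by simp
 also have "... <= 2 ^ L * 2 ^ (2 * L)" using DK(1) L64 power_increasing[of 2 L "2::nat"] by (intro mult_mono) auto
 also have "... <= pK P" by (rule Kle[of _ "3 * L"]) (auto simp: power_add[symmetric])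
 finally have "(SUM i<l. ell (rw (N * i + u)) (rw (N * i + v))) <= pK P" .
 thus ?thesis by (simp add: WW_def e bshl_eq)
qed

text \<open>A finished row is never touched again, so the weights from which a row was built can be
  expressed by the final rows.\<close>

lemma rows_spec:
 assumes l: "l < DD" and v: "v < N"
 shows "rv l v = row dd S (Wl l) v"
proof -
 define R where "R l = bitr P (%l rw j. rowsstep P pp dd S l rw j) (%j. 0) l" for l
 have RS: "R (Suc l) j = rowsstep P pp dd S l (R l) j" if "l < DD" "j < pK P" for l j
  unfolding R_def using that DK(2) by (intro bitr_Suc) auto
 have keep: "i < l ==> l <= DD ==> v < N ==> R l (N * i + v) = R (Suc i) (N * i + v)" for i l v
 proof (induction l)
  case (Suc l)
  show ?case
  proof (cases "i = l")
   case False
   hence il: "i < l" using Suc.prems by simp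
   have "N * i + v < N * Suc i" using Suc.prems by simp
   also have "... <= N * l" using il by (intro mult_left_mono) auto
   finally have lt: "N * i + v < N * l" .
   have "R (Suc l) (N * i + v) = rowsstep P pp dd S l (R l) (N * i + v)"
    using Suc.prems il by (intro RS ixK) auto
   also have "... = R l (N * i + v)" using lt Suc.prems by (simp add: rowsstep_def)
   finally show ?thesis using Suc.IH il Suc.prems by simp
  qed simp
 qed simp
 have fin: "rv i v = R (Suc i) (N * i + v)" if "i < DD" "v < N" for i v
  unfolding rwf_def rows_def R_def[symmetric] using keep[OF that(1) order_refl that(2)] .
 have "WW P pp dd S (R l) l = Wl l"
 proof (intro ext)
  fix u w
  have "R l (N * i + a) = rv i a" if "i < l" "a < N" for i a
   using keep[OF that(1) _ that(2)] fin[of i a] that l by simp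
  thus "WW P pp dd S (R l) l u w = Wl l u w"
   using l by (auto simp: W_eq rm_iff intro!: arg_cong[where f = "%x. 2 ^ x"] sum.cong)
 qed
 moreover have "R (Suc l) (N * l + v) = row dd S (WW P pp dd S (R l) l) v"
  using RS[OF l ixK[OF l v]] l v by (simp add: rowsstep_def)
 ultimately show ?thesis using fin[OF l v] by simp
qed

definition swp2 :: "nat => nat" where
 "swp2 x = (if x = 1 then 2 else if x = 2 then 1 else x)"

lemma rowloc_W:
 assumes "l <= DD"
  and rows: "!!i v. i < l ==> v < N ==> rv i v <= 2 & rv i (ng v) = swp2 (rv i v)"
 shows "rowloc P pp dd S (Wl l)"
proof (unfold_locales)
 have cl: "close P pp dd u v = close P pp dd v u" for u v by (simp add: close_eq add.commute)
 show "Wl l u v = Wl l v u" for u v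
  using assms(1) cl[of u v] by (auto simp: W_eq ell_def intro!: arg_cong[where f = "%x. 2 ^ x"] sum.cong)
 show "Wl l (ng u) (ng v) = Wl l u v" if u: "u < N" and v: "v < N" for u v
 proof -
  have "close P pp dd (ng u) (ng v) = close P pp dd u v"
   using dsym[OF u v] dsym[OF v u] by (simp add: close_eq add.commute)
  moreover have "ng a : rm S \<longleftrightarrow> a : rm S" if "a < N" for a using that rm_ng by (metis ng_ng)
  moreover have "ell (rv i (ng u)) (rv i (ng v)) = ell (rv i u) (rv i v)" if "i < l" for i
  proof -
   have e: "x <= 2 ==> y <= 2 ==> ell (swp2 x) (swp2 y) = ell x y" for x y by (auto simp: ell_def swp2_def)
   show ?thesis using rows[OF that u] rows[OF that v] e by simp
  qed
  ultimately show ?thesis using u v assms(1) by (simp add: W_eq)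
 qed
 show "u : rm S" if "Wl l u v ~= 0" for u v using that assms(1) by (auto simp: W_eq split: if_splits)
 show "Wl l u v <= 2 ^ (33554432 * L)" for u v
 proof -
  have "(SUM i<l. ell (rv i u) (rv i v)) <= (SUM i<l. 4)" by (intro sum_mono ell_le)
  also have "... <= 33554432 * L" using assms(1) by (simp add: DDv)
  finally have "(2::nat) ^ (SUM i<l. ell (rv i u) (rv i v)) <= 2 ^ (33554432 * L)" by (rule power_increasing) simp
  thus ?thesis using assms(1) by (simp add: W_eq)
 qed
 show "1 <= Wl l u u" if "u : rm S" for u
  using that assms(1) by (simp add: W_eq close_eq dd0 rm_iff)
 show "rm S ~= {}" by (rule rm_ne)
qed

lemma rows_code: "l <= DD ==> i < l ==> v < N ==>
  rv i v <= 2 & (rv i v ~= 0 --> v : rm S) & rv i (ng v) = swp2 (rv i v)"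
proof (induction l arbitrary: i v)
 case (Suc l)
 show ?case
 proof (cases "i < l")
  case False
  hence i: "i = l" "l < DD" using Suc.prems by auto
  have "rowloc P pp dd S (Wl l)" by (rule rowloc_W) (use Suc in auto)
  then interpret rw: rowloc P pp dd S "Wl l" .
  have "rw.swap = swp2" by (simp add: fun_eq_iff rw.swap_def swp2_def)
  thus ?thesis using rw.rinv_row rows_spec[OF i(2)] Suc.prems i
   by (simp add: rw.rinv_def)
 qed (use Suc in auto)
qed simp

lemma rowloc_l: "l <= DD ==> rowloc P pp dd S (Wl l)"
 by (rule rowloc_W) (use rows_code in auto)

definition WTl :: "nat => nat" where "WTl l = (SUM u<N. SUM v<N. Wl l u v)"

text \<open>For the values 0, 1, 4 of \<open>ell\<close> one has
  \<open>2^ell <= 1 + 4 * ell\<close>, and the weighted sum of \<open>ell\<close> is at most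
  \<open>2^(-25)\<close> of the total by \<open>row_loss\<close>.\<close>

lemma WT_step: "l < DD ==> 2 ^ 23 * WTl (Suc l) <= (2 ^ 23 + 1) * WTl l"
proof -
 assume l: "l < DD"
 interpret rw: rowloc P pp dd S "Wl l" using l by (intro rowloc_l) simp
 let ?loss = "SUM u<N. SUM v<N. Wl l u v * ell (rv l u) (rv l v)"
 have "WTl (Suc l) <= (SUM u<N. SUM v<N. Wl l u v + 4 * (Wl l u v * ell (rv l u) (rv l v)))"
  unfolding WTl_def
 proof (intro sum_mono)
  fix u v
  have e: "(2::nat) ^ ell x y <= 1 + 4 * ell x y" for x y by (simp add: ell_def)
  have "Wl (Suc l) u v = Wl l u v * 2 ^ ell (rv l u) (rv l v)"
   using l by (simp add: W_eq power_add)
  also have "... <= Wl l u v * (1 + 4 * ell (rv l u) (rv l v))" using e by (rule mult_left_mono) simp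
  finally show "Wl (Suc l) u v <= Wl l u v + 4 * (Wl l u v * ell (rv l u) (rv l v))" by (simp add: algebra_simps)
 qed
 hence 1: "WTl (Suc l) <= WTl l + 4 * ?loss" by (simp add: WTl_def sum.distrib sum_distrib_left)
 have "?loss = (SUM u<N. SUM v<N. Wl l u v * ell (row dd S (Wl l) u) (row dd S (Wl l) v))"
  using rows_spec[OF l] by (intro sum.cong) auto
 hence "2 ^ 25 * ?loss <= WTl l" using rw.row_loss by (simp add: WTl_def rw.WT_eq)
 thus ?thesis using 1 by simp
qed

text \<open>The total starts at \<open>N^2 <= 2^(2 L)\<close> or less and grows by a factor of at
  most \<open>e^L <= 4^L\<close>.\<close>

lemma WT_D: "WTl (DD) <= 2 ^ (4 * L)"
proof -
 have "l <= DD ==> real (WTl l) <= real (WTl 0) * (1 + 1 / 2 ^ 23) ^ l" for l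
 proof (induction l)
  case (Suc l)
  have "real (2 ^ 23 * WTl (Suc l)) <= real ((2 ^ 23 + 1) * WTl l)" using WT_step[of l] Suc.prems by (simp only: of_nat_le_iff)
  hence "real (WTl (Suc l)) <= (1 + 1 / 2 ^ 23) * real (WTl l)" by (simp add: field_simps)
  also have "... <= (1 + 1 / 2 ^ 23) * (real (WTl 0) * (1 + 1 / 2 ^ 23) ^ l)" using Suc by (intro mult_left_mono) auto
  finally show ?case by (simp add: mult_ac)
 qed simp
 hence "real (WTl (DD)) <= real (WTl 0) * (1 + 1 / 2 ^ 23) ^ DD" by simp
 also have "(1 + 1 / 2 ^ 23 :: real) ^ DD <= exp (1 / 2 ^ 23) ^ DD"
  by (intro power_mono) (use exp_ge_add_one_self[of "1 / 2 ^ 23 :: real"] in auto)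
 also have "exp (1 / 2 ^ 23 :: real) ^ DD = exp 1 ^ L"
  by (simp add: DDv exp_of_nat_mult[symmetric])
 also have "(exp 1 :: real) ^ L <= 4 ^ L" using exp_le by (intro power_mono) auto
 finally have "real (WTl (DD)) <= real (WTl 0) * 4 ^ L" by (simp add: mult_left_mono)
 also have "WTl 0 <= N * N"
 proof -
  have "WTl 0 <= (SUM u<N. SUM v<N. 1)" unfolding WTl_def by (intro sum_mono) (simp add: W_eq)
  thus ?thesis by simp
 qed
 hence "real (WTl 0) * 4 ^ L <= real (2 ^ (2 * L)) * 4 ^ L" using NNK(1) by (intro mult_right_mono) (auto simp only: of_nat_le_iff, simp)
 also have "real (2 ^ (2 * L)) * 4 ^ L = real (2 ^ (4 * L))" by (simp add: power_mult power_mult_distrib[symmetric])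
 finally show ?thesis by (simp only: of_nat_le_iff)
qed

text \<open>The weight of one pair is a summand of the final total: multiplicative weights turn the
  average loss of the rows into a bound for every close pair.\<close>

lemma ell_total:
 assumes "u : rm S" "v : rm S" "close P pp dd u v"
 shows "(SUM l<DD. ell (rv l u) (rv l v)) <= 4 * L"
proof -
 have uv: "u < N" "v < N" using assms by (auto simp: rm_iff)
 have "2 ^ (SUM l<DD. ell (rv l u) (rv l v)) = Wl (DD) u v" using assms by (simp add: W_eq)
 also have "... <= (SUM v<N. Wl (DD) u v)" using uv by (intro member_le_sum) auto
 also have "... <= WTl (DD)" unfolding WTl_def
  using uv by (intro member_le_sum[of u "{..<N}" "%u. SUM v<N. Wl (DD) u v"]) auto
 also have "... <= 2 ^ (4 * L)" by (rule WT_D)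
 finally show ?thesis by (simp add: power_increasing_iff)
qed

end

context rndS begin

section \<open>Directions with a large conflict-free set\<close>

abbreviation "res R \<equiv> resd P pp dd S R"

lemma conf_eq: "conf pp dd u v \<longleftrightarrow> dd u (ng v) * 2 ^ 64 * pk P <= pp"
 using kL by (simp add: conf_def shl_num bmul_eq smallK)

lemma conf_sym: "u < N ==> v < N ==> conf pp dd u v = conf pp dd v u"
 using dsym[of u "ng v"] by (simp add: conf_eq)

text \<open>\<open>m\<close> records the amounts subtracted. Once the pair coded by
  \<open>i\<close>, that is \<open>i div N\<close> and \<open>i mod N\<close>, has been processed,
  one of its residues is 0 and stays so.\<close>

lemma greedy:
 assumes R: "R <= rm S"
 shows "EX m :: nat => nat => nat. (ALL u v. m u v = m v u) & (ALL u v. m u v ~= 0 --> u : R & v : R & conf pp dd u v) &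
  (ALL u<N. (SUM v<N. m u v) + res R u = (if u : R then wt dd S u else 0)) &
  (ALL u:R. ALL v:R. u ~= v --> conf pp dd u v --> res R u = 0 | res R v = 0)"
proof -
 let ?r0 = "%v. if v : R then wt dd S v else 0"
 define r where "r i = bitr P (%i r j. rstep P pp dd R i r j) ?r0 i" for i
 have RN: "u < N" if "u : R" for u using R that by (auto simp: rm_iff)
 have r0: "r 0 u = ?r0 u" if "u < N" for u
  unfolding r_def using that NK(1) by (intro bitr_0) linarith
 have rS: "r (Suc i) j = (if j = i div N | j = i mod N then r i j - mtch P pp dd R (r i) (i div N) (i mod N) else r i j)"
  if "i < N * N" "j < N" for i j
 proof -
  have "r (Suc i) j = rstep P pp dd R i (r i) j"
   unfolding r_def using that NK(1) NNK(2) by (intro bitr_Suc) linarith+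
  thus ?thesis using that divN by (simp add: rstep_def)
 qed
 have "i <= N * N ==> EX m :: nat => nat => nat. (ALL u v. m u v = m v u) & (ALL u v. m u v ~= 0 --> u : R & v : R & conf pp dd u v) &
  (ALL u<N. (SUM v<N. m u v) + r i u = ?r0 u) &
  (ALL j<i. j div N : R --> j mod N : R --> j div N ~= j mod N --> conf pp dd (j div N) (j mod N) --> r i (j div N) = 0 | r i (j mod N) = 0)" for i
 proof (induction i)
  case 0
  thus ?case using r0 by (intro exI[of _ "%_ _. 0"]) simp
 next
  case (Suc i)
  then obtain m :: "nat => nat => nat" where m: "ALL u v. m u v = m v u" "ALL u v. m u v ~= 0 --> u : R & v : R & conf pp dd u v"
   "ALL u<N. (SUM v<N. m u v) + r i u = ?r0 u"
   "ALL j<i. j div N : R --> j mod N : R --> j div N ~= j mod N --> conf pp dd (j div N) (j mod N) --> r i (j div N) = 0 | r i (j mod N) = 0"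
   by auto
  have i: "i < N * N" using Suc.prems by simp
  define a where "a = i div N"
  define b where "b = i mod N"
  have ab: "a < N" "b < N" using i N_pos by (auto simp: a_def b_def less_mult_imp_div_less)
  define t where "t = mtch P pp dd R (r i) a b"
  have rS': "r (Suc i) j = (if j = a | j = b then r i j - t else r i j)" if "j < N" for j
   using rS[OF i that] by (simp add: a_def b_def t_def)
  have mono: "r (Suc i) j <= r i j" if "j < N" for j using rS'[OF that] by simp
  show ?case
  proof (cases "t = 0")
   case True
   hence eq: "r (Suc i) j = r i j" if "j < N" for j using rS'[OF that] by simp
   have "r i a = 0 | r i b = 0" if "a : R" "b : R" "a ~= b" "conf pp dd a b"
    using True that by (simp add: t_def mtch_def min_def split: if_splits)
   thus ?thesis using m eq ab RN
    by (intro exI[of _ m]) (auto simp: less_Suc_eq a_def b_def)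
  next
   case False
   hence t: "a : R" "b : R" "a ~= b" "conf pp dd a b" "t = min (r i a) (r i b)"
    by (auto simp: t_def mtch_def split: if_splits)
   define m' where "m' u v = m u v + (if (u = a & v = b) | (u = b & v = a) then t else 0)" for u v
   have "m' u v = m' v u" for u v using m(1) by (auto simp: m'_def)
   moreover have "u : R & v : R & conf pp dd u v" if "m' u v ~= 0" for u v
    using that m(2) t ab conf_sym by (auto simp: m'_def split: if_splits)
   moreover have "(SUM v<N. m' u v) + r (Suc i) u = ?r0 u" if u: "u < N" for u
   proof -
    have "(SUM v<N. m' u v) = (SUM v<N. m u v) + (SUM v<N. if (u = a & v = b) | (u = b & v = a) then t else 0)"
     by (simp add: m'_def sum.distrib)
    also have "(SUM v<N. if (u = a & v = b) | (u = b & v = a) then t else 0) = (if u = a | u = b then t else 0)"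
    proof -
     consider "u = a" | "u = b" "u ~= a" | "u ~= a" "u ~= b" by blast
     thus ?thesis
     proof cases
      case 1
      hence "(SUM v<N. if (u = a & v = b) | (u = b & v = a) then t else 0) = (SUM v<N. if v = b then t else 0)"
       using t(3) by (intro sum.cong) auto
      thus ?thesis using 1 ab by simp
     next
      case 2
      hence "(SUM v<N. if (u = a & v = b) | (u = b & v = a) then t else 0) = (SUM v<N. if v = a then t else 0)"
       by (intro sum.cong) auto
      thus ?thesis using 2 ab by simp
     qed simp
    qed
    finally show ?thesis using m(3) u rS'[OF u] t(5) by auto
   qed
   moreover have "r (Suc i) (j div N) = 0 | r (Suc i) (j mod N) = 0"
    if j: "j < Suc i" "j div N : R" "j mod N : R" "j div N ~= j mod N" "conf pp dd (j div N) (j mod N)" for j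
   proof (cases "j = i")
    case True
    thus ?thesis using rS'[OF ab(1)] rS'[OF ab(2)] t(5) by (auto simp: a_def b_def)
   next
    case False
    hence "r i (j div N) = 0 | r i (j mod N) = 0" using m(4) j by simp
    thus ?thesis using mono[OF RN[OF j(2)]] mono[OF RN[OF j(3)]] by auto
   qed
   ultimately show ?thesis by (intro exI[of _ m']) blast
  qed
 qed
 from this[of "N * N"] obtain m :: "nat => nat => nat" where m: "ALL u v. m u v = m v u" "ALL u v. m u v ~= 0 --> u : R & v : R & conf pp dd u v"
   "ALL u<N. (SUM v<N. m u v) + r (N * N) u = ?r0 u"
   "ALL j<N * N. j div N : R --> j mod N : R --> j div N ~= j mod N --> conf pp dd (j div N) (j mod N) --> r (N * N) (j div N) = 0 | r (N * N) (j mod N) = 0"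
  by auto
 have rr: "res R = r (N * N)" by (simp add: resd_def r_def)
 have "res R u = 0 | res R v = 0" if "u : R" "v : R" "u ~= v" "conf pp dd u v" for u v
 proof -
  have uv: "u < N" "v < N" using RN that by auto
  have "N * u + v < N * Suc u" using uv by simp
  also have "... <= N * N" using uv by (intro mult_left_mono) auto
  finally have "N * u + v < N * N" .
  moreover have "(N * u + v) div N = u" "(N * u + v) mod N = v" using uv by auto
  ultimately show ?thesis using m(4)[rule_format, of "N * u + v"] that rr by simp
 qed
 hence last: "ALL u:R. ALL v:R. u ~= v --> conf pp dd u v --> r (N * N) u = 0 | r (N * N) v = 0"
  by (intro ballI impI) (simp only: rr)
 show ?thesis unfolding rr
  by (rule exI[of _ m], intro conjI, rule m(1), rule m(2), rule m(3), rule last)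
qed

definition cr :: "nat => real" where
 "cr c = (if c = 1 then 1 else if c = 2 then -1 else 0)"

definition xv :: "nat => nat => real" where "xv v l = cr (rv l v)"

definition bits :: "nat => nat set" where "bits z = {l. l < DD & bbit P z l}"

abbreviation "II \<equiv> {..<DD}"

lemma lin_f: "lin II (bits z) (xv v) = real (fpos P rwf z v) - real (fneg P rwf z v)"
proof -
 have "real (fpos P rwf z v) - real (fneg P rwf z v) = (SUM l<DD. real (if (rv l v = 1 & bbit P z l) | (rv l v = 2 & ~ bbit P z l) then 1 else 0) -
   real (if (rv l v = 2 & bbit P z l) | (rv l v = 1 & ~ bbit P z l) then 1 else 0))"
  unfolding fpos_def fneg_def bsum_eq[OF DK(2)] sum_subtractf of_nat_sum by (intro arg_cong2[where f = "(-)"] sum.cong) auto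
 also have "... = lin II (bits z) (xv v)"
  unfolding lin_def by (intro sum.cong) (auto simp: sg_def bits_def xv_def cr_def)
 finally show ?thesis by simp
qed

lemma Rz_iff: "v : Rz P dd S rwf z \<longleftrightarrow> v : rm S & dd (ng v) v <= dd v (ng v) & sqrt (DD) / 4 <= lin II (bits z) (xv v)"
proof -
 have fle: "fpos P rwf z v <= DD"
 proof -
  have "fpos P rwf z v <= (SUM l<DD. 1)" unfolding fpos_def bsum_eq[OF DK(2)] by (intro sum_mono) auto
  thus ?thesis by simp
 qed
 define f where "f = fpos P rwf z v - fneg P rwf z v"
 have fK: "f <= pK P" using fle DK(2) by (simp add: f_def)
 have "fneg P rwf z v < fpos P rwf z v & DD <= bshl P (bmul P f f) 4 \<longleftrightarrow> sqrt (DD) / 4 <= lin II (bits z) (xv v)"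
 proof
  assume a: "fneg P rwf z v < fpos P rwf z v & DD <= bshl P (bmul P f f) 4"
  hence "DD <= 16 * f^2" using fK by (simp add: bmul_eq shl_num power2_eq_square)
  hence "real (DD) <= real (16 * f^2)" by (simp only: of_nat_le_iff)
  also have "... = (4 * real f)^2" by simp
  finally have "sqrt (DD) <= 4 * real f" by (intro real_le_lsqrt) auto
  thus "sqrt (DD) / 4 <= lin II (bits z) (xv v)" using a by (simp add: lin_f f_def of_nat_diff)
 next
  assume a: "sqrt (DD) / 4 <= lin II (bits z) (xv v)"
  have "0 < sqrt (DD)" using DK(3) by simp
  hence "0 < real (fpos P rwf z v) - real (fneg P rwf z v)" using a unfolding lin_f by linarith
  hence lt: "fneg P rwf z v < fpos P rwf z v" by simp
  hence "sqrt (DD) <= 4 * real f" using a by (simp add: lin_f f_def of_nat_diff)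
  hence "(sqrt (DD))^2 <= (4 * real f)^2" by (intro power_mono) auto
  hence "real (DD) <= real (16 * f^2)" by simp
  hence "DD <= 16 * f^2" by (simp only: of_nat_le_iff)
  thus "fneg P rwf z v < fpos P rwf z v & DD <= bshl P (bmul P f f) 4"
   using lt fK by (simp add: bmul_eq shl_num power2_eq_square)
 qed
 moreover have "tr P dd (ng v) = dd (ng v) v" "tr P dd v = dd v (ng v)" if "v : rm S"
  using that by (auto simp: tr_def rm_iff)
 ultimately show ?thesis unfolding Rz_def f_def by auto
qed

lemma sqD: "real (DD) = 8388608 * real L" by (simp add: DDv)

lemma near:
 assumes "u : rm S" "v : rm S" "close P pp dd v u"
 shows "(SUM l:II. (xv u l - xv v l)^2) <= 4 * real L"
proof -
 have uv: "u < N" "v < N" using assms by (auto simp: rm_iff)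
 have "(SUM l:II. (xv u l - xv v l)^2) = (SUM l<DD. real (ell (rv l v) (rv l u)))"
 proof (rule sum.cong)
  fix l assume "l : II"
  hence "rv l u <= 2" "rv l v <= 2" using rows_code[of "DD" l] uv by auto
  hence "rv l u : {0,1,2}" "rv l v : {0,1,2}" by auto
  thus "(xv u l - xv v l)^2 = real (ell (rv l v) (rv l u))" by (auto simp: xv_def cr_def ell_def)
 qed simp
 also have "... = real (SUM l<DD. ell (rv l v) (rv l u))" by simp
 also have "... <= real (4 * L)" using ell_total[OF assms(2,1,3)] by (simp only: of_nat_le_iff)
 finally show ?thesis by simp
qed

lemma xng: "v < N ==> l : II ==> xv (ng v) l = - xv v l"
proof -
 assume v: "v < N" and l: "l : II"
 hence "rv l v <= 2" "rv l (ng v) = swp2 (rv l v)" using rows_code[of "DD" l v] by auto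
 thus ?thesis by (auto simp: xv_def cr_def swp2_def)
qed

definition msq :: "nat => real" where "msq v = (SUM l:II. (xv v l)^2)"

text \<open>Each row covers half of the weight, hence a third of the weight lies on vectors of
  squared norm at least \<open>DD / 4\<close>. Half of that lies on literals at least as likely as
  their negations, and anticoncentration keeps 3/32: \<open>1/3 * 1/2 * 3/32 = 1/64\<close>.\<close>

lemma mass_R:
 assumes dn: "!!l. l < DD ==> rdone P dd S (rowl P rwf l)"
 shows "real (wtot dd S) / 64 <= EP II (%A. SUM v:rm S. if dd (ng v) v <= dd v (ng v) & sqrt (DD) / 4 <= lin II A (xv v) then real (wt dd S v) else 0)"
proof -
 let ?w = "%v. real (wt dd S v)" and ?W = "real (wtot dd S)" and ?D = "real (DD)"
 let ?G = "{v : rm S. ?D / 4 <= msq v}"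
 let ?Gp = "{v : ?G. dd (ng v) v <= dd v (ng v)}"
 have D0: "?D > 0" using DK(3) by simp
 have Wrm: "?W = (SUM v:rm S. ?w v)"
 proof -
  have "(SUM v<N. ?w v) = (SUM v:rm S. ?w v)"
   by (rule sum.mono_neutral_right) (auto simp: rm_iff wt_eq)
  thus ?thesis by (simp add: wtot_eq)
 qed
 have msq_eq: "msq v = (SUM l<DD. if rv l v = 0 then 0 else 1)" if "v < N" for v
  unfolding msq_def
 proof (rule sum.cong)
  fix l assume "l : II"
  hence "rv l v <= 2" using rows_code[of "DD" l v] that by auto
  hence "rv l v : {0,1,2}" by auto
  thus "(xv v l)^2 = (if rv l v = 0 then 0 else 1)" by (auto simp: xv_def cr_def)
 qed simp
 have msq_le: "msq v <= ?D" if "v < N" for v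
 proof -
  have "msq v <= (SUM l<DD. 1)" unfolding msq_eq[OF that] by (intro sum_mono) auto
  thus ?thesis by simp
 qed
 have "?D * (?W / 2) = (SUM l<DD. ?W / 2)" by simp
 also have "... <= (SUM l<DD. SUM v<N. if rv l v = 0 then 0 else ?w v)"
 proof (rule sum_mono)
  fix l assume "l : {..<DD}"
  hence l: "l < DD" by simp
  have "wtot dd S <= 2 * (SUM v<N. if rv l v = 0 then 0 else wt dd S v)"
   using dn[OF l] l by (simp add: rdone_def cov_def rowl_def mult_2)
  hence "?W <= real (2 * (SUM v<N. if rv l v = 0 then 0 else wt dd S v))" by (simp only: of_nat_le_iff)
  also have "... = 2 * (SUM v<N. if rv l v = 0 then 0 else ?w v)" by (simp add: of_nat_sum if_distrib cong: if_cong)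
  finally show "?W / 2 <= (SUM v<N. if rv l v = 0 then 0 else ?w v)" by simp
 qed
 also have "... = (SUM v<N. SUM l<DD. if rv l v = 0 then 0 else ?w v)" by (rule sum.swap)
 also have "... = (SUM v<N. ?w v * msq v)"
  by (intro sum.cong) (auto simp: msq_eq sum_distrib_left intro!: sum.cong)
 also have "... = (SUM v:rm S. ?w v * msq v)"
  by (rule sum.mono_neutral_right) (auto simp: rm_iff wt_eq)
 also have "... <= (SUM v:rm S. ?w v * (?D / 4) + (if v : ?G then ?w v * (3 * ?D / 4) else 0))"
 proof (rule sum_mono)
  fix v assume v: "v : rm S"
  hence vN: "v < N" by (simp add: rm_iff)
  show "?w v * msq v <= ?w v * (?D / 4) + (if v : ?G then ?w v * (3 * ?D / 4) else 0)"
  proof (cases "v : ?G")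
   case True
   have "?w v * msq v <= ?w v * ?D" using msq_le[OF vN] by (intro mult_left_mono) auto
   thus ?thesis using True by (simp add: algebra_simps)
  next
   case False
   hence "?w v * msq v <= ?w v * (?D / 4)" using v by (intro mult_left_mono) auto
   thus ?thesis unfolding if_not_P[OF False] by linarith
  qed
 qed
 also have "... = ?W * (?D / 4) + (SUM v:?G. ?w v) * (3 * ?D / 4)"
 proof -
  have "(SUM v:rm S. if v : ?G then ?w v * c else 0) = (SUM v:?G. ?w v) * c" for c
  proof -
   have "(SUM v:rm S. if v : ?G then ?w v * c else 0) = (SUM v:rm S Int ?G. ?w v * c)" by (simp only: sum.inter_restrict rm_fin)
   also have "rm S Int ?G = ?G" by auto
   finally show ?thesis by (simp only: sum_distrib_right)
  qed
  thus ?thesis unfolding sum.distrib Wrm sum_distrib_right[symmetric] by simp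
 qed
 finally have "?D * (?W / 4) <= ?D * ((SUM v:?G. ?w v) * (3 / 4))" by (simp add: algebra_simps)
 hence G: "?W / 3 <= (SUM v:?G. ?w v)" using D0 by simp
 have msq_ng: "msq (ng v) = msq v" if "v < N" for v
  unfolding msq_def using xng[OF that] by (intro sum.cong) auto
 have Gp: "(SUM v:?G. ?w v) <= 2 * (SUM v:?Gp. ?w v)"
 proof -
  let ?Gm = "{v : ?G. dd v (ng v) <= dd (ng v) v}"
  have "(SUM v:?Gm. ?w v) = (SUM v:?Gp. ?w v)"
   by (rule sum.reindex_bij_witness[of _ "ng" "ng"]) (auto simp: rm_ng rm_iff msq_ng wt_ng)
  moreover have "(SUM v:?G. ?w v) <= (SUM v:?Gp. ?w v) + (SUM v:?Gm. ?w v)"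
  proof -
   have "?G = ?Gp Un ?Gm" by auto
   hence "(SUM v:?G. ?w v) = (SUM v:?Gp Un ?Gm. ?w v)" by (rule arg_cong)
   also have "... <= (SUM v:?Gp. ?w v) + (SUM v:?Gm. ?w v)"
    by (subst sum_Un) (auto intro!: sum_nonneg)
   finally show ?thesis .
  qed
  ultimately show ?thesis by simp
 qed
 have "?W / 64 <= (SUM v:?Gp. ?w v) * (3 / 32)" using G Gp by linarith
 also have "... = (SUM v:?Gp. ?w v * (3 / 32))" by (rule sum_distrib_right)
 also have "... <= (SUM v:?Gp. EP II (%A. if sqrt (DD) / 4 <= lin II A (xv v) then ?w v else 0))"
 proof (rule sum_mono)
  fix v assume v: "v : ?Gp"
  have m0: "0 < msq v" using v D0 by (auto intro: less_le_trans[of 0 "?D / 4"])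
  have "sqrt ?D / 2 <= sqrt (msq v)"
  proof -
   have "sqrt (?D / 4) <= sqrt (msq v)" using v by (intro real_sqrt_le_mono) auto
   thus ?thesis by (simp add: real_sqrt_divide)
  qed
  hence s: "sqrt ?D / 4 <= sqrt (msq v) / 2" by simp
  have "3 / 32 <= EP II (%A. if sqrt (msq v) / 2 <= lin II A (xv v) then 1 else 0)"
   using lin_anticonc[of II "msq v" "xv v"] m0 by (simp add: msq_def)
  hence "?w v * (3 / 32) <= ?w v * EP II (%A. if sqrt (msq v) / 2 <= lin II A (xv v) then 1 else 0)"
   by (intro mult_left_mono) auto
  also have "... = EP II (%A. ?w v * (if sqrt (msq v) / 2 <= lin II A (xv v) then 1 else 0))" by (simp add: EP_cmul)
  also have "... <= EP II (%A. if sqrt (DD) / 4 <= lin II A (xv v) then ?w v else 0)"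
   using s by (intro EP_mono) auto
  finally show "?w v * (3 / 32) <= EP II (%A. if sqrt (DD) / 4 <= lin II A (xv v) then ?w v else 0)" .
 qed
 also have "... = EP II (%A. SUM v:?Gp. if sqrt (DD) / 4 <= lin II A (xv v) then ?w v else 0)" by (simp add: EP_sum)
 also have "... <= EP II (%A. SUM v:rm S. if dd (ng v) v <= dd v (ng v) & sqrt (DD) / 4 <= lin II A (xv v) then ?w v else 0)"
 proof (rule EP_mono)
  fix A
  have "(SUM v:?Gp. if sqrt (DD) / 4 <= lin II A (xv v) then ?w v else 0) = (SUM v:?Gp. if dd (ng v) v <= dd v (ng v) & sqrt (DD) / 4 <= lin II A (xv v) then ?w v else 0)"
   by (intro sum.cong) auto
  also have "... <= (SUM v:rm S. if dd (ng v) v <= dd v (ng v) & sqrt (DD) / 4 <= lin II A (xv v) then ?w v else 0)"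
   by (rule sum_mono2) auto
  finally show "(SUM v:?Gp. if sqrt (DD) / 4 <= lin II A (xv v) then ?w v else 0) <= ..." .
 qed
 finally show ?thesis .
qed

end

text \<open>The thresholds cutting an arc lie in an interval of length \<open>d u v\<close>, so all
  \<open>w\<close> thresholds together cut at most the total length, and the best one is no worse
  than the average.\<close>

lemma region_threshold:
 fixes d :: "'v => 'v => nat" and T :: "nat => 'v set"
 assumes fin: "finite E"
  and sep: "!!u v h h'. (u, v) : E ==> h <= h' ==> h' < w ==> u : T h ==> v ~: T h' ==> h' < h + d u v"
  and w: "w > 0"
 shows "EX h<w. w * card {(u, v) : E. u : T h & v ~: T h} <= (SUM (u, v):E. d u v)"
proof (rule ccontr)
 assume "~ ?thesis"
 hence lt: "(SUM (u, v):E. d u v) < w * card {(u, v) : E. u : T h & v ~: T h}" if "h < w" for h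
  using that by (auto simp: not_le)
 have "(SUM h<w. SUM e:E. d (fst e) (snd e)) < (SUM h<w. w * card {(u, v) : E. u : T h & v ~: T h})"
  using lt w by (intro sum_strict_mono) (auto simp: case_prod_beta lessThan_empty_iff)
 hence "w * (SUM e:E. d (fst e) (snd e)) < w * (SUM h<w. card {(u, v) : E. u : T h & v ~: T h})"
  by (simp add: sum_distrib_left)
 hence "(SUM e:E. d (fst e) (snd e)) < (SUM h<w. card {(u, v) : E. u : T h & v ~: T h})" by simp
 also have "... = (SUM h<w. SUM e:E. if fst e : T h & snd e ~: T h then 1 else 0)"
 proof (rule sum.cong)
  fix h
  have "{(u, v) : E. u : T h & v ~: T h} = {e : E. fst e : T h & snd e ~: T h}" by auto
  thus "card {(u, v) : E. u : T h & v ~: T h} = (SUM e:E. if fst e : T h & snd e ~: T h then 1 else 0)"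
   using fin by (simp add: sum.inter_filter[symmetric])
 qed simp
 also have "... = (SUM e:E. SUM h<w. if fst e : T h & snd e ~: T h then 1 else 0)" by (rule sum.swap)
 also have "... = (SUM e:E. card {h. h < w & fst e : T h & snd e ~: T h})"
  by (intro sum.cong refl) (simp add: sum.If_cases Int_def)
 also have "... <= (SUM e:E. d (fst e) (snd e))"
 proof (rule sum_mono)
  fix e assume e: "e : E"
  let ?H = "{h. h < w & fst e : T h & snd e ~: T h}"
  show "card ?H <= d (fst e) (snd e)"
  proof (cases "?H = {}")
   case False
   define h0 where "h0 = Min ?H"
   have fH: "finite ?H" by simp
   have h0: "h0 : ?H" "!!h. h : ?H ==> h0 <= h" using Min_in[OF fH False] Min_le[OF fH] by (auto simp: h0_def)
   have "?H <= {h0..<h0 + d (fst e) (snd e)}"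
   proof
    fix h assume h: "h : ?H"
    hence "h0 <= h" by (rule h0(2))
    moreover have "h < h0 + d (fst e) (snd e)" using sep[of "fst e" "snd e" h0 h] e h h0(1) \<open>h0 <= h\<close> by auto
    ultimately show "h : {h0..<h0 + d (fst e) (snd e)}" by simp
   qed
   hence "card ?H <= card {h0..<h0 + d (fst e) (snd e)}" by (intro card_mono) auto
   thus ?thesis by simp
  qed (simp only: card.empty zero_le)
 qed
 finally show False by simp
qed

context rndS begin

abbreviation "wT \<equiv> wtot dd S"

lemma wT_pos: "0 < wT"
proof -
 obtain u where u: "u : rm S" using rm_ne by blast
 hence "1 <= wt dd S u" by (simp add: wt_eq)
 also have "... <= wT" using u by (intro wt_le_wtot) (simp add: rm_iff)
 finally show ?thesis by simp
qed

lemma zok_eq: "zok P pp dd S rwf z \<longleftrightarrow> wT <= 128 * (SUM v<N. res (Rz P dd S rwf z) v)"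
 by (simp add: zok_def shl_num mult.commute)

lemma Rz_rm: "Rz P dd S rwf z <= rm S" by (auto simp: Rz_def)

text \<open>If every sign pattern left less than \<open>wT / 128\<close> unmatched, the matchings
  would carry an expected weight of at least \<open>wT / 128\<close>. Chaining \<open>k\<close> of
  them would then exceed what the maximum of \<open>2^b\<close> short Rademacher sums
  allows.\<close>

lemma zok_ex:
 assumes dn: "!!l. l < DD ==> rdone P dd S (rowl P rwf l)"
 shows "EX z<2 ^ DD. zok P pp dd S rwf z"
proof (rule ccontr)
 assume "~ ?thesis"
 hence no: "128 * (SUM v<N. res (Rz P dd S rwf z) v) < wT" if "z < 2 ^ DD" for z
  using that by (auto simp: zok_eq not_le)
 have "EX z<2 ^ DD. bits z = A" if "A <= II" for A
 proof -
  obtain z :: nat where z: "z < 2 ^ DD" "ALL l<DD. odd (z div 2 ^ l) \<longleftrightarrow> l : A" using ex_bits by blast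
  have "bits z = A" using z(2) that DK(2) by (auto simp: bits_def bbit_eq)
  thus ?thesis using z(1) by blast
 qed
 then obtain zf where zf: "!!A. A <= II ==> zf A < 2 ^ DD & bits (zf A) = A" by metis
 define R where "R A = Rz P dd S rwf (zf A)" for A
 have "ALL A. EX m :: nat => nat => nat. (ALL u v. m u v = m v u) & (ALL u v. m u v ~= 0 --> u : R A & v : R A & conf pp dd u v) &
  (ALL u<N. (SUM v<N. m u v) + res (R A) u = (if u : R A then wt dd S u else 0))"
  using greedy[OF Rz_rm] unfolding R_def by blast
 then obtain mm :: "nat set => nat => nat => nat" where mm: "!!A u v. mm A u v = mm A v u"
   "!!A u v. mm A u v ~= 0 ==> u : R A & v : R A & conf pp dd u v"
   "!!A u. u < N ==> (SUM v<N. mm A u v) + res (R A) u = (if u : R A then wt dd S u else 0)"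
  by metis
 let ?V = "rm S"
 let ?m = "%A u v. real (mm A u v)"
 let ?W = "real wT"
 define dst where "dst u v = real (dd u v + dd v u)" for u v
 \<comment> \<open>\<open>pk P\<close> steps of this length make up the radius of
   \<open>close\<close>.\<close>
 define rho where "rho = real pp / (2 ^ 63 * real (pk P))"
 have k0: "real (pk P) > 0" using k1 by simp
 have krho: "real (pk P) * rho = real pp / 2 ^ 63" using k0 by (simp add: rho_def)
 have cl: "dst u v <= real (pk P) * rho \<longleftrightarrow> close P pp dd u v" for u v
 proof -
  have "dst u v <= real (pk P) * rho \<longleftrightarrow> real ((dd u v + dd v u) * 2 ^ 63) <= real pp"
   unfolding krho dst_def by (simp add: field_simps)
  thus ?thesis unfolding close_eq by (simp only: of_nat_le_iff)
 qed
 have VN: "v < N" if "v : ?V" for v using that by (simp add: rm_iff)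
 have RV: "R A <= ?V" for A by (simp add: R_def Rz_rm)
 have sumV: "(SUM v:?V. ?m A u v) = real (SUM v<N. mm A u v)" for A u
 proof -
  have "(SUM v<N. ?m A u v) = (SUM v:?V. ?m A u v)"
  proof (rule sum.mono_neutral_right)
   show "ALL v:{..<N} - ?V. ?m A u v = 0" using mm(2)[of A u] RV[of A] by (metis DiffD2 of_nat_0 subsetD)
  qed (auto simp: rm_iff)
  thus ?thesis by simp
 qed
 have wV: "(SUM v:?V. real (wt dd S v)) = ?W"
 proof -
  have "(SUM v<N. real (wt dd S v)) = (SUM v:?V. real (wt dd S v))"
   by (rule sum.mono_neutral_right) (auto simp: rm_iff wt_eq)
  thus ?thesis by (simp add: wtot_eq)
 qed
 have Rlin: "u : R A \<longleftrightarrow> u : ?V & dd (ng u) u <= dd u (ng u) & sqrt (DD) / 4 <= lin II A (xv u)" if "A <= II" for A u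
  unfolding R_def Rz_iff using zf[OF that] by simp
 have M: "?W / 128 <= EP II (%A. SUM u:?V. SUM v:?V. ?m A u v)"
 proof -
  have "?W / 128 = ?W / 64 - ?W / 128" by simp
  also have "... <= EP II (%A. SUM v:?V. if dd (ng v) v <= dd v (ng v) & sqrt (DD) / 4 <= lin II A (xv v) then real (wt dd S v) else 0) - ?W / 128"
   using mass_R[OF dn] by simp
  also have "... = EP II (%A. (SUM v:?V. if dd (ng v) v <= dd v (ng v) & sqrt (DD) / 4 <= lin II A (xv v) then real (wt dd S v) else 0) - ?W / 128)"
   by (simp add: EP_diff EP_const)
  also have "... <= EP II (%A. SUM u:?V. SUM v:?V. ?m A u v)"
  proof (rule EP_mono)
   fix A assume A: "A <= II"
   have "(SUM u:?V. if dd (ng u) u <= dd u (ng u) & sqrt (DD) / 4 <= lin II A (xv u) then real (wt dd S u) else 0)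
    = (SUM u:?V. real (SUM v<N. mm A u v) + real (res (R A) u))"
   proof (rule sum.cong)
    fix u assume u: "u : ?V"
    have "real (SUM v<N. mm A u v) + real (res (R A) u) = real (if u : R A then wt dd S u else 0)"
     using mm(3)[OF VN[OF u], of A] by (simp only: of_nat_add[symmetric])
    thus "(if dd (ng u) u <= dd u (ng u) & sqrt (DD) / 4 <= lin II A (xv u) then real (wt dd S u) else 0) = real (SUM v<N. mm A u v) + real (res (R A) u)"
     using Rlin[OF A, of u] u by simp
   qed simp
   also have "... = (SUM u:?V. SUM v:?V. ?m A u v) + (SUM u:?V. real (res (R A) u))" by (simp add: sum.distrib sumV)
   also have "(SUM u:?V. real (res (R A) u)) <= (SUM u<N. real (res (R A) u))" by (rule sum_mono2) (auto simp: rm_iff)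
   also have "... <= ?W / 128"
   proof -
    have "128 * (SUM v<N. res (R A) v) <= wT" using no[of "zf A"] zf[OF A] by (simp add: R_def)
    hence "real (128 * (SUM v<N. res (R A) v)) <= ?W" by (simp only: of_nat_le_iff)
    thus ?thesis by simp
   qed
   finally show "(SUM v:?V. if dd (ng v) v <= dd v (ng v) & sqrt (DD) / 4 <= lin II A (xv v) then real (wt dd S v) else 0) - ?W / 128 <= (SUM u:?V. SUM v:?V. ?m A u v)" by simp
  qed
  finally show ?thesis .
 qed
 let ?D = "real (DD)"
 have D0: "?D > 0" using DK(3) by simp
 define l where "l = 2048 * real (pk P) / sqrt ?D"
 have l0: "l > 0" using D0 k0 by (simp add: l_def)
 have chain: "l * (real (pk P) * (2 * (sqrt ?D / 4) * (?W / 128) - 2 * (SUM u:?V. real (wt dd S u)) * sqrt (2 * (4 * real L)))) <= (SUM u:?V. real (wt dd S u)) * (ln (2 ^ pb P :: nat) + l^2 * (4 * real L) / 2)"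
 proof (rule arv_chain[where ng = "ng" and x = xv and dst = dst and rho = rho and m = ?m and I = II])
  show "ng v : ?V" if "v : ?V" for v using that by (rule rm_ng)
  show "ng (ng v) = v" if "v : ?V" for v using VN[OF that] by simp
  show "xv (ng v) i = - xv v i" if "v : ?V" "i : II" for v i using xng VN that by blast
  show "dst v v = 0" if "v : ?V" for v using dd0[OF VN[OF that]] by (simp add: dst_def)
  show "dst u w <= dst u v + dst v w" if "u : ?V" "v : ?V" "w : ?V" for u v w
   using tri[of u v w] tri[of w v u] VN that by (simp add: dst_def)
  show "dst (ng u) (ng v) = dst u v" if "u : ?V" "v : ?V" for u v
   using dsym[of u v] dsym[of v u] VN that by (simp add: dst_def)
  show "rho >= 0" by (simp add: rho_def)
  show "(SUM i:II. (xv u i - xv v i)^2) <= 4 * real L" if "u : ?V" "v : ?V" "dst v u <= real (pk P) * rho" for u v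
   using near[OF that(1,2)] that(3) cl by simp
  show "card {u : ?V. dst v u <= real (pk P) * rho} <= 2 ^ pb P" if "v : ?V" for v
  proof -
   have "card {u : ?V. dst v u <= real (pk P) * rho} <= card {u. u < N & close P pp dd v u}"
    using cl VN by (intro card_mono) auto
   thus ?thesis using balls[OF that] by simp
  qed
  \<comment> \<open>The conflict bounds only \<open>dd u (ng v)\<close>. By \<open>bal\<close>, and
    because both literals are at least as likely as their negations, the opposite distance is no
    larger; this doubles the conflict distance to \<open>rho\<close>.\<close>
  show "dst (ng u) v <= rho & sqrt ?D / 4 <= lin II A (xv u) & sqrt ?D / 4 <= lin II A (xv v)"
   if A: "A <= II" and uv: "u : ?V" "v : ?V" and p: "0 < ?m A u v" for A u v
  proof -
   have m: "u : R A" "v : R A" "conf pp dd u v" using mm(2)[of A u v] p by auto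
   note ru = Rlin[OF A, of u] and rv = Rlin[OF A, of v]
   have uvN: "u < N" "v < N" using VN uv by auto
   have b: "dd u (ng v) + dd (ng v) v = dd (ng v) u + dd u (ng u)" using bal[of u "ng v"] uvN by simp
   have "dd (ng v) v <= dd v (ng v)" "dd (ng u) u <= dd u (ng u)" using m ru rv by auto
   moreover have "dd u (ng u) + dd (ng u) u = pp" "dd v (ng v) + dd (ng v) v = pp" using tot uvN by auto
   ultimately have "dd (ng v) u <= dd u (ng v)" using b by linarith
   moreover have "dd (ng u) v = dd (ng v) u" using dsym[of "ng v" u] uvN by simp
   moreover have "dd v (ng u) = dd u (ng v)" using dsym[of u "ng v"] uvN by simp
   ultimately have "dd (ng u) v + dd v (ng u) <= 2 * dd u (ng v)" by simp
   hence "(dd (ng u) v + dd v (ng u)) * (2 ^ 63 * pk P) <= 2 * dd u (ng v) * (2 ^ 63 * pk P)" by (rule mult_right_mono) simp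
   also have "... <= pp" using m(3) by (simp add: conf_eq mult_ac)
   finally have "real ((dd (ng u) v + dd v (ng u)) * (2 ^ 63 * pk P)) <= real pp" by (simp only: of_nat_le_iff)
   hence "dst (ng u) v <= rho" using k0 unfolding dst_def rho_def by (simp add: field_simps)
   thus ?thesis using m ru rv by simp
  qed
  show "(SUM v:?V. ?m A u v) <= real (wt dd S u)" if "u : ?V" for A u
  proof -
   have "(SUM v<N. mm A u v) <= wt dd S u" using mm(3)[OF VN[OF that], of A] by (simp split: if_splits)
   thus ?thesis unfolding sumV by (simp only: of_nat_le_iff)
  qed
 qed (use mm(1) M l0 D0 in auto)
 have s1: "sqrt (2 * (4 * real L)) = sqrt ?D / 1024"
 proof -
  have e: "2 * (4 * real L) = ?D / 1024^2" by (simp add: sqD)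
  show ?thesis unfolding e by (simp only: real_sqrt_divide) simp
 qed
 have l2: "l^2 * (4 * real L) / 2 = (real (pk P))^2"
 proof -
  have "l^2 = 2048^2 * (real (pk P))^2 / ?D" using D0 by (simp add: l_def power_divide power_mult_distrib)
  moreover have "real L > 0" using L64 by simp
  ultimately show ?thesis by (simp add: sqD)
 qed
 have lln: "ln (real (2 ^ pb P :: nat)) <= (real (pk P))^2"
 proof -
  have "ln (real (2 ^ pb P :: nat)) = real (pb P) * ln 2" by (simp add: ln_realpow)
  also have "... <= real (pb P) * 1" using ln_le_minus_one[of 2] by (intro mult_left_mono) auto
  also have "... <= real ((pk P)^2)" using bk by simp
  finally show ?thesis by simp
 qed
 have W0: "?W > 0" using wT_pos by simp
 have e1: "l * (real (pk P) * (2 * (sqrt ?D / 4) * (?W / 128) - 2 * ?W * (sqrt ?D / 1024))) = 4 * (real (pk P))^2 * ?W"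
 proof -
  have "2 * (sqrt ?D / 4) * (?W / 128) - 2 * ?W * (sqrt ?D / 1024) = ?W * sqrt ?D / 512" by (simp add: algebra_simps)
  thus ?thesis using D0 by (simp add: l_def power2_eq_square)
 qed
 have "4 * (real (pk P))^2 * ?W <= ?W * (ln (real (2 ^ pb P :: nat)) + (real (pk P))^2)"
  using chain unfolding wV s1 l2 e1 .
 also have "... <= ?W * (2 * (real (pk P))^2)" using lln W0 by (intro mult_left_mono) auto
 finally have "(2 * (real (pk P))^2) * ?W <= 0" by (simp add: algebra_simps)
 thus False using W0 k0 by (simp add: mult_le_0_iff)
qed

end

context rounding begin

lemma cnt_eq: "cntb P S' B = card {(u, v) : {(u, v). u : rm S' & v : rm S' & adjb u v}. u : B & v ~: B}"
proof -
 let ?E = "{(u, v). u : rm S' & v : rm S' & adjb u v & u : B & v ~: B}"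
 have "cntb P S' B = (SUM (u, v):{..<N} \<times> {..<N}. if (u, v) : ?E then 1 else 0)"
  unfolding cntb_def sumN by (subst sum.cartesian_product) (intro sum.cong, auto)
 also have "... = (SUM e:({..<N} \<times> {..<N}) Int ?E. 1)"
  by (simp add: sum.inter_restrict[symmetric] case_prod_beta sum.If_cases Int_def)
 also have "({..<N} \<times> {..<N}) Int ?E = ?E" by (auto simp: rm_iff)
 also have "?E = {(u, v) : {(u, v). u : rm S' & v : rm S' & adjb u v}. u : B & v ~: B}" by auto
 finally show ?thesis by simp
qed

lemma cnt_le: "cntb P S' B <= N * N"
proof -
 have "cntb P S' B <= (SUM u<N. SUM v<N. 1)" unfolding cntb_def sumN by (intro sum_mono) auto
 thus ?thesis by simp
qed

lemma arcs_fin: "finite {(u, v). u : rm S' & v : rm S' & adjb u v}"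
 by (rule finite_subset[of _ "rm S' \<times> rm S'"]) auto

lemma vol_eq: "volr dd (rm S') = (SUM (u, v):{(u, v). u : rm S' & v : rm S' & adjb u v}. dd u v)"
proof -
 let ?E = "{(u, v). u : rm S' & v : rm S' & adjb u v}"
 have "volr dd (rm S') = (SUM (u, v):{..<N} \<times> {..<N}. if (u, v) : ?E then dd u v else 0)"
  unfolding volr_def sumN by (subst sum.cartesian_product) (intro sum.cong, auto)
 also have "... = (SUM (u, v):({..<N} \<times> {..<N}) Int ?E. dd u v)"
  by (subst sum.inter_restrict) (auto simp: case_prod_beta intro!: sum.cong)
 also have "({..<N} \<times> {..<N}) Int ?E = ?E" by (auto simp: rm_iff)
 finally show ?thesis .
qed

end

context rndS begin

definition TT :: "nat set" where "TT = ballS P pp dd S (Rp P pp dd S) (thr P pp dd S)"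
abbreviation "wd \<equiv> wid P pp"

lemma wd_eq: "wd = pp div (pk P * 2 ^ 65)"
 using k1 by (simp add: wid_def shl_65 bdiv_eq)

lemma wd_pos: "0 < wd"
proof -
 have "pk P * 2 ^ 65 <= 2 ^ L * 2 ^ (3 * L)" using kL L64 by (intro mult_mono power_increasing) auto
 also have "... = 2 ^ (4 * L)" by (simp add: power_add[symmetric])
 finally have "pk P * 2 ^ 65 <= pp" using pplow by simp
 thus ?thesis using k1 by (simp add: wd_eq div_greater_zero_iff)
qed

lemma wd_K: "wd <= pK P" unfolding wd_eq using ppK by (meson div_le_dividend order_trans)

lemma wd_th: "h < wd ==> (2 * h) * 2 ^ 64 * pk P <= pp"
proof -
 assume "h < wd"
 hence "h * (pk P * 2 ^ 65) <= wd * (pk P * 2 ^ 65)" by (intro mult_right_mono) auto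
 also have "... <= pp" unfolding wd_eq by (rule div_times_less_eq_dividend)
 finally show ?thesis by (simp add: mult_ac)
qed

text \<open>A literal and its negation in one ball would yield a conflict inside \<open>Q\<close>.
  The progress is that \<open>Q\<close> and its negation, together at least 1/64 of the weight,
  leave the remaining set.\<close>

lemma round_step:
 assumes ns: "~ stuck P pp dd S"
 shows "TT <= rm S" "!!v. v : TT ==> ng v ~: TT" "64 * wtot dd (S Un TT) <= 63 * wtot dd S"
  "wd * cntb P S TT <= volr dd (rm S)"
proof -
 have dn: "rdone P dd S (rowl P rwf l)" if "l < DD" for l
  using ns that unfolding stuck_def bex_eq[OF DK(2)] stk1_def rwf_def by blast
 define z where "z = zz P pp dd S rwf"
 have pD: "bshl P 1 (DD) = 2 ^ DD" by (simp add: bshl_eq DK)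
 have pDK: "2 ^ DD <= pK P" by (rule Kle[OF order_refl]) (simp add: DDv)
 have z: "zok P pp dd S rwf z" unfolding z_def zz_def pD by (rule bleast(1)[OF pDK zok_ex[OF dn]])
 define R where "R = Rz P dd S rwf z"
 have RV: "R <= rm S" by (simp add: R_def Rz_rm)
 obtain m :: "nat => nat => nat" where m: "ALL u<N. (SUM v<N. m u v) + res R u = (if u : R then wt dd S u else 0)"
   "ALL u:R. ALL v:R. u ~= v --> conf pp dd u v --> res R u = 0 | res R v = 0"
  using greedy[OF RV] by blast
 define Q where "Q = Rp P pp dd S"
 have Qe: "Q = {v. res R v ~= 0}" by (simp add: Q_def Rp_def R_def z_def rwf_def)
 have resN: "res R v = 0" if "~ v < N" for v
 proof (rule ccontr)
  assume nz: "res R v ~= 0"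
  have nR: "v ~: R" using RV that by (auto simp: rm_iff)
  define r where "r i = bitr P (%i r j. rstep P pp dd R i r j) (%v. if v : R then wt dd S v else 0) i" for i
  have "i <= N * N ==> r i v = 0" for i
  proof (induction i)
   case 0
   thus ?case using nR by (simp add: r_def bitr_def)
  next
   case (Suc i)
   show ?case
   proof (cases "v < pK P")
    case True
    hence "r (Suc i) v = rstep P pp dd R i (r i) v"
     unfolding r_def using Suc.prems NNK(2) by (intro bitr_Suc) linarith+
    thus ?thesis using Suc by (simp add: rstep_def)
   qed (simp add: r_def bitr_def itr_support)
  qed
  hence "res R v = 0" by (simp add: resd_def r_def)
  thus False using nz by simp
 qed
 have QR: "Q <= R"
 proof
  fix v assume v: "v : Q"
  hence "res R v ~= 0" by (simp add: Qe)
  moreover from this have "v < N" using resN[of v] by (cases "v < N") auto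
  ultimately show "v : R" using m(1)[rule_format, of v] by (simp split: if_splits)
 qed
 have QV: "Q <= rm S" using QR RV by blast
 have QN: "v < N" if "v : Q" for v using that QV by (auto simp: rm_iff)
 have nc: "~ conf pp dd u v" if "u : Q" "v : Q" for u v
 proof (cases "u = v")
  case True
  \<comment> \<open>The matching skips \<open>u = v\<close>; that undecided literals have large mass
    excludes this conflict.\<close>
  have "pp < 8 * dd u (ng u)" using rm_und QV that by blast
  also have "... <= dd u (ng u) * 2 ^ 64 * pk P" using k1 by simp
  finally show ?thesis using True by (simp add: conf_eq)
 next
  case False
  have "u : R" "v : R" "res R u ~= 0" "res R v ~= 0" using that QR by (auto simp: Qe)
  thus ?thesis using m(2)[rule_format, of u v] False by auto
 qed
 let ?T = "%h. ballS P pp dd S Q h"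
 have Tiff: "v : ?T h \<longleftrightarrow> v : rm S & (EX u:Q. dd u v <= h)" for v h using QN by (auto simp: ballS_def)
 let ?E = "{(u, v). u : rm S & v : rm S & adjb u v}"
 have "EX h<wd. wd * card {(u, v) : ?E. u : ?T h & v ~: ?T h} <= (SUM (u, v):?E. dd u v)"
 proof (rule region_threshold[OF arcs_fin _ wd_pos])
  fix u v h h' assume e: "(u, v) : ?E" "u : ?T h" "v ~: ?T h'"
  then obtain a where a: "a : Q" "dd a u <= h" by (auto simp: Tiff)
  have "dd a v <= dd a u + dd u v" using e QN[OF a(1)] by (intro tri) (auto simp: rm_iff)
  moreover have "h' < dd a v" using e a by (auto simp: Tiff not_le)
  ultimately show "h' < h + dd u v" using a(2) by simp
 qed
 hence ex: "EX h<wd. bmul P wd (cntb P S (?T h)) <= volr dd (rm S)"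
  using cnt_le NNK(2) unfolding cnt_eq[symmetric] vol_eq[symmetric] by (metis bmul_eq order_trans)
 define h where "h = thr P pp dd S"
 have h: "h < wd" "bmul P wd (cntb P S (?T h)) <= volr dd (rm S)"
  using bleast[OF wd_K ex] unfolding h_def thr_def Q_def by auto
 have TT: "TT = ?T h" by (simp add: TT_def Q_def h_def)
 show "wd * cntb P S TT <= volr dd (rm S)"
  using h(2) cnt_le[of S "?T h"] NNK(2) by (simp add: TT bmul_eq)
 show TV: "TT <= rm S" by (auto simp: TT Tiff)
 show dj: "ng v ~: TT" if v: "v : TT" for v
 proof
  assume v': "ng v : TT"
  obtain a where a: "a : Q" "dd a v <= h" using v by (auto simp: TT Tiff)
  obtain b where b: "b : Q" "dd b (ng v) <= h" using v' by (auto simp: TT Tiff)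
  have N: "a < N" "b < N" "v < N" using QN a b v TV by (auto simp: rm_iff)
  have "dd v (ng b) = dd b (ng v)" using dsym[of b "ng v"] N by simp
  hence "dd a (ng b) <= 2 * h" using tri[of a v "ng b"] N a b by simp
  hence "dd a (ng b) * 2 ^ 64 * pk P <= (2 * h) * 2 ^ 64 * pk P" by (intro mult_right_mono) auto
  also have "... <= pp" by (rule wd_th[OF h(1)])
  finally show False using nc[OF a(1) b(1)] by (simp add: conf_eq)
 qed
 have QT: "Q <= TT"
 proof
  fix u assume u: "u : Q"
  have "dd u u <= h" using dd0[OF QN[OF u]] by simp
  thus "u : TT" using u QV unfolding TT Tiff by blast
 qed
 have Qdj: "ng v ~: Q" if "v : Q" for v using dj QT that by blast
 have finQ: "finite Q" by (rule finite_subset[OF QV rm_fin])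
 have wQ: "wtot dd S <= 128 * (SUM v:Q. wt dd S v)"
 proof -
  have "wtot dd S <= 128 * (SUM v<N. res R v)" using z by (simp add: zok_eq R_def)
  also have "(SUM v<N. res R v) = (SUM v:Q. res R v)" using QN by (intro sum.mono_neutral_right) (auto simp: Qe)
  also have "... <= (SUM v:Q. wt dd S v)"
  proof (rule sum_mono)
   fix v assume v: "v : Q"
   show "res R v <= wt dd S v" using m(1)[rule_format, OF QN[OF v]] QR v by (auto split: if_splits)
  qed
  finally show ?thesis by simp
 qed
 have wmono: "wt dd (S Un TT) v <= wt dd S v" for v
 proof -
  have sub: "rm (S Un TT) <= rm S" by (auto simp: rm_iff)
  have "(SUM u<N. if u : rm (S Un TT) then (if adjb v u then dd v u else 0) + (if adjb u v then dd u v else 0) else 0)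
    <= (SUM u<N. if u : rm S then (if adjb v u then dd v u else 0) + (if adjb u v then dd u v else 0) else 0)"
   using sub by (intro sum_mono) auto
  thus ?thesis using sub by (auto simp: wt_eq)
 qed
 have "wtot dd (S Un TT) + 2 * (SUM v:Q. wt dd S v) <= wtot dd S"
 proof -
  let ?nQ = "ng ` Q"
  have dis: "Q Int ?nQ = {}"
  proof (rule equals0I)
   fix x assume x: "x : Q Int ?nQ"
   then obtain y where "y : Q" "x = ng y" by blast
   thus False using Qdj[of y] x by simp
  qed
  have inj: "inj_on (ng) Q" using QN by (auto simp: inj_on_def ng_inj)
  have "(SUM v:?nQ. wt dd S v) = (SUM v:Q. wt dd S v)"
   using QN by (simp add: sum.reindex[OF inj] wt_ng)
  moreover have "(SUM v:Q Un ?nQ. wt dd S v) = (SUM v:Q. wt dd S v) + (SUM v:?nQ. wt dd S v)"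
   by (rule sum.union_disjoint[OF finQ finite_imageI[OF finQ] dis])
  moreover have "wtot dd (S Un TT) = (SUM v:rm (S Un TT). wt dd (S Un TT) v)"
   unfolding wtot_eq by (rule sum.mono_neutral_right) (auto simp: rm_iff wt_eq)
  moreover have "(SUM v:rm (S Un TT). wt dd (S Un TT) v) <= (SUM v:rm (S Un TT). wt dd S v)" by (rule sum_mono) (rule wmono)
  moreover have "(SUM v:rm (S Un TT). wt dd S v) + (SUM v:Q Un ?nQ. wt dd S v) <= wtot dd S"
  proof -
   have "rm (S Un TT) Int (Q Un ?nQ) = {}" using QT QN by (auto simp: rm_iff)
   hence "(SUM v:rm (S Un TT). wt dd S v) + (SUM v:Q Un ?nQ. wt dd S v) = (SUM v:rm (S Un TT) Un (Q Un ?nQ). wt dd S v)"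
    using finQ by (intro sum.union_disjoint[symmetric]) auto
   also have "... <= (SUM v<N. wt dd S v)" using QN by (intro sum_mono2) (auto simp: rm_iff)
   finally show ?thesis by (simp add: wtot_eq)
  qed
  ultimately show ?thesis by linarith
 qed
 thus "64 * wtot dd (S Un TT) <= 63 * wtot dd S" using wQ by linarith
qed

end

section \<open>Rounding a leaf\<close>

context rowloc begin

text \<open>An unfinished row was abandoned because no walk on the uncovered set \<open>U\<close>
  has a sparse sweep cut. The spectral certificate then applies to the sign vector of any
  \<open>X\<close> that takes one of each literal and its negation.\<close>

lemma certificate:
 assumes nd: "~ rdone P dd S (row dd S W)"
  and X: "!!u. u < N ==> u : X \<longleftrightarrow> ng u ~: X"
 defines "U \<equiv> unc P S (row dd S W)"
 shows "WT <= 2 ^ 63 * (SUM u<N. SUM v<N. if u : U & v : U & u : X & v ~: X then W u v else 0)"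
proof -
 let ?b = "row dd S W"
 define y where "y i t v = walk P U Eg wL lm i t v" for i t v
 have nf: "~ fd P U Eg wL lm" using row_final(2) nd unfolding rfd_def U_def by blast
 have UN: "v < N" if "v : U" for v using that by (auto simp: U_def unc_def rm_iff)
 have Ufin: "finite U" by (rule finite_subset[of _ "{..<N}"]) (use UN in auto)
 have Ung: "ng v : U" if "v : U" for v using unc_ng[OF rinv_row] that by (simp add: U_def)
 have sU: "(SUM u<N. if u : U then f u else 0) = (SUM u:U. f u)" for f :: "nat => nat"
 proof -
  have "{..<N} Int U = U" using UN by auto
  thus ?thesis using sum.inter_restrict[of "{..<N}" f U] by simp
 qed
 have EgK: "Eg u v <= pK P" if "u < N" "v < N" for u v using Eg_le[OF that] by (rule lmK)
 have Edeg: "(SUM u:U. Eg u v) <= (SUM u<N. W v u) * wT" if "v : U" for v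
 proof -
  have "(SUM u:U. Eg u v) = (SUM u:U. W v u) * wT" by (simp add: Eg_eq Wsym[of _ v] sum_distrib_right)
  also have "... <= (SUM u<N. W v u) * wT" using UN by (intro mult_right_mono sum_mono2) auto
  finally show ?thesis .
 qed
 have cU: "2 * (SUM v:U. wL v) >= wT * WT"
 proof -
  have sp: "cov P dd S ?b + (SUM v:U. wv v) = wT"
  proof -
   have "cov P dd S ?b + (SUM v<N. if v : U then wv v else 0) = (SUM v<N. wv v)"
    unfolding cov_def sumN sum.distrib[symmetric] by (intro sum.cong) (auto simp: U_def unc_def wt_eq)
   thus ?thesis by (simp add: sU wtot_eq)
  qed
  have "wT <= 2 * (SUM v:U. wv v)" using nd sp by (simp add: rdone_def)
  hence "wT * WT <= 2 * (SUM v:U. wv v) * WT" by (rule mult_right_mono) simp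
  also have "... = 2 * (SUM v:U. wv v * WT)" by (simp add: sum_distrib_right)
  also have "... <= 2 * (SUM v:U. wL v)" using UN by (intro mult_left_mono sum_mono) (auto simp: wL_eq)
  finally show ?thesis .
 qed
 have Une: "U ~= {}"
 proof
  assume "U = {}"
  thus False using cU wT_pos WT_pos by simp
 qed
 define s where "s v = (if v : X then 1 else -1 :: real)" for v
 have main: "(SUM v:U. real (wL v)) <= real (2 ^ 59) * (SUM u:U. SUM v:U. real (Eg u v) * (s u - s v)^2)"
 \<comment> \<open>\<open>2^28\<close> is the threshold in \<open>good\<close>, \<open>2^59\<close>
   is eight times its square, and \<open>T\<close> is the last time below \<open>Tw\<close>.\<close>
 proof (rule spectral_certificate[where ng = "ng" and y = y and lam = lm and C = "2 ^ 28" and T = "N * N * 2 ^ 62"])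
  show "finite U" by (rule Ufin)
  show "ng v : U" if "v : U" for v using Ung[OF that] .
  show "ng (ng v) = v" if "v : U" for v using UN[OF that] by simp
  show "Eg u v = Eg v u" for u v by (simp add: Eg_eq Wsym[of u v])
  show "Eg (ng u) (ng v) = Eg u v" if "u : U" "v : U" for u v using Wng UN that by (simp add: Eg_eq)
  show "wL (ng v) = wL v" if "v : U" for v
  proof -
   have v: "v < N" using UN[OF that] .
   have "(SUM u<N. W (ng v) u) = (SUM u<N. W (ng v) (ng u))" by (rule sum_ng[symmetric])
   also have "... = (SUM u<N. W v u)" using Wng[OF v] by (intro sum.cong) auto
   finally show ?thesis using v by (simp add: wL_eq wt_ng)
  qed
  show "(SUM u:U. Eg u v) <= wL v" if "v : U" for v using Edeg[OF that] wL_eq[OF UN[OF that]] by simp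
  show lm2: "2 * (SUM u:U. Eg u v) <= lm" if "v : U" for v
  proof -
   have "(SUM u<N. W v u) * wT <= WT * wT" using row_le[OF UN[OF that]] by (rule mult_right_mono) simp
   thus ?thesis using Edeg[OF that] lm_eq mult.commute[of WT wT] by linarith
  qed
  show "0 < lm" using wT_pos WT_pos by (simp add: lm_eq)
  show "y i 0 v = (if v = i then 1 else 0)" if "v : U" for i v
   using UN[OF that] NK(1) unfolding y_def walk_def by (subst bitr_0) linarith+
  show "y i (Suc t) v = 2 ^ 59 * ((SUM u:U. y i t u * Eg u v) + y i t v * (lm - (SUM u:U. Eg u v))) + y i t v * wL v"
   if v: "v : U" and t: "t < N * N * 2 ^ 62" for i t v
  proof -
   have vN: "v < N" using UN[OF v] .
   have "y i (Suc t) v = wstep P U Eg wL lm (y i t) v"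
    unfolding y_def walk_def using t TwK Twv by (intro bitr_Suc less_le_trans[OF vN NK(1)]) auto
   also have "... = ((SUM u:U. bmul P (y i t u) (Eg u v)) + bmul P (y i t v) (lm - (SUM u:U. Eg u v))) * 2 ^ 59 + bmul P (y i t v) (wL v)"
    using v by (simp add: wstep_def sU shl_num)
   also have "(SUM u:U. bmul P (y i t u) (Eg u v)) = (SUM u:U. y i t u * Eg u v)"
    using EgK UN v by (intro sum.cong) (auto simp: bmul_eq)
   also have "bmul P (y i t v) (lm - (SUM u:U. Eg u v)) = y i t v * (lm - (SUM u:U. Eg u v))"
    by (rule bmul_eq[OF lmK]) simp
   also have "bmul P (y i t v) (wL v) = y i t v * wL v" by (rule bmul_eq[OF lmK[OF wL_le[OF vN]]])
   finally show ?thesis by (simp only: mult.commute)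
  qed
  show "(0::nat) < 2 ^ 28" "8 * (2 ^ 28)^2 <= (2::nat) ^ 59" by simp_all
  show "let A = {v : U. y i t m - y i t (ng m) <= y i t v - y i t (ng v)}
    in (SUM v:U. int (wL v) * \<bar>bsgn (ng) A v\<bar>) <= int (2 ^ 28) * (SUM u:U. SUM v:U. int (Eg u v) * \<bar>bsgn (ng) A u - bsgn (ng) A v\<bar>)"
   if i: "i : U" and m: "m : U" and t: "t <= N * N * 2 ^ 62" and xm: "y i t (ng m) < y i t m" for i t m
  proof -
   define A where "A = {v : U. y i t m - y i t (ng m) <= y i t v - y i t (ng v)}"
   have As: "swp P U (y i t) m = A" using xm by (auto simp: swp_def xx_def A_def)
   have mA: "m : A" using m by (simp add: A_def)
   have "~ fd3 P U Eg wL lm i t m"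
   proof
    assume "fd3 P U Eg wL lm i t m"
    hence "fd2 P U Eg wL lm i t" using UN[OF m] by (auto simp: fd2_def)
    moreover have "t < Tw P" using t by (simp only: Twv)
    ultimately have "bex P (Tw P) (%t1. fd2 P U Eg wL lm i t1)" unfolding bex_eq[OF TwK] by blast
    hence "fd1 P U Eg wL lm i" using i by (simp add: fd1_def)
    thus False using nf UN[OF i] by (auto simp: fd_def)
   qed
   moreover have "walk P U Eg wL lm i t = y i t" by (simp add: y_def fun_eq_iff)
   ultimately have "~ good P U Eg wL A" by (simp add: fd3_def As)
   hence lt: "meas P wL A < bnd P U Eg A * 2 ^ 28" using mA UN[OF m] by (auto simp: good_def shl_num)
   have AU: "A <= U" by (auto simp: A_def)
   have ngA: "v : U" if "v < N" "ng v : A" for v using Ung[of "ng v"] AU that by auto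
   have "meas P wL A = (SUM v<N. if v : U then (if v : A | ng v : A then wL v else 0) else 0)"
    unfolding meas_def sumN using AU ngA by (intro sum.cong) auto
   also have "... = (SUM v:U. if v : A | ng v : A then wL v else 0)" by (rule sU)
   finally have 1: "int (meas P wL A) = (SUM v:U. int (wL v) * \<bar>bsgn (ng) A v\<bar>)"
    by (auto simp: bsgn_def intro!: sum.cong)
   have el: "el1 P x z <= pK P" for x z using numK[of 2] numK[of 1] by (auto simp: el1_def)
   have "bnd P U Eg A = (SUM u<N. if u : U then (SUM v<N. if v : U then Eg u v * el1 P (bc P A u) (bc P A v) else 0) else 0)"
    unfolding bnd_def sumN by (intro sum.cong refl) (auto simp: bmul_eq[OF el] cong: if_cong intro!: sum.neutral)
   also have "... = (SUM u:U. SUM v:U. Eg u v * el1 P (bc P A u) (bc P A v))" by (simp add: sU)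
   finally have "int (bnd P U Eg A) = (SUM u:U. SUM v:U. int (Eg u v) * int (el1 P (bc P A u) (bc P A v)))" by simp
   also have "... = (SUM u:U. SUM v:U. int (Eg u v) * \<bar>bsgn (ng) A u - bsgn (ng) A v\<bar>)"
    by (intro sum.cong refl arg_cong2[where f = "(*)"]) (auto simp: bsgn_def bc_def el1_def)
   finally have 2: "int (bnd P U Eg A) = ..." .
   have "int (meas P wL A) <= int (2 ^ 28 * bnd P U Eg A)" using lt by (simp only: of_nat_le_iff mult.commute)
   thus ?thesis unfolding A_def[symmetric] Let_def 1[symmetric] 2[symmetric] by simp
  qed
  show "\<bar>s v\<bar> = 1" for v by (simp add: s_def)
  show "s (ng v) = - s v" if "v : U" for v using X[OF UN[OF that]] by (simp add: s_def)
  show "2 ^ 59 * lm * (card U)^2 <= 2 * (N * N * 2 ^ 62) * (SUM v:U. wL v)"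
  proof -
   have "card U <= N" using card_mono[of "{..<N}" U] UN by auto
   hence "(card U)^2 <= N * N" by (simp add: power2_eq_square mult_mono)
   hence "2 ^ 59 * lm * (card U)^2 <= 2 ^ 59 * lm * (N * N)" by (rule mult_left_mono) simp
   also have "... = 2 ^ 60 * (N * N) * (wT * WT)" by (simp add: lm_eq)
   also have "... <= 2 ^ 60 * (N * N) * (2 * (SUM v:U. wL v))" using cU by (rule mult_left_mono) simp
   also have "... <= 2 * (N * N * 2 ^ 62) * (SUM v:U. wL v)" by simp
   finally show ?thesis .
  qed
  show "U ~= {}" by (rule Une)
 qed
 let ?Z = "SUM u:U. SUM v:U. if u : X & v ~: X then W u v else 0"
 \<comment> \<open>The squared difference is 4 exactly on separated pairs, which occur in both
   orders; hence the factor 8 in the result.\<close>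
 have "(SUM u:U. SUM v:U. real (Eg u v) * (s u - s v)^2) = (SUM u:U. SUM v:U. 4 * real wT * (real (if u : X & v ~: X then W u v else 0) + real (if v : X & u ~: X then W v u else 0)))"
  by (intro sum.cong refl) (auto simp: s_def Eg_eq Wsym)
 also have "... = 4 * real wT * ((SUM u:U. SUM v:U. real (if u : X & v ~: X then W u v else 0)) + (SUM u:U. SUM v:U. real (if v : X & u ~: X then W v u else 0)))"
  by (simp only: sum_distrib_left[symmetric] sum.distrib)
 also have "(SUM u:U. SUM v:U. real (if v : X & u ~: X then W v u else 0)) = (SUM u:U. SUM v:U. real (if u : X & v ~: X then W u v else 0))"
  by (rule sum.swap)
 also have "(SUM u:U. SUM v:U. real (if u : X & v ~: X then W u v else 0)) = real ?Z" by (simp only: of_nat_sum)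
 finally have sE: "(SUM u:U. SUM v:U. real (Eg u v) * (s u - s v)^2) = 8 * real wT * real ?Z" by simp
 have "real (wT * WT) <= real (2 * (SUM v:U. wL v))" using cU by (simp only: of_nat_le_iff)
 also have "... <= 2 * (real (2 ^ 59) * (8 * real wT * real ?Z))" using main unfolding sE by simp
 also have "... = real (wT * (2 ^ 63 * ?Z))" by simp
 finally have "wT * WT <= wT * (2 ^ 63 * ?Z)" by (simp only: of_nat_le_iff)
 hence le: "WT <= 2 ^ 63 * ?Z" using wT_pos by (simp only: nat_mult_le_cancel1)
 have "(SUM u<N. SUM v<N. if u : U & v : U & u : X & v ~: X then W u v else 0) = (SUM u<N. if u : U then (SUM v<N. if v : U then (if u : X & v ~: X then W u v else 0) else 0) else 0)"
  by (intro sum.cong refl) (auto intro!: sum.neutral sum.cong)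
 also have "... = ?Z" by (simp add: sU)
 finally show ?thesis using le by simp
qed

end

context rndS begin

text \<open>The two sides of a separating hyperplane. Every assignment separates at least
  \<open>2^(-63)\<close> of the weight; the leaf separates at most \<open>2^(-64)\<close> of it on
  average, as the weights sit on \<open>close\<close> pairs.\<close>

lemma stuck_certificate:
 assumes st: "stuck P pp dd S"
 defines "l \<equiv> lsel P pp dd S"
 defines "W \<equiv> WW P pp dd S (rows P pp dd S) l"
  and "U \<equiv> unc P S (rowl P (rows P pp dd S) l)"
 shows "!!X. (!!u. u < N ==> u : X \<longleftrightarrow> ng u ~: X) ==>
   Wsum P W <= 2 ^ 63 * (SUM u<N. SUM v<N. if u : U & v : U & u : X & v ~: X then W u v else 0)"
  and "2 ^ 64 * (SUM u<N. SUM v<N. if u : U & v : U then W u v * dd u v else 0) <= Wsum P W * pp"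
  and "1 <= Wsum P W" "Wsum P W <= 2 ^ (33554434 * L)"
  and "W u v <= 2 ^ (33554432 * L)"
proof -
 have l: "l < DD" "stk1 P pp dd S l"
  using bleast[OF DK(2) st[unfolded stuck_def bex_eq[OF DK(2)]]] unfolding l_def lsel_def by auto
 have WWl: "W = Wl l" by (simp add: W_def rwf_def)
 interpret rw: rowloc P pp dd S W unfolding WWl using l(1) by (intro rowloc_l) simp
 have eq: "rowl P rwf l v = row dd S W v" if "v < N" for v
  using rows_spec[OF l(1) that] l(1) by (simp add: rowl_def WWl)
 have "cov P dd S (rowl P rwf l) = cov P dd S (row dd S W)"
  unfolding cov_def sumN by (intro sum.cong) (auto simp: eq)
 hence nd: "~ rdone P dd S (row dd S W)" using l(2) by (simp add: stk1_def rdone_def rwf_def)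
 have U: "U = unc P S (row dd S W)" unfolding U_def rwf_def[symmetric]
  by (auto simp: unc_def rm_iff eq)
 show "Wsum P W <= 2 ^ 63 * (SUM u<N. SUM v<N. if u : U & v : U & u : X & v ~: X then W u v else 0)"
  if "!!u. u < N ==> u : X \<longleftrightarrow> ng u ~: X" for X
  unfolding U by (rule rw.certificate[OF nd that])
 show "1 <= Wsum P W" using rw.WT_pos by simp
 show "Wsum P W <= 2 ^ (33554434 * L)" by (rule rw.WT_le)
 show "W u v <= 2 ^ (33554432 * L)" by (rule rw.Wle)
 let ?f = "%u v. if u : U & v : U then W u v * dd u v else 0"
 have sw: "(SUM u<N. SUM v<N. ?f u v) = (SUM u<N. SUM v<N. ?f v u)" by (rule sum.swap)
 have "2 ^ 64 * (SUM u<N. SUM v<N. ?f u v) = 2 ^ 63 * ((SUM u<N. SUM v<N. ?f u v) + (SUM u<N. SUM v<N. ?f v u))"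
  using sw by simp
 also have "... = (SUM u<N. SUM v<N. 2 ^ 63 * (?f u v + ?f v u))"
  by (simp only: sum.distrib[symmetric] sum_distrib_left)
 also have "... <= (SUM u<N. SUM v<N. W u v * pp)"
 proof (intro sum_mono)
  fix u v
  show "2 ^ 63 * (?f u v + ?f v u) <= W u v * pp"
  proof (cases "W u v = 0")
   case True
   thus ?thesis using rw.Wsym[of u v] by simp
  next
   case False
   hence c: "(dd u v + dd v u) * 2 ^ 63 <= pp" using l(1)
    by (simp add: WWl W_eq close_eq split: if_splits)
   have "2 ^ 63 * (?f u v + ?f v u) <= W u v * ((dd u v + dd v u) * 2 ^ 63)"
    using rw.Wsym[of u v] by (simp add: algebra_simps)
   also have "... <= W u v * pp" using c by (rule mult_left_mono) simp
   finally show ?thesis .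
  qed
 qed
 also have "... = Wsum P W * pp" by (simp add: rw.WT_eq sum_distrib_right)
 finally show "2 ^ 64 * (SUM u<N. SUM v<N. ?f u v) <= Wsum P W * pp" .
qed

end

locale leaf = rounding +
 assumes nodense: "!!u. u < nn P ==> und P pp dd u ==> card {v. v < nn P & close P pp dd u v} <= 2 ^ pb P"
begin

text \<open>Arcs are counted together with their mirror images, because a partial set
  \<open>S\<close> may decide the ends of an arc through either of the two.\<close>

definition bset :: "nat set => (nat \<times> nat) set" where
 "bset S = {(u, v). u < N & v < N & adjb u v & ((u : S & v ~: S) | (ng v : S & ng u ~: S))}"

abbreviation "V0 \<equiv> volr dd {u. u < N}"
abbreviation "wid0 \<equiv> wid P pp"

lemma bset_fin: "finite (bset S)"
 by (rule finite_subset[of _ "{..<N} \<times> {..<N}"]) (auto simp: bset_def)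

text \<open>A newly cut arc leaves \<open>T\<close> within the remaining literals, or its mirror
  image does.\<close>

lemma bset_Un:
 assumes "T <= rm S"
 shows "card (bset (S Un T)) <= card (bset S) + 2 * cntb P S T"
proof -
 let ?E = "{(u, v) : {(u, v). u : rm S & v : rm S & adjb u v}. u : T & v ~: T}"
 let ?g = "%(u, v). (ng v, ng u)"
 have fE: "finite ?E" by (rule finite_subset[OF _ arcs_fin[of S]]) auto
 have "bset (S Un T) <= bset S Un ?E Un ?g ` ?E"
 proof
  fix e assume e: "e : bset (S Un T)"
  obtain u v where uv: "e = (u, v)" by (cases e)
  have N: "u < N" "v < N" "adjb u v" using e uv by (auto simp: bset_def)
  consider "u : S Un T" "v ~: S Un T" | "ng v : S Un T" "ng u ~: S Un T" using e uv by (auto simp: bset_def)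
  thus "e : bset S Un ?E Un ?g ` ?E"
  proof cases
   case 1
   show ?thesis
   proof (cases "(u, v) : bset S")
    case False
    hence "u : T" "ng v ~: S" using 1 N assms by (auto simp: bset_def rm_iff)
    thus ?thesis using 1 N assms uv by (auto simp: rm_iff)
   qed (simp add: uv)
  next
   case 2
   show ?thesis
   proof (cases "(u, v) : bset S")
    case False
    hence t: "ng v : T" "u ~: S" using 2 N assms by (auto simp: bset_def rm_iff)
    hence "(ng v, ng u) : ?E" using 2 N assms adj_sym[of u v] by (auto simp: rm_iff)
    hence "?g (ng v, ng u) : ?g ` ?E" by (rule imageI)
    thus ?thesis using N uv by simp
   qed (simp add: uv)
  qed
 qed
 hence "card (bset (S Un T)) <= card (bset S Un ?E Un ?g ` ?E)"
  using bset_fin fE by (intro card_mono) auto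
 also have "... <= card (bset S) + card ?E + card (?g ` ?E)"
  by (meson card_Un_le add_right_mono order_trans)
 also have "... <= card (bset S) + 2 * cntb P S T"
  using card_image_le[OF fE, of ?g] by (simp add: cnt_eq)
 finally show ?thesis .
qed

lemma und_eq: "u < N ==> und P pp dd u \<longleftrightarrow> pp < 8 * dd u (ng u) & pp < 8 * dd (ng u) u"
 by (simp add: und_def tr_def shl_num mult.commute)

lemma wd_eq: "wid0 = pp div (pk P * 2 ^ 65)"
 using k1 by (simp add: wid_def shl_65 bdiv_eq)

lemma vol_le_wtot: "volr dd (rm S) <= wtot dd S" "wtot dd S <= N + 2 * volr dd (rm S)"
proof -
 let ?a = "%u v. if adjb u v & u : rm S & v : rm S then dd u v else 0"
 have w: "wt dd S u = (if u : rm S then 1 else 0) + ((SUM v<N. ?a u v) + (SUM v<N. ?a v u))" for u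
  unfolding wt_eq sum.distrib[symmetric] by (auto intro!: sum.cong)
 have "wtot dd S = (SUM u<N. if u : rm S then 1 else 0) + (volr dd (rm S) + (SUM u<N. SUM v<N. ?a v u))"
  unfolding wtot_eq w by (simp only: sum.distrib volr_def sumN)
 also have "(SUM u<N. SUM v<N. ?a v u) = volr dd (rm S)" unfolding volr_def sumN by (rule sum.swap)
 finally have e: "wtot dd S = (SUM u<N. if u : rm S then 1 else 0) + 2 * volr dd (rm S)" by simp
 show "volr dd (rm S) <= wtot dd S" using e by simp
 have "(SUM u<N. if u : rm S then 1 else 0) <= (SUM u<N. 1::nat)" by (rule sum_mono) simp
 thus "wtot dd S <= N + 2 * volr dd (rm S)" using e by simp
qed

lemma vol_mono: "volr dd (rm S) <= V0"
 unfolding volr_def sumN by (intro sum_mono) (auto simp: rm_iff)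

text \<open>An amortised invariant: a round adds at most \<open>2 * wtot\<close> to the cut term and
  removes a 64th of the weight, whence the factor 128. The right-hand side is the estimate after the
  first round, \<open>2 * V0 + 128 * (N + 2 * V0)\<close>.\<close>

definition ok :: "nat set => bool" where
 "ok S \<longleftrightarrow> S <= {..<N} & (ALL v:S. ng v ~: S) & (ALL u:rm S. und P pp dd u) &
   wid0 * card (bset S) + 128 * wtot dd S <= 258 * V0 + 128 * N"

text \<open>By \<open>bal\<close> and \<open>tot\<close> the mass of the negation rises along an arc
  by at most the length of the arc, so it can be swept like a distance. Literals left outside have
  both masses above \<open>pp / 8\<close>.\<close>

lemma round0: "ok (ball0 P pp dd (thr0 P pp dd))"
proof -
 let ?w = "pp div 8" let ?T = "%h. ball0 P pp dd h"
 have w8: "pp div 2 div 2 div 2 = ?w" by (simp add: div_mult2_eq[symmetric])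
 have "(2::nat) ^ 3 <= 2 ^ (4 * L)" using L64 by (intro power_increasing) auto
 hence pp8: "8 <= pp" using pplow by simp
 hence wpos: "0 < ?w" by simp
 have wK: "?w <= pK P" using ppK by (meson div_le_dividend order_trans)
 have Tiff: "v : ?T h \<longleftrightarrow> v < N & dd (ng v) v <= ?w + 1 + h" for v h by (auto simp: ball0_def tr_def w8)
 let ?E = "{(u, v). u : rm {} & v : rm {} & adjb u v}"
 have rm0: "rm {} = {u. u < N}" by (auto simp: rm_iff)
 have "EX h<?w. ?w * card {(u, v) : ?E. u : ?T h & v ~: ?T h} <= (SUM (u, v):?E. dd u v)"
 proof (rule region_threshold[OF arcs_fin _ wpos])
  fix u v h h' assume e: "(u, v) : ?E" "u : ?T h" "v ~: ?T h'"
  hence N: "u < N" "v < N" by (auto simp: rm_iff)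
  have "dd u v + dd v (ng v) = dd v u + dd u (ng u)" using bal N by blast
  moreover have "dd u (ng u) + dd (ng u) u = pp" "dd v (ng v) + dd (ng v) v = pp" using tot N by auto
  moreover have "dd (ng u) u <= ?w + 1 + h" "?w + 1 + h' < dd (ng v) v" using e N by (auto simp: Tiff)
  ultimately show "h' < h + dd u v" by linarith
 qed
 hence ex: "EX h<?w. bmul P ?w (cntb P {} (?T h)) <= volr dd (rm {})"
  using cnt_le NNK(2) unfolding cnt_eq[symmetric] vol_eq[symmetric] by (metis bmul_eq order_trans)
 define h where "h = thr0 P pp dd"
 have h: "h < ?w" "bmul P ?w (cntb P {} (?T h)) <= volr dd (rm {})"
  using bleast[OF wK ex] unfolding h_def thr0_def w8 by auto
 have c: "?w * cntb P {} (?T h) <= V0" using h(2) cnt_le[of "{}" "?T h"] NNK(2) rm0 by (simp add: bmul_eq)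
 have sub: "?T h <= rm {}" by (auto simp: rm_iff Tiff)
 have wle: "wid0 <= ?w"
 proof -
  have "8 <= pk P * 2 ^ 65" using mult_mono[of 1 "pk P" 8 "2^65"] k1 by simp
  thus ?thesis unfolding wd_eq by (intro div_le_mono2) auto
 qed
 have b0: "card (bset {}) = 0" by (simp add: bset_def)
 have "wid0 * card (bset (?T h)) <= ?w * (2 * cntb P {} (?T h))"
  using wle bset_Un[OF sub] b0 by (intro mult_mono) auto
 also have "... <= 2 * V0" using c by simp
 finally have 1: "wid0 * card (bset (?T h)) <= 2 * V0" .
 have 2: "wtot dd (?T h) <= N + 2 * V0" using vol_le_wtot(2)[of "?T h"] vol_mono[of "?T h"] by linarith
 have 3: "ng v ~: ?T h" if "v : ?T h" for v
 proof
  assume "ng v : ?T h"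
  hence "dd v (ng v) <= ?w + 1 + h" "dd (ng v) v <= ?w + 1 + h" "v < N" using that by (auto simp: Tiff)
  moreover have "8 * ?w <= pp" by simp
  ultimately show False using tot[of v] h(1) wpos by linarith
 qed
 have 4: "und P pp dd u" if "u : rm (?T h)" for u
 proof -
  have "u < N" "?w + 1 + h < dd (ng u) u" "?w + 1 + h < dd u (ng u)" using that by (auto simp: rm_iff Tiff)
  thus ?thesis by (auto simp: und_eq)
 qed
 show ?thesis unfolding ok_def h_def[symmetric] using 1 2 3 4 by (auto simp: Tiff)
qed

lemma ok_rndS: "ok S ==> nempty P S ==> rndS P pp dd S"
proof unfold_locales
 assume o: "ok S" and n: "nempty P S"
 show "rm S ~= {}" using n by (auto simp: nempty_def)
 show "card {u. u < N & close P pp dd v u} <= 2 ^ pb P" if "v : rm S" for v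
  using nodense[of v] o that by (auto simp: ok_def rm_iff)
 show "pp < 8 * dd v (ng v)" if "v : rm S" for v
  using o that und_eq[of v] by (auto simp: ok_def rm_iff)
qed

lemma ok_step:
 assumes o: "ok S" and n: "nempty P S" and s: "~ stuck P pp dd S"
 defines "S' \<equiv> S Un ballS P pp dd S (Rp P pp dd S) (thr P pp dd S)"
 shows "ok S'" "card S < card S'"
proof -
 interpret rs: rndS P pp dd S by (rule ok_rndS[OF o n])
 note st = rs.round_step[OF s]
 have S': "S' = S Un rs.TT" by (simp add: S'_def rs.TT_def)
 have sN: "S' <= {..<N}" using o st(1) by (auto simp: S' ok_def rm_iff)
 have dj: "ng v ~: S'" if "v : S'" for v
  using that o st(1) st(2)[of v] by (auto simp: S' ok_def rm_iff subset_iff)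
 have un: "und P pp dd u" if "u : rm S'" for u using that o by (auto simp: S' ok_def rm_iff)
 have "wid0 * card (bset S') <= wid0 * (card (bset S) + 2 * cntb P S rs.TT)"
  unfolding S' by (rule mult_left_mono[OF bset_Un[OF st(1)]]) simp
 also have "... <= wid0 * card (bset S) + 2 * volr dd (rm S)" using st(4) by (simp add: algebra_simps)
 also have "... <= wid0 * card (bset S) + 2 * wtot dd S" using vol_le_wtot(1)[of S] by simp
 finally have "wid0 * card (bset S') + 128 * wtot dd S' <= wid0 * card (bset S) + 128 * wtot dd S"
  using st(3) unfolding S' by linarith
 thus "ok S'" using o sN dj un by (auto simp: ok_def)
 have "S' ~= S" using st(3) rs.wT_pos unfolding S' by auto
 hence "S \<subset> S'" by (auto simp: S')
 thus "card S < card S'" by (rule psubset_card_mono[OF finite_subset[OF sN finite_lessThan]])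
qed

definition Sr :: "nat => nat set" where
 "Sr i = {v. bitr P (%i A j. if j : rnd P pp dd i {v. A v ~= 0} then 1 else 0) (%j. 0) i v ~= 0}"

lemma Sr_Suc:
 assumes "i <= N" "rnd P pp dd i (Sr i) <= {..<N}"
 shows "Sr (Suc i) = rnd P pp dd i (Sr i)"
proof -
 let ?f = "%i A j. if j : rnd P pp dd i {v. A v ~= 0} then 1 else 0 :: nat"
 have iK: "Suc i <= pK P" using assms(1) NK(2) by linarith
 have "bitr P ?f (%j. 0) (Suc i) v = (if v : rnd P pp dd i (Sr i) then 1 else 0)" for v
 proof (cases "v < pK P")
  case True
  thus ?thesis using bitr_Suc[OF iK True, of ?f "%j. 0"] by (simp add: Sr_def)
 next
  case False
  hence "v ~: rnd P pp dd i (Sr i)" using assms(2) NK(1) by (meson lessThan_iff less_le_trans subsetD)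
  thus ?thesis using False by (simp add: bitr_def itr_support)
 qed
 thus ?thesis unfolding Sr_def[of "Suc i"] by auto
qed

lemma Sr_0: "Sr 0 = {}"
 by (simp add: Sr_def bitr_def)

lemma Sr_ok:
 "i <= N ==> ok (Sr (Suc i)) & ((nempty P (Sr (Suc i)) --> stuck P pp dd (Sr (Suc i))) | i <= card (Sr (Suc i)))"
proof (induction i)
 case 0
 have e: "rnd P pp dd 0 (Sr 0) = ball0 P pp dd (thr0 P pp dd)" by (simp add: rnd_def Sr_0)
 have "Sr (Suc 0) = ball0 P pp dd (thr0 P pp dd)" using round0 by (subst Sr_Suc) (auto simp: e ok_def)
 thus ?case using round0 by simp
next
 case (Suc i)
 let ?S = "Sr (Suc i)"
 have o: "ok ?S" using Suc by simp
 show ?case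
 proof (cases "nempty P ?S & ~ stuck P pp dd ?S")
  case True
  let ?S' = "?S Un ballS P pp dd ?S (Rp P pp dd ?S) (thr P pp dd ?S)"
  have r: "rnd P pp dd (Suc i) ?S = ?S'" using True by (auto simp: rnd_def)
  have o': "ok ?S'" "card ?S < card ?S'" using ok_step[OF o] True by auto
  have "Sr (Suc (Suc i)) = ?S'" using o'(1) Suc.prems by (subst Sr_Suc) (auto simp: r ok_def)
  thus ?thesis using o' Suc True by auto
 next
  case False
  hence r: "rnd P pp dd (Suc i) ?S = ?S" by (auto simp: rnd_def)
  have "Sr (Suc (Suc i)) = ?S" using o Suc.prems by (subst Sr_Suc) (auto simp: r ok_def)
  thus ?thesis using o False by auto
 qed
qed

text \<open>Each of the \<open>N\<close> rounds after the first decides a further literal or changes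
  nothing, so a set that is still incomplete must be stuck.\<close>

lemma rnds_final: "ok (rnds P pp dd)" "nempty P (rnds P pp dd) ==> stuck P pp dd (rnds P pp dd)"
proof -
 let ?S = "rnds P pp dd"
 have S: "?S = Sr (Suc N)" by (simp add: rnds_def Sr_def)
 show o: "ok ?S" unfolding S using Sr_ok[of N] by simp
 assume n: "nempty P ?S"
 then obtain u where u: "u < N" "u ~: ?S" by (auto simp: nempty_def rm_iff)
 have "?S \<subset> {..<N}" using u o by (auto simp: ok_def)
 hence "card ?S < card {..<N}" by (rule psubset_card_mono[rotated]) simp
 thus "stuck P pp dd ?S" using Sr_ok[of N] n unfolding S by auto
qed

end

section \<open>Pseudo-measures\<close>

context alg begin

definition lits :: "nat set => nat set" where "lits g = {u. u < N & u : g}"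

lemma lits_fin [simp]: "finite (lits g)"
 by (simp add: lits_def)

lemma cns_eq: "cns g \<longleftrightarrow> (ALL u<N. u : g --> ng u ~: g)"
 by (auto simp: cns_def)

lemma clen_eq: "clen g = card (lits g)"
proof -
 have "clen g = (SUM u:{..<N}. if u : g then 1 else 0)" by (simp add: clen_def)
 also have "... = card ({..<N} Int g)" by (simp add: sum.If_cases)
 also have "{..<N} Int g = lits g" by (auto simp: lits_def)
 finally show ?thesis .
qed

lemma cns_mono: "g <= h ==> cns h ==> cns g"
 by (auto simp: cns_eq)

lemma numL: "x <= 2 ^ 64 ==> x <= pK P"
proof -
 have "(2::nat) ^ 64 <= 2 ^ L" using L64 by (rule power_increasing) simp
 thus "x <= 2 ^ 64 ==> x <= pK P" by (intro smallK) linarith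
qed

lemma powL_eq: "a <= 2 ^ 64 ==> powL P a = 2 ^ (a * L)"
proof -
 assume a: "a <= 2 ^ 64"
 have "(2::nat) ^ 64 <= 2 ^ L" using L64 by (rule power_increasing) simp
 hence "a * L <= 2 ^ L * 2 ^ L" using a by (intro mult_mono) auto
 hence "a * L <= pK P" by (intro Kle[of _ "2 * L"]) (auto simp: power_add[symmetric] mult_2)
 thus ?thesis using numL[OF a] by (simp add: powL_def bmul_eq bshl_eq mult.commute)
qed

lemma tcap_eq: "tcap = 2 ^ (134217778 * L)"
 by (simp add: tcap_def powL_eq)

lemma cUU_eq: "cUU P = 2 ^ (67108884 * L) + 2 ^ (67108874 * L)"
 by (simp add: cUU_def powL_eq)

lemma slots_eq: "slots = N * N + 1"
 by (simp add: slots_def)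

lemma ecnt_eq: "ecnt = tcap * slots"
 using NNK by (simp add: ecnt_def bmul_eq slots_eq)

lemma ecnt_le: "str * ecnt + str <= pK P" "ecnt <= pK P"
proof -
 have s: "str <= 2 ^ L" using N2 by (simp add: str_def)
 have "1 <= (2::nat) ^ (2 * L)" by simp
 hence "slots <= 2 ^ (2 * L + 1)" using NNK(1) unfolding slots_eq power_add power_one_right by linarith
 hence "ecnt <= 2 ^ (134217778 * L) * 2 ^ (2 * L + 1)" unfolding ecnt_eq tcap_eq by (intro mult_left_mono) auto
 also have "... = 2 ^ (134217780 * L + 1)" by (simp add: power_add[symmetric])
 finally have e: "ecnt <= 2 ^ (134217780 * L + 1)" .
 thus "ecnt <= pK P" by (rule Kle) (use L64 in linarith)
 have "str * ecnt + str = str * (ecnt + 1)" by simp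
 also have "... <= 2 ^ L * (2 ^ (134217780 * L + 1) + 2 ^ (134217780 * L + 1))"
  using s e by (intro mult_mono add_mono) auto
 also have "... = 2 ^ (134217781 * L + 2)" by (simp add: power_add[symmetric])
 also have "... <= pK P" by (rule Kle[OF order_refl]) (use L64 in linarith)
 finally show "str * ecnt + str <= pK P" .
qed

definition Q2 :: "nat set => nat set => int" where
 "Q2 g h = (if EX u<N. u : g & ng u : h then 0 else 2 ^ card (lits g Int lits h))"

definition ec :: "(nat => nat) => nat => int" where
 "ec lg e = int (ecp P lg e) - int (ecn P lg e)"

definition sm :: "(nat => nat) => nat set => int" where
 "sm lg g = int (mpos P lg g) - int (mneg P lg g)"

definition wfl :: "(nat => nat) => bool" where
 "wfl lg \<longleftrightarrow> (ALL e<ecnt. ec lg e ~= 0 --> cns (ebt lg e))"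

lemma mmK: "mm <= pK P"
 using qL L_le by (intro smallK) (unfold mm_def, linarith)

lemma q2sh_eq: "int (q2sh P lg g e x) = int x * Q2 g (ebt lg e)"
proof -
 have c: "bsum P N (%u. if u : g & u : ebt lg e then 1 else 0) = card (lits g Int lits (ebt lg e))"
 proof -
  have "bsum P N (%u. if u : g & u : ebt lg e then 1 else 0) = card ({..<N} Int {u. u : g & u : ebt lg e})"
   by (simp add: sum.If_cases)
  also have "{..<N} Int {u. u : g & u : ebt lg e} = lits g Int lits (ebt lg e)" by (auto simp: lits_def)
  finally show ?thesis .
 qed
 have "card (lits g Int lits (ebt lg e)) <= card {..<N}" by (rule card_mono) (auto simp: lits_def)
 hence "card (lits g Int lits (ebt lg e)) <= pK P" using NK(1) unfolding card_lessThan by linarith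
 hence b: "bshl P x (card (lits g Int lits (ebt lg e))) = x * 2 ^ card (lits g Int lits (ebt lg e))" by (simp add: bshl_eq)
 show ?thesis
 proof (cases "EX u<N. u : g & ng u : ebt lg e")
  case True
  thus ?thesis unfolding q2sh_def Q2_def exN if_P[OF True] by simp
 next
  case False
  thus ?thesis unfolding q2sh_def Q2_def exN if_not_P[OF False] c b by simp
 qed
qed

lemma sm_eq: "sm lg g = (if cns g then 2 ^ (mm - clen g) *
  (int (cUU P) + (SUM e<ecnt. ec lg e * (Q2 g (ebt lg e) - 1))) else 0)"
proof (cases "cns g")
 case True
 have mK: "mm - clen g <= pK P" using mmK by simp
 have "sm lg g = (int (cUU P) + (SUM e<ecnt. int (q2sh P lg g e (ecp P lg e)) + int (ecn P lg e))) * 2 ^ (mm - clen g)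
   - (SUM e<ecnt. int (q2sh P lg g e (ecn P lg e)) + int (ecp P lg e)) * 2 ^ (mm - clen g)"
  using True by (simp add: sm_def mpos_def mneg_def bsum_eq ecnt_le(2) bshl_eq mK)
 also have "... = 2 ^ (mm - clen g) * (int (cUU P) + ((SUM e<ecnt. int (q2sh P lg g e (ecp P lg e)) + int (ecn P lg e))
   - (SUM e<ecnt. int (q2sh P lg g e (ecn P lg e)) + int (ecp P lg e))))" by (simp add: algebra_simps)
 also have "(SUM e<ecnt. int (q2sh P lg g e (ecp P lg e)) + int (ecn P lg e))
   - (SUM e<ecnt. int (q2sh P lg g e (ecn P lg e)) + int (ecp P lg e)) = (SUM e<ecnt. ec lg e * (Q2 g (ebt lg e) - 1))"
  unfolding sum_subtractf[symmetric] by (intro sum.cong refl) (simp add: q2sh_eq ec_def algebra_simps)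
 finally show ?thesis using True by simp
qed (simp add: sm_def mpos_def mneg_def)

lemma Q2_empty: "Q2 {} h = 1"
 by (simp add: Q2_def lits_def)

lemma mcap_eq: "mcap P = cUU P * 2 ^ mm"
 by (simp add: mcap_def bshl_eq mmK)

lemma sm_empty: "sm lg {} = int (mcap P)"
proof -
 have "cns {}" "clen {} = 0" by (simp_all add: cns_eq clen_eq lits_def)
 thus ?thesis unfolding sm_eq by (simp add: Q2_empty mcap_eq)
qed

lemma cns_insert: "u < N ==> cns g ==> ng u ~: g ==> cns (insert u g)"
 unfolding cns_eq by (metis insert_iff ng_ng ng_neq)

text \<open>A free literal is a fair coin under the uniform measure, so the two conditional values
  average to the old one.\<close>

lemma Q2_split:
 assumes h: "cns h" and u: "u < N" "u ~: g" "ng u ~: g"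
 shows "Q2 (insert u g) h + Q2 (insert (ng u) g) h = 2 * Q2 g h"
proof (cases "EX w<N. w : g & ng w : h")
 case True
 thus ?thesis unfolding Q2_def by auto
next
 case False
 have key: "Q2 (insert w g) h = (if ng w : h then 0 else if w : h then 2 * Q2 g h else Q2 g h)" if w: "w < N" "w ~: g" for w
 proof (cases "ng w : h")
  case True
  thus ?thesis using w by (auto simp: Q2_def)
 next
  case nc: False
  have nx: "~ (EX x<N. x : insert w g & ng x : h)" using False nc by auto
  show ?thesis
  proof (cases "w : h")
   case True
   have "lits (insert w g) Int lits h = insert w (lits g Int lits h)" using True w by (auto simp: lits_def)
   moreover have "w ~: lits g Int lits h" using w by (simp add: lits_def)
   ultimately have "card (lits (insert w g) Int lits h) = Suc (card (lits g Int lits h))" by simp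
   thus ?thesis using nx False True nc unfolding Q2_def by simp
  next
   case nw: False
   have "lits (insert w g) Int lits h = lits g Int lits h" using nw by (auto simp: lits_def)
   thus ?thesis using nx False nw nc unfolding Q2_def by simp
  qed
 qed
 have "~ (u : h & ng u : h)" using h u(1) by (auto simp: cns_eq)
 thus ?thesis using key[of u] key[of "ng u"] u by (auto split: if_splits)
qed

text \<open>The factor \<open>2^(m - |g|)\<close> halves when a literal is added, which turns the
  averaging property of \<open>Q2\<close> into additivity. Below \<open>mm\<close> literals the
  exponent is not truncated.\<close>

lemma sm_add:
 assumes w: "wfl lg" and u: "u < N" and c: "clen g < mm"
 shows "sm lg g = sm lg (insert u g) + sm lg (insert (ng u) g)"
proof (cases "cns g & u ~: g & ng u ~: g")
 case False
 consider "~ cns g" | "cns g" "u : g" | "cns g" "ng u : g" using False by blast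
 thus ?thesis
 proof cases
  case 1
  hence "~ cns (insert u g)" "~ cns (insert (ng u) g)" using cns_mono by blast+
  thus ?thesis using 1 by (simp add: sm_eq)
 next
  case 2
  hence "~ cns (insert (ng u) g)" using u by (auto simp: cns_eq)
  thus ?thesis using 2 by (simp add: sm_eq insert_absorb)
 next
  case 3
  hence "~ cns (insert u g)" using u unfolding cns_eq by blast
  thus ?thesis using 3 by (simp add: sm_eq insert_absorb)
 qed
next
 case True
 have c1: "cns (insert u g)" "cns (insert (ng u) g)" using cns_insert u True by auto
 have "lits (insert u g) = insert u (lits g)" "lits (insert (ng u) g) = insert (ng u) (lits g)" using u by (auto simp: lits_def)
 moreover have "u ~: lits g" "ng u ~: lits g" using True by (auto simp: lits_def)
 ultimately have l: "clen (insert u g) = Suc (clen g)" "clen (insert (ng u) g) = Suc (clen g)"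
  by (simp_all add: clen_eq)
 have p: "(2::int) ^ (mm - clen g) = 2 * 2 ^ (mm - Suc (clen g))"
  using c by (simp add: Suc_diff_Suc flip: power_Suc)
 let ?s = "%g. SUM e<ecnt. ec lg e * (Q2 g (ebt lg e) - 1)"
 have "?s (insert u g) + ?s (insert (ng u) g) = (SUM e<ecnt. 2 * (ec lg e * (Q2 g (ebt lg e) - 1)))"
  unfolding sum.distrib[symmetric]
 proof (rule sum.cong)
  fix e assume "e : {..<ecnt}"
  show "ec lg e * (Q2 (insert u g) (ebt lg e) - 1) + ec lg e * (Q2 (insert (ng u) g) (ebt lg e) - 1)
   = 2 * (ec lg e * (Q2 g (ebt lg e) - 1))"
  proof (cases "ec lg e = 0")
   case False
   hence "cns (ebt lg e)" using w \<open>e : {..<ecnt}\<close> by (simp add: wfl_def)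
   hence q: "Q2 (insert u g) (ebt lg e) = 2 * Q2 g (ebt lg e) - Q2 (insert (ng u) g) (ebt lg e)"
    using Q2_split[of "ebt lg e" u g] u True by linarith
   show ?thesis unfolding q by (simp add: algebra_simps)
  qed simp
 qed simp
 hence s: "?s (insert u g) = 2 * ?s g - ?s (insert (ng u) g)" by (simp add: sum_distrib_left)
 define a b d where "a = ?s (insert u g)" "b = ?s (insert (ng u) g)" "d = ?s g"
 have s': "a = 2 * d - b" using s by (simp only: a_b_d_def)
 show ?thesis using c1 True unfolding sm_eq l p a_b_d_def[symmetric] by (simp add: s' algebra_simps)
qed

text \<open>The kernel Q2 is the inner product of the Fourier expansions of the two normalised subcube
indicators; fc g T is the coefficient of g at the set T of variables.\<close>

definition sgl :: "nat set => nat => int" where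
 "sgl g i = (if i : g then 1 else if ng i : g then -1 else 0)"

definition fc :: "nat set => nat set => int" where
 "fc g T = (PROD i:T. sgl g i)"

definition TS :: "nat set set" where
 "TS = {T. T <= {..<pn P} & T ~= {} & card T <= mm}"

lemma TS_fin: "finite TS"
 by (rule finite_subset[of _ "Pow {..<pn P}"]) (auto simp: TS_def)

definition vr :: "nat => nat" where "vr w = (if w < pn P then w else ng w)"

lemma vr_lt: "w < N ==> vr w < pn P"
 by (auto simp: vr_def ng_def nn_def)

lemma n_lt: "i < pn P ==> i < N" by (simp add: nn_def)

lemma vr_ng: "i < pn P ==> vr i = i & vr (ng i) = i"
 by (auto simp: vr_def ng_def nn_def)

lemma vr_cases: "w < N ==> w = vr w | w = ng (vr w)"
 by (auto simp: vr_def)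

text \<open>The sum is the expansion of the product over all variables of
  \<open>1 + sgl g i * sgl h i\<close>. A factor is 0 on a conflict, 2 on a common literal and 1
  otherwise.\<close>

lemma Q2_fourier:
 assumes g: "cns g" and h: "cns h"
 shows "(SUM T:Pow {..<pn P}. fc g T * fc h T) = Q2 g h"
proof -
 let ?n = "pn P"
 have gh: "~ (i : k & ng i : k)" if "i < ?n" "cns k" for i k using that n_lt by (auto simp: cns_eq)
 have "(SUM T:Pow {..<?n}. fc g T * fc h T) = (SUM T:Pow {..<?n}. (PROD i:T. sgl g i * sgl h i) * (PROD i:{..<?n} - T. 1))"
  by (intro sum.cong refl) (simp add: fc_def prod.distrib)
 also have "... = (PROD i<?n. sgl g i * sgl h i + 1)" by (rule prod_add[symmetric]) simp
 also have "... = Q2 g h"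
 proof (cases "EX u<N. u : g & ng u : h")
  case True
  then obtain u where u: "u < N" "u : g" "ng u : h" by blast
  have i: "vr u < ?n" using vr_lt u by simp
  have "sgl g (vr u) * sgl h (vr u) + 1 = 0"
   using vr_cases[OF u(1)]
  proof
   assume "u = vr u"
   thus ?thesis using gh[OF i h] u by (simp add: sgl_def)
  next
   assume e: "u = ng (vr u)"
   hence "ng u = vr u" using n_lt[OF i] ng_ng[of "vr u"] by simp
   hence "vr u : h" "ng (vr u) : g" using e u by auto
   thus ?thesis using gh[OF i g] by (simp add: sgl_def)
  qed
  hence "(PROD i<?n. sgl g i * sgl h i + 1) = 0" using i by (intro prod_zero) auto
  thus ?thesis using True by (simp add: Q2_def)
 next
  case False
  let ?I = "{i. i < ?n & (i : g & i : h | ng i : g & ng i : h)}"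
  have f: "sgl g i * sgl h i + 1 = (if i : ?I then 2 else 1)" if i: "i < ?n" for i
  proof -
   have "~ (i : g & ng i : h)" "~ (ng i : g & i : h)"
    using False n_lt[OF i] ng_ng[OF n_lt[OF i]] ng_lt[OF n_lt[OF i]] by metis+
   thus ?thesis using gh[OF i g] gh[OF i h] i unfolding sgl_def by auto
  qed
  have "(PROD i<?n. sgl g i * sgl h i + 1) = (PROD i<?n. if i : ?I then 2 else 1)" using f by (intro prod.cong) auto
  also have "... = 2 ^ card ({..<?n} Int ?I)" by (simp only: prod.inter_restrict[OF finite_lessThan, symmetric] prod_constant)
  also have "{..<?n} Int ?I = ?I" by auto
  also have "card ?I = card (lits g Int lits h)"
  proof (rule bij_betw_same_card[of "%i. if i : g then i else ng i"], rule bij_betw_byWitness[where f' = vr])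
   show "ALL i:?I. vr (if i : g then i else ng i) = i" using vr_ng by auto
   show "ALL w:lits g Int lits h. (if vr w : g then vr w else ng (vr w)) = w"
   proof
    fix w assume w: "w : lits g Int lits h"
    hence wN: "w < N" "w : g" by (auto simp: lits_def)
    show "(if vr w : g then vr w else ng (vr w)) = w"
     using vr_cases[OF wN(1)] gh[OF vr_lt[OF wN(1)] g] wN by auto
   qed
   show "(%i. if i : g then i else ng i) ` ?I <= lits g Int lits h"
   proof
    fix x assume "x : (%i. if i : g then i else ng i) ` ?I"
    then obtain i where i: "i : ?I" "x = (if i : g then i else ng i)" by blast
    hence iN: "i < N" "i < ?n" using n_lt by auto
    show "x : lits g Int lits h" using i iN gh[OF iN(2) g] by (auto simp: lits_def)
   qed
   show "vr ` (lits g Int lits h) <= ?I"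
   proof
    fix x assume "x : vr ` (lits g Int lits h)"
    then obtain w where w: "w < N" "w : g" "w : h" "x = vr w" by (auto simp: lits_def)
    show "x : ?I" using vr_cases[OF w(1)] vr_lt[OF w(1)] w by auto
   qed
  qed
  finally show ?thesis using False by (simp add: Q2_def)
 qed
 finally show ?thesis .
qed

text \<open>A coefficient is nonzero only if \<open>g\<close> fixes every variable of
  \<open>T\<close>.\<close>

lemma fc_zero:
 assumes "T <= {..<pn P}" "clen g < card T"
 shows "fc g T = 0"
proof (rule ccontr)
 assume "fc g T ~= 0"
 have fT: "finite T" using assms(1) finite_subset by blast
 hence nz: "sgl g i ~= 0" if "i : T" for i using \<open>fc g T ~= 0\<close> that by (auto simp: fc_def)
 have "T <= vr ` lits g"
 proof
  fix i assume i: "i : T"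
  hence n: "i < pn P" using assms(1) by auto
  have "i : g | ng i : g" using nz[OF i] by (auto simp: sgl_def split: if_splits)
  thus "i : vr ` lits g"
  proof
   assume "i : g"
   thus ?thesis using vr_ng[OF n] n_lt[OF n] by (intro image_eqI[of _ _ i]) (auto simp: lits_def)
  next
   assume "ng i : g"
   thus ?thesis using vr_ng[OF n] n_lt[OF n] by (intro image_eqI[of _ _ "ng i"]) (auto simp: lits_def)
  qed
 qed
 hence "card T <= card (lits g)" by (meson card_image_le card_mono finite_imageI lits_fin order_trans)
 thus False using assms(2) by (simp add: clen_eq)
qed

lemma Q2_TS:
 assumes "cns g" "cns h" "clen g <= mm"
 shows "(SUM T:TS. fc g T * fc h T) = Q2 g h - 1"
proof -
 have "Q2 g h = (SUM T:Pow {..<pn P}. fc g T * fc h T)" using Q2_fourier assms by simp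
 also have "... = (SUM T:insert {} TS. fc g T * fc h T)"
 proof (rule sum.mono_neutral_right)
  show "insert {} TS <= Pow {..<pn P}" by (auto simp: TS_def)
  show "ALL T:Pow {..<pn P} - insert {} TS. fc g T * fc h T = 0"
  proof
   fix T assume "T : Pow {..<pn P} - insert {} TS"
   hence "T <= {..<pn P}" "mm < card T" by (auto simp: TS_def)
   thus "fc g T * fc h T = 0" using fc_zero[of T g] assms(3) by simp
  qed
 qed simp
 also have "... = 1 + (SUM T:TS. fc g T * fc h T)"
  by (subst sum.insert) (auto simp: TS_fin fc_def TS_def)
 finally show ?thesis by simp
qed

lemma fc_le1: "\<bar>fc g T\<bar> <= 1"
 unfolding fc_def abs_prod by (rule prod_le_1) (auto simp: sgl_def)

lemma q1: "1 <= pq P"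
 using qb by (cases "pq P") auto

text \<open>Give each variable the weight \<open>2^(-b)\<close>. The generating function is
  \<open>(1 + 2^(-b))^n <= e^q\<close> because \<open>n <= q * 2^b\<close>, and removing the weights
  costs a factor of at most \<open>2^(b * mm)\<close>.\<close>

lemma card_TS: "card TS <= 2 ^ (5 * L)"
proof -
 let ?n = "pn P" let ?B = "2 ^ pb P :: real"
 have "real (card TS) * (1 / ?B) ^ mm = (SUM T:TS. (1 / ?B) ^ mm)" by simp
 also have "... <= (SUM T:TS. (1 / ?B) ^ card T)"
  by (intro sum_mono power_decreasing) (auto simp: TS_def)
 also have "... <= (SUM T:Pow {..<?n}. (1 / ?B) ^ card T)"
  by (intro sum_mono2) (auto simp: TS_def)
 also have "... = (SUM T:Pow {..<?n}. (PROD i:T. 1 / ?B) * (PROD i:{..<?n} - T. 1))" by simp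
 also have "... = (PROD i<?n. 1 / ?B + 1)" by (rule prod_add[symmetric]) simp
 also have "... = (1 + 1 / ?B) ^ ?n" by (simp add: add.commute)
 also have "... <= exp (1 / ?B) ^ ?n" by (intro power_mono exp_ge_add_one_self) auto
 also have "... = exp (real ?n / ?B)" by (simp add: exp_of_nat_mult[symmetric])
 also have "... <= exp (real (pq P))"
 proof -
  have "?n <= pq P * 2 ^ pb P" using qb by (simp add: nn_def)
  hence "real ?n <= real (pq P * 2 ^ pb P)" by (simp only: of_nat_le_iff)
  hence "real ?n / ?B <= real (pq P)" by (simp add: field_simps)
  thus ?thesis by simp
 qed
 also have "... = exp 1 ^ pq P" by (simp add: exp_of_nat_mult[symmetric])
 also have "... <= 4 ^ pq P" by (rule power_mono) (use exp_le in auto)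
 finally have "real (card TS) <= 4 ^ pq P * ?B ^ mm" by (simp add: field_simps)
 also have "... = real (2 ^ (2 * pq P + pb P * mm))"
 proof -
  have "(4::real) ^ pq P = 2 ^ (2 * pq P)" by (simp add: power_mult)
  thus ?thesis by (simp add: power_add power_mult)
 qed
 finally have "card TS <= 2 ^ (2 * pq P + pb P * mm)" by (simp only: of_nat_le_iff)
 also have "... <= 2 ^ (5 * L)"
 proof (rule power_increasing)
  have "pb P <= pb P * pq P" using q1 by (cases "pq P") auto
  moreover have "pb P * mm = pb P * pq P + 3 * pb P" by (simp add: mm_def algebra_simps)
  ultimately have "pb P * mm <= 4 * L" using bL by linarith
  thus "2 * pq P + pb P * mm <= 5 * L" using qL by linarith
 qed simp
 finally show ?thesis .
qed

end

text \<open>The law of total variance. For a sign with mass \<open>p\<close> and signed mass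
  \<open>y\<close>, \<open>p - y^2 / p\<close> is the variance times \<open>p\<close>; the
  subtracted last term is the variance between the two parts.\<close>

lemma variance_split:
 fixes p1 p2 y1 y2 :: real
 assumes "p1 > 0" "p2 > 0"
 shows "(p1 - y1^2 / p1) + (p2 - y2^2 / p2) =
  (p1 + p2) - (y1 + y2)^2 / (p1 + p2) - (y1 * p2 - y2 * p1)^2 / (p1 * p2 * (p1 + p2))"
proof -
 have "y1^2 / p1 + y2^2 / p2 = (y1 + y2)^2 / (p1 + p2) + (y1 * p2 - y2 * p1)^2 / (p1 * p2 * (p1 + p2))"
 proof -
  define D where "D = p1 * p2 * (p1 + p2)"
  have D: "p1 ~= 0" "p2 ~= 0" "p1 + p2 ~= 0" using assms by auto
  have "y1^2 / p1 = y1^2 * (p2 * (p1 + p2)) / D" "y2^2 / p2 = y2^2 * (p1 * (p1 + p2)) / D"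
   "(y1 + y2)^2 / (p1 + p2) = (y1 + y2)^2 * (p1 * p2) / D"
   using D by (simp_all add: D_def mult_ac)
  moreover have "y1^2 * (p2 * (p1 + p2)) + y2^2 * (p1 * (p1 + p2)) = (y1 + y2)^2 * (p1 * p2) + (y1 * p2 - y2 * p1)^2"
   by (simp add: power2_eq_square algebra_simps)
  ultimately show ?thesis unfolding D_def[symmetric] by (simp only: add_divide_distrib[symmetric])
 qed
 thus ?thesis by linarith
qed

context alg begin

section \<open>Conditioning along paths\<close>

definition pth :: "(nat => nat) => nat => nat => nat set" where
 "pth lg z t = {u. bitr P (%i A j. if j : pathstep P lg z i {v. A v ~= 0} then 1 else 0) (%j. 0) t u ~= 0}"

definition dns :: "(nat => nat) => nat set => bool" where
 "dns lg al \<longleftrightarrow> hasdense P (mass lg al) (ddm lg al)"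

definition ctr :: "(nat => nat) => nat set => nat" where
 "ctr lg al = cen P (mass lg al) (ddm lg al)"

lemma path_pth: "path P lg z = pth lg z (pq P)"
 by (simp add: path_def pth_def)

lemma pth_0: "pth lg z 0 = {}"
 by (simp add: pth_def bitr_def)

lemma ctr:
 assumes "dns lg al"
 shows "ctr lg al < N" "dense P (mass lg al) (ddm lg al) (ctr lg al)"
proof -
 have "EX u<N. dense P (mass lg al) (ddm lg al) u" using assms by (simp add: dns_def hasdense_def)
 from bleast[OF NK(1) this] show "ctr lg al < N" "dense P (mass lg al) (ddm lg al) (ctr lg al)"
  by (simp_all add: ctr_def cen_def)
qed

lemma mass_cns: "0 < mass lg g ==> cns g"
 by (rule ccontr) (simp add: mass_def mpos_def)

lemma tr_mass: "u < N ==> tr P (ddm lg al) u = mass lg (insert u al)"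
 by (simp add: tr_def ddm_def)

lemma ctr_und:
 assumes "dns lg al"
 shows "mass lg al < 8 * mass lg (insert (ctr lg al) al)"
  "mass lg al < 8 * mass lg (insert (ng (ctr lg al)) al)"
  "ctr lg al ~: al" "ng (ctr lg al) ~: al"
proof -
 let ?c = "ctr lg al"
 note c = ctr[OF assms]
 show 1: "mass lg al < 8 * mass lg (insert ?c al)" and 2: "mass lg al < 8 * mass lg (insert (ng ?c) al)"
  using c by (simp_all add: dense_def und_def tr_mass shl_num mult.commute)
 have "cns (insert ?c al)" "cns (insert (ng ?c) al)" using 1 2 by (auto intro!: mass_cns[of lg])
 thus "ctr lg al ~: al" "ng (ctr lg al) ~: al" using c(1) unfolding cns_eq
  by (metis insert_iff ng_lt ng_ng)+
qed

lemma bbit_bit: "i <= pq P ==> bbit P z i \<longleftrightarrow> bit z i"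
proof -
 assume "i <= pq P"
 hence "i <= pK P" using qL L_le by (intro smallK) linarith
 thus ?thesis by (simp add: bbit_eq bit_iff_odd)
qed

definition nxt :: "(nat => nat) => bool => nat set => nat set" where
 "nxt lg x al = (if dns lg al then insert (if x then ctr lg al else ng (ctr lg al)) al else al)"

lemma qK: "pq P <= pK P" using qL L_le by (intro smallK) linarith

lemma pth_Suc: "t < pq P ==> pth lg z (Suc t) = nxt lg (bit z t) (pth lg z t) & pth lg z (Suc t) <= {..<N}"
proof (induction t)
 have gen: "pth lg z (Suc t) = nxt lg (bit z t) (pth lg z t) & pth lg z (Suc t) <= {..<N}"
  if t: "t < pq P" and sub: "pth lg z t <= {..<N}" for t
 proof -
  let ?f = "%i A j. if j : pathstep P lg z i {v. A v ~= 0} then 1 else 0 :: nat"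
  have ps: "pathstep P lg z t (pth lg z t) = nxt lg (bit z t) (pth lg z t)"
   using t by (auto simp: pathstep_def nxt_def dns_def ctr_def bbit_bit)
  have sN: "nxt lg (bit z t) (pth lg z t) <= {..<N}" using sub ctr(1)[of lg "pth lg z t"] by (auto simp: nxt_def)
  have tK: "Suc t <= pK P" using t qK by simp
  have "bitr P ?f (%j. 0) (Suc t) v = (if v : nxt lg (bit z t) (pth lg z t) then 1 else 0)" for v
  proof (cases "v < pK P")
   case True
   thus ?thesis using bitr_Suc[OF tK True, of ?f "%j. 0"] ps by (simp add: pth_def)
  next
   case False
   hence "v ~: nxt lg (bit z t) (pth lg z t)" using sN NK(1) by (meson lessThan_iff less_le_trans subsetD)
   thus ?thesis using False by (simp add: bitr_def itr_support)
  qed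
  hence "pth lg z (Suc t) = nxt lg (bit z t) (pth lg z t)" unfolding pth_def[of lg z "Suc t"] by auto
  thus ?thesis using sN by simp
 qed
 { case 0 thus ?case by (intro gen) (simp_all add: pth_0) }
 { case (Suc t)
  have "t < pq P" using Suc.prems by simp
  from Suc.IH[OF this] have "pth lg z (Suc t) <= {..<N}" by (rule conjunct2)
  thus ?case using Suc.prems by (intro gen) }
qed

lemma pth_cong: "t <= pq P ==> (!!i. i < t ==> bit z i = bit z' i) ==> pth lg z t = pth lg z' t"
proof (induction t)
 case (Suc t)
 thus ?case using pth_Suc[of t lg z] pth_Suc[of t lg z'] Suc.prems(2)[of t] by auto
qed (simp add: pth_0)

lemma pth_len: "t <= pq P ==> clen (pth lg z t) <= t"
proof (induction t)
 case (Suc t)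
 let ?al = "pth lg z t"
 have "lits (nxt lg (bit z t) ?al) <= insert (if bit z t then ctr lg ?al else ng (ctr lg ?al)) (lits ?al)"
  by (auto simp: lits_def nxt_def)
 hence "card (lits (nxt lg (bit z t) ?al)) <= card (insert (if bit z t then ctr lg ?al else ng (ctr lg ?al)) (lits ?al))"
  by (rule card_mono[rotated]) simp
 also have "... <= Suc (card (lits ?al))" by (simp add: card_insert_if)
 finally show ?case using Suc pth_Suc[of t lg z] by (simp add: clen_eq)
qed (simp add: pth_0 clen_eq lits_def)

lemma pth_child:
 assumes "t < pq P" "dns lg (pth lg z t)"
 shows "pth lg (set_bit t z) (Suc t) = insert (ctr lg (pth lg z t)) (pth lg z t)"
  "pth lg (unset_bit t z) (Suc t) = insert (ng (ctr lg (pth lg z t))) (pth lg z t)"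
proof -
 have "pth lg (set_bit t z) t = pth lg z t" "pth lg (unset_bit t z) t = pth lg z t"
  using assms(1) by (auto intro!: pth_cong simp: bit_set_bit_iff bit_unset_bit_iff)
 thus "pth lg (set_bit t z) (Suc t) = insert (ctr lg (pth lg z t)) (pth lg z t)"
  "pth lg (unset_bit t z) (Suc t) = insert (ng (ctr lg (pth lg z t))) (pth lg z t)"
  using pth_Suc[OF assms(1), of lg "set_bit t z"] pth_Suc[OF assms(1), of lg "unset_bit t z"] assms(2)
  by (auto simp: nxt_def bit_set_bit_iff bit_unset_bit_iff)
qed

lemma pth_stop: "t <= t' ==> t' <= pq P ==> ~ dns lg (pth lg z t) ==> pth lg z t' = pth lg z t"
proof (induction t' rule: dec_induct)
 case (step t')
 thus ?case using pth_Suc[of t' lg z] by (simp add: nxt_def)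
qed simp

lemma pth_leaf: "EX z'<2 ^ pq P. pth lg z (pq P) = path P lg z'"
proof (intro exI conjI)
 show "take_bit (pq P) z < 2 ^ pq P" by simp
 show "pth lg z (pq P) = path P lg (take_bit (pq P) z)" unfolding path_pth
  by (rule pth_cong) (simp_all add: bit_take_bit_iff)
qed

lemma shl_q: "bshl P 1 (pq P) = 2 ^ pq P" "2 ^ pq P <= pK P"
proof -
 show "bshl P 1 (pq P) = 2 ^ pq P" using qK by (simp add: bshl_eq)
 show "2 ^ pq P <= pK P" using qL by (intro smallK power_increasing) auto
qed

lemma clen_insert: "clen (insert u g) <= Suc (clen g)"
proof -
 have "lits (insert u g) <= insert u (lits g)" by (auto simp: lits_def)
 hence "card (lits (insert u g)) <= card (insert u (lits g))" by (rule card_mono[rotated]) simp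
 also have "... <= Suc (card (lits g))" by (simp add: card_insert_if)
 finally show ?thesis by (simp add: clen_eq)
qed

text \<open>The algorithm inspects the ends of paths only. An inner node is the sum of its two
  children, so nonnegativity rises from the leaves; at depth \<open>t\<close> three more literals
  stay within the degree \<open>mm\<close>.\<close>

lemma nonneg:
 assumes w: "wfl lg" and h: "~ hasneg P lg" and u: "u < N" "v < N" "w < N"
 shows "t <= pq P ==> 0 <= sm lg (insert u (insert v (insert w (pth lg z t))))"
proof (induction t arbitrary: z rule: inc_induct)
 case base
 obtain z' where z': "z' < 2 ^ pq P" "pth lg z (pq P) = path P lg z'" using pth_leaf by blast
 have "~ negz P lg z' u v w"
 proof
  assume "negz P lg z' u v w"
  hence "neg1 P lg z'" using u by (auto simp: neg1_def neg2_def neg3_def)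
  thus False using h z'(1) unfolding hasneg_def shl_q(1) bex_eq[OF shl_q(2)] by blast
 qed
 thus ?case unfolding z'(2) by (simp add: negz_def sm_def)
next
 case (step t)
 let ?al = "pth lg z t"
 show ?case
 proof (cases "dns lg ?al")
  case True
  let ?c = "ctr lg ?al" let ?g = "insert u (insert v (insert w ?al))"
  have "clen ?g <= t + 3" using clen_insert[of u "insert v (insert w ?al)"] clen_insert[of v "insert w ?al"] clen_insert[of w ?al]
   pth_len[of t lg z] step.hyps by linarith
  hence "clen ?g < mm" using step.hyps by (simp add: mm_def)
  hence "sm lg ?g = sm lg (insert ?c ?g) + sm lg (insert (ng ?c) ?g)" using sm_add[OF w] ctr(1)[OF True] by blast
  moreover have "0 <= sm lg (insert u (insert v (insert w (insert ?c ?al))))"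
   using step.IH[of "set_bit t z"] pth_child(1)[OF step.hyps(2) True] by simp
  moreover have "0 <= sm lg (insert u (insert v (insert w (insert (ng ?c) ?al))))"
   using step.IH[of "unset_bit t z"] pth_child(2)[OF step.hyps(2) True] by simp
  ultimately show ?thesis by (simp add: insert_commute)
 next
  case False
  thus ?thesis using step.IH[of z] pth_stop[of t "Suc t" lg z] step.hyps by simp
 qed
qed

definition node :: "(nat => nat) => nat set => bool" where
 "node lg al \<longleftrightarrow> wfl lg & clen al + 3 <= mm & sm lg al <= int (mcap P) &
   (ALL u<N. ALL v<N. ALL w<N. 0 <= sm lg (insert u (insert v (insert w al))))"

context
 fixes lg :: "nat => nat" and al :: "nat set"
 assumes nd: "node lg al"
begin

lemma node_ge: "u < N ==> v < N ==> w < N ==> 0 <= sm lg (insert u (insert v (insert w al)))"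
 "u < N ==> v < N ==> 0 <= sm lg (insert u (insert v al))"
 "u < N ==> 0 <= sm lg (insert u al)"
proof -
 show 1: "0 <= sm lg (insert u (insert v (insert w al)))" if "u < N" "v < N" "w < N" for u v w
  using nd that by (simp add: node_def)
 show "u < N ==> v < N ==> 0 <= sm lg (insert u (insert v al))" using 1[of u v v] by simp
 show "u < N ==> 0 <= sm lg (insert u al)" using 1[of u u u] by simp
qed

lemma node_add:
 "w < N ==> sm lg al = sm lg (insert w al) + sm lg (insert (ng w) al)"
 "w < N ==> sm lg (insert u al) = sm lg (insert w (insert u al)) + sm lg (insert (ng w) (insert u al))"
 "w < N ==> sm lg (insert u (insert v al)) = sm lg (insert w (insert u (insert v al))) + sm lg (insert (ng w) (insert u (insert v al)))"
proof -
 have wf: "wfl lg" and c: "clen al + 3 <= mm" using nd by (auto simp: node_def)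
 have c1: "clen (insert u al) < mm" for u using clen_insert[of u al] c by linarith
 have c2: "clen (insert u (insert v al)) < mm" using clen_insert[of u "insert v al"] clen_insert[of v al] c by linarith
 show "w < N ==> sm lg al = sm lg (insert w al) + sm lg (insert (ng w) al)" using c by (intro sm_add wf) simp_all
 show "w < N ==> sm lg (insert u al) = sm lg (insert w (insert u al)) + sm lg (insert (ng w) (insert u al))"
  using c1 by (intro sm_add wf)
 show "w < N ==> sm lg (insert u (insert v al)) = sm lg (insert w (insert u (insert v al))) + sm lg (insert (ng w) (insert u (insert v al)))"
  using c2 by (intro sm_add wf)
qed

lemma node_le:
 "u < N ==> sm lg (insert u al) <= sm lg al"
 "u < N ==> v < N ==> sm lg (insert u (insert v al)) <= sm lg al"
 "0 <= sm lg al"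
proof -
 show 1: "sm lg (insert u al) <= sm lg al" if "u < N" for u
  using node_add(1)[OF that] node_ge(3)[OF ng_lt[OF that]] by linarith
 show "sm lg (insert u (insert v al)) <= sm lg al" if "u < N" "v < N"
  using node_add(2)[OF that(1), of v] node_ge(2)[OF ng_lt[OF that(1)] that(2)] 1[OF that(2)] by linarith
 have "0 < N" using N_pos by simp
 thus "0 <= sm lg al" using node_ge(3)[of 0] 1[of 0] by linarith
qed

lemma mass_sm: "0 <= sm lg g ==> sm lg g <= sm lg al ==> int (mass lg g) = sm lg g"
 using nd unfolding node_def mass_def sm_def by linarith

lemma node_mass:
 "int (mass lg al) = sm lg al"
 "u < N ==> int (mass lg (insert u al)) = sm lg (insert u al)"
 "u < N ==> v < N ==> int (ddm lg al u v) = sm lg (insert u (insert (ng v) al))"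
 using node_le node_ge by (auto intro!: mass_sm simp: ddm_def)

text \<open>Each axiom compares atoms with at most three literals beyond \<open>al\<close> and
  follows by splitting them with additivity.\<close>

lemma node_rounding:
 assumes low: "2 ^ (4 * L) <= sm lg al"
 shows "rounding P (mass lg al) (ddm lg al)"
proof unfold_locales
 let ?m = "%u v. sm lg (insert u (insert v al))"
 have i2: "insert u (insert v al) = insert v (insert u al)" for u v by (rule insert_commute)
 note eq = node_mass
 show "ddm lg al u v <= mass lg al" if "u < N" "v < N" for u v
  using eq(1) eq(3)[OF that] node_le(2)[of u "ng v"] that by simp
 show "mass lg al <= 2 ^ (67108890 * pL P)"
 proof -
  have "mass lg al <= mcap P" by (simp add: mass_def)
  also have "... <= (2 ^ (67108884 * L) + 2 ^ (67108884 * L)) * 2 ^ L"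
   unfolding mcap_eq cUU_eq using qL by (intro mult_mono add_mono power_increasing) (auto simp: mm_def)
  also have "... = 2 * (2 ^ (67108884 * L) * 2 ^ L)" by (simp add: algebra_simps)
  also have "... = 2 ^ (67108885 * L + 1)" by (simp add: power_add[symmetric])
  also have "... <= 2 ^ (67108890 * L)" using L64 by (intro power_increasing) auto
  finally show ?thesis .
 qed
 have "int (2 ^ (4 * L)) <= int (mass lg al)" using low eq(1) by simp
 thus "2 ^ (4 * pL P) <= mass lg al" by (simp only: of_nat_le_iff)
 show "ddm lg al u u = 0" if "u < N" for u
 proof -
  have "~ cns (insert u (insert (ng u) al))" using that unfolding cns_eq by blast
  thus ?thesis by (simp add: ddm_def mass_def mpos_def)
 qed
 show "ddm lg al u w <= ddm lg al u v + ddm lg al v w" if u: "u < N" "v < N" "w < N" for u v w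
 proof -
  have "?m u (ng w) = sm lg (insert v (insert u (insert (ng w) al))) + sm lg (insert (ng v) (insert u (insert (ng w) al)))"
   by (rule node_add(3)[OF u(2)])
  moreover have "?m u (ng v) = sm lg (insert w (insert u (insert (ng v) al))) + sm lg (insert (ng w) (insert u (insert (ng v) al)))"
   by (rule node_add(3)[OF u(3)])
  moreover have "?m v (ng w) = sm lg (insert u (insert v (insert (ng w) al))) + sm lg (insert (ng u) (insert v (insert (ng w) al)))"
   by (rule node_add(3)[OF u(1)])
  moreover have "insert (ng w) (insert u (insert (ng v) al)) = insert (ng v) (insert u (insert (ng w) al))"
   "insert v (insert u (insert (ng w) al)) = insert u (insert v (insert (ng w) al))" by auto
  moreover have "0 <= sm lg (insert w (insert u (insert (ng v) al)))" "0 <= sm lg (insert (ng u) (insert v (insert (ng w) al)))"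
   using u by (intro node_ge(1); simp)+
  ultimately have "?m u (ng w) <= ?m u (ng v) + ?m v (ng w)" by simp
  thus ?thesis using eq(3)[OF u(1,2)] eq(3)[OF u(2,3)] eq(3)[OF u(1,3)] by linarith
 qed
 show "ddm lg al (ng v) (ng u) = ddm lg al u v" if "u < N" "v < N" for u v
  using that by (simp add: ddm_def i2)
 show "ddm lg al u (ng u) + ddm lg al (ng u) u = mass lg al" if "u < N" for u
  using node_add(1)[OF that] eq(3)[of u "ng u"] eq(3)[of "ng u" u] eq(1) that by simp
 show "ddm lg al u v + ddm lg al v (ng v) = ddm lg al v u + ddm lg al u (ng u)" if u: "u < N" "v < N" for u v
 proof -
  have "sm lg (insert v al) = ?m u v + ?m (ng u) v" by (rule node_add(2)[OF u(1)])
  moreover have "sm lg (insert u al) = ?m v u + ?m (ng v) u" by (rule node_add(2)[OF u(2)])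
  moreover have "?m u v = ?m v u" "?m (ng u) v = ?m v (ng u)" "?m (ng v) u = ?m u (ng v)" by (simp_all only: i2)
  ultimately have "?m u (ng v) + sm lg (insert v al) = ?m v (ng u) + sm lg (insert u al)" by simp
  hence "int (ddm lg al u v + ddm lg al v (ng v)) = int (ddm lg al v u + ddm lg al u (ng u))"
   using eq(3)[OF u] eq(3)[OF u(2,1)] eq(3)[of v "ng v"] eq(3)[of u "ng u"] u by simp
  thus ?thesis by (simp only: of_nat_eq_iff)
 qed
qed

definition Vl :: int where
 "Vl = (SUM u<N. SUM v<N. if adjb u v then sm lg (insert u (insert (ng v) al)) else 0)"

end

lemma volr_Vl: "node lg al ==> int (volr (ddm lg al) {u. u < N}) = Vl lg al"
 unfolding volr_def sumN Vl_def of_nat_sum by (intro sum.cong refl) (auto simp: node_mass)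

text \<open>Dense centres are undecided, so a step keeps more than an eighth of the mass.\<close>

lemma pth_node:
 assumes w: "wfl lg" and h: "~ hasneg P lg"
 shows "t <= pq P ==> node lg (pth lg z t) & int (mcap P) <= sm lg (pth lg z t) * 8 ^ t"
proof (induction t)
 case 0
 have "clen {} = 0" by (simp add: clen_eq lits_def)
 moreover have "ALL u<N. ALL v<N. ALL x<N. 0 <= sm lg (insert u (insert v (insert x {})))"
  using nonneg[OF w h, of _ _ _ 0] by (simp add: pth_0)
 ultimately show ?case using w by (simp add: node_def pth_0 sm_empty mm_def)
next
 case (Suc t)
 let ?al = "pth lg z t" let ?al' = "pth lg z (Suc t)"
 have nd: "node lg ?al" and lo: "int (mcap P) <= sm lg ?al * 8 ^ t" using Suc by auto
 have "clen ?al' + 3 <= mm" using pth_len[OF Suc.prems, of lg z] Suc.prems by (simp add: mm_def)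
 moreover have nn: "ALL u<N. ALL v<N. ALL x<N. 0 <= sm lg (insert u (insert v (insert x ?al')))"
  using nonneg[OF w h _ _ _ Suc.prems] by blast
 moreover have "sm lg ?al' <= sm lg ?al & sm lg ?al <= sm lg ?al' * 8"
 proof (cases "dns lg ?al")
  case True
  define x where "x = (if bit z t then ctr lg ?al else ng (ctr lg ?al))"
  have x: "x < N" using ctr(1)[OF True] by (simp add: x_def)
  have e: "?al' = insert x ?al" using pth_Suc[of t lg z] Suc.prems True by (simp add: nxt_def x_def)
  have "mass lg ?al < 8 * mass lg (insert x ?al)" using ctr_und[OF True] by (simp add: x_def)
  thus ?thesis unfolding e using node_le(1)[OF nd x] node_mass(1)[OF nd] node_mass(2)[OF nd x] by linarith
 next
  case False
  thus ?thesis using pth_stop[of t "Suc t" lg z] Suc.prems node_le(3)[OF nd] by simp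
 qed
 moreover have "sm lg ?al * 8 ^ t <= sm lg ?al' * 8 ^ Suc t" if "sm lg ?al <= sm lg ?al' * 8"
  using mult_right_mono[OF that, of "8 ^ t"] by simp
 ultimately have "sm lg ?al' <= sm lg ?al" "int (mcap P) <= sm lg ?al' * 8 ^ Suc t" using lo by linarith+
 thus ?case using w nd nn \<open>clen ?al' + 3 <= mm\<close> unfolding node_def by auto
qed

lemma pth_low:
 assumes w: "wfl lg" and h: "~ hasneg P lg" and t: "t <= pq P"
 shows "2 ^ mm * 2 ^ (67108883 * L) <= sm lg (pth lg z t)" "2 ^ (4 * L) <= sm lg (pth lg z t)" "0 < sm lg (pth lg z t)"
proof -
 let ?p = "sm lg (pth lg z t)"
 have nd: "node lg (pth lg z t)" and lo: "int (mcap P) <= ?p * 8 ^ t" using pth_node[OF w h t] by auto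
 have p0: "0 <= ?p" by (rule node_le(3)[OF nd])
 have "(8::int) ^ t = 2 ^ (3 * t)" by (simp add: power_mult)
 also have "... <= 2 ^ L" using t qL by (intro power_increasing) auto
 finally have "?p * 8 ^ t <= ?p * 2 ^ L" using p0 by (rule mult_left_mono)
 moreover have "(2::int) ^ (67108884 * L) * 2 ^ mm <= int (mcap P)" by (simp add: mcap_eq cUU_eq)
 moreover have "(2::int) ^ (67108884 * L) = 2 ^ (67108883 * L) * 2 ^ L" by (simp add: power_add[symmetric])
 ultimately have "2 ^ (67108883 * L) * 2 ^ L * 2 ^ mm <= ?p * 2 ^ L" using lo by (metis order_trans)
 hence "(2 ^ mm * 2 ^ (67108883 * L)) * 2 ^ L <= ?p * 2 ^ L" by (simp only: mult_ac)
 thus 1: "2 ^ mm * 2 ^ (67108883 * L) <= ?p" by (rule mult_right_le_imp_le) simp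
 have "(2::int) ^ (4 * L) = 1 * 2 ^ (4 * L)" by simp
 also have "... <= 2 ^ mm * 2 ^ (67108883 * L)" by (intro mult_mono power_increasing) auto
 finally show "2 ^ (4 * L) <= ?p" using 1 by simp
 thus "0 < ?p" using zero_less_power[of "2::int" "4 * L"] by linarith
qed

text \<open>The variances of all literals, regarded as signs, times the mass.\<close>

definition Phi :: "(nat => nat) => nat set => real" where
 "Phi lg al = (SUM u<N. real_of_int (sm lg al) - (real_of_int (2 * sm lg (insert u al) - sm lg al))^2 / real_of_int (sm lg al))"

text \<open>The volume is scaled by the guess so that at the root it counts for at most
  \<open>N\<close> times the mass, like \<open>Phi\<close>. A single averaging then finds a leaf
  good in both respects.\<close>

definition Fp :: "(nat => nat) => nat => nat set => real" where
 "Fp lg o1 al = Phi lg al + real N * (2 ^ (2 * L) * real_of_int (Vl lg al) / (2 ^ (2 * L) * real o1 + 1))"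

lemma Vl_nonneg: "node lg al ==> 0 <= Vl lg al"
 unfolding Vl_def by (intro sum_nonneg) (auto intro!: node_ge(2))

lemma y_bound:
 assumes nd: "node lg al" and p: "0 < sm lg al" and u: "u < N"
 shows "0 <= real_of_int (sm lg al) - (real_of_int (2 * sm lg (insert u al) - sm lg al))^2 / real_of_int (sm lg al)"
  "0 < sm lg (insert u al) ==> sm lg (insert u al) < sm lg al ==>
   0 < real_of_int (sm lg al) - (real_of_int (2 * sm lg (insert u al) - sm lg al))^2 / real_of_int (sm lg al)"
proof -
 let ?p = "real_of_int (sm lg al)" and ?x = "real_of_int (sm lg (insert u al))"
 have e: "?p - (real_of_int (2 * sm lg (insert u al) - sm lg al))^2 / ?p = 4 * ?x * (?p - ?x) / ?p"
  using p by (simp add: field_simps power2_eq_square)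
 have x: "0 <= ?x" "?x <= ?p" using node_ge(3)[OF nd u] node_le(1)[OF nd u] by auto
 show "0 <= ?p - (real_of_int (2 * sm lg (insert u al) - sm lg al))^2 / ?p" unfolding e using x p by simp
 show "0 < ?p - (real_of_int (2 * sm lg (insert u al) - sm lg al))^2 / ?p" if "0 < sm lg (insert u al)" "sm lg (insert u al) < sm lg al"
  unfolding e using that p by simp
qed

text \<open>For \<open>u\<close> close to the centre the conditional means are nearly 1 and -1, so
  the variance between the two parts is at least \<open>q / 16\<close>. More than \<open>2^b\<close>
  literals are close, and the volume term is additive.\<close>

lemma Fp_drop:
 assumes nd: "node lg al" and ds: "dns lg al" and p: "0 < sm lg al"
  and nd1: "node lg (insert (ctr lg al) al)" and nd2: "node lg (insert (ng (ctr lg al)) al)"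
 shows "Fp lg o1 (insert (ctr lg al) al) + Fp lg o1 (insert (ng (ctr lg al)) al) <= Fp lg o1 al - 2 ^ pb P / 16 * real_of_int (sm lg al)"
proof -
 let ?c = "ctr lg al"
 let ?a1 = "insert ?c al" and ?a2 = "insert (ng ?c) al"
 let ?r = "real_of_int"
 have c: "?c < N" by (rule ctr(1)[OF ds])
 have cl: "2 ^ pb P < card {v. v < N & close P (mass lg al) (ddm lg al) ?c v}"
 proof -
  have bK: "pb P <= pK P"
  proof -
   have "pb P <= pb P * pq P" using q1 by (cases "pq P") auto
   thus ?thesis using bL L_le by (intro smallK) linarith
  qed
  have "bshl P 1 (pb P) < bsum P N (%v. if close P (mass lg al) (ddm lg al) ?c v then 1 else 0)"
   using ctr(2)[OF ds] by (simp add: dense_def)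
  thus ?thesis using bK by (simp add: bshl_eq sum.If_cases Int_def)
 qed
 define q p1 p2 where "q = ?r (sm lg al)" and "p1 = ?r (sm lg ?a1)" and "p2 = ?r (sm lg ?a2)"
 have pp: "q = p1 + p2" using node_add(1)[OF nd c] by (simp add: q_def p1_def p2_def)
 have q0: "q > 0" using p by (simp add: q_def p1_def p2_def)
 have m: "int (mass lg al) = sm lg al" "int (mass lg ?a1) = sm lg ?a1" "int (mass lg ?a2) = sm lg ?a2"
  using node_mass(1)[OF nd] node_mass(2)[OF nd c] node_mass(2)[OF nd ng_lt[OF c]] by auto
 have "sm lg al < 8 * sm lg ?a1" "sm lg al < 8 * sm lg ?a2" using ctr_und(1,2)[OF ds] m by linarith+
 hence p8: "q / 8 <= p1" "q / 8 <= p2" unfolding q_def p1_def p2_def by linarith+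
 hence p0: "p1 > 0" "p2 > 0" using q0 by auto
 \<comment> \<open>Of two shares of at least 1/8 with sum 1 the product is least at the extremes,
   \<open>1/8 * 7/8\<close>.\<close>
 have "0 <= (p1 - q / 8) * (p2 - q / 8)" using p8 by (intro mult_nonneg_nonneg) auto
 also have "... = p1 * p2 - q / 8 * (p1 + p2) + q * q / 64" by (simp add: algebra_simps)
 finally have p12: "7 / 64 * (q * q) <= p1 * p2" unfolding pp[symmetric] by simp
 have "q * q / 16 <= p1 * p2" using p12 mult_pos_pos[OF q0 q0] by linarith
 hence p12q: "q / 16 <= p1 * p2 / q" using q0 by (simp add: pos_le_divide_eq)
 define y y1 y2 where "y u = ?r (2 * sm lg (insert u al) - sm lg al)" and "y1 u = ?r (2 * sm lg (insert u ?a1) - sm lg ?a1)"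
   and "y2 u = ?r (2 * sm lg (insert u ?a2) - sm lg ?a2)" for u
 have yy: "y u = y1 u + y2 u" for u
  using node_add(1)[OF nd c] node_add(2)[OF nd c, of u] by (simp add: y_def y1_def y2_def insert_commute[of u])
 let ?Cl = "{v. v < N & close P (mass lg al) (ddm lg al) ?c v}"
 have trm: "(p1 - (y1 u)^2 / p1) + (p2 - (y2 u)^2 / p2) <= (q - (y u)^2 / q) - (if u : ?Cl then q / 16 else 0)" if u: "u < N" for u
 proof -
  define z where "z = y1 u * p2 - y2 u * p1"
  have "(if u : ?Cl then q / 16 else 0) <= z^2 / (p1 * p2 * q)"
  proof (cases "u : ?Cl")
   case True
   define d1 d2 where "d1 = ?r (sm lg (insert ?c (insert (ng u) al)))" and "d2 = ?r (sm lg (insert u (insert (ng ?c) al)))"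
   have dn: "int (ddm lg al ?c u) = sm lg (insert ?c (insert (ng u) al))" "int (ddm lg al u ?c) = sm lg (insert u (insert (ng ?c) al))"
    using node_mass(3)[OF nd] c u by auto
   have "(ddm lg al ?c u + ddm lg al u ?c) * 2 ^ 63 <= mass lg al" using True by (simp add: close_def shl_num)
   hence "int ((ddm lg al ?c u + ddm lg al u ?c) * 2 ^ 63) <= int (mass lg al)" by (simp only: of_nat_le_iff)
   hence "(sm lg (insert ?c (insert (ng u) al)) + sm lg (insert u (insert (ng ?c) al))) * 2 ^ 63 <= sm lg al"
    using dn m(1) by simp
   hence "?r ((sm lg (insert ?c (insert (ng u) al)) + sm lg (insert u (insert (ng ?c) al))) * 2 ^ 63) <= q"
    unfolding q_def p1_def p2_def by (simp only: of_int_le_iff)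
   hence dq: "(d1 + d2) * 2 ^ 63 <= q" by (simp add: d1_def d2_def)
   have d0: "0 <= d1" "0 <= d2" using node_ge(2)[OF nd] c u by (auto simp: d1_def d2_def)
   have "sm lg ?a1 = sm lg (insert u ?a1) + sm lg (insert (ng u) ?a1)" by (rule node_add(2)[OF nd u])
   hence e1: "y1 u = p1 - 2 * d1" by (simp add: y_def y1_def y2_def q_def p1_def p2_def d1_def d2_def insert_commute[of "ng u"])
   have e2: "y2 u = 2 * d2 - p2" by (simp add: y_def y1_def y2_def q_def p1_def p2_def d1_def d2_def)
   have zz: "z = 2 * (p1 * p2) - 2 * (d1 * p2 + d2 * p1)" unfolding z_def e1 e2 by (simp add: algebra_simps)
   have "d1 * p2 + d2 * p1 <= d1 * q + d2 * q" using d0 p0 pp by (intro add_mono mult_left_mono) auto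
   also have "... = (d1 + d2) * q" by (simp add: algebra_simps)
   also have "... <= (q / 2 ^ 63) * q" using dq q0 by (intro mult_right_mono) auto
   also have "... <= 1 / 64 * (q * q)" using q0 by simp
   finally have "d1 * p2 + d2 * p1 <= 1 / 64 * (q * q)" .
   moreover have "0 < q * q" using q0 by simp
   moreover have "a <= 1 / 64 * s ==> 0 < s ==> 7 / 64 * s <= c ==> c <= 2 * c - 2 * a" for a c s :: real by linarith
   ultimately have "p1 * p2 <= z" using p12 unfolding zz by blast
   hence "(p1 * p2)^2 <= z^2" using p0 by (intro power_mono) auto
   hence "(p1 * p2)^2 / (p1 * p2 * q) <= z^2 / (p1 * p2 * q)" using p0 q0 by (intro divide_right_mono) auto
   moreover have "(p1 * p2)^2 / (p1 * p2 * q) = p1 * p2 / q" using p0 q0 by (simp add: power2_eq_square)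
   ultimately have "q / 16 <= z^2 / (p1 * p2 * q)" using p12q by linarith
   thus ?thesis unfolding if_P[OF True] .
  next
   case False
   have "0 <= z^2 / (p1 * p2 * q)" using p0 q0 by simp
   thus ?thesis unfolding if_not_P[OF False] .
  qed
  thus ?thesis using variance_split[OF p0, of "y1 u" "y2 u"] unfolding yy z_def pp by linarith
 qed
 have "Phi lg ?a1 + Phi lg ?a2 = (SUM u<N. (p1 - (y1 u)^2 / p1) + (p2 - (y2 u)^2 / p2))"
  unfolding Phi_def y_def y1_def y2_def q_def p1_def p2_def sum.distrib ..
 also have "... <= (SUM u<N. (q - (y u)^2 / q) - (if u : ?Cl then q / 16 else 0))" using trm by (intro sum_mono) auto
 also have "... = Phi lg al - (SUM u<N. if u : ?Cl then q / 16 else 0)"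
  unfolding Phi_def y_def y1_def y2_def q_def p1_def p2_def by (rule sum_subtractf)
 also have "(SUM u<N. if u : ?Cl then q / 16 else 0) = real (card ?Cl) * (q / 16)"
 proof -
  have "{..<N} Int ?Cl = ?Cl" by auto
  thus ?thesis using sum.inter_restrict[of "{..<N}" "%_. q / 16" ?Cl] by simp
 qed
 finally have 1: "Phi lg ?a1 + Phi lg ?a2 <= Phi lg al - real (card ?Cl) * (q / 16)" .
 have "real (2 ^ pb P) <= real (card ?Cl)" using cl by (simp only: of_nat_le_iff)
 hence "real (2 ^ pb P) * (q / 16) <= real (card ?Cl) * (q / 16)" using q0 by (intro mult_right_mono) auto
 hence 2: "Phi lg ?a1 + Phi lg ?a2 <= Phi lg al - 2 ^ pb P / 16 * q" using 1 by simp
 have "Vl lg al = Vl lg ?a1 + Vl lg ?a2" unfolding Vl_def[OF nd] Vl_def[OF nd1] Vl_def[OF nd2] sum.distrib[symmetric]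
  by (intro sum.cong refl) (auto simp: insert_commute[of _ ?c] insert_commute[of _ "ng ?c"] intro!: node_add(3)[OF nd c])
 hence "Fp lg o1 ?a1 + Fp lg o1 ?a2 = Phi lg ?a1 + Phi lg ?a2 + real N * (2 ^ (2 * L) * ?r (Vl lg al) / (2 ^ (2 * L) * real o1 + 1))"
  unfolding Fp_def by (simp add: ring_distribs add_divide_distrib)
 thus ?thesis using 2 unfolding Fp_def q_def p1_def p2_def by linarith
qed

lemma objb_eq: "o1 <= N * N ==> objb P x o1 = x * (o1 * 2 ^ (2 * L) + 1)" "bshl P x (xL P) = x * 2 ^ (2 * L)"
proof -
 have "2 * L <= pK P"
 proof (rule Kle)
  have "2 * L <= 2 * 2 ^ L" using L_le by simp
  thus "2 * L <= 2 ^ Suc L" by simp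
  show "Suc L <= 167772260 * L" using L64 by simp
 qed
 thus 1: "bshl P x (xL P) = x * 2 ^ (2 * L)" for x by (simp add: xL_def bshl_eq mult_2)
 assume "o1 <= N * N"
 hence "o1 * 2 ^ (2 * L) <= 2 ^ (2 * L) * 2 ^ (2 * L)" using NNK(1) by (intro mult_right_mono) auto
 hence "o1 * 2 ^ (2 * L) + 1 <= 2 ^ (4 * L) + 2 ^ (4 * L)" by (intro add_mono) (auto simp: power_add[symmetric])
 also have "... = 2 ^ (4 * L + 1)" by simp
 finally have "o1 * 2 ^ (2 * L) + 1 <= pK P" by (rule Kle) (use L64 in linarith)
 thus "objb P x o1 = x * (o1 * 2 ^ (2 * L) + 1)" unfolding objb_def 1 by (rule bmul_eq)
qed

text \<open>Otherwise each path ends in a leaf of too large volume or makes pq conditioning steps. The potential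
Fp is at most 2 N times the mass at the root and drops by 2^b / 16 times the mass in each step, whereas
pq * 2^b > 32 N.\<close>

lemma leaf_exists:
 assumes w: "wfl lg" and h: "~ hasneg P lg" and ob: "~ objviol P lg o1" and o1: "o1 <= N * N"
 shows "EX z<2 ^ pq P. leafok P (mass lg (path P lg z)) (ddm lg (path P lg z)) o1"
proof (rule ccontr)
 assume no: "~ ?thesis"
 let ?X = "2 ^ (2 * L) :: real"
 let ?r = "real_of_int"
 define d where "d = ?X * real o1 + 1"
 have d0: "d > 0" by (simp add: d_def add_nonneg_pos)
 have F: "Fp lg o1 al = Phi lg al + real N * (?X * ?r (Vl lg al) / d)" for al by (simp add: Fp_def d_def)
 have Phi0: "0 <= Phi lg al" if "node lg al" "0 < sm lg al" for al
  unfolding Phi_def using y_bound(1)[OF that] by (intro sum_nonneg) auto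
 have nond: "2 * real N * ?r (sm lg (pth lg z t)) < Fp lg o1 (pth lg z t)" if t: "t <= pq P" and ds: "~ dns lg (pth lg z t)" for z t
 proof -
  let ?al = "pth lg z t"
  have nd: "node lg ?al" using pth_node[OF w h t] by blast
  have p: "0 < sm lg ?al" by (rule pth_low(3)[OF w h t])
  obtain z' where z': "z' < 2 ^ pq P" "pth lg z (pq P) = path P lg z'" using pth_leaf by blast
  have al: "?al = path P lg z'" using pth_stop[OF t order_refl ds] z'(2) by simp
  have "~ leafok P (mass lg ?al) (ddm lg ?al) o1" unfolding al using no z'(1) by blast
  hence "2 * (mass lg ?al * (o1 * 2 ^ (2 * L) + 1)) < volr (ddm lg ?al) {u. u < N} * 2 ^ (2 * L)"
   using ds by (simp add: leafok_def dns_def objb_eq(1)[OF o1] objb_eq(2) not_le)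
  hence "real (2 * (mass lg ?al * (o1 * 2 ^ (2 * L) + 1))) < real (volr (ddm lg ?al) {u. u < N} * 2 ^ (2 * L))"
   by (simp only: of_nat_less_iff)
  moreover have "real (mass lg ?al) = ?r (sm lg ?al)" using node_mass(1)[OF nd] by (metis of_int_of_nat_eq)
  moreover have "real (volr (ddm lg ?al) {u. u < N}) = ?r (Vl lg ?al)" using volr_Vl[OF nd] by (metis of_int_of_nat_eq)
  ultimately have "2 * ?r (sm lg ?al) * d < ?X * ?r (Vl lg ?al)" by (simp add: d_def algebra_simps)
  hence "2 * ?r (sm lg ?al) < ?X * ?r (Vl lg ?al) / d" using d0 by (simp add: pos_less_divide_eq)
  hence "real N * (2 * ?r (sm lg ?al)) < real N * (?X * ?r (Vl lg ?al) / d)" using N_pos by (intro mult_strict_left_mono) auto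
  thus ?thesis using Phi0[OF nd p] unfolding F by simp
 qed
 let ?B = "2 ^ pb P / 16 :: real"
 \<comment> \<open>The second bound counts the drops still to come; the first is what the excess
   volume of a path that stops early provides.\<close>
 have main: "min (2 * real N) (real (pq P - t) * ?B) * ?r (sm lg (pth lg z t)) < Fp lg o1 (pth lg z t)" if "t <= pq P" for z t
  using that
 proof (induction t arbitrary: z rule: inc_induct)
  case base
  let ?al = "pth lg z (pq P)"
  have nd: "node lg ?al" using pth_node[OF w h order_refl] by blast
  have p: "0 < sm lg ?al" by (rule pth_low(3)[OF w h order_refl])
  show ?case
  proof (cases "dns lg ?al")
   case True
   let ?c = "ctr lg ?al"
   have c: "?c < N" by (rule ctr(1)[OF True])
   have m: "int (mass lg ?al) = sm lg ?al" "int (mass lg (insert ?c ?al)) = sm lg (insert ?c ?al)" "int (mass lg (insert (ng ?c) ?al)) = sm lg (insert (ng ?c) ?al)"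
    using node_mass(1)[OF nd] node_mass(2)[OF nd c] node_mass(2)[OF nd ng_lt[OF c]] by auto
   \<comment> \<open>The claimed bound is 0 here, and strictness comes from the variance of the
     undecided centre.\<close>
   have "0 < sm lg (insert ?c ?al)" "sm lg (insert ?c ?al) < sm lg ?al"
    using ctr_und(1,2)[OF True] m p node_add(1)[OF nd c] by linarith+
   from y_bound(2)[OF nd p c this]
   have "0 < Phi lg ?al" unfolding Phi_def using c y_bound(1)[OF nd p] by (intro sum_pos2[where i = ?c]) auto
   moreover have "0 <= real N * (?X * ?r (Vl lg ?al) / d)" using Vl_nonneg[OF nd] d0 by simp
   ultimately have "0 < Fp lg o1 ?al" unfolding F by linarith
   thus ?thesis by simp
  next
   case False
   have "min (2 * real N) (real (pq P - pq P) * ?B) * ?r (sm lg ?al) <= 2 * real N * ?r (sm lg ?al)"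
    using p by (intro mult_right_mono) auto
   thus ?thesis using nond[OF order_refl False] by simp
  qed
 next
  case (step t)
  let ?al = "pth lg z t"
  have t: "t <= pq P" "Suc t <= pq P" using step.hyps by auto
  have nd: "node lg ?al" using pth_node[OF w h t(1)] by blast
  have p: "0 < sm lg ?al" by (rule pth_low(3)[OF w h t(1)])
  define M where "M = min (2 * real N) (real (pq P - t) * ?B)"
  define M' where "M' = min (2 * real N) (real (pq P - Suc t) * ?B)"
  show ?case
  proof (cases "dns lg ?al")
   case True
   let ?c = "ctr lg ?al"
   let ?a1 = "insert ?c ?al" and ?a2 = "insert (ng ?c) ?al"
   note ch = pth_child[OF step.hyps(2) True]
   have nd': "node lg ?a1" "node lg ?a2" unfolding ch[symmetric] using pth_node[OF w h t(2)] by blast+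
   have "M' * ?r (sm lg ?a1) < Fp lg o1 ?a1" "M' * ?r (sm lg ?a2) < Fp lg o1 ?a2"
    unfolding ch[symmetric] M'_def by (rule step.IH)+
   hence "M' * ?r (sm lg ?a1) + M' * ?r (sm lg ?a2) < Fp lg o1 ?al - ?B * ?r (sm lg ?al)"
    using Fp_drop[OF nd True p nd', of o1] by linarith
   moreover have "M' * ?r (sm lg ?a1) + M' * ?r (sm lg ?a2) = M' * ?r (sm lg ?al)"
    unfolding node_add(1)[OF nd ctr(1)[OF True]] by (simp add: ring_distribs)
   ultimately have "(M' + ?B) * ?r (sm lg ?al) < Fp lg o1 ?al" by (simp add: ring_distribs)
   moreover have "M <= M' + ?B"
   proof -
    have e: "real (pq P - t) = real (pq P - Suc t) + 1" using step.hyps by (simp add: of_nat_diff)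
    have "real (pq P - t) * ?B = real (pq P - Suc t) * ?B + ?B" unfolding e by (simp only: distrib_right mult_1_left)
    moreover have "0 <= ?B" by simp
    ultimately show ?thesis unfolding M_def M'_def by linarith
   qed
   hence "M * ?r (sm lg ?al) <= (M' + ?B) * ?r (sm lg ?al)" using p by (intro mult_right_mono) auto
   ultimately show ?thesis unfolding M_def by linarith
  next
   case False
   have "M * ?r (sm lg ?al) <= 2 * real N * ?r (sm lg ?al)"
    using p unfolding M_def by (intro mult_right_mono) auto
   thus ?thesis using nond[OF t(1) False] unfolding M_def by simp
  qed
 qed
 have nd: "node lg {}" using pth_node[OF w h, of 0 0] by (simp add: pth_0)
 have p: "0 < sm lg {}" using pth_low(3)[OF w h, of 0 0] by (simp add: pth_0)
 have qB: "2 * real N <= real (pq P - 0) * ?B"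
 proof -
  have "real (32 * N) <= real (pq P * 2 ^ pb P)" using qb by (simp only: of_nat_le_iff)
  thus ?thesis by simp
 qed
 have lo: "2 * real N * ?r (sm lg {}) < Fp lg o1 {}" using main[of 0 0] qB by (simp add: pth_0 min_absorb1)
 have "Phi lg {} <= (SUM u<N. ?r (sm lg {}))" unfolding Phi_def using p by (intro sum_mono) simp
 hence 1: "Phi lg {} <= real N * ?r (sm lg {})" by simp
 have "volr (ddm lg {}) {u. u < N} * 2 ^ (2 * L) <= mcap P * (o1 * 2 ^ (2 * L) + 1)"
  using ob by (simp add: objviol_def objb_eq(1)[OF o1] objb_eq(2) not_less)
 hence "real (volr (ddm lg {}) {u. u < N} * 2 ^ (2 * L)) <= real (mcap P * (o1 * 2 ^ (2 * L) + 1))"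
  by (simp only: of_nat_le_iff)
 moreover have "real (volr (ddm lg {}) {u. u < N}) = ?r (Vl lg {})" using volr_Vl[OF nd] by (metis of_int_of_nat_eq)
 ultimately have "?X * ?r (Vl lg {}) <= ?r (sm lg {}) * d" by (simp add: d_def sm_empty algebra_simps)
 hence "?X * ?r (Vl lg {}) / d <= ?r (sm lg {})" using d0 by (simp add: pos_divide_le_eq)
 hence "real N * (?X * ?r (Vl lg {}) / d) <= real N * ?r (sm lg {})" by (rule mult_left_mono) simp
 thus False using 1 lo unfolding F by linarith
qed

end

section \<open>Progress of the perceptron\<close>

text \<open>Isolates arithmetic of the certificate update: \<open>a\<close> is total weight times
  leaf mass, \<open>b\<close> the same with the mass of the target, \<open>c\<close> the slack and
  \<open>f\<close> the separated pseudo-mass. The target cancels and half of \<open>a\<close>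
  survives.\<close>

lemma cut_gain_bound:
 fixes a b c e f g :: int
 assumes "g <= - a + b + c" "e <= f - b" "2 * f <= a"
 shows "2 * (e + g) <= - a + 2 * c"
proof -
 have "e + g <= (f - b) + (- a + b + c)" using assms(2,1) by (rule add_mono)
 hence "2 * (e + g) <= 2 * ((f - b) + (- a + b + c))" by (rule mult_left_mono) simp
 also have "... = 2 * f - 2 * a + 2 * c" by (simp only: algebra_simps)
 also have "... <= a - 2 * a + 2 * c" using assms(3) by (intro add_right_mono diff_right_mono)
 finally show ?thesis by simp
qed

lemma sum_div_mod:
 fixes h :: "nat => nat => 'a::comm_monoid_add"
 shows "(SUM i<N * N. h (i div N) (i mod N)) = (SUM u<N. SUM v<N. h u v)"
proof (cases "N = 0")
 case False
 have "(SUM i<N * N. h (i div N) (i mod N)) = (SUM (u, v):{..<N} \<times> {..<N}. h u v)"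
 proof (rule sum.reindex_bij_witness[of _ "%(u, v). u * N + v" "%i. (i div N, i mod N)"])
  fix i assume "i : {..<N * N}"
  thus "(i div N, i mod N) : {..<N} \<times> {..<N}" using False by (simp add: less_mult_imp_div_less)
 next
  fix e assume e: "e : {..<N} \<times> {..<N}"
  obtain u v where uv: "e = (u, v)" by (cases e)
  have "u * N + v < Suc u * N" using e uv by simp
  also have "... <= N * N" using e uv by (intro mult_right_mono) auto
  finally show "(case e of (u, v) => u * N + v) : {..<N * N}" using uv by simp
 qed (use False in auto)
 thus ?thesis by (simp add: sum.cartesian_product)
qed simp

context alg begin

section \<open>The potential and its decrease\<close>

definition Us :: int where "Us = 2 ^ (67108884 * L)"
definition Gs :: int where "Gs = 2 ^ (67108874 * L)"

lemma pw: "i <= j ==> (2::int) ^ (i * L) <= 2 ^ (j * L)"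
 by (intro power_increasing mult_right_mono) auto

lemma pw2: "i < j ==> 4 * (2::int) ^ (i * L) <= 2 ^ (j * L)"
proof -
 assume "i < j"
 hence "Suc i * L <= j * L" by (intro mult_right_mono) auto
 hence "2 + i * L <= j * L" using L64 by simp
 hence "(2::int) ^ (2 + i * L) <= 2 ^ (j * L)" by (rule power_increasing) simp
 thus ?thesis by (simp add: power_add)
qed

lemma mmL: "mm <= L" using qL by (simp add: mm_def)

text \<open>The Fourier vector of the log, which is the state of the perceptron.\<close>

definition Yc :: "(nat => nat) => nat set => int" where
 "Yc lg T = (SUM e<ecnt. ec lg e * fc (ebt lg e) T)"

definition Pot :: "(nat => nat) => nat set => int" where
 "Pot lg X = (SUM T:TS. (Yc lg T - Us * fc X T)^2)"

definition truth :: "nat set => bool" where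
 "truth X \<longleftrightarrow> (ALL u<N. u : X \<longleftrightarrow> ng u ~: X)"

lemma truth_cns: "truth X ==> cns X"
 unfolding truth_def cns_eq by blast

lemma truth_ng: "truth X ==> u < N ==> ng u : X \<longleftrightarrow> u ~: X"
 unfolding truth_def by blast

lemma truth_sub: "truth X ==> lits g <= X ==> cns g"
 unfolding cns_eq
proof (intro allI impI notI)
 fix u assume X: "truth X" and g: "lits g <= X" and u: "u < N" "u : g" "ng u : g"
 have "u : lits g" "ng u : lits g" using u ng_lt[OF u(1)] unfolding lits_def by blast+
 thus False using truth_ng[OF X u(1)] g by blast
qed

lemma Q2_truth:
 assumes X: "truth X"
 shows "Q2 g X = (if lits g <= X then 2 ^ clen g else 0)"
proof (cases "lits g <= X")
 case True
 have "~ (EX u<N. u : g & ng u : X)" using True truth_ng[OF X] unfolding lits_def by blast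
 moreover have "lits g Int lits X = lits g" using True by (auto simp: lits_def)
 ultimately show ?thesis using True by (simp add: Q2_def clen_eq)
next
 case False
 hence "EX u<N. u : g & ng u : X" using truth_ng[OF X] unfolding lits_def by blast
 thus ?thesis using False by (simp add: Q2_def)
qed

text \<open>By the kernel identity an inner product with an atom evaluates measures:
  \<open>sm\<close> for the log, and the point mass of size \<open>2^mm * Us\<close> for
  \<open>X\<close>. The surplus \<open>Gs\<close> in \<open>cUU\<close> remains as a slack.\<close>

lemma correlation:
 assumes w: "wfl lg" and X: "truth X" and g: "cns g" "clen g <= mm"
 shows "2 ^ (mm - clen g) * (SUM T:TS. (Yc lg T - Us * fc X T) * fc g T)
  = sm lg g - (if lits g <= X then 2 ^ mm * Us else 0) - Gs * 2 ^ (mm - clen g)"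
proof -
 have "(SUM T:TS. Yc lg T * fc g T) = (SUM T:TS. SUM e<ecnt. ec lg e * (fc g T * fc (ebt lg e) T))"
  unfolding Yc_def sum_distrib_right by (intro sum.cong refl) simp
 also have "... = (SUM e<ecnt. SUM T:TS. ec lg e * (fc g T * fc (ebt lg e) T))" by (rule sum.swap)
 also have "... = (SUM e<ecnt. ec lg e * (Q2 g (ebt lg e) - 1))"
 proof (rule sum.cong)
  fix e assume e: "e : {..<ecnt}"
  show "(SUM T:TS. ec lg e * (fc g T * fc (ebt lg e) T)) = ec lg e * (Q2 g (ebt lg e) - 1)"
  proof (cases "ec lg e = 0")
   case False
   hence "cns (ebt lg e)" using w e by (simp add: wfl_def)
   thus ?thesis using Q2_TS[OF g(1) _ g(2), of "ebt lg e"] by (simp add: sum_distrib_left[symmetric])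
  qed simp
 qed simp
 finally have 1: "(SUM T:TS. Yc lg T * fc g T) = (SUM e<ecnt. ec lg e * (Q2 g (ebt lg e) - 1))" .
 define S where "S = (SUM e<ecnt. ec lg e * (Q2 g (ebt lg e) - 1))"
 have "(SUM T:TS. fc X T * fc g T) = Q2 g X - 1"
  using Q2_TS[OF g(1) truth_cns[OF X] g(2)] by (simp add: mult.commute)
 hence 2: "(SUM T:TS. (Yc lg T - Us * fc X T) * fc g T) = S - Us * (Q2 g X - 1)"
  using 1 by (simp add: left_diff_distrib sum_subtractf S_def mult.assoc sum_distrib_left[symmetric])
 have p: "(2::int) ^ (mm - clen g) * 2 ^ clen g = 2 ^ mm" using g(2) by (simp add: power_add[symmetric])
 have 3: "sm lg g = 2 ^ (mm - clen g) * (Us + Gs + S)"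
  using g(1) by (simp add: sm_eq S_def cUU_eq Us_def Gs_def)
 have 4: "2 ^ (mm - clen g) * Q2 g X = (if lits g <= X then 2 ^ mm else 0)" using p by (simp add: Q2_truth[OF X])
 have "2 ^ (mm - clen g) * (S - Us * (Q2 g X - 1)) = sm lg g - Us * (2 ^ (mm - clen g) * Q2 g X) - Gs * 2 ^ (mm - clen g)"
  unfolding 3 by (simp add: algebra_simps)
 thus ?thesis unfolding 2 4 by simp
qed

text \<open>The expanded square: twice the correlation of the update with the current error, plus
  the squared length of the update, bounded coordinatewise over at most \<open>2^(5 L)\<close>
  sets.\<close>

lemma pot_update:
 fixes wi d :: "nat => int"
 assumes w: "wfl lg" and X: "truth X"
  and Y: "!!T. T : TS ==> Yc lg' T = Yc lg T + (SUM i<m. d i * fc (g i) T)"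
  and d: "!!i. i < m ==> d i = (if cns (g i) then wi i * 2 ^ (mm - clen (g i)) else 0)"
  and len: "!!i. i < m ==> wi i ~= 0 ==> clen (g i) <= mm"
 shows "Pot lg' X <= Pot lg X + 2 * (SUM i<m. if cns (g i) then wi i * (sm lg (g i) - (if lits (g i) <= X then 2 ^ mm * Us else 0)
   - Gs * 2 ^ (mm - clen (g i))) else 0) + 2 ^ (5 * L) * (2 ^ mm * (SUM i<m. \<bar>wi i\<bar>))^2"
proof -
 define R where "R T = Yc lg T - Us * fc X T" for T
 define Z where "Z T = (SUM i<m. d i * fc (g i) T)" for T
 have "Pot lg' X = (SUM T:TS. (R T)^2 + 2 * (R T * Z T) + (Z T)^2)"
  unfolding Pot_def by (intro sum.cong refl) (simp add: Y R_def Z_def power2_eq_square algebra_simps)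
 also have "... = Pot lg X + 2 * (SUM T:TS. R T * Z T) + (SUM T:TS. (Z T)^2)"
  by (simp add: sum.distrib sum_distrib_left Pot_def R_def)
 also have "(SUM T:TS. R T * Z T) = (SUM T:TS. SUM i<m. d i * (R T * fc (g i) T))"
  unfolding Z_def sum_distrib_left by (intro sum.cong refl) simp
 also have "... = (SUM i<m. SUM T:TS. d i * (R T * fc (g i) T))" by (rule sum.swap)
 also have "... = (SUM i<m. if cns (g i) then wi i * (sm lg (g i) - (if lits (g i) <= X then 2 ^ mm * Us else 0)
   - Gs * 2 ^ (mm - clen (g i))) else 0)"
 proof (rule sum.cong)
  fix i assume "i : {..<m}"
  hence i: "i < m" by simp
  show "(SUM T:TS. d i * (R T * fc (g i) T)) = (if cns (g i) then wi i * (sm lg (g i) - (if lits (g i) <= X then 2 ^ mm * Us else 0)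
   - Gs * 2 ^ (mm - clen (g i))) else 0)"
  proof (cases "cns (g i) & wi i ~= 0")
   case True
   have "(SUM T:TS. d i * (R T * fc (g i) T)) = wi i * (2 ^ (mm - clen (g i)) * (SUM T:TS. R T * fc (g i) T))"
    using True d[OF i] by (simp add: sum_distrib_left[symmetric])
   also have "... = wi i * (sm lg (g i) - (if lits (g i) <= X then 2 ^ mm * Us else 0) - Gs * 2 ^ (mm - clen (g i)))"
    unfolding R_def using correlation[OF w X] True len[OF i] by simp
   finally show ?thesis using True by simp
  next
   case False
   hence "d i = 0" using d[OF i] by auto
   thus ?thesis using False by auto
  qed
 qed simp
 also have "(SUM T:TS. (Z T)^2) <= (SUM T:TS. (2 ^ mm * (SUM i<m. \<bar>wi i\<bar>))^2)"
 proof (rule sum_mono)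
  fix T
  have "\<bar>Z T\<bar> <= (SUM i<m. \<bar>d i * fc (g i) T\<bar>)" unfolding Z_def by (rule sum_abs)
  also have "... <= (SUM i<m. 2 ^ mm * \<bar>wi i\<bar>)"
  proof (rule sum_mono)
   fix i assume "i : {..<m}"
   hence i: "i < m" by simp
   have "\<bar>d i * fc (g i) T\<bar> <= \<bar>d i\<bar> * 1" unfolding abs_mult by (intro mult_left_mono fc_le1) simp
   also have "... <= 2 ^ mm * \<bar>wi i\<bar>"
   proof (cases "cns (g i)")
    case True
    have "(2::int) ^ (mm - clen (g i)) <= 2 ^ mm" by (rule power_increasing) auto
    hence "\<bar>wi i\<bar> * 2 ^ (mm - clen (g i)) <= \<bar>wi i\<bar> * 2 ^ mm" by (rule mult_left_mono) simp
    thus ?thesis using d[OF i] True by (simp add: abs_mult mult.commute)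
   qed (simp add: d[OF i])
   finally show "\<bar>d i * fc (g i) T\<bar> <= 2 ^ mm * \<bar>wi i\<bar>" .
  qed
  finally have "\<bar>Z T\<bar> <= 2 ^ mm * (SUM i<m. \<bar>wi i\<bar>)" by (simp add: sum_distrib_left)
  thus "(Z T)^2 <= (2 ^ mm * (SUM i<m. \<bar>wi i\<bar>))^2" by (metis abs_ge_zero power2_abs power_mono)
 qed
 also have "... = int (card TS) * (2 ^ mm * (SUM i<m. \<bar>wi i\<bar>))^2" by simp
 also have "... <= 2 ^ (5 * L) * (2 ^ mm * (SUM i<m. \<bar>wi i\<bar>))^2"
 proof (rule mult_right_mono)
  have "int (card TS) <= int (2 ^ (5 * L))" using card_TS by (simp only: of_nat_le_iff)
  thus "int (card TS) <= 2 ^ (5 * L)" by simp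
 qed simp
 finally show ?thesis by simp
qed

definition oX :: "nat set => nat" where
 "oX X = (SUM u<N. SUM v<N. if adjb u v & u : X & v ~: X then 1 else 0)"

lemma oX_le: "oX X <= N * N"
proof -
 have "oX X <= (SUM u<N. SUM v<N. 1)" unfolding oX_def by (intro sum_mono) auto
 thus ?thesis by simp
qed

definition dw :: "(nat => nat) => nat => nat => int" where
 "dw lg o1 i = int (upos P lg o1 i) - int (uneg P lg o1 i)"

definition gain :: "(nat => nat) => nat => nat set => nat => int" where
 "gain lg o1 X i = (let g = ubet lg o1 i in if cns g then dw lg o1 i * (sm lg g - (if lits g <= X then 2 ^ mm * Us else 0)
   - Gs * 2 ^ (mm - clen g)) else 0)"

definition decreases :: "(nat => nat) => nat => nat set => bool" where
 "decreases lg o1 X \<longleftrightarrow> (ALL i<slots. dw lg o1 i ~= 0 --> clen (ubet lg o1 i) <= mm) &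
   2 * (SUM i<slots. gain lg o1 X i) + 2 ^ (5 * L) * (2 ^ mm * (SUM i<slots. \<bar>dw lg o1 i\<bar>))^2 <= -1"

lemma mm_pow: "(2::int) ^ mm <= 2 ^ L"
 using mmL by (rule power_increasing) simp

lemma sum_slots: "(SUM i<slots. f i) = (SUM i<N * N. f i) + f (N * N)"
 for f :: "nat => int" by (simp add: slots_eq)

text \<open>The atom is negative for the log and nonnegative for the point mass, so the slack
  \<open>Gs\<close> is gained in full and exceeds the squared length, at most
  \<open>2^(7 L)\<close>.\<close>

lemma dec_neg:
 assumes h: "hasneg P lg"
 shows "decreases lg o1 X"
proof -
 let ?b = "vset P lg"
 have "EX z<2 ^ pq P. neg1 P lg z" using h unfolding hasneg_def shl_q(1) bex_eq[OF shl_q(2)] .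
 from bleast[OF shl_q(2) this] have "neg1 P lg (vz P lg)" unfolding vz_def shl_q(1) by blast
 hence "EX u<N. neg2 P lg (vz P lg) u" by (simp add: neg1_def)
 from bleast[OF NK(1) this] have "neg2 P lg (vz P lg) (vu P lg)" by (simp add: vu_def)
 hence "EX v<N. neg3 P lg (vz P lg) (vu P lg) v" by (simp add: neg2_def)
 from bleast[OF NK(1) this] have "neg3 P lg (vz P lg) (vu P lg) (vv P lg)" by (simp add: vv_def)
 hence "EX w<N. negz P lg (vz P lg) (vu P lg) (vv P lg) w" by (simp add: neg3_def)
 from bleast[OF NK(1) this] have "negz P lg (vz P lg) (vu P lg) (vv P lg) (vw P lg)" by (simp add: vw_def)
 hence neg: "sm lg ?b < 0" by (simp add: negz_def sm_def vset_def)
 have len: "clen ?b <= mm"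
  using clen_insert[of "vu P lg" "insert (vv P lg) (insert (vw P lg) (path P lg (vz P lg)))"]
   clen_insert[of "vv P lg" "insert (vw P lg) (path P lg (vz P lg))"] clen_insert[of "vw P lg" "path P lg (vz P lg)"]
   pth_len[of "pq P" lg "vz P lg"] unfolding vset_def path_pth mm_def by linarith
 have cn: "cns ?b" using neg by (simp add: sm_eq split: if_splits)
 have ub: "ubet lg o1 i = ?b" for i using h by (simp add: ubet_def)
 have dw: "dw lg o1 i = (if i = N * N then 1 else 0)" for i using h by (simp add: dw_def upos_def uneg_def)
 have "(SUM i<N * N. gain lg o1 X i) = 0" by (intro sum.neutral) (auto simp: gain_def Let_def dw)
 hence g: "(SUM i<slots. gain lg o1 X i) = gain lg o1 X (N * N)" by (simp add: sum_slots)
 have "(SUM i<N * N. \<bar>dw lg o1 i\<bar>) = 0" by (intro sum.neutral) (auto simp: dw)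
 hence a: "(SUM i<slots. \<bar>dw lg o1 i\<bar>) = 1" by (simp add: sum_slots dw)
 have "Gs * 1 <= Gs * 2 ^ (mm - clen ?b)" by (intro mult_left_mono) (auto simp: Gs_def)
 moreover have "0 <= (if lits ?b <= X then 2 ^ mm * Us else 0)" by (simp add: Us_def)
 moreover have "gain lg o1 X (N * N) = sm lg ?b - (if lits ?b <= X then 2 ^ mm * Us else 0) - Gs * 2 ^ (mm - clen ?b)"
  using cn by (simp add: gain_def Let_def ub dw)
 ultimately have g1: "gain lg o1 X (N * N) <= - Gs" using neg by linarith
 have "2 ^ (5 * L) * (2 ^ mm * 1)^2 <= 2 ^ (5 * L) * ((2::int) ^ L)^2"
  using mm_pow by (intro mult_left_mono power_mono) auto
 also have "... = 2 ^ (7 * L)" by (simp add: power_add[symmetric] power_mult[symmetric])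
 also have "... <= Gs" unfolding Gs_def by (rule pw) simp
 finally have q: "2 ^ (5 * L) * (2 ^ mm * 1)^2 <= Gs" .
 have "1 <= Gs" by (simp add: Gs_def)
 thus ?thesis unfolding decreases_def g a ub using len q g1 by auto
qed

text \<open>When the guess is the cut value of \<open>X\<close>, the objective of the log exceeds
  that of the point mass by the slack in \<open>objb\<close>. Scaled by \<open>Us\<close> this slack
  is \<open>2^(67108882 L)\<close> times \<open>2^mm\<close>, far above the contribution of
  \<open>Gs\<close> from all pairs.\<close>

lemma dec_obj:
 assumes w: "wfl lg" and h: "~ hasneg P lg" and ob: "objviol P lg (oX X)" and X: "truth X"
 shows "decreases lg (oX X) X"
proof -
 let ?o = "oX X"
 have nd: "node lg {}" using pth_node[OF w h, of 0 0] by (simp add: pth_0)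
 let ?g = "%u v. insert u (insert (ng v) {})"
 have ub: "ubet lg ?o i = ?g (i div N) (i mod N)" if "i < N * N" for i
  using h ob that by (simp add: ubet_def divN)
 have dw: "dw lg ?o i = (if adjb (i div N) (i mod N) then -1 else 0)" if "i < N * N" for i
  using h ob that by (simp add: dw_def upos_def uneg_def divN)
 have dw': "dw lg ?o (N * N) = 0" using h ob by (simp add: dw_def upos_def uneg_def)
 have len: "clen (?g u v) <= mm" for u v
 proof -
  have "clen {} = 0" by (simp add: clen_eq lits_def)
  thus ?thesis using clen_insert[of u "{ng v}"] clen_insert[of "ng v" "{}"] unfolding mm_def by linarith
 qed
 have "(SUM i<slots. gain lg ?o X i) = (SUM i<N * N. gain lg ?o X i)" by (simp add: sum_slots gain_def Let_def dw')
 also have "... <= (SUM i<N * N. (%u v. if adjb u v then - sm lg (?g u v) + (if u : X & v ~: X then 2 ^ mm * Us else 0) + Gs * 2 ^ mm else 0) (i div N) (i mod N))"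
 proof (rule sum_mono)
  fix i assume "i : {..<N * N}"
  hence i: "i < N * N" by simp
  define u v where "u = i div N" and "v = i mod N"
  have uv: "u < N" "v < N" using i N_pos by (auto simp: u_def v_def less_mult_imp_div_less)
  have U0: "0 <= 2 ^ mm * Us" "0 <= Gs * 2 ^ mm" by (simp_all add: Us_def Gs_def)
  have "gain lg ?o X i <= (if adjb u v then - sm lg (?g u v) + (if u : X & v ~: X then 2 ^ mm * Us else 0) + Gs * 2 ^ mm else 0)"
  proof (cases "cns (?g u v)")
   case True
   have l: "lits (?g u v) <= X \<longleftrightarrow> u : X & v ~: X"
   proof -
    have "lits (?g u v) = insert u (insert (ng v) {})" using uv by (auto simp: lits_def)
    thus ?thesis using truth_ng[OF X uv(2)] by simp
   qed
   have "Gs * 2 ^ (mm - clen (?g u v)) <= Gs * 2 ^ mm" by (intro mult_left_mono power_increasing) (auto simp: Gs_def)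
   thus ?thesis using True unfolding gain_def Let_def ub[OF i] dw[OF i] u_def[symmetric] v_def[symmetric] l by simp
  next
   case False
   hence "sm lg (?g u v) = 0" by (simp add: sm_eq)
   thus ?thesis using False U0 unfolding gain_def Let_def ub[OF i] u_def[symmetric] v_def[symmetric] by simp
  qed
  thus "gain lg ?o X i <= (%u v. if adjb u v then - sm lg (?g u v) + (if u : X & v ~: X then 2 ^ mm * Us else 0) + Gs * 2 ^ mm else 0) (i div N) (i mod N)"
   by (simp only: u_def v_def)
 qed
 also have "... = (SUM u<N. SUM v<N. if adjb u v then - sm lg (?g u v) + (if u : X & v ~: X then 2 ^ mm * Us else 0) + Gs * 2 ^ mm else 0)"
  by (rule sum_div_mod)
 also have "... <= (SUM u<N. SUM v<N. - (if adjb u v then sm lg (?g u v) else 0) + (2 ^ mm * Us * int (if adjb u v & u : X & v ~: X then 1 else 0) + Gs * 2 ^ mm))"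
  by (intro sum_mono) (auto simp: Gs_def)
 also have "... = (SUM u<N. SUM v<N. - (if adjb u v then sm lg (?g u v) else 0)) +
   ((SUM u<N. SUM v<N. 2 ^ mm * Us * int (if adjb u v & u : X & v ~: X then 1 else 0)) + (SUM u<N. SUM v<N. Gs * 2 ^ mm))"
  by (simp only: sum.distrib)
 also have "(SUM u<N. SUM v<N. - (if adjb u v then sm lg (?g u v) else 0)) = - Vl lg {}" by (simp only: Vl_def[OF nd] sum_negf)
 also have "(SUM u<N. SUM v<N. 2 ^ mm * Us * int (if adjb u v & u : X & v ~: X then 1 else 0)) = 2 ^ mm * Us * int ?o"
  by (simp only: oX_def of_nat_sum sum_distrib_left)
 also have "(SUM u<N. SUM v<N. Gs * 2 ^ mm) = int (N * N) * (Gs * 2 ^ mm)" by simp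
 finally have 1: "(SUM i<slots. gain lg ?o X i) <= - Vl lg {} + (2 ^ mm * Us * int ?o + int (N * N) * (Gs * 2 ^ mm))" .
 have "mcap P * (?o * 2 ^ (2 * L) + 1) < volr (ddm lg {}) {u. u < N} * 2 ^ (2 * L)"
  using ob by (simp add: objviol_def objb_eq(1)[OF oX_le] objb_eq(2))
 hence "int (mcap P * (?o * 2 ^ (2 * L) + 1)) < int (volr (ddm lg {}) {u. u < N} * 2 ^ (2 * L))" by (simp only: of_nat_less_iff)
 hence 2: "int (mcap P) * (int ?o * 2 ^ (2 * L) + 1) < Vl lg {} * 2 ^ (2 * L)" using volr_Vl[OF nd] by (simp add: algebra_simps)
 have mc: "2 ^ mm * Us <= int (mcap P)" by (simp add: mcap_eq cUU_eq Us_def)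
 have "2 ^ mm * Us * (int ?o * 2 ^ (2 * L) + 1) <= int (mcap P) * (int ?o * 2 ^ (2 * L) + 1)"
  using mc by (rule mult_right_mono) simp
 hence 3: "2 ^ mm * Us * (int ?o * 2 ^ (2 * L) + 1) < Vl lg {} * 2 ^ (2 * L)" using 2 by (rule le_less_trans)
 have Ue: "Us = 2 ^ (67108882 * L) * 2 ^ (2 * L)" unfolding Us_def by (simp only: power_add[symmetric]) (simp add: algebra_simps)
 have "(2 ^ mm * Us * int ?o + 2 ^ mm * 2 ^ (67108882 * L)) * 2 ^ (2 * L) = 2 ^ mm * Us * (int ?o * 2 ^ (2 * L)) + 2 ^ mm * Us"
  unfolding Ue by (simp add: algebra_simps)
 also have "... < Vl lg {} * 2 ^ (2 * L)" using 3 by (simp add: algebra_simps)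
 finally have 4: "2 ^ mm * Us * int ?o + 2 ^ mm * 2 ^ (67108882 * L) < Vl lg {}" by (rule mult_right_less_imp_less) simp
 have "int (N * N) <= int (2 ^ (2 * L))" using NNK(1) by (simp only: of_nat_le_iff)
 hence NN: "int (N * N) <= 2 ^ (2 * L)" by simp
 have "int (N * N) * (Gs * 2 ^ mm) <= 2 ^ (2 * L) * (Gs * 2 ^ mm)" using NN by (rule mult_right_mono) (simp add: Gs_def)
 also have "... = 2 ^ mm * 2 ^ (67108876 * L)"
 proof -
  have "(2::int) ^ (67108876 * L) = 2 ^ (2 * L) * Gs" unfolding Gs_def by (simp only: power_add[symmetric]) (simp add: algebra_simps)
  thus ?thesis by simp
 qed
 finally have 5: "int (N * N) * (Gs * 2 ^ mm) <= 2 ^ mm * 2 ^ (67108876 * L)" .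
 define z y where "z = (2::int) ^ mm * 2 ^ (67108876 * L)" and "y = (2::int) ^ mm * 2 ^ (67108882 * L)"
 have "4 * (2::int) ^ (67108876 * L) <= 2 ^ (67108882 * L)" by (rule pw2) simp
 hence "2 ^ mm * (4 * (2::int) ^ (67108876 * L)) <= 2 ^ mm * 2 ^ (67108882 * L)" by (rule mult_left_mono) simp
 hence "4 * z <= y" by (simp add: z_def y_def)
 moreover have "0 <= z" by (simp add: z_def)
 ultimately have 6: "2 * (SUM i<slots. gain lg ?o X i) <= - z" using 1 4 5 unfolding z_def[symmetric] y_def[symmetric] by linarith
 have "(SUM i<slots. \<bar>dw lg ?o i\<bar>) = (SUM i<N * N. \<bar>dw lg ?o i\<bar>)" by (simp add: sum_slots dw')
 also have "... <= (SUM i<N * N. 1)" by (intro sum_mono) (simp add: dw)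
 also have "... <= 2 ^ (2 * L)" using NN by simp
 finally have a: "(SUM i<slots. \<bar>dw lg ?o i\<bar>) <= 2 ^ (2 * L)" .
 have "2 ^ (5 * L) * (2 ^ mm * (SUM i<slots. \<bar>dw lg ?o i\<bar>))^2 <= 2 ^ (5 * L) * (2 ^ L * (2::int) ^ (2 * L))^2"
  using mm_pow a by (intro mult_left_mono power_mono mult_mono) (auto intro: sum_nonneg)
 also have "... = 2 ^ (11 * L)" by (simp add: power_add[symmetric] power_mult[symmetric])
 also have "... <= 2 ^ (67108875 * L)" by (rule pw) simp
 finally have q: "2 ^ (5 * L) * (2 ^ mm * (SUM i<slots. \<bar>dw lg ?o i\<bar>))^2 <= 2 ^ (67108875 * L)" .
 define x where "x = (2::int) ^ (67108875 * L)"
 have "1 * 2 ^ (67108876 * L) <= z" unfolding z_def by (intro mult_right_mono) auto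
 moreover have "4 * x <= 2 ^ (67108876 * L)" unfolding x_def by (rule pw2) simp
 ultimately have "4 * x <= z" by simp
 moreover have "1 <= x" by (simp add: x_def)
 ultimately have "2 * (SUM i<slots. gain lg ?o X i) + 2 ^ (5 * L) * (2 ^ mm * (SUM i<slots. \<bar>dw lg ?o i\<bar>))^2 <= -1"
  using 6 q unfolding x_def[symmetric] by linarith
 moreover have "clen (ubet lg ?o i) <= mm" if "i < slots" "dw lg ?o i ~= 0" for i
 proof -
  have "i < N * N" using that dw' by (auto simp: slots_eq less_Suc_eq)
  thus ?thesis using len by (simp add: ub)
 qed
 ultimately show ?thesis by (auto simp: decreases_def)
qed

lemma leaf_sel:
 assumes w: "wfl lg" and h: "~ hasneg P lg" and ob: "~ objviol P lg o1" and o1: "o1 <= N * N"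
 defines "al \<equiv> asel P lg o1"
 shows "node lg al" "leaf P (mass lg al) (ddm lg al)" "2 ^ mm * 2 ^ (67108883 * L) <= sm lg al" "clen al <= pq P"
  "leafok P (mass lg al) (ddm lg al) o1"
proof -
 from bleast[OF shl_q(2) leaf_exists[OF w h ob o1]]
 show lk: "leafok P (mass lg al) (ddm lg al) o1" unfolding al_def asel_def zsel_def shl_q(1) by blast
 have al: "al = pth lg (zsel P lg o1) (pq P)" by (simp add: al_def asel_def path_pth)
 show nd: "node lg al" unfolding al using pth_node[OF w h order_refl] by blast
 show "2 ^ mm * 2 ^ (67108883 * L) <= sm lg al" unfolding al by (rule pth_low(1)[OF w h order_refl])
 show "clen al <= pq P" unfolding al by (rule pth_len[OF order_refl])
 have lo: "2 ^ (4 * L) <= sm lg al" unfolding al by (rule pth_low(2)[OF w h order_refl])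
 interpret rounding P "mass lg al" "ddm lg al" by (rule node_rounding[OF nd lo])
 show "leaf P (mass lg al) (ddm lg al)"
 proof unfold_locales
  fix u assume u: "u < N" "und P (mass lg al) (ddm lg al) u"
  have "~ dense P (mass lg al) (ddm lg al) u" using lk u(1) by (auto simp: leafok_def hasdense_def)
  moreover have "pb P <= pK P"
  proof -
   have "pb P <= pb P * pq P" using q1 by (cases "pq P") auto
   thus ?thesis using bL L_le by (intro smallK) linarith
  qed
  ultimately show "card {v. v < N & close P (mass lg al) (ddm lg al) u v} <= 2 ^ pb P"
   using u(2) by (simp add: dense_def bshl_eq sum.If_cases Int_def not_less)
 qed
qed

text \<open>The update puts \<open>2^63 * W\<close> on the pairs and \<open>- Wsum\<close> on the
  leaf. The point mass at \<open>X\<close> satisfies this inequality, while the leaf misses it by at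
  least half of \<open>Wsum\<close> times its mass. That gain is linear in \<open>Wsum\<close>; the
  quadratic cost stays below \<open>Wsum * Gs\<close> because \<open>Wsum\<close> itself is small
  against \<open>Gs\<close>.\<close>

lemma dec_cut:
 assumes w: "wfl lg" and h: "~ hasneg P lg" and ob: "~ objviol P lg o1" and o1: "o1 <= N * N"
  and ne: "nempty P (sol P lg o1)" and X: "truth X"
 shows "decreases lg o1 X"
proof -
 define al where "al = asel P lg o1"
 note lf = leaf_sel[OF w h ob o1, folded al_def]
 interpret leaf P "mass lg al" "ddm lg al" by (rule lf(2))
 define S where "S = sol P lg o1"
 have S: "S = rnds P (mass lg al) (ddm lg al)" by (simp add: S_def sol_def al_def)
 have ne': "nempty P S" using ne by (simp add: S_def)
 have st: "stuck P (mass lg al) (ddm lg al) S" using rnds_final(2) ne' unfolding S by blast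
 interpret rs: rndS P "mass lg al" "ddm lg al" S using ok_rndS[of S] rnds_final(1) ne' unfolding S by blast
 define W where "W = sW P lg o1"
 define R where "R = sR P lg o1"
 have We: "W = WW P (mass lg al) (ddm lg al) S (rows P (mass lg al) (ddm lg al) S) (lsel P (mass lg al) (ddm lg al) S)"
  by (simp add: W_def fun_eq_iff sW_def sl_def al_def S_def)
 have Re: "R = unc P S (rowl P (rows P (mass lg al) (ddm lg al) S) (lsel P (mass lg al) (ddm lg al) S))"
  by (simp add: R_def sR_def sl_def al_def S_def)
 note ct = rs.stuck_certificate[OF st, folded We Re]
 let ?g = "%u v. insert u (insert (ng v) al)"
 have ub: "ubet lg o1 i = ?g (i div N) (i mod N)" if "i < N * N" for i
  using h ob that by (simp add: ubet_def divN al_def)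
 have ub': "ubet lg o1 (N * N) = al" using h ob by (simp add: ubet_def al_def)
 have dw: "dw lg o1 i = (if i div N : R & i mod N : R then int (W (i div N) (i mod N) * 2 ^ 63) else 0)" if "i < N * N" for i
  using h ob that by (simp add: dw_def upos_def uneg_def divN R_def W_def shl_num)
 have dw': "dw lg o1 (N * N) = - int (Wsum P W)" using h ob by (simp add: dw_def upos_def uneg_def W_def)
 have len: "clen (?g u v) <= mm" "clen al <= mm" for u v
  using clen_insert[of u "insert (ng v) al"] clen_insert[of "ng v" al] lf(4) unfolding mm_def by linarith+
 define p where "p = sm lg al"
 have p: "2 ^ mm * 2 ^ (67108883 * L) <= p" using lf(3) by (simp add: p_def)
 have "0 < (2::int) ^ mm * 2 ^ (67108883 * L)" by simp
 hence p0: "0 < p" using p by linarith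
 hence cal: "cns al" by (simp add: p_def sm_eq split: if_splits)
 define x where "x = (if lits al <= X then 2 ^ mm * Us else 0)"
 have x0: "0 <= x" by (simp add: x_def Us_def)
 have G0: "0 <= Gs" by (simp add: Gs_def)
 define ws where "ws = int (Wsum P W)"
 have ws1: "1 <= ws" using ct(3) by (simp add: ws_def)
 let ?a = "%u v. if u : R & v : R then int (W u v * ddm lg al u v) else 0"
 let ?t = "%u v. if u : R & v : R & u : X & v ~: X then int (W u v) else 0"
 have "(SUM i<N * N. gain lg o1 X i) <= (SUM i<N * N. (%u v. 2 ^ 63 * ?a u v - 2 ^ 63 * x * ?t u v) (i div N) (i mod N))"
 proof (rule sum_mono)
  fix i assume "i : {..<N * N}"
  hence i: "i < N * N" by simp
  define u v where "u = i div N" and "v = i mod N"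
  have uv: "u < N" "v < N" using i N_pos by (auto simp: u_def v_def less_mult_imp_div_less)
  have sg: "sm lg (?g u v) = int (ddm lg al u v)" using node_mass(3)[OF lf(1) uv] by simp
  have "gain lg o1 X i <= 2 ^ 63 * ?a u v - 2 ^ 63 * x * ?t u v"
  proof (cases "u : R & v : R")
   case uvR: True
   have lt: "lits (?g u v) <= X \<longleftrightarrow> u : X & v ~: X & lits al <= X"
   proof -
    have "lits (?g u v) = insert u (insert (ng v) (lits al))" using uv by (auto simp: lits_def)
    thus ?thesis using truth_ng[OF X uv(2)] by simp
   qed
   show ?thesis
   proof (cases "cns (?g u v)")
    case True
    have "gain lg o1 X i = int (W u v * 2 ^ 63) * (sm lg (?g u v) - (if lits (?g u v) <= X then 2 ^ mm * Us else 0) - Gs * 2 ^ (mm - clen (?g u v)))"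
     using True uvR unfolding gain_def Let_def ub[OF i] dw[OF i] u_def[symmetric] v_def[symmetric] by simp
    also have "... <= int (W u v * 2 ^ 63) * (sm lg (?g u v) - (if lits (?g u v) <= X then 2 ^ mm * Us else 0))"
     using G0 by (intro mult_left_mono) auto
    also have "... = 2 ^ 63 * ?a u v - 2 ^ 63 * x * ?t u v"
     using uvR unfolding sg lt x_def by (simp add: algebra_simps)
    finally show ?thesis .
   next
    case False
    hence "sm lg (?g u v) = 0" by (simp add: sm_eq)
    moreover have "?t u v * x = 0"
    proof (rule ccontr)
     assume "?t u v * x ~= 0"
     hence "lits (?g u v) <= X" unfolding lt x_def by (auto split: if_splits)
     hence "cns (?g u v)" by (rule truth_sub[OF X])
     thus False using False by simp
    qed
    hence "2 ^ 63 * x * ?t u v = 0" by auto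
    moreover have "gain lg o1 X i = 0" using False unfolding gain_def Let_def ub[OF i] u_def[symmetric] v_def[symmetric] by simp
    moreover have "?a u v = 0" using sg \<open>sm lg (?g u v) = 0\<close> by simp
    moreover have "b = 0 ==> g = 0 ==> a = 0 ==> g <= 2 ^ 63 * a - b" for a b g :: int by simp
    ultimately show ?thesis by blast
   qed
  next
   case False
   hence "dw lg o1 i = 0" unfolding dw[OF i] u_def[symmetric] v_def[symmetric] by (simp only: if_False)
   thus ?thesis using False by (auto simp: gain_def Let_def)
  qed
  thus "gain lg o1 X i <= (%u v. 2 ^ 63 * ?a u v - 2 ^ 63 * x * ?t u v) (i div N) (i mod N)" by (simp only: u_def v_def)
 qed
 also have "... = (SUM u<N. SUM v<N. 2 ^ 63 * ?a u v - 2 ^ 63 * x * ?t u v)" by (rule sum_div_mod)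
 also have "... = 2 ^ 63 * (SUM u<N. SUM v<N. ?a u v) - x * (2 ^ 63 * (SUM u<N. SUM v<N. ?t u v))"
  by (simp only: sum_subtractf sum_distrib_left mult_ac)
 finally have 1: "(SUM i<N * N. gain lg o1 X i) <= 2 ^ 63 * (SUM u<N. SUM v<N. ?a u v) - x * (2 ^ 63 * (SUM u<N. SUM v<N. ?t u v))" .
 have "int (Wsum P W) <= int (2 ^ 63 * (SUM u<N. SUM v<N. if u : R & v : R & u : X & v ~: X then W u v else 0))"
  using ct(1)[of X] X unfolding truth_def by (simp only: of_nat_le_iff)
 also have "... = 2 ^ 63 * (SUM u<N. SUM v<N. ?t u v)" unfolding of_nat_mult of_nat_sum by (simp cong: if_cong add: if_distrib[of int])
 finally have "x * ws <= x * (2 ^ 63 * (SUM u<N. SUM v<N. ?t u v))" unfolding ws_def using x0 by (rule mult_left_mono)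
 hence 2: "(SUM i<N * N. gain lg o1 X i) <= 2 ^ 63 * (SUM u<N. SUM v<N. ?a u v) - x * ws" using 1 by linarith
 have "int (2 ^ 64 * (SUM u<N. SUM v<N. if u : R & v : R then W u v * ddm lg al u v else 0)) <= int (Wsum P W * mass lg al)"
  using ct(2) by (simp only: of_nat_le_iff)
 moreover have "int (2 ^ 64 * (SUM u<N. SUM v<N. if u : R & v : R then W u v * ddm lg al u v else 0)) = 2 ^ 64 * (SUM u<N. SUM v<N. ?a u v)"
  unfolding of_nat_mult of_nat_sum by (simp cong: if_cong add: if_distrib[of int])
 ultimately have 3: "2 * (2 ^ 63 * (SUM u<N. SUM v<N. ?a u v)) <= ws * p" using node_mass(1)[OF lf(1)] by (simp add: ws_def p_def)
 have "gain lg o1 X (N * N) = - ws * (p - x - Gs * 2 ^ (mm - clen al))"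
  using cal by (simp add: gain_def Let_def ub' dw' ws_def p_def x_def)
 also have "... = - (ws * p) + x * ws + ws * (Gs * 2 ^ (mm - clen al))" by (simp add: algebra_simps)
 also have "... <= - (ws * p) + x * ws + ws * (Gs * 2 ^ mm)"
  using G0 ws1 by (intro add_left_mono mult_left_mono power_increasing) auto
 finally have gN: "gain lg o1 X (N * N) <= - (ws * p) + x * ws + ws * (Gs * 2 ^ mm)" .
 define A where "A = 2 ^ 63 * (SUM u<N. SUM v<N. ?a u v)"
 have "2 * (SUM i<slots. gain lg o1 X i) <= - (ws * p) + 2 * (ws * (Gs * 2 ^ mm))"
 proof -
  show ?thesis unfolding sum_slots by (rule cut_gain_bound[OF gN 2[folded A_def] 3[folded A_def]])
 qed
 moreover have "ws * (2 ^ mm * 2 ^ (67108883 * L)) <= ws * p" using p ws1 by (intro mult_left_mono) auto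
 moreover have "ws * (2 ^ mm * (4 * Gs)) <= ws * (2 ^ mm * 2 ^ (67108883 * L))"
  using ws1 unfolding Gs_def by (intro mult_left_mono pw2) auto
 moreover have "ws * (2 ^ mm * (4 * Gs)) = 4 * (ws * (Gs * 2 ^ mm))" by (simp only: mult_ac)
 moreover have "ws * (Gs * 1) <= ws * (Gs * 2 ^ mm)" using ws1 G0 by (intro mult_left_mono) auto
 ultimately have 4: "2 * (SUM i<slots. gain lg o1 X i) <= - (2 * (ws * Gs))" using mult_nonneg_nonneg[of ws Gs] ws1 G0 by linarith
 have "(SUM i<N * N. \<bar>dw lg o1 i\<bar>) <= (SUM i<N * N. (%u v. int (W u v) * 2 ^ 63) (i div N) (i mod N))"
  by (intro sum_mono) (simp add: dw)
 also have "... = (SUM u<N. SUM v<N. int (W u v) * 2 ^ 63)" by (rule sum_div_mod)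
 also have "... = 2 ^ 63 * ws" by (simp add: ws_def Wsum_def sum_distrib_right mult.commute)
 finally have "(SUM i<slots. \<bar>dw lg o1 i\<bar>) <= 2 ^ 63 * ws + ws" using ws1 by (simp add: sum_slots dw' ws_def)
 also have "... <= 2 ^ 64 * ws" using ws1 by simp
 also have "... <= 2 ^ L * ws" using ws1 L64 by (intro mult_right_mono power_increasing) auto
 finally have a: "(SUM i<slots. \<bar>dw lg o1 i\<bar>) <= 2 ^ L * ws" .
 have wsle: "ws <= 2 ^ (33554434 * L)"
 proof -
  have "int (Wsum P W) <= int (2 ^ (33554434 * L))" using ct(4) by (simp only: of_nat_le_iff)
  thus ?thesis by (simp add: ws_def)
 qed
 have "2 ^ (5 * L) * (2 ^ mm * (SUM i<slots. \<bar>dw lg o1 i\<bar>))^2 <= 2 ^ (5 * L) * (2 ^ L * (2 ^ L * ws))^2"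
  using mm_pow a ws1 by (intro mult_left_mono power_mono mult_mono) (auto intro: sum_nonneg)
 also have "... = ws * (2 ^ (9 * L) * ws)"
  by (simp add: power_mult_distrib power2_eq_square power_add[symmetric] mult_ac)
 also have "... <= ws * (2 ^ (9 * L) * 2 ^ (33554434 * L))" using wsle ws1 by (intro mult_left_mono) auto
 also have "... = ws * 2 ^ (33554443 * L)" by (simp add: power_add[symmetric])
 also have "... <= ws * Gs" unfolding Gs_def using ws1 by (intro mult_left_mono pw) auto
 finally have q: "2 ^ (5 * L) * (2 ^ mm * (SUM i<slots. \<bar>dw lg o1 i\<bar>))^2 <= ws * Gs" .
 have "1 * 1 <= ws * Gs" using ws1 by (intro mult_mono) (auto simp: Gs_def)
 hence "2 * (SUM i<slots. gain lg o1 X i) + 2 ^ (5 * L) * (2 ^ mm * (SUM i<slots. \<bar>dw lg o1 i\<bar>))^2 <= -1" using 4 q by linarith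
 moreover have "clen (ubet lg o1 i) <= mm" if "i < slots" for i
 proof (cases "i < N * N")
  case True
  thus ?thesis using len(1) by (simp add: ub)
 next
  case False
  hence "i = N * N" using that by (simp add: slots_eq)
  thus ?thesis using len(2) by (simp add: ub')
 qed
 ultimately show ?thesis by (auto simp: decreases_def)
qed

end

context alg begin

section \<open>The log as an array\<close>

lemma cns_lits: "(!!u. u < N ==> u : g \<longleftrightarrow> u : h) ==> cns g = cns h"
 unfolding cns_eq by (metis ng_lt)

lemma fc_lits: "(!!u. u < N ==> u : g \<longleftrightarrow> u : h) ==> T : TS ==> fc g T = fc h T"
 unfolding fc_def
proof (rule prod.cong)
 fix i assume a: "!!u. u < N ==> u : g \<longleftrightarrow> u : h" and T: "T : TS" and i: "i : T"
 have "i < N" using T i n_lt by (auto simp: TS_def)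
 thus "sgl g i = sgl h i" using a[of i] a[of "ng i"] by (simp add: sgl_def)
qed simp

lemma scal_eq: "int (scal P g x) = (if cns g then int x * 2 ^ (mm - clen g) else 0)"
proof -
 have "mm - clen g <= pK P" using mmK by simp
 thus ?thesis by (simp add: scal_def bshl_eq)
qed

definition lgs :: "nat => nat => nat => nat" where
 "lgs o1 t = bitr P (%t1 lg j. lgstep P o1 t1 lg j) (%j. 0) t"

lemma lgf_lgs: "lgf P o1 = lgs o1 (tcap)"
 by (simp add: lgf_def lgs_def)

lemma tcapK: "tcap <= pK P"
 unfolding tcap_eq by (rule Kle[OF order_refl]) simp

lemma lgs_0: "lgs o1 0 = (%j. 0)"
 by (simp add: lgs_def bitr_def fun_eq_iff)

lemma lgs_Suc: "t < tcap ==> j < pK P ==> lgs o1 (Suc t) j = lgstep P o1 t (lgs o1 t) j"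
 unfolding lgs_def using tcapK by (intro bitr_Suc) auto

lemma lgs_out: "pK P <= j ==> lgs o1 t j = 0"
 by (simp add: lgs_def bitr_def itr_support)

text \<open>A log without a due update stays fixed, so an update due at the end shows that all
  earlier steps were updates.\<close>

lemma lgs_frozen: "t < tcap ==> ~ upd P (lgs o1 t) o1 ==> lgs o1 (Suc t) = lgs o1 t"
proof (rule ext)
 fix j assume "t < tcap" "~ upd P (lgs o1 t) o1"
 thus "lgs o1 (Suc t) j = lgs o1 t j"
  by (cases "j < pK P") (simp_all add: lgs_Suc lgstep_def lgs_out)
qed

lemma cellK: "e < ecnt ==> f < str ==> str * e + f < pK P"
proof -
 assume "e < ecnt" "f < str"
 hence "str * e + f < str * Suc e" by simp
 also have "... <= str * ecnt" using \<open>e < ecnt\<close> by (intro mult_left_mono) auto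
 finally show ?thesis using ecnt_le(1) by linarith
qed

lemma cell:
 assumes t: "t < tcap" and e: "e < ecnt" and f: "f < str"
 shows "lgs o1 (Suc t) (str * e + f) = (if upd P (lgs o1 t) o1 & slots * t <= e & e < slots * t + slots
   then ucell P (lgs o1 t) o1 (e - slots * t) f else lgs o1 t (str * e + f))"
proof -
 have K: "str * e + f < pK P" by (rule cellK[OF e f])
 have "bdiv P (str * e + f) (str) = e" "bmod P (str * e + f) (str) = f"
  using K f by (simp_all add: bdiv_eq bmod_eq)
 moreover have "bmul P (slots) t = slots * t" using t tcapK by (simp add: bmul_eq)
 ultimately show ?thesis using lgs_Suc[OF t K] by (simp add: lgstep_def)
qed

lemma entry:
 assumes e: "e < ecnt"
 shows "ecp P lg e = lg (str * e + 0)" "ecn P lg e = lg (str * e + 1)" "u : ebt lg e \<longleftrightarrow> lg (str * e + (2 + u)) ~= 0"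
 using e ecnt_le(2) by (simp_all add: ecp_def ecn_def ebt_def bmul_eq add.assoc)

definition dd2 :: "(nat => nat) => nat => nat => int" where
 "dd2 lg o1 i = (if cns (ubet lg o1 i) then dw lg o1 i * 2 ^ (mm - clen (ubet lg o1 i)) else 0)"

lemma str2: "2 <= str" "u < N ==> 2 + u < str" "0 < str" "1 < str" by (simp_all add: str_def)

lemma entry_new:
 assumes t: "t < tcap" and e: "e < ecnt" and up: "upd P (lgs o1 t) o1"
  and b: "slots * t <= e" "e < slots * t + slots"
 shows "ec (lgs o1 (Suc t)) e = dd2 (lgs o1 t) o1 (e - slots * t)"
  "u < N ==> u : ebt (lgs o1 (Suc t)) e \<longleftrightarrow> u : ubet (lgs o1 t) o1 (e - slots * t)"
 using cell[OF t e, of 0 o1] cell[OF t e, of 1 o1] cell[OF t e, of "2 + u" o1] up b str2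
 by (simp_all add: ec_def entry[OF e] ucell_def scal_eq dd2_def dw_def left_diff_distrib)

lemma entry_old:
 assumes t: "t < tcap" and e: "e < ecnt" and b: "~ (slots * t <= e & e < slots * t + slots)"
 shows "ec (lgs o1 (Suc t)) e = ec (lgs o1 t) e"
  "u < N ==> u : ebt (lgs o1 (Suc t)) e \<longleftrightarrow> u : ebt (lgs o1 t) e"
 using cell[OF t e, of 0 o1] cell[OF t e, of 1 o1] cell[OF t e, of "2 + u" o1] b str2
 by (auto simp: ec_def entry[OF e])

text \<open>Step \<open>t\<close> writes the \<open>t\<close>-th block of slots, which is zero until
  then; updates thus add to the Fourier vector and overwrite nothing.\<close>

lemma lgs_inv: "t <= tcap ==> wfl (lgs o1 t) & (ALL e f. slots * t <= e --> e < ecnt --> f < str --> lgs o1 t (str * e + f) = 0)"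
proof (induction t)
 case 0
 show ?case by (auto simp: wfl_def ec_def lgs_0 ecp_def ecn_def)
next
 case (Suc t)
 hence t: "t < tcap" and w: "wfl (lgs o1 t)"
  and z: "!!e f. slots * t <= e ==> e < ecnt ==> f < str ==> lgs o1 t (str * e + f) = 0" by auto
 show ?case
 proof (cases "upd P (lgs o1 t) o1")
  case True
  have "wfl (lgs o1 (Suc t))" unfolding wfl_def
  proof (intro allI impI)
   fix e assume e: "e < ecnt" and nz: "ec (lgs o1 (Suc t)) e ~= 0"
   show "cns (ebt (lgs o1 (Suc t)) e)"
   proof (cases "slots * t <= e & e < slots * t + slots")
    case b: True
    hence "dd2 (lgs o1 t) o1 (e - slots * t) ~= 0" using entry_new(1)[OF t e True] nz by simp
    hence "cns (ubet (lgs o1 t) o1 (e - slots * t))" by (auto simp: dd2_def split: if_splits)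
    moreover have "cns (ebt (lgs o1 (Suc t)) e) = cns (ubet (lgs o1 t) o1 (e - slots * t))"
     using entry_new(2)[OF t e True] b by (intro cns_lits) blast
    ultimately show ?thesis by simp
   next
    case b: False
    have "cns (ebt (lgs o1 t) e)" using entry_old(1)[OF t e b] nz w e by (simp add: wfl_def)
    moreover have "cns (ebt (lgs o1 (Suc t)) e) = cns (ebt (lgs o1 t) e)"
     using entry_old(2)[OF t e b] by (intro cns_lits) blast
    ultimately show ?thesis by simp
   qed
  qed
  moreover have "lgs o1 (Suc t) (str * e + f) = 0" if "slots * Suc t <= e" "e < ecnt" "f < str" for e f
   using cell[OF t that(2,3), of o1] z[of e f] that by simp
  ultimately show ?thesis by blast
 next
  case False
  thus ?thesis using lgs_frozen[OF t False] w z by simp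
 qed
qed

lemma Yc_step:
 assumes t: "t < tcap" and up: "upd P (lgs o1 t) o1" and T: "T : TS"
 shows "Yc (lgs o1 (Suc t)) T = Yc (lgs o1 t) T + (SUM i<slots. dd2 (lgs o1 t) o1 i * fc (ubet (lgs o1 t) o1 i) T)"
proof -
 let ?lg = "lgs o1 t" and ?lg' = "lgs o1 (Suc t)" and ?s = "slots * t"
 let ?B = "{?s..<?s + slots}"
 let ?f = "%i. dd2 ?lg o1 i * fc (ubet ?lg o1 i) T"
 have sub: "?B <= {..<ecnt}"
 proof -
  have "?s + slots = slots * Suc t" by simp
  also have "... <= slots * tcap" using t by (intro mult_left_mono) auto
  also have "... = ecnt" by (simp add: ecnt_eq)
  finally show ?thesis by auto
 qed
 have "Yc ?lg' T = (SUM e<ecnt. ec ?lg e * fc (ebt ?lg e) T + (if e : ?B then ?f (e - ?s) else 0))"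
  unfolding Yc_def
 proof (rule sum.cong)
  fix e assume "e : {..<ecnt}"
  hence e: "e < ecnt" by simp
  show "ec ?lg' e * fc (ebt ?lg' e) T = ec ?lg e * fc (ebt ?lg e) T + (if e : ?B then ?f (e - ?s) else 0)"
  proof (cases "e : ?B")
   case True
   hence b: "?s <= e" "e < ?s + slots" by auto
   have z: "lgs o1 t (str * e + f) = 0" if "f < str" for f using lgs_inv[OF less_imp_le[OF t], of o1] b(1) e that by blast
   have "ec ?lg e = 0" unfolding ec_def entry(1,2)[OF e] z[OF str2(3)] z[OF str2(4)] by simp
   moreover have "fc (ebt ?lg' e) T = fc (ubet ?lg o1 (e - ?s)) T"
    using entry_new(2)[OF t e up b] T by (intro fc_lits) blast+
   ultimately show ?thesis using entry_new(1)[OF t e up b] True by simp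
  next
   case False
   hence b: "~ (?s <= e & e < ?s + slots)" by simp
   have "fc (ebt ?lg' e) T = fc (ebt ?lg e) T" using entry_old(2)[OF t e b] T by (intro fc_lits) blast+
   thus ?thesis unfolding if_not_P[OF False] entry_old(1)[OF t e b, of o1] by simp
  qed
 qed simp
 also have "... = Yc ?lg T + (SUM e<ecnt. if e : ?B then ?f (e - ?s) else 0)" by (simp only: sum.distrib Yc_def)
 also have "(SUM e<ecnt. if e : ?B then ?f (e - ?s) else 0) = (SUM e:{..<ecnt} Int ?B. ?f (e - ?s))"
  by (rule sum.inter_restrict[symmetric]) simp
 also have "{..<ecnt} Int ?B = ?B" using sub by auto
 also have "(SUM e:?B. ?f (e - ?s)) = (SUM i<slots. ?f i)"
  by (rule sum.reindex_bij_witness[of _ "%i. i + ?s" "%e. e - ?s"]) auto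
 finally show ?thesis .
qed

lemma pot_step:
 assumes t: "t < tcap" and X: "truth X" and up: "upd P (lgs (oX X) t) (oX X)"
 shows "Pot (lgs (oX X) (Suc t)) X <= Pot (lgs (oX X) t) X - 1"
proof -
 let ?o = "oX X"
 let ?lg = "lgs ?o t"
 have w: "wfl ?lg" using lgs_inv[of t ?o] t by simp
 have d: "decreases ?lg ?o X"
 proof (cases "hasneg P ?lg")
  case True
  thus ?thesis by (rule dec_neg)
 next
  case nh: False
  show ?thesis
  proof (cases "objviol P ?lg ?o")
   case True
   thus ?thesis by (rule dec_obj[OF w nh _ X])
  next
   case False
   hence "nempty P (sol P ?lg ?o)" using up nh by (simp add: upd_def upd3_def)
   thus ?thesis by (rule dec_cut[OF w nh False oX_le _ X])
  qed
 qed
 have "Pot (lgs ?o (Suc t)) X <= Pot ?lg X + 2 * (SUM i<slots. if cns (ubet ?lg ?o i) then dw ?lg ?o i * (sm ?lg (ubet ?lg ?o i) - (if lits (ubet ?lg ?o i) <= X then 2 ^ mm * Us else 0)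
   - Gs * 2 ^ (mm - clen (ubet ?lg ?o i))) else 0) + 2 ^ (5 * L) * (2 ^ mm * (SUM i<slots. \<bar>dw ?lg ?o i\<bar>))^2"
 proof (rule pot_update[OF w X])
  show "Yc (lgs ?o (Suc t)) T = Yc ?lg T + (SUM i<slots. dd2 ?lg ?o i * fc (ubet ?lg ?o i) T)" if "T : TS" for T
   by (rule Yc_step[OF t up that])
  show "clen (ubet ?lg ?o i) <= mm" if "i < slots" "dw ?lg ?o i ~= 0" for i using d that by (simp add: decreases_def)
 qed (simp add: dd2_def)
 also have "... <= Pot ?lg X - 1" using d unfolding decreases_def gain_def Let_def by linarith
 finally show ?thesis .
qed

text \<open>Every update lowers the squared distance Pot to the point mass at X by at least 1.\<close>

lemma lgf_stop:
 assumes X: "truth X"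
 shows "~ upd P (lgf P (oX X)) (oX X)"
proof
 let ?o = "oX X"
 assume up: "upd P (lgf P ?o) ?o"
 have all: "upd P (lgs ?o t) ?o" if "t <= tcap" for t
  using that
 proof (induction t rule: inc_induct)
  case base
  thus ?case using up by (simp add: lgf_lgs)
 next
  case (step t)
  show ?case
  proof (rule ccontr)
   assume n: "~ upd P (lgs ?o t) ?o"
   hence "lgs ?o (Suc t) = lgs ?o t" by (rule lgs_frozen[OF step.hyps(2)])
   thus False using step.IH n by simp
  qed
 qed
 have "t <= tcap ==> Pot (lgs ?o t) X <= Pot (lgs ?o 0) X - int t" for t
 proof (induction t)
  case (Suc t)
  thus ?case using pot_step[OF _ X all[of t]] by fastforce
 qed simp
 from this[OF order_refl] have 1: "Pot (lgs ?o (tcap)) X <= Pot (lgs ?o 0) X - int (tcap)" .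
 have "0 <= Pot (lgs ?o (tcap)) X" unfolding Pot_def by (rule sum_nonneg) simp
 \<comment> \<open>The log starts empty, so this is the squared norm of the point mass: at most
   \<open>Us^2\<close> on each of at most \<open>2^(5 L)\<close> sets. \<open>tcap\<close> exceeds
   it.\<close>
 moreover have "Pot (lgs ?o 0) X <= 2 ^ (134217773 * L)"
 proof -
  have Y0: "Yc (lgs ?o 0) T = 0" for T by (simp add: Yc_def ec_def lgs_0 ecp_def ecn_def)
  have "Pot (lgs ?o 0) X <= (SUM T:TS. Us^2)" unfolding Pot_def
  proof (rule sum_mono)
   fix T
   have "\<bar>Us * fc X T\<bar> <= Us * 1" unfolding abs_mult using fc_le1[of X T] by (intro mult_mono) (auto simp: Us_def)
   hence "\<bar>Us * fc X T\<bar>^2 <= (Us * 1)^2" by (intro power_mono) auto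
   thus "(Yc (lgs ?o 0) T - Us * fc X T)^2 <= Us^2" by (simp add: Y0)
  qed
  also have "... = int (card TS) * Us^2" by simp
  also have "... <= 2 ^ (5 * L) * Us^2"
  proof (rule mult_right_mono)
   have "int (card TS) <= int (2 ^ (5 * L))" using card_TS by (simp only: of_nat_le_iff)
   thus "int (card TS) <= 2 ^ (5 * L)" by simp
  qed simp
  also have "... = 2 ^ (134217773 * L)"
  proof -
   have "Us^2 = 2 ^ (134217768 * L)" unfolding Us_def power_mult[symmetric] by (simp add: mult.commute)
   thus ?thesis by (simp add: power_add[symmetric])
  qed
  finally show ?thesis .
 qed
 moreover have "4 * (2::int) ^ (134217773 * L) <= 2 ^ (134217778 * L)" by (rule pw2) simp
 moreover have "int (tcap) = 2 ^ (134217778 * L)" by (simp add: tcap_eq)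
 moreover have "1 <= (2::int) ^ (134217773 * L)" by simp
 moreover have "0 <= a ==> b <= x ==> 4 * x <= y ==> c = y ==> 1 <= x ==> a <= b - c ==> False" for a b c x y :: int by simp
 ultimately show False using 1 by blast
qed

lemma oX_card: "oX X = card {(u, v). u < N & v < N & adjb u v & u : X & v ~: X}"
proof -
 let ?E = "{(u, v). adjb u v & u : X & v ~: X}"
 have "oX X = (SUM e:{..<N} \<times> {..<N}. if e : ?E then 1 else 0)"
  unfolding oX_def by (subst sum.cartesian_product) (intro sum.cong, auto split: if_splits)
 also have "... = (SUM e:({..<N} \<times> {..<N}) Int ?E. 1)" by (rule sum.inter_restrict[symmetric]) simp
 also have "... = card (({..<N} \<times> {..<N}) Int ?E)" by simp
 also have "({..<N} \<times> {..<N}) Int ?E = {(u, v). u < N & v < N & adjb u v & u : X & v ~: X}" by auto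
 finally show ?thesis .
qed

section \<open>Quality of the output\<close>

definition res_set :: "nat set" where "res_set = sol P (lgf P (osel P)) (osel P)"

lemma outp_res: "outp P j = (if j : res_set then 1 else 0)"
 by (simp add: outp_def res_set_def)

theorem res_set_correct:
 assumes L100: "100 <= L" and X: "truth X"
 shows "truth res_set" "res_set <= {..<N}" "oX res_set <= 2 ^ 76 * pk P * oX X"
proof -
 let ?o = "osel P"
 let ?Q = "%o1. ~ upd P (lgf P o1) o1"
 have ex: "EX o1<Suc (N * N). ?Q o1" using lgf_stop[OF X] oX_le[of X] by (auto simp: less_Suc_eq_le)
 have oe: "?o = bleast P (Suc (N * N)) ?Q" by (simp add: osel_def)
 have Q: "?Q ?o" "?o < Suc (N * N)" unfolding oe using bleast[OF NNK(3) ex] by auto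
 have oo: "?o <= oX X" unfolding oe bleast_LEAST[OF NNK(3) ex] using lgf_stop[OF X] by (rule Least_le)
 define lg where "lg = lgf P ?o"
 have w: "wfl lg" using lgs_inv[of "tcap" ?o] by (simp add: lg_def lgf_lgs)
 have h: "~ hasneg P lg" and ob: "~ objviol P lg ?o" and ne: "~ nempty P (sol P lg ?o)"
  using Q(1) by (auto simp: upd_def upd3_def lg_def)
 have oN: "?o <= N * N" using Q(2) by simp
 define al where "al = asel P lg ?o"
 note lf = leaf_sel[OF w h ob oN, folded al_def]
 interpret leaf P "mass lg al" "ddm lg al" by (rule lf(2))
 let ?pp = "mass lg al"
 have S: "res_set = rnds P ?pp (ddm lg al)" by (simp add: res_set_def sol_def al_def lg_def)
 have ok: "ok res_set" unfolding S by (rule rnds_final(1))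
 thus sub: "res_set <= {..<N}" by (simp add: ok_def)
 have rm0: "rm res_set = {}"
 proof -
  have "~ nempty P res_set" using ne by (simp add: res_set_def lg_def)
  thus ?thesis by (auto simp: nempty_def rm_iff)
 qed
 show tr: "truth res_set" unfolding truth_def
 proof (intro allI impI)
  fix u assume u: "u < N"
  have "u ~: rm res_set" using rm0 by simp
  thus "u : res_set \<longleftrightarrow> ng u ~: res_set" using u ok by (auto simp: ok_def rm_iff)
 qed
 let ?c = "oX res_set" and ?w = "wid P ?pp" and ?k = "pk P * 2 ^ 65" and ?Y = "2 ^ (2 * L) :: nat"
 have "?c = card {(u, v). u < N & v < N & adjb u v & u : res_set & v ~: res_set}" by (rule oX_card)
 also have "... <= card (bset res_set)" by (rule card_mono[OF bset_fin]) (auto simp: bset_def)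
 finally have "?w * ?c <= ?w * card (bset res_set)" by (rule mult_left_mono) simp
 hence 1: "?w * ?c <= 258 * V0 + 128 * N" using ok unfolding ok_def by linarith
 have 2: "V0 * ?Y <= 2 * (?pp * (?o * ?Y + 1))"
  using lf(5) by (simp add: leafok_def objb_eq(1)[OF oN] objb_eq(2))
 have k0: "0 < ?k" using k1 by simp
 have kle: "?k <= 2 ^ (L + 65)" using kL by (simp add: power_add)
 have wk: "?w = ?pp div ?k" by (rule wd_eq)
 \<comment> \<open>The lower bound on leaf masses makes the region width so large that flooring it
   costs at most a factor 2 and the term \<open>128 * N\<close> vanishes beside it.\<close>
 have big: "2 ^ (2 * L + 30) <= ?w"
 proof -
  have "2 ^ (2 * L + 30) * ?k <= 2 ^ (2 * L + 30) * 2 ^ (L + 65)" using kle by (rule mult_left_mono) simp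
  also have "... = 2 ^ (3 * L + 95)" by (simp add: power_add[symmetric])
  also have "... <= 2 ^ (4 * L)" using L100 by (intro power_increasing) auto
  also have "... <= ?pp" by (rule pplow)
  finally show ?thesis unfolding wk using k0 by (simp only: less_eq_div_iff_mult_less_eq)
 qed
 have w1: "1 <= ?w" using big one_le_power[of "2::nat" "2 * L + 30"] by linarith
 have "?pp < (?w + 1) * ?k" unfolding wk using k0 dividend_less_div_times[of ?k ?pp] by (simp add: algebra_simps)
 also have "... <= (?w + ?w) * ?k" using w1 by (intro mult_right_mono) auto
 finally have pw: "?pp <= 2 * (?w * ?k)" by (simp add: algebra_simps)
 have N128: "256 * N <= ?w"
 proof -
  have "256 * N <= 2 ^ 8 * 2 ^ L" using NK(3) by simp
  also have "... = 2 ^ (8 + L)" by (simp only: power_add)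
  also have "... <= 2 ^ (2 * L + 30)" by (rule power_increasing) auto
  finally show ?thesis using big by linarith
 qed
 have "?w * (2 * (?c * ?Y)) = 2 * ?Y * (?w * ?c)" by simp
 also have "... <= 2 * ?Y * (258 * V0 + 128 * N)" using 1 by (rule mult_left_mono) simp
 also have "... = 516 * (V0 * ?Y) + ?Y * (256 * N)" by (simp add: algebra_simps)
 also have "... <= 516 * (2 * (?pp * (?o * ?Y + 1))) + ?Y * ?w" using 2 N128 by (intro add_mono mult_left_mono) auto
 also have "... <= 516 * (2 * ((2 * (?w * ?k)) * (?o * ?Y + 1))) + ?Y * ?w"
  using pw by (intro add_mono mult_left_mono mult_right_mono) auto
 also have "... = ?w * (2064 * ?k * (?o * ?Y + 1) + ?Y)" by (simp add: algebra_simps)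
 finally have 3: "2 * (?c * ?Y) <= 2064 * ?k * (?o * ?Y + 1) + ?Y" using w1 by (simp only: mult_le_cancel1)
 have "2064 * ?k <= 2 ^ 77 * pk P" by simp
 hence 4: "2064 * ?k * (?o * ?Y) <= 2 ^ 77 * pk P * (?o * ?Y)" by (rule mult_right_mono) simp
 \<comment> \<open>The slack in \<open>objb\<close> and the term in \<open>N\<close> then amount to
   less than one arc in total, and integrality removes them.\<close>
 have 5: "2064 * ?k < ?Y"
 proof -
  have "2064 * ?k <= 2 ^ 12 * 2 ^ (L + 65)" using kle by simp
  also have "... = 2 ^ (L + 77)" by (simp add: power_add)
  also have "... < ?Y" using L100 by (intro power_strict_increasing) auto
  finally show ?thesis .
 qed
 have "2 * (?c * ?Y) < 2 ^ 77 * pk P * (?o * ?Y) + 2 * ?Y" using 3 4 5 by (simp add: distrib_left)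
 also have "... = 2 * ((2 ^ 76 * pk P * ?o + 1) * ?Y)" by (simp add: algebra_simps)
 finally have "?c < 2 ^ 76 * pk P * ?o + 1" by (simp only: mult_less_cancel1 mult_less_cancel2)
 hence "?c <= 2 ^ 76 * pk P * ?o" by simp
 also have "... <= 2 ^ 76 * pk P * oX X" using oo by (rule mult_left_mono) simp
 finally show "?c <= 2 ^ 76 * pk P * oX X" .
qed

end

section \<open>Choice of parameters and running time\<close>

text \<open>Raising \<open>k\<close> to a constant \<open>k0\<close> costs a constant factor in the
  approximation and makes the asymptotic estimates valid for every input.\<close>

definition kp :: "nat => prm => nat" where
 "kp k0 P = (if pk P <= k0 then k0 else pk P)"

definition lnn :: "prm => nat" where
 "lnn P = bleast P (nn P + 2) (%l. nn P + 2 <= bshl P 1 l)"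

text \<open>At \<open>l + 7\<close> the ball size exceeds \<open>64 * n\<close>; stopping there
  keeps the exponent logarithmic in \<open>n\<close> when \<open>k^2\<close> is large.\<close>

definition bb :: "nat => prm => nat" where
 "bb k0 P = min (bmul P (kp k0 P) (kp k0 P)) (lnn P + 7)"

definition qq :: "nat => prm => nat" where
 "qq k0 P = bdiv P (bmul P (nn P) 32) (bshl P 1 (bb k0 P)) + 1"

definition LLp :: "nat => prm => nat" where
 "LLp k0 P = bmul P (qq k0 P) (bb k0 P) + lnn P + k0"

definition KKp :: "nat => prm => nat" where
 "KKp k0 P = bshl P 1 (bmul P (LLp k0 P) 167772260)"

lemma CN_kp [cn]: "6 <= t ==> CN t (%s. kp k0 (prm_of s))"
 unfolding kp_def by (assumption | erule cm | rule cn | linarith)+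

lemma CN_lnn [cn]: "6 <= t ==> CN t (%s. lnn (prm_of s))"
 unfolding lnn_def by (assumption | erule cm | rule cn | linarith)+

lemma CN_bb [cn]: "6 <= t ==> CN t (%s. bb k0 (prm_of s))"
 unfolding bb_def by (assumption | erule cm | rule cn | linarith)+

lemma CN_qq [cn]: "6 <= t ==> CN t (%s. qq k0 (prm_of s))"
 unfolding qq_def by (assumption | erule cm | rule cn | linarith)+

lemma CN_LLp [cn]: "6 <= t ==> CN t (%s. LLp k0 (prm_of s))"
 unfolding LLp_def by (assumption | erule cm | rule cn | linarith)+

lemma CN_KKp [cn]: "6 <= t ==> CN t (%s. KKp k0 (prm_of s))"
 unfolding KKp_def by (assumption | erule cm | rule cn | linarith)+

text \<open>The parameters are computed with a provisional \<open>pK\<close> polynomial in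
  \<open>n\<close>, which suffices for every loop involved.\<close>

lemma param_values:
 assumes K: "167772260 * (1000 + k0) * (pn P * pn P + pn P + 1) <= pK P" and k: "pk P <= pn P + 1"
 defines "l \<equiv> lnn P"
 shows "kp k0 P = max k0 (pk P)" "nn P + 2 <= 2 ^ l" "2 ^ l <= 4 * (pn P + 1)"
  "bb k0 P = min ((kp k0 P)^2) (l + 7)" "qq k0 P = 32 * nn P div 2 ^ bb k0 P + 1"
  "LLp k0 P = qq k0 P * bb k0 P + l + k0" "KKp k0 P = 2 ^ (167772260 * LLp k0 P)"
proof -
 let ?n = "pn P"
 define m where "m = ?n * ?n + ?n + 1"
 have m: "?n + 1 <= m" "?n * ?n <= m" "k0 <= k0 * m" by (simp_all add: m_def)
 have K': "167772260 * (1000 * m + k0 * m) <= pK P" using K by (simp add: m_def algebra_simps)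
 have KK: "x <= pK P" if "x <= 1000 * m + k0 * m" for x
 proof -
  have "1000 * m + k0 * m <= 167772260 * (1000 * m + k0 * m)" by simp
  thus ?thesis using that K' by (meson order_trans)
 qed
 have Nn: "nn P = 2 * ?n" by (simp add: nn_def)
 have K0: "0 < pK P" using KK[of 1] m(1) by linarith
 show kp: "kp k0 P = max k0 (pk P)" by (simp add: kp_def max_def)
 have sh: "bshl P 1 i = 2 ^ i" if "i <= 2 * ?n + 10" for i
 proof -
  have "i <= pK P" using that m(1) by (intro KK) linarith
  thus ?thesis using K0 by (simp add: bshl_eq)
 qed
 let ?Q = "%i. nn P + 2 <= bshl P 1 i"
 have N2K: "nn P + 2 <= pK P" using m(1) unfolding Nn by (intro KK) linarith
 have "?Q (nn P + 1)" using less_exp[of "nn P + 1"] sh[of "nn P + 1"] by (simp add: Nn Suc_leI)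
 hence ex: "EX i<nn P + 2. ?Q i" by (intro exI[of _ "nn P + 1"]) simp
 have l: "?Q l" "l < nn P + 2" using bleast[OF N2K ex] by (simp_all add: l_def lnn_def)
 have le: "l = (LEAST i. ?Q i)" unfolding l_def lnn_def by (rule bleast_LEAST[OF N2K ex])
 have lN: "l <= 2 * ?n + 1" using l(2) by (simp add: Nn)
 hence sl: "bshl P 1 l = 2 ^ l" by (intro sh) simp
 show N2: "nn P + 2 <= 2 ^ l" using l(1) sl by simp
 have "l ~= 0" using N2 by (intro notI) simp
 then obtain j where j: "l = Suc j" by (cases l) auto
 have "~ ?Q j" using le j not_less_Least[of j ?Q] by simp
 moreover have "bshl P 1 j = 2 ^ j" using j lN by (intro sh) simp
 ultimately show l4: "2 ^ l <= 4 * (?n + 1)" using j by (simp add: Nn)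
 have kK: "kp k0 P <= pK P" using m k kp by (intro KK) linarith
 show b: "bb k0 P = min ((kp k0 P)^2) (l + 7)" using kK by (simp add: bb_def bmul_eq power2_eq_square l_def)
 hence bl: "bb k0 P <= 2 * ?n + 8" using lN by simp
 hence sb: "bshl P 1 (bb k0 P) = 2 ^ bb k0 P" by (intro sh) simp
 have "32 <= pK P" using m(1) by (intro KK) linarith
 hence b32: "bmul P (nn P) 32 = nn P * 32" by (rule bmul_eq)
 have "nn P * 32 <= pK P" using m(1) unfolding Nn by (intro KK) linarith
 hence "bdiv P (nn P * 32) (2 ^ bb k0 P) = nn P * 32 div 2 ^ bb k0 P" by (intro bdiv_eq) auto
 thus q: "qq k0 P = 32 * nn P div 2 ^ bb k0 P + 1" unfolding qq_def b32 sb by (simp add: mult.commute)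
 have "bb k0 P <= pK P" using bl m(1) by (intro KK) linarith
 thus LL: "LLp k0 P = qq k0 P * bb k0 P + l + k0" by (simp add: LLp_def bmul_eq l_def)
 have "32 * nn P div 2 ^ bb k0 P <= 32 * nn P" by (rule div_le_dividend)
 hence "qq k0 P <= 64 * ?n + 1" using q by (simp add: Nn)
 hence "qq k0 P * bb k0 P <= (64 * ?n + 1) * (2 * ?n + 8)" using bl by (rule mult_le_mono)
 also have "... = 128 * (?n * ?n) + 514 * ?n + 8" by (simp add: algebra_simps)
 finally have "LLp k0 P <= 1000 * m + k0 * m" using LL lN m by linarith
 hence "LLp k0 P * 167772260 <= (1000 * m + k0 * m) * 167772260" by (rule mult_right_mono) simp
 also have "... <= pK P" using K' by (simp only: mult.commute)
 finally have LK: "LLp k0 P * 167772260 <= pK P" .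
 have "167772260 * 1 <= 167772260 * (1000 * m + k0 * m)" by (rule mult_left_mono) (use m(1) in simp_all)
 from order_trans[OF this K'] have cK: "167772260 <= pK P" by (simp only: mult_1_right)
 show "KKp k0 P = 2 ^ (167772260 * LLp k0 P)"
  unfolding KKp_def bmul_eq[OF cK] bshl_eq[OF LK K0] by (simp add: mult.commute)
qed

text \<open>If b = l + 7 then q = 1 and the bound is polynomial; otherwise b = k^2 with k at least r.\<close>

lemma exp_bound:
 fixes n k0 A k l b q L :: nat and r :: real
 assumes k: "k = max k0 (min (nat \<lceil>r\<rceil>) (n + 1))" and l: "2 * n + 2 <= 2 ^ l" "2 ^ l <= 4 * (n + 1)"
  and b: "b = min (k^2) (l + 7)" and q: "q = 64 * n div 2 ^ b + 1" and L: "L = q * b + l + k0"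
  and k0: "64 * A <= k0" "100 <= k0" and r: "r > 1"
 shows "real (2 ^ (A * L)) <= exp (real n / 2 powr (1 / 2 * r^2)) * (2 ^ (7 + k0) * 4 * (real n + 1)) ^ (2 * A)"
proof -
 define m where "m = 64 * n div 2 ^ b"
 have AL: "A * L = A * (m * b) + A * (b + l + k0)" by (simp add: L q m_def algebra_simps)
 have p: "(2::real) ^ (A * (b + l + k0)) <= (2 ^ (7 + k0) * 4 * (real n + 1)) ^ (2 * A)"
 proof -
  have "A * (b + l + k0) <= (l + (7 + k0)) * (2 * A)"
  proof -
   have "b + l + k0 <= (l + (7 + k0)) * 2" using b by simp
   hence "A * (b + l + k0) <= A * ((l + (7 + k0)) * 2)" by (rule mult_left_mono) simp
   thus ?thesis by (simp only: mult_ac)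
  qed
  hence "(2::real) ^ (A * (b + l + k0)) <= 2 ^ ((l + (7 + k0)) * (2 * A))" by (rule power_increasing) simp
  also have "... = (2 ^ l * 2 ^ (7 + k0)) ^ (2 * A)" by (simp only: power_mult power_add)
  also have "... <= (4 * (real n + 1) * 2 ^ (7 + k0)) ^ (2 * A)"
  proof (intro power_mono mult_right_mono)
   have "real (2 ^ l) <= real (4 * (n + 1))" using l(2) by (simp only: of_nat_le_iff)
   thus "(2::real) ^ l <= 4 * (real n + 1)" by simp
  qed auto
  finally show ?thesis by (simp only: mult_ac)
 qed
 have e: "(2::real) ^ (A * (m * b)) <= exp (real n / 2 powr (1 / 2 * r^2))"
 proof (cases "l + 7 <= k^2")
  case True
  hence "b = l + 7" using b by simp
  hence "64 * n < 2 ^ b" using l(1) by (simp add: power_add)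
  hence "m = 0" by (simp add: m_def)
  thus ?thesis by simp
 next
  case False
  hence bk: "b = k^2" "k^2 < l + 7" using b by auto
  have k100: "100 <= k" "k0 <= k" using k k0 by auto
  have "n + 1 <= 2 ^ n" by (metis Suc_eq_plus1 Suc_leI less_exp)
  hence "(2::nat) ^ l <= 2 ^ (n + 2)" using l(2) by simp
  hence ln: "l <= n + 2" by (rule power_le_imp_le_exp[rotated]) simp
  \<comment> \<open>Had the cap \<open>n + 1\<close> cut \<open>r\<close> down, \<open>k^2\<close>
    would be too large for this case.\<close>
  have rk: "r <= real k"
  proof (rule ccontr)
   assume "~ r <= real k"
   hence "k < nat \<lceil>r\<rceil>" by linarith
   hence "n + 1 <= k" using k by (auto simp: max_def min_def split: if_splits)
   hence "100 * (n + 1) <= k * k" using k100(1) by (intro mult_mono) auto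
   thus False using bk(2) ln by (simp add: power2_eq_square)
  qed
  \<comment> \<open>The square root of \<open>2^b\<close>: one factor \<open>t\<close> absorbs
    \<open>64 * A * b\<close>, the other leaves the exponent \<open>r^2 / 2\<close>.\<close>
  define t where "t = (2::real) powr (real b / 2)"
  have t0: "t > 0" by (simp add: t_def)
  have tt: "t * t = 2 ^ b" by (simp add: t_def powr_add[symmetric] powr_realpow[symmetric])
  have Ab: "64 * real A * real b <= t"
  proof -
   have "real (64 * A * k^2) <= real (k * k^2)" using k0 k100(2) by (simp only: of_nat_le_iff) (intro mult_right_mono, auto)
   also have "... = real k ^ 3" by (simp add: power3_eq_cube power2_eq_square)
   also have "... <= (2 ^ k) ^ 3"
   proof (rule power_mono)
    have "real k < real (2 ^ k)" using less_exp[of k] by (simp only: of_nat_less_iff)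
    thus "real k <= 2 ^ k" by simp
   qed simp
   also have "... = 2 ^ (k * 3)" by (simp only: power_mult)
   also have "... = 2 powr real (k * 3)" by (rule powr_realpow[symmetric]) simp
   also have "... <= t" unfolding t_def
   proof (rule powr_mono)
    have "6 * k <= k * k" using k100(1) by (intro mult_right_mono) auto
    hence "real (6 * k) <= real (k * k)" by (simp only: of_nat_le_iff)
    thus "real (k * 3) <= real b / 2" by (simp add: bk(1) power2_eq_square)
   qed simp
   finally show ?thesis by (simp add: bk(1))
  qed
  have "m * 2 ^ b <= 64 * n" unfolding m_def by (rule div_times_less_eq_dividend)
  hence "real (m * 2 ^ b) <= real (64 * n)" by (simp only: of_nat_le_iff)
  hence m1: "real m <= 64 * real n / (t * t)" by (simp add: tt pos_le_divide_eq)
  have "real (A * (m * b)) = real m * (real A * real b)" by simp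
  also have "... <= 64 * real n / (t * t) * (real A * real b)" using m1 by (rule mult_right_mono) simp
  also have "... = real n * (64 * real A * real b) / (t * t)" by simp
  also have "... <= real n * t / (t * t)" using Ab t0 by (intro divide_right_mono mult_left_mono) auto
  also have "... = real n / t" using t0 by simp
  also have "... <= real n / 2 powr (1 / 2 * r^2)"
  proof (rule divide_left_mono)
   have "r^2 <= (real k)^2" using rk r by (intro power_mono) auto
   thus "2 powr (1 / 2 * r^2) <= t" unfolding t_def by (intro powr_mono) (auto simp: bk(1))
  qed (use t0 in auto)
  finally have x: "real (A * (m * b)) <= real n / 2 powr (1 / 2 * r^2)" .
  have "(2::real) ^ (A * (m * b)) <= exp 1 ^ (A * (m * b))" using exp_ge_add_one_self[of 1] by (intro power_mono) auto
  also have "... = exp (real (A * (m * b)))" using exp_of_nat_mult[of "A * (m * b)" "1::real"] by simp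
  also have "... <= exp (real n / 2 powr (1 / 2 * r^2))" using x by simp
  finally show ?thesis .
 qed
 have "real (2 ^ (A * L)) = 2 ^ (A * (m * b)) * 2 ^ (A * (b + l + k0))" by (simp add: AL power_add)
 also have "... <= exp (real n / 2 powr (1 / 2 * r^2)) * (2 ^ (7 + k0) * 4 * (real n + 1)) ^ (2 * A)"
  using e p by (intro mult_mono) auto
 finally show ?thesis .
qed

text \<open>Without multiplication, \<open>n * n\<close> is accumulated in a loop and the factor
  \<open>C0\<close> by repeated addition. The cap \<open>n + 1\<close> keeps the parameter
  polynomial in \<open>n\<close>.\<close>

lemma phase_setup:
 "EX c. ALL s. EX t s'. exec c s t s' & t <= 3 * reg s 0 + C0 + 20 & mem s' = mem s &
   reg s' 0 = C0 * (reg s 0 * reg s 0 + reg s 0 + 1) & reg s' 1 = reg s 0 & reg s' 2 = min (reg s 1) (reg s 0 + 1)"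
proof -
 define pre where "pre = Seq (Const 6 1) (Seq (Const 9 0) (Seq (Add 2 0 6) (Seq (Sub 7 1 2) (Seq (Sub 2 1 7)
  (Seq (Add 1 0 9) (Seq (Add 3 0 6) (Add 4 0 9)))))))"
 define body where "body = Seq (Add 3 3 1) (Sub 4 4 6)"
 define mid where "mid = Seq (Const 9 0) (Seq (Add 0 3 9) (Const 7 0))"
 define post where "post = Seq (Const 9 0) (Add 0 7 9)"
 define c where "c = Seq pre (Seq (While 4 body) (Seq mid (Seq (addK 7 C0) post)))"
 show ?thesis
 proof (intro exI[of _ c] allI)
  fix s :: state
  let ?n = "reg s 0" and ?k = "reg s 1"
  define s1 where "s1 = straight_run pre s"
  have e1: "exec pre s 8 s1" unfolding s1_def by (rule exec_straight') (simp_all add: pre_def)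
  define I :: "nat => state => bool" where "I j u \<longleftrightarrow> reg u 1 = ?n & reg u 2 = min ?k (?n + 1) & reg u 6 = 1 & reg u 4 = ?n - j &
    reg u 3 = ?n + 1 + j * ?n & mem u = mem s" for j u
  have I0: "I 0 s1" by (simp add: I_def s1_def pre_def)
  have "EX n s'. exec (While 4 body) s1 n s' & n <= ?n * (2 + 1) + 1 & I ?n s'"
  proof (rule exec_While_count[where I = I])
   fix j u assume j: "j < ?n" and u: "I j u"
   have "exec body u 2 (straight_run body u)" by (rule exec_straight') (simp_all add: body_def)
   moreover have "I (Suc j) (straight_run body u)" using u by (auto simp: I_def body_def)
   ultimately show "reg u 4 ~= 0 & (EX n s'. exec body u n s' & n <= 2 & I (Suc j) s')"
    using j u by (auto simp: I_def)
  qed (use I0 in \<open>auto simp: I_def\<close>)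
  then obtain t2 s2 where 2: "exec (While 4 body) s1 t2 s2" "t2 <= ?n * 3 + 1" "I ?n s2" by auto
  define s3 where "s3 = straight_run mid s2"
  have e3: "exec mid s2 3 s3" unfolding s3_def by (rule exec_straight') (simp_all add: mid_def)
  define s4 where "s4 = straight_run (addK 7 C0) s3"
  have e4: "exec (addK 7 C0) s3 (C0 + 1) s4" unfolding s4_def by (rule exec_straight'[OF straight_addK time_addK])
  have s4: "s4 = s3\<lparr>reg := (reg s3)(7+1 := 0, 7 := reg s3 7 + C0 * reg s3 0)\<rparr>" unfolding s4_def by (rule run_addK) simp
  define s5 where "s5 = straight_run post s4"
  have e5: "exec post s4 2 s5" unfolding s5_def by (rule exec_straight') (simp_all add: post_def)
  have "exec c s (8 + (t2 + (3 + (C0 + 1 + 2)))) s5" unfolding c_def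
   by (intro exec.Seq[OF e1] exec.Seq[OF 2(1)] exec.Seq[OF e3] exec.Seq[OF e4 e5])
  moreover have "8 + (t2 + (3 + (C0 + 1 + 2))) <= 3 * ?n + C0 + 20" using 2(2) by simp
  moreover have "mem s5 = mem s & reg s5 0 = C0 * (?n * ?n + ?n + 1) & reg s5 1 = ?n & reg s5 2 = min ?k (?n + 1)"
   using 2(3) by (simp add: I_def s5_def post_def s4 s3_def mid_def add.commute)
  ultimately show "EX t s'. exec c s t s' & t <= 3 * ?n + C0 + 20 & mem s' = mem s &
   reg s' 0 = C0 * (?n * ?n + ?n + 1) & reg s' 1 = ?n & reg s' 2 = min ?k (?n + 1)" by blast
 qed
qed

text \<open>The five values are computed at rising levels, which protects the earlier ones, and
  moved into place only at the end because all five programs read the original registers.\<close>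

lemma phase_params:
 "EX c a. ALL s. EX t s'. exec c s t s' & t <= (reg s 0 + 2) ^ a & (ALL x<6 * reg s 0. mem s' x = mem s x) &
   reg s' 0 = KKp k0 (prm_of s) & reg s' 1 = reg s 1 & reg s' 2 = kp k0 (prm_of s) & reg s' 3 = bb k0 (prm_of s) &
   reg s' 4 = qq k0 (prm_of s) & reg s' 5 = LLp k0 (prm_of s)"
proof -
 have six: "(6::nat) <= 6" by simp
 note f = CN_kp[OF six, of k0] CN_bb[OF six, of k0] CN_qq[OF six, of k0] CN_LLp[OF six, of k0] CN_KKp[OF six, of k0]
 obtain c1 a1 where 1: "runs c1 a1 6 (%s. kp k0 (prm_of s))"
  using CN_exec[OF f(1), of 6] by auto
 obtain c2 a2 where 2: "runs c2 a2 7 (%s. bb k0 (prm_of s))"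
  using CN_exec[OF f(2), of 7] by auto
 obtain c3 a3 where 3: "runs c3 a3 8 (%s. qq k0 (prm_of s))"
  using CN_exec[OF f(3), of 8] by auto
 obtain c4 a4 where 4: "runs c4 a4 9 (%s. LLp k0 (prm_of s))"
  using CN_exec[OF f(4), of 9] by auto
 obtain c5 a5 where 5: "runs c5 a5 10 (%s. KKp k0 (prm_of s))"
  using CN_exec[OF f(5), of 10] by auto
 define mv where "mv = Seq (Const 11 0) (Seq (Add 2 6 11) (Seq (Add 3 7 11) (Seq (Add 4 8 11) (Seq (Add 5 9 11) (Add 0 10 11)))))"
 define c where "c = Seq c1 (Seq c2 (Seq c3 (Seq c4 (Seq c5 mv))))"
 define a where "a = a1 + (a2 + (a3 + (a4 + (a5 + 6 + 1) + 1) + 1) + 1) + 1"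
 show ?thesis
 proof (rule exI[of _ c], rule exI[of _ a], rule allI)
  fix s :: state
  let ?x = "reg s 0 + 2"
  obtain n1 s1 where s1: "exec c1 s n1 s1" "n1 <= ?x ^ a1" "agr 6 s s1" "reg s1 6 = kp k0 (prm_of s)" using 1 by blast
  obtain n2 s2 where s2: "exec c2 s1 n2 s2" "n2 <= (reg s1 0 + 2) ^ a2" "agr 7 s1 s2" "reg s2 7 = bb k0 (prm_of s1)" using 2 by blast
  obtain n3 s3 where s3: "exec c3 s2 n3 s3" "n3 <= (reg s2 0 + 2) ^ a3" "agr 8 s2 s3" "reg s3 8 = qq k0 (prm_of s2)" using 3 by blast
  obtain n4 s4 where s4: "exec c4 s3 n4 s4" "n4 <= (reg s3 0 + 2) ^ a4" "agr 9 s3 s4" "reg s4 9 = LLp k0 (prm_of s3)" using 4 by blast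
  obtain n5 s5 where s5: "exec c5 s4 n5 s5" "n5 <= (reg s4 0 + 2) ^ a5" "agr 10 s4 s5" "reg s5 10 = KKp k0 (prm_of s4)" using 5 by blast
  have A: "agr 6 s s2" "agr 6 s s3" "agr 6 s s4" "agr 6 s s5"
  proof -
   show a2: "agr 6 s s2" using agr_trans[OF s1(3) agr_mono[OF s2(3)]] by simp
   show a3: "agr 6 s s3" using agr_trans[OF a2 agr_mono[OF s3(3)]] by simp
   show a4: "agr 6 s s4" using agr_trans[OF a3 agr_mono[OF s4(3)]] by simp
   show "agr 6 s s5" using agr_trans[OF a4 agr_mono[OF s5(3)]] by simp
  qed
  have r0: "reg s1 0 = reg s 0" "reg s2 0 = reg s 0" "reg s3 0 = reg s 0" "reg s4 0 = reg s 0"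
   using agr_reg[OF s1(3), of 0] agr_reg[OF A(1), of 0] agr_reg[OF A(2), of 0] agr_reg[OF A(3), of 0] by auto
  have v: "reg s5 6 = kp k0 (prm_of s)" "reg s5 7 = bb k0 (prm_of s)" "reg s5 8 = qq k0 (prm_of s)" "reg s5 9 = LLp k0 (prm_of s)" "reg s5 10 = KKp k0 (prm_of s)"
   using agr_reg[OF s2(3), of 6] agr_reg[OF s3(3), of 6] agr_reg[OF s4(3), of 6] agr_reg[OF s5(3), of 6] s1(4)
    agr_reg[OF s3(3), of 7] agr_reg[OF s4(3), of 7] agr_reg[OF s5(3), of 7] s2(4) CN_dep[OF f(2) s1(3)]
    agr_reg[OF s4(3), of 8] agr_reg[OF s5(3), of 8] s3(4) CN_dep[OF f(3) A(1)]
    agr_reg[OF s5(3), of 9] s4(4) CN_dep[OF f(4) A(2)] s5(4) CN_dep[OF f(5) A(3)] by simp_all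
  define s6 where "s6 = straight_run mv s5"
  have e6: "exec mv s5 6 s6" unfolding s6_def by (rule exec_straight') (simp_all add: mv_def)
  have "exec c s (n1 + (n2 + (n3 + (n4 + (n5 + 6))))) s6" unfolding c_def
   by (intro exec.Seq[OF s1(1)] exec.Seq[OF s2(1)] exec.Seq[OF s3(1)] exec.Seq[OF s4(1)] exec.Seq[OF s5(1) e6])
  moreover have "n1 + (n2 + (n3 + (n4 + (n5 + 6)))) <= ?x ^ a"
  proof -
   have x2: "2 <= ?x" by simp
   have "n5 + 6 <= ?x ^ a5 + ?x ^ 6" using s5(2)[unfolded r0] const_le_pow[OF x2, of 6] by linarith
   also have "... <= ?x ^ (a5 + 6 + 1)" by (rule pow_add_le[OF x2])
   finally have "n4 + (n5 + 6) <= ?x ^ a4 + ?x ^ (a5 + 6 + 1)" using s4(2) r0 by simp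
   also have "... <= ?x ^ (a4 + (a5 + 6 + 1) + 1)" by (rule pow_add_le[OF x2])
   finally have "n3 + (n4 + (n5 + 6)) <= ?x ^ a3 + ?x ^ (a4 + (a5 + 6 + 1) + 1)" using s3(2) r0 by simp
   also have "... <= ?x ^ (a3 + (a4 + (a5 + 6 + 1) + 1) + 1)" by (rule pow_add_le[OF x2])
   finally have "n2 + (n3 + (n4 + (n5 + 6))) <= ?x ^ a2 + ?x ^ (a3 + (a4 + (a5 + 6 + 1) + 1) + 1)" using s2(2) r0 by simp
   also have "... <= ?x ^ (a2 + (a3 + (a4 + (a5 + 6 + 1) + 1) + 1) + 1)" by (rule pow_add_le[OF x2])
   finally have "n1 + (n2 + (n3 + (n4 + (n5 + 6)))) <= ?x ^ a1 + ?x ^ (a2 + (a3 + (a4 + (a5 + 6 + 1) + 1) + 1) + 1)" using s1(2) by simp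
   also have "... <= ?x ^ a" unfolding a_def by (rule pow_add_le[OF x2])
   finally show ?thesis .
  qed
  moreover have "ALL x<6 * reg s 0. mem s6 x = mem s x" using A(4) by (simp add: s6_def mv_def agr_def)
  moreover have "reg s6 0 = KKp k0 (prm_of s) & reg s6 1 = reg s 1 & reg s6 2 = kp k0 (prm_of s) & reg s6 3 = bb k0 (prm_of s) &
   reg s6 4 = qq k0 (prm_of s) & reg s6 5 = LLp k0 (prm_of s)" using v agr_reg[OF A(4), of 1] by (simp add: s6_def mv_def)
  ultimately show "EX t s'. exec c s t s' & t <= ?x ^ a & (ALL x<6 * reg s 0. mem s' x = mem s x) &
   reg s' 0 = KKp k0 (prm_of s) & reg s' 1 = reg s 1 & reg s' 2 = kp k0 (prm_of s) & reg s' 3 = bb k0 (prm_of s) &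
   reg s' 4 = qq k0 (prm_of s) & reg s' 5 = LLp k0 (prm_of s)" by blast
 qed
qed

text \<open>The output depends on the adjacency matrix in array 0, so it is tabulated in array 6
  before it replaces that matrix.\<close>

lemma phase_main:
 "EX c a. ALL s. EX t s'. exec c s t s' & t <= (reg s 0 + 2) ^ a & (ALL j<reg s 0. mem s' j = outp (prm_of s) j)"
proof -
 have CA1: "CA 6 (%s. outp (prm_of s))"
  unfolding CA_def by (intro allI impI) (rule cn, assumption+)
 have i1: "outp (prm_of s') j = outp (prm_of s) j" if "agr_but 6 6 s s'" for s s' j
 proof -
  have "CN 6 (%s. outp (prm_of s) j)" using CA1[unfolded CA_def, rule_format, of 6 "%_. j"] CN_const[of 6 j] by simp
  thus ?thesis by (rule CN_dep) (rule agr_butD[OF that], simp_all)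
 qed
 obtain c1 a1 where 1: "ALL s. EX n s'. exec c1 s n s' & n <= (reg s 0 + 2) ^ a1 & agr_but 6 6 s s' &
   (ALL j<reg s 0. mem s' (6 * reg s 0 + j) = outp (prm_of s) j)"
  using fill[of 6 "%s. outp (prm_of s)" 6, OF CA1 _ _ i1] by auto
 have i2: "arr 6 s' j = arr 6 s j" if "agr_but 0 7 s s'" for s s' j
  using that by (auto simp: agr_but_def arr_def)
 have CA2: "CA 7 (arr 6)" by (rule CA_arr) simp
 obtain c2 a2 where 2: "ALL s. EX n s'. exec c2 s n s' & n <= (reg s 0 + 2) ^ a2 & agr_but 0 7 s s' &
   (ALL j<reg s 0. mem s' (0 * reg s 0 + j) = arr 6 s j)"
  using fill[of 7 "arr 6" 0, OF CA2 _ _ i2] by auto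
 show ?thesis
 proof (rule exI[of _ "Seq c1 c2"], rule exI[of _ "a1 + a2 + 1"], rule allI)
  fix s :: state
  obtain n1 s1 where s1: "exec c1 s n1 s1" "n1 <= (reg s 0 + 2) ^ a1" "agr_but 6 6 s s1"
   "ALL j<reg s 0. mem s1 (6 * reg s 0 + j) = outp (prm_of s) j" using 1 by blast
  obtain n2 s2 where s2: "exec c2 s1 n2 s2" "n2 <= (reg s1 0 + 2) ^ a2" "agr_but 0 7 s1 s2"
   "ALL j<reg s1 0. mem s2 (0 * reg s1 0 + j) = arr 6 s1 j" using 2 by blast
  have r: "reg s1 0 = reg s 0" using s1(3) by (simp add: agr_but_def)
  have "exec (Seq c1 c2) s (n1 + n2) s2" by (rule exec.Seq[OF s1(1) s2(1)])
  moreover have "n1 + n2 <= (reg s 0 + 2) ^ (a1 + a2 + 1)"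
  proof -
   have "n1 + n2 <= (reg s 0 + 2) ^ a1 + (reg s 0 + 2) ^ a2" using s1(2) s2(2) r by simp
   also have "... <= (reg s 0 + 2) ^ (a1 + a2 + 1)" by (rule pow_add_le) simp
   finally show ?thesis .
  qed
  moreover have "ALL j<reg s 0. mem s2 j = outp (prm_of s) j" using s1(4) s2(4) r by (simp add: arr_def)
  ultimately show "EX t s'. exec (Seq c1 c2) s t s' & t <= (reg s 0 + 2) ^ (a1 + a2 + 1) & (ALL j<reg s 0. mem s' j = outp (prm_of s) j)" by blast
 qed
qed

section \<open>Vertices, literals and cuts\<close>

lemma vert_index_neg:
 assumes "v : sym_verts n"
 shows "- v : sym_verts n" "vert_index n (- v) = 2 * n - 1 - vert_index n v"
 using assms by (auto simp: vert_index_def sym_verts_def nat_diff_distrib)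

lemma vert_index_lt: "v : sym_verts n ==> vert_index n v < 2 * n"
 using bij_betwE[OF vert_index_bij] by blast

lemma vert_index_inj: "inj_on (vert_index n) (sym_verts n)"
 using vert_index_bij by (rule bij_betw_imp_inj_on)

lemma vert_index_surj: "u < 2 * n ==> EX v:sym_verts n. vert_index n v = u"
 using vert_index_bij[of n] unfolding bij_betw_def by (metis image_iff lessThan_iff)

lemma arcs_in_verts:
 assumes "symmetric_digraph n G" "(i, j) : parcs G"
 shows "i : sym_verts n" "j : sym_verts n"
proof -
 interpret pair_wf_digraph G using assms(1) by (simp add: symmetric_digraph_def)
 show "i : sym_verts n" "j : sym_verts n"
  using arc_fst_in_verts[OF assms(2)] arc_snd_in_verts[OF assms(2)] assms(1) by (simp_all add: symmetric_digraph_def)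
qed

lemma mixed_radix_unique:
 fixes m u u' v v' :: nat
 assumes "v < m" "v' < m" "m * u + v = m * u' + v'"
 shows "u = u' & v = v'"
proof -
 have "(m * u + v) div m = u" "(m * u' + v') div m = u'" using assms(1,2) by simp_all
 hence "u = u'" using assms(3) by metis
 thus ?thesis using assms(3) by simp
qed

context alg begin

context
 fixes G :: "int pair_pre_digraph"
 assumes sd: "symmetric_digraph (pn P) G"
begin

abbreviation "vi \<equiv> vert_index (pn P)"

lemma ng_vi: "x : sym_verts (pn P) ==> ng (vi x) = vi (- x)"
 using vert_index_neg(2)[of x "pn P"] by (simp add: ng_def nn_def mult_2)

lemma vi_surj: "u < N ==> EX x:sym_verts (pn P). vi x = u"
 using vert_index_surj[of u "pn P"] by (simp add: nn_def mult_2)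

lemma vi_lt: "x : sym_verts (pn P) ==> vi x < N"
 using vert_index_lt[of x "pn P"] by (simp add: nn_def mult_2)

lemma vi_mem: "S <= sym_verts (pn P) ==> x : sym_verts (pn P) ==> vi x : vi ` S \<longleftrightarrow> x : S"
 by (rule inj_on_image_mem_iff[OF vert_index_inj])

lemma cut_mem:
 assumes S: "symmetric_cut G S" and x: "x : sym_verts (pn P)"
 shows "- x : S \<longleftrightarrow> x ~: S" "x : uminus ` S \<longleftrightarrow> x ~: S"
proof -
 have V: "pverts G = sym_verts (pn P)" using sd by (simp add: symmetric_digraph_def)
 have "sym_verts (pn P) - S = uminus ` S" using S V by (simp add: symmetric_cut_def)
 thus 1: "x : uminus ` S \<longleftrightarrow> x ~: S" using x by blast
 have "x : uminus ` S \<longleftrightarrow> - x : S" by (metis image_iff minus_minus)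
 thus "- x : S \<longleftrightarrow> x ~: S" using 1 by simp
qed

lemma graph_cut:
 assumes adj: "!!u v. u < N ==> v < N ==> adjb u v \<longleftrightarrow> (EX i j. (i, j) : parcs G & vi i = u & vi j = v)"
  and S: "symmetric_cut G S"
 shows "truth (vi ` S)" "oX (vi ` S) = cut_value G S"
proof -
 have V: "pverts G = sym_verts (pn P)" using sd by (simp add: symmetric_digraph_def)
 have SV: "S <= sym_verts (pn P)" using S V by (simp add: symmetric_cut_def)
 show "truth (vi ` S)" unfolding truth_def
 proof (intro allI impI)
  fix u assume "u < N"
  then obtain x where x: "x : sym_verts (pn P)" "vi x = u" using vi_surj by blast
  have "ng u : vi ` S \<longleftrightarrow> - x : S" using vi_mem[OF SV vert_index_neg(1)[OF x(1)]] ng_vi[OF x(1)] x(2) by simp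
  moreover have "u : vi ` S \<longleftrightarrow> x : S" using vi_mem[OF SV x(1)] x(2) by simp
  ultimately show "u : vi ` S \<longleftrightarrow> ng u ~: vi ` S" using cut_mem(1)[OF S x(1)] by simp
 qed
 let ?f = "%(i, j). (vi i, vi j)"
 let ?A = "{(i, j) : parcs G. i : S & j : uminus ` S}"
 let ?B = "{(u, v). u < N & v < N & adjb u v & u : vi ` S & v ~: vi ` S}"
 have inj: "inj_on ?f ?A"
 proof (rule inj_onI)
  fix e e' assume e: "e : ?A" "e' : ?A" "?f e = ?f e'"
  obtain i j i' j' where ij: "e = (i, j)" "e' = (i', j')" by (cases e, cases e')
  have "i : sym_verts (pn P)" "j : sym_verts (pn P)" "i' : sym_verts (pn P)" "j' : sym_verts (pn P)"
   using e ij arcs_in_verts[OF sd] by blast+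
  thus "e = e'" using e(3) ij vert_index_inj[of "pn P"] by (auto dest: inj_onD)
 qed
 have "?f ` ?A = ?B"
 proof
  show "?f ` ?A <= ?B"
  proof
   fix z assume "z : ?f ` ?A"
   then obtain i j where ij: "(i, j) : parcs G" "i : S" "j : uminus ` S" "z = (vi i, vi j)" by auto
   note ijV = arcs_in_verts[OF sd ij(1)]
   have "j ~: S" using cut_mem(2)[OF S ijV(2)] ij(3) by simp
   hence "vi j ~: vi ` S" using vi_mem[OF SV ijV(2)] by simp
   moreover have "adjb (vi i) (vi j)" using adj[OF vi_lt[OF ijV(1)] vi_lt[OF ijV(2)]] ij(1) by blast
   ultimately show "z : ?B" using ij vi_lt[OF ijV(1)] vi_lt[OF ijV(2)] by simp
  qed
  show "?B <= ?f ` ?A"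
  proof
   fix z assume "z : ?B"
   then obtain u v where uv: "z = (u, v)" "u < N" "v < N" "adjb u v" "u : vi ` S" "v ~: vi ` S" by auto
   then obtain i j where ij: "(i, j) : parcs G" "vi i = u" "vi j = v" using adj by blast
   note ijV = arcs_in_verts[OF sd ij(1)]
   have "i : S" "j ~: S" using vi_mem[OF SV ijV(1)] vi_mem[OF SV ijV(2)] uv ij by auto
   hence "(i, j) : ?A" using ij(1) cut_mem(2)[OF S ijV(2)] by simp
   thus "z : ?f ` ?A" using uv(1) ij by (intro image_eqI[of _ _ "(i, j)"]) auto
  qed
 qed
 hence "card ?B = card ?A" using card_image[OF inj] by simp
 thus "oX (vi ` S) = cut_value G S" by (simp add: oX_card cut_value_def)
qed

lemma output_cut:
 assumes R: "truth R" "R <= {..<N}"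
 defines "S \<equiv> {v : sym_verts (pn P). vi v : R}"
 shows "symmetric_cut G S" "vi ` S = R"
proof -
 have V: "pverts G = sym_verts (pn P)" using sd by (simp add: symmetric_digraph_def)
 have neg: "- x : S \<longleftrightarrow> x ~: S" if x: "x : sym_verts (pn P)" for x
  using truth_ng[OF R(1) vi_lt[OF x]] ng_vi[OF x] x vert_index_neg(1)[OF x] by (simp add: S_def)
 have "sym_verts (pn P) - S = uminus ` S"
 proof (rule set_eqI)
  fix x
  have "x : uminus ` S \<longleftrightarrow> - x : S" by (metis image_iff minus_minus)
  moreover have "- x : S ==> x : sym_verts (pn P)" using vert_index_neg(1)[of "- x" "pn P"] by (simp add: S_def)
  ultimately show "x : sym_verts (pn P) - S \<longleftrightarrow> x : uminus ` S" using neg by blast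
 qed
 thus "symmetric_cut G S" by (simp add: symmetric_cut_def V S_def)
 show "vi ` S = R"
 proof (rule set_eqI)
  fix u
  show "u : vi ` S \<longleftrightarrow> u : R"
  proof
   assume "u : R"
   then obtain x where "x : sym_verts (pn P)" "vi x = u" using vi_surj R(2) by blast
   thus "u : vi ` S" using \<open>u : R\<close> by (auto simp: S_def)
  qed (auto simp: S_def)
 qed
qed

end

end

text \<open>The positive vertices form a symmetric cut, so the minimum ranges over a nonempty finite
  set.\<close>

lemma min_dicut_attained:
 assumes "symmetric_digraph n G"
 shows "EX S. symmetric_cut G S & cut_value G S = min_symmetric_dicut G"
proof -
 have V: "pverts G = sym_verts n" using assms by (simp add: symmetric_digraph_def)
 have "finite (sym_verts n)" by (simp add: sym_verts_def)
 hence fin: "finite {S. symmetric_cut G S}"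
  by (rule finite_subset[rotated, OF finite_Pow_iff[THEN iffD2]]) (auto simp: symmetric_cut_def V)
 have "uminus ` {1..int n} = {- int n..-1}" by (auto intro: image_eqI[of _ _ "- _"])
 hence "symmetric_cut G {1..int n}" by (auto simp: symmetric_cut_def V sym_verts_def)
 hence "min_symmetric_dicut G : cut_value G ` {S. symmetric_cut G S}"
  unfolding min_symmetric_dicut_def using fin by (intro Min_in) auto
 thus ?thesis by auto
qed

theorem theorem5p7:
  shows "\<exists>(C::real) > 0. \<exists>(c::real) > 0. \<exists>p :: real poly.
    \<forall>r :: nat \<Rightarrow> real. (\<forall>n. r n > 1) \<longrightarrow>
      (\<exists>A :: com. approximates_in_time A r (\<lambda>n. C * r n)
        (\<lambda>n. exp (real n / 2 powr (c * (r n)\<^sup>2)) * poly p (real n)))"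
proof -
 obtain cC aC where main: "ALL s. EX t s'. exec cC s t s' & t <= (reg s 0 + 2) ^ aC & (ALL j<reg s 0. mem s' j = outp (prm_of s) j)"
  using phase_main by blast
 \<comment> \<open>The main phase takes at most \<open>(K + 2) ^ aC\<close> steps. The coefficient
   exceeds the one in \<open>K\<close> by 1 to absorb the added 2, which bounds this by
   \<open>2 ^ (A * L)\<close>.\<close>
 define A where "A = 167772261 * aC"
 \<comment> \<open>\<open>k0\<close> has to dominate \<open>A\<close>, which is possible because the
   main program, and with it \<open>aC\<close>, is fixed before \<open>k0\<close> is chosen.\<close>
 define k0 where "k0 = 64 * A + 100"
 define C0 where "C0 = 167772260 * (1000 + k0)"
 obtain cA where stp: "ALL s. EX t s'. exec cA s t s' & t <= 3 * reg s 0 + C0 + 20 & mem s' = mem s &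
   reg s' 0 = C0 * (reg s 0 * reg s 0 + reg s 0 + 1) & reg s' 1 = reg s 0 & reg s' 2 = min (reg s 1) (reg s 0 + 1)"
  using phase_setup by blast
 obtain cB aB where params: "ALL s. EX t s'. exec cB s t s' & t <= (reg s 0 + 2) ^ aB & (ALL x<6 * reg s 0. mem s' x = mem s x) &
   reg s' 0 = KKp k0 (prm_of s) & reg s' 1 = reg s 1 & reg s' 2 = kp k0 (prm_of s) & reg s' 3 = bb k0 (prm_of s) &
   reg s' 4 = qq k0 (prm_of s) & reg s' 5 = LLp k0 (prm_of s)"
  using phase_params[of k0] by blast
 define prog where "prog = Seq cA (Seq cB cC)"
 define M :: real where "M = 2 ^ (7 + k0) * 4"
 \<comment> \<open>One summand per phase, the last from \<open>exp_bound\<close>; the first two are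
   multiplied by an exponential of at least 1.\<close>
 define p :: "real poly" where "p = [:real C0 + 20, 3:] + [:real C0 + 2, real C0, real C0:] ^ aB + [:M, M:] ^ (2 * A)"
 define C :: real where "C = 2 ^ 77 * real k0"
 have "approximates_in_time prog r (%n. C * r n) (%n. exp (real n / 2 powr (1 / 2 * (r n)^2)) * poly p (real n))"
  if r: "ALL n. r n > 1" for r
  unfolding approximates_in_time_def
 proof (intro allI impI)
  fix n and G :: "int pair_pre_digraph"
  assume sd: "symmetric_digraph n G"
  let ?k = "nat \<lceil>r n\<rceil>"
  define s0 where "s0 = input_state n ?k G"
  have s0: "reg s0 0 = n" "reg s0 1 = ?k" by (simp_all add: s0_def input_state_def)
  obtain tA s1 where s1: "exec cA s0 tA s1" "tA <= 3 * n + C0 + 20" "mem s1 = mem s0"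
   "reg s1 0 = C0 * (n * n + n + 1)" "reg s1 1 = n" "reg s1 2 = min ?k (n + 1)"
   using stp s0 by metis
  obtain tB s2 where s2: "exec cB s1 tB s2" "tB <= (reg s1 0 + 2) ^ aB" "ALL x<6 * reg s1 0. mem s2 x = mem s1 x"
   "reg s2 0 = KKp k0 (prm_of s1)" "reg s2 1 = reg s1 1" "reg s2 2 = kp k0 (prm_of s1)" "reg s2 3 = bb k0 (prm_of s1)"
   "reg s2 4 = qq k0 (prm_of s1)" "reg s2 5 = LLp k0 (prm_of s1)"
   using params by blast
  obtain tC s3 where s3: "exec cC s2 tC s3" "tC <= (reg s2 0 + 2) ^ aC" "ALL j<reg s2 0. mem s3 j = outp (prm_of s2) j"
   using main by blast
  have ex: "exec prog s0 (tA + (tB + tC)) s3" unfolding prog_def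
   by (intro exec.Seq[OF s1(1)] exec.Seq[OF s2(1) s3(1)])
  let ?P = "prm_of s1"
  define l where "l = lnn ?P"
  have P1: "pK ?P = C0 * (n * n + n + 1)" "pn ?P = n" "pk ?P = min ?k (n + 1)" "nn ?P = 2 * n"
   using s1 by (simp_all add: prm_of_def nn_def)
  have pv: "kp k0 ?P = max k0 (min ?k (n + 1))" "2 * n + 2 <= 2 ^ l" "2 ^ l <= 4 * (n + 1)"
   "bb k0 ?P = min ((kp k0 ?P)^2) (l + 7)" "qq k0 ?P = 64 * n div 2 ^ bb k0 ?P + 1"
   "LLp k0 ?P = qq k0 ?P * bb k0 ?P + l + k0" "KKp k0 ?P = 2 ^ (167772260 * LLp k0 ?P)"
  proof -
   have h1: "167772260 * (1000 + k0) * (pn ?P * pn ?P + pn ?P + 1) <= pK ?P" unfolding P1(1,2) C0_def by (rule order_refl)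
   have h2: "pk ?P <= pn ?P + 1" unfolding P1(2,3) by (rule min.cobounded2)
   have q64: "32 * nn ?P = 64 * n" by (simp add: P1(4))
   note v = param_values[OF h1 h2, folded l_def, unfolded q64 P1(2,3), unfolded P1(4)]
   show "kp k0 ?P = max k0 (min ?k (n + 1))" "2 * n + 2 <= 2 ^ l" "2 ^ l <= 4 * (n + 1)"
    "bb k0 ?P = min ((kp k0 ?P)^2) (l + 7)" "qq k0 ?P = 64 * n div 2 ^ bb k0 ?P + 1"
    "LLp k0 ?P = qq k0 ?P * bb k0 ?P + l + k0" "KKp k0 ?P = 2 ^ (167772260 * LLp k0 ?P)"
    by (fact v)+
  qed
  have L100: "100 <= LLp k0 ?P" unfolding pv(6) by (simp add: k0_def)
  have e1: "1 <= exp (real n / 2 powr (1 / 2 * (r n)^2))" by simp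
  have time: "real (tA + (tB + tC)) <= exp (real n / 2 powr (1 / 2 * (r n)^2)) * poly p (real n)"
  proof -
   let ?e = "exp (real n / 2 powr (1 / 2 * (r n)^2))"
   have "real tA <= real (3 * n + C0 + 20)" using s1(2) by (simp only: of_nat_le_iff)
   also have "... = poly [:real C0 + 20, 3:] (real n)" by simp
   also have "... <= ?e * poly [:real C0 + 20, 3:] (real n)" using mult_right_mono[OF e1, of "poly [:real C0 + 20, 3:] (real n)"] by simp
   finally have A: "real tA <= ?e * poly [:real C0 + 20, 3:] (real n)" .
   have "real tB <= real ((reg s1 0 + 2) ^ aB)" using s2(2) by (simp only: of_nat_le_iff)
   also have "... = poly ([:real C0 + 2, real C0, real C0:] ^ aB) (real n)" by (simp add: s1(4) poly_power algebra_simps)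
   also have "... <= ?e * poly ([:real C0 + 2, real C0, real C0:] ^ aB) (real n)"
    using mult_right_mono[OF e1, of "poly ([:real C0 + 2, real C0, real C0:] ^ aB) (real n)"] by (simp add: poly_power)
   finally have B: "real tB <= ?e * poly ([:real C0 + 2, real C0, real C0:] ^ aB) (real n)" .
   have "reg s2 0 + 2 <= 2 ^ (167772261 * LLp k0 ?P)"
   proof -
    let ?L = "LLp k0 ?P"
    have "(2::nat) ^ 1 <= 2 ^ (167772260 * ?L)" using L100 by (intro power_increasing) auto
    hence "reg s2 0 + 2 <= 2 ^ (167772260 * ?L) + 2 ^ (167772260 * ?L)" unfolding s2(4) pv(7) by simp
    also have "... = 2 ^ (167772260 * ?L + 1)" by simp
    also have "... <= 2 ^ (167772261 * ?L)" using L100 by (intro power_increasing) auto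
    finally show ?thesis .
   qed
   hence "tC <= (2 ^ (167772261 * LLp k0 ?P)) ^ aC" using s3(2) by (meson order_trans power_mono zero_le)
   also have "... = 2 ^ (A * LLp k0 ?P)" by (simp add: A_def power_mult[symmetric] mult_ac)
   finally have "real tC <= real (2 ^ (A * LLp k0 ?P))" by (simp only: of_nat_le_iff)
   also have "... <= ?e * (2 ^ (7 + k0) * 4 * (real n + 1)) ^ (2 * A)"
    using r by (intro exp_bound[OF pv(1-6)]) (auto simp: k0_def)
   also have "... = ?e * poly ([:M, M:] ^ (2 * A)) (real n)" by (simp add: M_def poly_power algebra_simps)
   finally show ?thesis using A B by (simp add: p_def distrib_left)
  qed
  have "symmetric_cut G (output_set n s3) & real (cut_value G (output_set n s3)) <= C * r n * real (min_symmetric_dicut G)"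
  proof (cases "n = 0")
   \<comment> \<open>The empty graph lies outside the locale \<open>alg\<close>, which assumes at
     least one variable.\<close>
   case True
   hence "output_set n s3 = {}" by (simp add: output_set_def sym_verts_def)
   moreover have "pverts G = {}" using sd True by (simp add: symmetric_digraph_def sym_verts_def)
   moreover have "0 <= C * r n" using r[rule_format, of n] by (simp add: C_def)
   ultimately show ?thesis by (simp add: symmetric_cut_def cut_value_def)
  next
   case n0: False
   define Q where "Q = prm_of s2"
   let ?L = "LLp k0 ?P"
   have Q: "pK Q = 2 ^ (167772260 * ?L)" "pn Q = n" "pk Q = kp k0 ?P" "pb Q = bb k0 ?P" "pq Q = qq k0 ?P" "pL Q = ?L" "padj Q = arr 0 s2" "nn Q = 2 * n"
    using s2 s1(5) pv(7) by (simp_all add: Q_def prm_of_def nn_def)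
   have lL: "(2::nat) ^ l <= 2 ^ ?L" unfolding pv(6) by (intro power_increasing) auto
   have N2: "2 * n + 2 <= 2 ^ ?L" using pv(2) lL by linarith
   have LK: "(2::nat) ^ ?L <= pK Q" "(2::nat) ^ (2 * ?L) <= pK Q" unfolding Q(1) by (intro power_increasing; simp)+
   have adj: "adjb Q u v \<longleftrightarrow> (EX i j. (i, j) : parcs G & vert_index n i = u & vert_index n j = v)" if uv: "u < 2 * n" "v < 2 * n" for u v
   proof -
    have "u <= pK Q" using uv N2 LK(1) by linarith
    hence b: "bmul Q (nn Q) u = 2 * n * u" by (simp add: bmul_eq Q(8))
    have lt: "2 * n * u + v < 2 * n * (2 * n)"
    proof -
     have "2 * n * u + v < 2 * n * Suc u" using uv by simp
     also have "... <= 2 * n * (2 * n)" using uv by (intro mult_left_mono) auto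
     finally show ?thesis .
    qed
    also have "... <= 2 ^ ?L * 2 ^ ?L" using N2 by (intro mult_mono) auto
    also have "... = 2 ^ (2 * ?L)" by (simp add: mult_2 power_add)
    finally have K: "2 * n * u + v < reg s2 0" using LK(2) by (simp add: Q_def prm_of_def)
    \<comment> \<open>The adjacency matrix lies within the memory that the parameter phase
      protects.\<close>
    have "2 * n * (2 * n) <= 6 * reg s1 0"
    proof -
     have "1 * (n * n) <= C0 * (n * n + n + 1)" by (intro mult_mono) (auto simp: C0_def)
     thus ?thesis unfolding s1(4) by linarith
    qed
    hence "mem s2 (2 * n * u + v) = mem s0 (2 * n * u + v)" using s2(3) s1(3) lt by (metis less_le_trans)
    hence "adjb Q u v \<longleftrightarrow> mem s0 (2 * n * u + v) = 1" using K by (simp add: adjb_def b Q(7) arr_def)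
    also have "... \<longleftrightarrow> (EX i j. (i, j) : parcs G & 2 * n * u + v = 2 * n * vert_index n i + vert_index n j)"
     by (auto simp: s0_def input_state_def split: if_splits)
    also have "... \<longleftrightarrow> (EX i j. (i, j) : parcs G & vert_index n i = u & vert_index n j = v)"
    proof -
     have "2 * n * u + v = 2 * n * vert_index n i + vert_index n j \<longleftrightarrow> vert_index n i = u & vert_index n j = v" if "(i, j) : parcs G" for i j
      using mixed_radix_unique[OF uv(2) vert_index_lt[OF arcs_in_verts(2)[OF sd that]], of u "vert_index n i"] by auto
     thus ?thesis by blast
    qed
    finally show ?thesis .
   qed
   interpret al: alg Q
   proof
    show "pK Q = 2 ^ (167772260 * pL Q)" by (simp add: Q)
    show "1 <= pn Q" using n0 by (simp add: Q(2))
    show "nn Q + 2 <= 2 ^ pL Q" using N2 by (simp only: Q(6,8))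
    show "64 <= pL Q" using L100 by (simp add: Q(6))
    have k100: "100 <= kp k0 ?P" unfolding pv(1) by (simp add: k0_def)
    have b7: "7 <= bb k0 ?P"
    proof -
     have "100 * 100 <= (kp k0 ?P)^2" unfolding power2_eq_square using k100 by (intro mult_mono) auto
     thus ?thesis unfolding pv(4) by simp
    qed
    have "qq k0 ?P * 7 <= qq k0 ?P * bb k0 ?P" using b7 by (rule mult_left_mono) simp
    moreover have "100 <= k0" by (simp add: k0_def)
    ultimately show "3 * pq Q + 3 <= pL Q" unfolding Q(5,6) pv(6) by linarith
    show "1 <= pk Q" using k100 by (simp add: Q(3))
    show "pk Q <= 2 ^ pL Q"
    proof -
     have "k0 <= 2 ^ k0" using less_exp[of k0] by simp
     also have "... <= 2 ^ ?L" unfolding pv(6) by (intro power_increasing) auto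
     finally have "k0 <= 2 ^ ?L" .
     moreover have "min ?k (n + 1) <= 2 ^ ?L" using N2 by linarith
     ultimately show ?thesis by (simp add: Q(3,6) pv(1))
    qed
    show "pb Q * pq Q <= pL Q" by (simp add: Q pv(6) mult.commute)
    show "pb Q <= (pk Q)^2" by (simp add: Q(3,4) pv(4))
    show "32 * nn Q < pq Q * 2 ^ pb Q"
    proof -
     have "64 * n < (64 * n div 2 ^ bb k0 ?P + 1) * 2 ^ bb k0 ?P"
      using dividend_less_div_times[of "2 ^ bb k0 ?P" "64 * n"] by simp
     thus ?thesis by (simp add: Q(4,5,8) pv(5))
    qed
    fix u v assume uv: "u < nn Q" "v < nn Q"
    show "adjb Q (ng Q v) (ng Q u) = adjb Q u v"
    proof -
     have imp: "adjb Q (ng Q v) (ng Q u)" if uv: "u < 2 * n" "v < 2 * n" "adjb Q u v" for u v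
     proof -
      obtain i j where ij: "(i, j) : parcs G" "vert_index n i = u" "vert_index n j = v" using adj[OF uv(1,2)] uv(3) by blast
      note ijV = arcs_in_verts[OF sd ij(1)]
      have "(- j, - i) : parcs G" using sd ij(1) by (simp add: symmetric_digraph_def)
      moreover have "vert_index n (- j) = ng Q v" "vert_index n (- i) = ng Q u"
       using vert_index_neg(2)[OF ijV(1)] vert_index_neg(2)[OF ijV(2)] ij by (simp_all add: ng_def Q(8))
      moreover have "ng Q v < 2 * n" "ng Q u < 2 * n" using uv by (simp_all add: ng_def Q(8))
      ultimately show ?thesis using adj[of "ng Q v" "ng Q u"] by blast
     qed
     have "ng Q (ng Q x) = x" if "x < 2 * n" for x using that by (simp add: ng_def Q(8))
     moreover have "ng Q x < 2 * n" if "x < 2 * n" for x using that by (simp add: ng_def Q(8))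
     ultimately show ?thesis using imp[of u v] imp[of "ng Q v" "ng Q u"] uv unfolding Q(8) by metis
    qed
   qed
   have sd': "symmetric_digraph (pn Q) G" using sd by (simp add: Q(2))
   have adj': "adjb Q u v \<longleftrightarrow> (EX i j. (i, j) : parcs G & vert_index (pn Q) i = u & vert_index (pn Q) j = v)" if "u < nn Q" "v < nn Q" for u v
    using adj that unfolding Q(2,8) by blast
   obtain S where S: "symmetric_cut G S" "cut_value G S = min_symmetric_dicut G" using min_dicut_attained[OF sd] by blast
   note gS = al.graph_cut[OF sd' adj' S(1)]
   have L100': "100 <= pL Q" using L100 by (simp add: Q(6))
   note rc = al.res_set_correct[OF L100' gS(1)]
   define R where "R = al.res_set"
   have oS: "output_set n s3 = {v : sym_verts (pn Q). vert_index (pn Q) v : R}"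
   proof -
    have "mem s3 (vert_index n v) = 1 \<longleftrightarrow> vert_index n v : R" if "v : sym_verts n" for v
    proof -
     have "vert_index n v < 2 * n" using vert_index_lt[OF that] .
     hence "vert_index n v < reg s2 0" using N2 LK(1) by (simp add: Q_def prm_of_def)
     hence "mem s3 (vert_index n v) = outp Q (vert_index n v)" using s3(3) by (simp add: Q_def)
     thus ?thesis by (simp add: al.outp_res R_def)
    qed
    thus ?thesis unfolding output_set_def Q(2) by blast
   qed
   note oc = al.output_cut[OF sd' rc(1,2), folded R_def, folded oS]
   have "cut_value G (output_set n s3) = al.oX R" using al.graph_cut(2)[OF sd' adj' oc(1)] oc(2) by simp
   also have "... <= 2 ^ 76 * pk Q * min_symmetric_dicut G" using rc(3) gS(2) S(2) by (simp add: R_def)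
   finally have "real (cut_value G (output_set n s3)) <= real (2 ^ 76 * pk Q * min_symmetric_dicut G)" by (simp only: of_nat_le_iff)
   also have "... = 2 ^ 76 * real (pk Q) * real (min_symmetric_dicut G)" by simp
   also have "... <= C * r n * real (min_symmetric_dicut G)"
   proof (rule mult_right_mono)
    have r1: "1 < r n" using r by blast
    have "pk Q <= max k0 ?k" by (simp add: Q(3) pv(1))
    hence "real (pk Q) <= real (max k0 ?k)" by (simp only: of_nat_le_iff)
    also have "... <= 2 * real k0 * r n"
    proof -
     have k1: "1 <= real k0" by (simp add: k0_def)
     have "real ?k <= r n + 1" using r1 by linarith
     also have "... <= 2 * 1 * r n" using r1 by simp
     also have "... <= 2 * real k0 * r n" using k1 r1 by (intro mult_right_mono mult_left_mono) auto
     finally have 1: "real ?k <= 2 * real k0 * r n" .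
     have "real k0 * 1 <= 2 * real k0 * r n" using r1 by (intro mult_mono) auto
     thus ?thesis using 1 by (simp add: max_def)
    qed
    finally have "2 ^ 76 * real (pk Q) <= 2 ^ 76 * (2 * real k0 * r n)" by (rule mult_left_mono) simp
    thus "2 ^ 76 * real (pk Q) <= C * r n" by (simp add: C_def)
   qed simp
   finally show ?thesis using oc(1) by blast
  qed
  thus "EX t s. exec prog (input_state n (nat \<lceil>r n\<rceil>) G) t s & real t <= exp (real n / 2 powr (1 / 2 * (r n)^2)) * poly p (real n) &
    symmetric_cut G (output_set n s) & real (cut_value G (output_set n s)) <= C * r n * real (min_symmetric_dicut G)"
   using ex time unfolding s0_def by blast
 qed
 moreover have "C > 0" by (simp add: C_def k0_def)
 moreover have "(1 / 2 :: real) > 0" by simp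
 ultimately show ?thesis by blast
qed

end
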